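(* Let $T>h_m$, let $\Sigma_T\in\mathbb{R}^{N\times N}$ be symmetric positive definite, with $i$-th diagonal block (of size $N_i\times N_i$) denoted $\Sigma_T^{(i)}$, and let $Z_T\in\mathbb{R}^N$. Then there exists a control $U\in L^2_{\mathcal F}([0,T];\mathbb{R}^m)$ such that the solution $Z=(Z_1,\dots,Z_m)$ of $$dZ(t)=\Big(\overline A Z(t)+\overline B\,\big(U_1(t-h_1),\dots,U_m(t-h_m)\big)^T+\overline r(t)\Big)dt+\overline\sigma(t)\,dW_t$$ associated with $U$ satisfies $\mathbb{E}[Z(T)]=Z_T$ and, for every $1\le i\le m$, $$\Sigma_{Z_i}(T)=\Sigma_T^{(i)}+\Sigma_{\min}^{(i)}(T),\qquad \Sigma^{(i)}_{\min}(T)=\int_{T-h_i}^T\Gamma_i(T-s)\,\overline\sigma(s)\overline\sigma(s)^T\,\Gamma_i(T-s)^T\,ds .$$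
   Context: Let $N,m\ge1$, $T>0$, and let $(\Omega,\mathcal F=(\mathcal F_t)_{t\ge0},\mathbb P)$ be a filtered probability space with a one-dimensional Wiener process $W$ adapted to $\mathcal F$. $L^2_{\mathcal F}([0,T];E)$ is the set of square-integrable $\mathcal F$-progressively measurable $E$-valued processes. Equalities between processes are up to modification. Data: $0<h_1<\dots<h_m$ are delays; $\overline A\in\mathbb{R}^{N\times N}$ and $\overline B\in\mathbb{R}^{N\times m}$ are block upper triangular with respect to a splitting $N=N_1+\dots+N_m$ with all $N_i\ge1$: $\overline A=(\overline A_{ij})$ with $\overline A_{ij}\in\mathbb{R}^{N_i\times N_j}$, $\overline B=(\overline B_{ij})$ with $\overline B_{ij}\in\mathbb{R}^{N_i\times1}$, $\overline A_{ij}=0$ and $\overline B_{ij}=0$ for $j<i$, and $(\overline A_{ii},\overline B_{ii})$ controllable for every $i$. (This is the form obtained by an invertible linear change of state $Z=MX$, $\overline A=MAM^{-1}$, $\overline B=MB$, $\overline\sigma=M\sigma$, $\overline G=MBGM^{-1}$, from the SDE $dX=(AX+\sum_iB_iU_i(t-h_i)+B\int_{t-h_m}^tG(t-s)\sigma(s)dW_s)dt+\sigma dW_t$ with $(A,B)$ controllable.) $\overline\sigma\in L^\infty([0,T],\mathbb{R}^N)$ is deterministic, $\overline r(t)=\int_{t-h_m}^t\overline G(t-s)\overline\sigma(s)\,dW_s$ with $\overline G:[0,h_m]\to\mathbb{R}^{N\times N}$ a deterministic function ($G$ being $C^1$). The initial value $Z(0)\in\mathbb{R}^N$ and the input history $U|_{[-h_m,0)}$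 are fixed and deterministic. Conventions: $\overline\sigma(s)=0$ for $s<0$. $Z_i,\overline\sigma_i,\overline G_i$ denote the $i$-th blocks (of $N_i$ rows). $\Sigma_{Z_i}(t)=\mathbb{E}[(Z_i(t)-\mathbb{E}Z_i(t))(Z_i(t)-\mathbb{E}Z_i(t))^T]$ is the covariance matrix. Set $h_{m+1}=2h_m$ and let $P_i\in\mathbb{R}^{N_i\times N}$ be the matrix with $P_iZ=Z_i$. The deterministic functions $\Gamma_i:[0,h_{i+1}]\to\mathbb{R}^{N_i\times N}$ are defined recursively for $i=m,m-1,\dots,1$ by $$\Gamma_i(u)=\int_{\max(u-h_{i+1},0)}^{\min(u,h_m)}e^{\overline A_{ii}(u-s)}\overline G_i(s)\,ds+\mathbf 1_{[0,h_i]}(u)\,e^{\overline A_{ii}u}P_i+\sum_{j=i+1}^m\Theta_{i,j}(u),$$ $$\Theta_{i,j}(u)=\int_{\max(u-h_{i+1},0)}^{\min(u,h_{j+1})}e^{\overline A_{ii}(u-s')}\overline A_{ij}\Gamma_j(s')\,ds'.$$ *)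

theory Defs
  imports "HOL-Probability.Probability"
begin

section \<open>Matrices and blocks\<close>

text \<open>
  On the type \<^typ>\<open>real^'n^'n\<close> the operations \<open>*\<close>, \<open>^\<close> and \<open>exp\<close> are not the matrix
  operations (the first two act componentwise), so powers and the exponential
  series are defined from the matrix product.
\<close>

definition matpow :: "real^'n^'n \<Rightarrow> nat \<Rightarrow> real^'n^'n" where
  "matpow A k = (((**) A) ^^ k) (mat 1)"

definition matexp :: "real^'n^'n \<Rightarrow> real^'n^'n" where
  "matexp A = (\<Sum>k. (1 / fact k) *\<^sub>R matpow A k)"

definition outer :: "real^'n \<Rightarrow> real^'n \<Rightarrow> real^'n^'n" where
  "outer v w = (\<chi> r c. v $ r * w $ c)"

definition sym_pos_def :: "real^'n^'n \<Rightarrow> bool" where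
  "sym_pos_def S \<longleftrightarrow> transpose S = S \<and> (\<forall>x. x \<noteq> 0 \<longrightarrow> 0 < x \<bullet> (S *v x))"

text \<open>
  The splitting \<open>N = N\<^sub>1 + \<dots> + N\<^sub>m\<close> is a monotone surjection \<open>blk\<close> from the coordinates
  (type \<open>'n\<close>) onto the blocks (type \<open>'m\<close>, which also indexes delays and inputs), and \<open>N\<^sub>i\<close> is the
  number of coordinates in block \<open>i\<close>.  Since the \<open>N\<^sub>i\<close> differ, a block of a matrix or
  vector is kept in the ambient size and extended by zero outside its rows and columns.  Sums and
  products of blocks are then the usual ones.  The exponential of a diagonal block
  extended by zero is the exponential of the block on block \<open>i\<close> and the identity on the other
  coordinates; below it only multiplies matrices whose rows outside block \<open>i\<close> vanish.
\<close>

definition splitting :: "('n::{finite,linorder} \<Rightarrow> 'm::{finite,linorder}) \<Rightarrow> bool" where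
  "splitting blk \<longleftrightarrow> mono blk \<and> surj blk"

definition block_size :: "('n::finite \<Rightarrow> 'm) \<Rightarrow> 'm \<Rightarrow> nat" where
  "block_size blk i = card {r. blk r = i}"

definition block :: "('n::finite \<Rightarrow> 'm) \<Rightarrow> 'm \<Rightarrow> 'm \<Rightarrow> real^'n^'n \<Rightarrow> real^'n^'n" where
  "block blk i j A = (\<chi> r c. if blk r = i \<and> blk c = j then A $ r $ c else 0)"

definition block_col :: "('n::finite \<Rightarrow> 'm::finite) \<Rightarrow> 'm \<Rightarrow> 'm \<Rightarrow> real^'m^'n \<Rightarrow> real^'n" where
  "block_col blk i j B = (\<chi> r. if blk r = i then B $ r $ j else 0)"

definition block_proj :: "('n::finite \<Rightarrow> 'm) \<Rightarrow> 'm \<Rightarrow> real^'n^'n" where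
  "block_proj blk i = (\<chi> r c. if r = c \<and> blk r = i then 1 else 0)"

definition block_upper_triangular ::
  "('n::finite \<Rightarrow> 'm::{finite,linorder}) \<Rightarrow> real^'n^'n \<Rightarrow> real^('m::_)^'n \<Rightarrow> bool" where
  "block_upper_triangular blk A B \<longleftrightarrow>
     (\<forall>i j. j < i \<longrightarrow> block blk i j A = 0 \<and> block_col blk i j B = 0)"

text \<open>Kalman's criterion: the matrix \<open>[b, A b, \<dots>, A\<^sup>n\<^sup>-\<^sup>1 b]\<close> has rank \<open>n\<close>, where
  \<open>A\<close> and \<open>b\<close> are the \<open>i\<close>-th diagonal blocks and \<open>n = N\<^sub>i\<close>.\<close>

definition controllable_block ::
  "('n::finite \<Rightarrow> 'm::finite) \<Rightarrow> real^'n^'n \<Rightarrow> real^'m^'n \<Rightarrow> 'm \<Rightarrow> bool" where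
  "controllable_block blk A B i \<longleftrightarrow>
     dim {matpow (block blk i i A) k *v block_col blk i i B | k. k < block_size blk i}
       = block_size blk i"


section \<open>Delays and the functions Gamma\<close>

definition last_delay :: "('m::{finite,linorder} \<Rightarrow> real) \<Rightarrow> real" where
  "last_delay h = h (Max UNIV)"

text \<open>\<open>next_delay h i\<close> is \<open>h\<^sub>i\<^sub>+\<^sub>1\<close>, with the convention \<open>h\<^sub>m\<^sub>+\<^sub>1 = 2 h\<^sub>m\<close>.\<close>

definition next_delay :: "('m::{finite,linorder} \<Rightarrow> real) \<Rightarrow> 'm \<Rightarrow> real" where
  "next_delay h i = (if \<exists>j. i < j then h (Min {j. i < j}) else 2 * last_delay h)"

text \<open>The last argument of \<open>Theta\<close> is the function \<open>\<Gamma>\<^sub>j\<close>.\<close>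

definition Theta ::
  "('n::finite \<Rightarrow> 'm::{finite,linorder}) \<Rightarrow> real^'n^'n \<Rightarrow> ('m \<Rightarrow> real) \<Rightarrow> 'm \<Rightarrow> 'm
    \<Rightarrow> (real \<Rightarrow> real^'n^'n) \<Rightarrow> real \<Rightarrow> real^'n^'n" where
  "Theta blk A h i j \<Gamma>j u =
     (LINT s:{max (u - next_delay h i) 0..min u (next_delay h j)}|lborel.
        matexp ((u - s) *\<^sub>R block blk i i A) ** block blk i j A ** \<Gamma>j s)"

function Gam ::
  "('n::finite \<Rightarrow> 'm::{finite,linorder}) \<Rightarrow> real^'n^'n \<Rightarrow> (real \<Rightarrow> real^'n^'n) \<Rightarrow> ('m \<Rightarrow> real)
    \<Rightarrow> 'm \<Rightarrow> real \<Rightarrow> real^'n^'n" where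
  "Gam blk A G h i = (\<lambda>u.
     (LINT s:{max (u - next_delay h i) 0..min u (last_delay h)}|lborel.
        matexp ((u - s) *\<^sub>R block blk i i A) ** (block_proj blk i ** G s))
     + indicator {0..h i} u *\<^sub>R (matexp (u *\<^sub>R block blk i i A) ** block_proj blk i)
     + (\<Sum>j\<in>{i<..}. Theta blk A h i j (Gam blk A G h j) u))"
  by pat_completeness auto
termination
  by (relation "Wellfounded.measure (\<lambda>(blk, A, G, h, i). card {i<..})")
     (auto intro!: psubset_card_mono)

declare Gam.simps [simp del]

definition Sigma_min ::
  "('n::finite \<Rightarrow> 'm::{finite,linorder}) \<Rightarrow> real^'n^'n \<Rightarrow> (real \<Rightarrow> real^'n^'n) \<Rightarrow> ('m \<Rightarrow> real)
    \<Rightarrow> (real \<Rightarrow> real^'n) \<Rightarrow> real \<Rightarrow> 'm \<Rightarrow> real^'n^'n" where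
  "Sigma_min blk A G h \<sigma> T i =
     (LINT s:{T - h i..T}|lborel.
        Gam blk A G h i (T - s) ** outer (\<sigma> s) (\<sigma> s) ** transpose (Gam blk A G h i (T - s)))"


section \<open>Filtrations, Wiener processes, stochastic integrals\<close>

definition filtration_on :: "'w measure \<Rightarrow> (real \<Rightarrow> 'w measure) \<Rightarrow> bool" where
  "filtration_on M F \<longleftrightarrow>
     (\<forall>t\<ge>0. subalgebra M (F t)) \<and> (\<forall>s t. 0 \<le> s \<longrightarrow> s \<le> t \<longrightarrow> sets (F s) \<subseteq> sets (F t))"

text \<open>The increments are only required to be independent of each other; a Wiener process whose
  increments are independent of the past of the filtration is a special case.\<close>

definition adapted_wiener_process ::
  "'w measure \<Rightarrow> (real \<Rightarrow> 'w measure) \<Rightarrow> (real \<Rightarrow> 'w \<Rightarrow> real) \<Rightarrow> bool" where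
  "adapted_wiener_process M F W \<longleftrightarrow>
     (\<forall>t\<ge>0. W t \<in> borel_measurable (F t)) \<and>
     (AE \<omega> in M. W 0 \<omega> = 0 \<and> continuous_on {0..} (\<lambda>t. W t \<omega>)) \<and>
     (\<forall>s t. 0 \<le> s \<longrightarrow> s < t \<longrightarrow>
        distributed M lborel (\<lambda>\<omega>. W t \<omega> - W s \<omega>) (normal_density 0 (sqrt (t - s)))) \<and>
     (\<forall>(t::nat \<Rightarrow> real) n. 0 \<le> t 0 \<longrightarrow> mono t \<longrightarrow>
        prob_space.indep_vars M (\<lambda>_. borel) (\<lambda>k \<omega>. W (t (Suc k)) \<omega> - W (t k) \<omega>) {..<n})"

definition progressively_measurable ::
  "(real \<Rightarrow> 'w measure) \<Rightarrow> real \<Rightarrow> (real \<Rightarrow> 'w \<Rightarrow> 'b::euclidean_space) \<Rightarrow> bool" where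
  "progressively_measurable F T X \<longleftrightarrow>
     (\<forall>t\<in>{0..T}. (\<lambda>(s, \<omega>). X s \<omega>) \<in> borel_measurable (restrict_space borel {0..t} \<Otimes>\<^sub>M F t))"

definition L2_progressive ::
  "'w measure \<Rightarrow> (real \<Rightarrow> 'w measure) \<Rightarrow> real \<Rightarrow> (real \<Rightarrow> 'w \<Rightarrow> 'b::euclidean_space) set" where
  "L2_progressive M F T =
     {X. progressively_measurable F T X \<and>
         (\<integral>\<^sup>+s\<in>{0..T}. (\<integral>\<^sup>+\<omega>. ennreal ((norm (X s \<omega>))\<^sup>2) \<partial>M) \<partial>lborel) < \<infinity>}"

text \<open>
  Every integrand of \<open>dW\<close> below is deterministic, so that the Ito integral is the Wiener integral:
  \<open>X\<close> is (a version of) the integral of \<open>f\<close> over \<open>[a, b]\<close> iff it is the limit in mean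
  square of integrals of step functions converging to \<open>f\<close> in mean square.
\<close>

definition step_function ::
  "nat \<Rightarrow> (nat \<Rightarrow> real) \<Rightarrow> (nat \<Rightarrow> 'b::euclidean_space) \<Rightarrow> real \<Rightarrow> 'b" where
  "step_function n t c s = (\<Sum>k<n. indicator {t k<..t (Suc k)} s *\<^sub>R c k)"

definition step_integral ::
  "(real \<Rightarrow> 'w \<Rightarrow> real) \<Rightarrow> nat \<Rightarrow> (nat \<Rightarrow> real) \<Rightarrow> (nat \<Rightarrow> 'b::euclidean_space) \<Rightarrow> 'w \<Rightarrow> 'b" where
  "step_integral W n t c \<omega> = (\<Sum>k<n. (W (t (Suc k)) \<omega> - W (t k) \<omega>) *\<^sub>R c k)"

definition has_wiener_integral ::
  "'w measure \<Rightarrow> (real \<Rightarrow> 'w \<Rightarrow> real) \<Rightarrow> (real \<Rightarrow> 'b::euclidean_space) \<Rightarrow> real \<Rightarrow> real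
    \<Rightarrow> ('w \<Rightarrow> 'b) \<Rightarrow> bool" where
  "has_wiener_integral M W f a b X \<longleftrightarrow>
     set_borel_measurable borel {a..b} f \<and> X \<in> borel_measurable M \<and>
     (\<forall>\<epsilon>::real. 0 < \<epsilon> \<longrightarrow> (\<exists>n t c. t 0 = a \<and> t n = b \<and> (\<forall>k<n. t k \<le> t (Suc k)) \<and>
        (\<integral>\<^sup>+s\<in>{a..b}. ennreal ((norm (f s - step_function n t c s))\<^sup>2) \<partial>lborel) < ennreal \<epsilon> \<and>
        (\<integral>\<^sup>+\<omega>. ennreal ((norm (X \<omega> - step_integral W n t c \<omega>))\<^sup>2) \<partial>M) < ennreal \<epsilon>))"


section \<open>The controlled equation\<close>

definition essentially_bounded :: "real \<Rightarrow> (real \<Rightarrow> real^'n) \<Rightarrow> bool" where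
  "essentially_bounded T \<sigma> \<longleftrightarrow>
     set_borel_measurable borel {0..T} \<sigma> \<and> (\<exists>C. AE s in lborel. s \<in> {0..T} \<longrightarrow> norm (\<sigma> s) \<le> C)"

definition C1_on :: "real set \<Rightarrow> (real \<Rightarrow> 'b::real_normed_vector) \<Rightarrow> bool" where
  "C1_on S f \<longleftrightarrow>
     (\<exists>f'. continuous_on S f' \<and> (\<forall>x\<in>S. (f has_vector_derivative f' x) (at x within S)))"

text \<open>The vector \<open>(U\<^sub>1(t - h\<^sub>1), \<dots>, U\<^sub>m(t - h\<^sub>m))\<close>, where \<open>hist\<close> is the input on \<open>[-h\<^sub>m, 0)\<close>.\<close>

definition delayed_input ::
  "('m::finite \<Rightarrow> real) \<Rightarrow> (real \<Rightarrow> real^'m) \<Rightarrow> (real \<Rightarrow> 'w \<Rightarrow> real^'m) \<Rightarrow> real \<Rightarrow> 'w \<Rightarrow> real^'m" where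
  "delayed_input h hist U t \<omega> =
     (\<chi> i. (if t - h i < 0 then hist (t - h i) else U (t - h i) \<omega>) $ i)"

text \<open>
  The process \<open>r\<close> with \<open>r(t) = \<integral>\<^sub>t\<^sub>-\<^sub>h\<^sub>m\<^sup>t G(t - s) \<sigma>(s) dW\<^sub>s\<close>, taken progressively measurable so that
  it can be integrated pathwise.  As \<open>\<sigma>\<close> is zero at negative times by convention, the integral
  starts at \<open>max 0 (t - h\<^sub>m)\<close>.
\<close>

definition noise_memory ::
  "'w measure \<Rightarrow> (real \<Rightarrow> 'w measure) \<Rightarrow> (real \<Rightarrow> 'w \<Rightarrow> real) \<Rightarrow> real \<Rightarrow> ('m::{finite,linorder} \<Rightarrow> real)
    \<Rightarrow> (real \<Rightarrow> real^'n^'n) \<Rightarrow> (real \<Rightarrow> real^'n) \<Rightarrow> (real \<Rightarrow> 'w \<Rightarrow> real^'n) \<Rightarrow> bool" where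
  "noise_memory M F W T h G \<sigma> r \<longleftrightarrow>
     r \<in> L2_progressive M F T \<and>
     (\<forall>t\<in>{0..T}. has_wiener_integral M W (\<lambda>s. G (t - s) *v \<sigma> s) (max 0 (t - last_delay h)) t (r t))"

definition is_solution ::
  "'w measure \<Rightarrow> (real \<Rightarrow> 'w measure) \<Rightarrow> (real \<Rightarrow> 'w \<Rightarrow> real) \<Rightarrow> real
    \<Rightarrow> real^'n^'n \<Rightarrow> real^('m::_)^'n \<Rightarrow> ('m::{finite,linorder} \<Rightarrow> real)
    \<Rightarrow> (real \<Rightarrow> real^'n^'n) \<Rightarrow> (real \<Rightarrow> real^'n) \<Rightarrow> real^'n \<Rightarrow> (real \<Rightarrow> real^('m::_))
    \<Rightarrow> (real \<Rightarrow> 'w \<Rightarrow> real^('m::_)) \<Rightarrow> (real \<Rightarrow> 'w \<Rightarrow> real^'n) \<Rightarrow> bool" where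
  "is_solution M F W T A B h G \<sigma> z0 hist U Z \<longleftrightarrow>
     Z \<in> L2_progressive M F T \<and>
     (\<exists>r. noise_memory M F W T h G \<sigma> r \<and>
       (let drift = (\<lambda>s \<omega>. A *v Z s \<omega> + B *v delayed_input h hist U s \<omega> + r s \<omega>) in
        (AE \<omega> in M. set_integrable lborel {0..T} (\<lambda>s. drift s \<omega>)) \<and>
        (\<forall>t\<in>{0..T}. \<exists>I. has_wiener_integral M W \<sigma> 0 t I \<and>
           (AE \<omega> in M. Z t \<omega> = z0 + (LINT s:{0..t}|lborel. drift s \<omega>) + I \<omega>))))"

definition mean :: "'w measure \<Rightarrow> ('w \<Rightarrow> real^'n) \<Rightarrow> real^'n" where
  "mean M X = (\<integral>\<omega>. X \<omega> \<partial>M)"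

definition covariance :: "'w measure \<Rightarrow> ('w \<Rightarrow> real^'n) \<Rightarrow> real^'n^'n" where
  "covariance M X = (\<integral>\<omega>. outer (X \<omega> - mean M X) (X \<omega> - mean M X) \<partial>M)"

end

theory Submission
  imports Defs
begin

text \<open>
  The state depends linearly on the noise and on the controls, so the question can be reduced to
  deterministic kernels. With zero input after time \<open>0\<close>, the state at time \<open>T\<close> is a constant plus a Wiener
  integral \<open>\<integral> \<Phi> dW\<close>, where \<open>\<Phi> u\<close> is the response at time \<open>T\<close> of the system, memory included, to a unit of
  noise at time \<open>u\<close> (\<open>open_loop_kernel\<close>). Block \<open>i\<close> of this response is \<open>\<Gamma>\<^sub>i (T - u) \<sigma>(u)\<close> as long as
  \<open>u \<ge> T - h\<^sub>i\<close>, because there the recursion for \<open>\<Gamma>\<close> is the variation-of-constants formula carried out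
  block by block (\<open>Gam_eq_flow\<close>).

  Let \<open>\<epsilon> > 0\<close> be small. The inputs that arrive during \<open>[T - \<epsilon>, T]\<close> through the channels \<open>i \<le> j\<close> are
  chosen no earlier than \<open>T - \<epsilon> - h\<^sub>i \<ge> T - \<epsilon> - h\<^sub>j\<close>. They may therefore depend on a random vector \<open>\<xi>\<^sub>j\<close>
  that is known at time \<open>T - \<epsilon> - h\<^sub>j\<close>. Since the system is block upper triangular with controllable
  diagonal blocks, these channels suffice to shift block \<open>j\<close> of the terminal state by any amount while
  leaving all other blocks where they are (\<open>steer_block\<close>). So the blocks can be treated independently
  of each other: block \<open>j\<close> is shifted by a constant, which corrects the mean, and by a Wiener integral over
  \<open>[0, T - \<epsilon> - h\<^sub>j]\<close>, which cancels the noise of block \<open>j\<close> from this period and replaces it by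
  \<open>\<integral> \<phi>\<^sub>j dW\<close> for a function \<open>\<phi>\<^sub>j\<close> of our choice. What remains in block \<open>j\<close> is the noise of
  \<open>[T - h\<^sub>j - \<epsilon>, T - h\<^sub>j]\<close>, whose covariance is of order \<open>\<epsilon>\<close>, and that of \<open>[T - h\<^sub>j, T]\<close>, whose covariance
  is \<open>\<Sigma>\<^sub>m\<^sub>i\<^sub>n\<close>. The target is positive definite, so for small \<open>\<epsilon>\<close> the diagonal block of
  the target minus the first of these covariances is positive semidefinite (\<open>covariance_deficit\<close>),
  hence a finite sum of matrices \<open>y y\<^sup>T\<close>, and it is the covariance of \<open>\<integral> \<phi>\<^sub>j dW\<close> for a step function
  \<open>\<phi>\<^sub>j\<close> (\<open>realise_covariance\<close>).

  All integrands of \<open>dW\<close> are deterministic, so the isometry \<open>E[\<integral> f dW \<integral> g dW] = \<integral> f g\<close> does the work of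
  stochastic calculus. In particular, a time integral of Wiener integrals is the Wiener integral of the
  integrated kernel because the difference of the two has variance zero (\<open>wi_time_integral\<close>).
  The equation itself is linear with additive noise and is solved path by path
  after splitting off the process \<open>\<integral>\<^sub>0\<^sup>t \<sigma> dW\<close>; this gives a solution for every square-integrable control
  (\<open>solution_exists\<close>) and the value at time \<open>T\<close> of any solution (\<open>solution_formula\<close>).
\<close>

section \<open>Matrix exponentials and variation of constants\<close>

lemma matrix_vector_bounded_bilinear:
  "bounded_bilinear ((*v) :: real^'n^'m \<Rightarrow> real^'n \<Rightarrow> real^'m)"
  unfolding bilinear_conv_bounded_bilinear[symmetric] bilinear_def
  by (auto intro!: linearI simp: vec_eq_iff matrix_vector_mult_def sum.distrib sum_distrib_left
      algebra_simps)

lemma matrix_matrix_bounded_bilinear: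
  "bounded_bilinear ((**) :: real^'k^'m \<Rightarrow> real^'n^'k \<Rightarrow> real^'n^'m)"
  unfolding bilinear_conv_bounded_bilinear[symmetric] bilinear_def
  by (auto intro!: linearI simp: vec_eq_iff matrix_matrix_mult_def sum.distrib sum_distrib_left
      algebra_simps)

interpretation mv: bounded_bilinear "(*v) :: real^'n^'m \<Rightarrow> real^'n \<Rightarrow> real^'m"
  by (rule matrix_vector_bounded_bilinear)

interpretation mm: bounded_bilinear "(**) :: real^'k^'m \<Rightarrow> real^'n^'k \<Rightarrow> real^'n^'m"
  by (rule matrix_matrix_bounded_bilinear)

lemma matpow_0: "matpow A 0 = mat 1"
  by (simp add: matpow_def)

lemma matpow_Suc: "matpow A (Suc k) = A ** matpow A k"
  by (simp add: matpow_def)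

lemma matpow_Suc_right: "matpow A (Suc k) = matpow A k ** A"
  by (induction k) (simp_all add: matpow_0 matpow_Suc matrix_mul_assoc)

lemma matpow_scaleR: "matpow (c *\<^sub>R A) k = c ^ k *\<^sub>R matpow A k"
  by (induction k) (simp_all add: matpow_0 matpow_Suc mm.scaleR_left mm.scaleR_right)

text \<open>
  A geometric bound on the entries of the powers lets the scalar exponential series dominate each entry
  of the matrix series.
\<close>

lemma matpow_entry_bound:
  fixes A :: "real^'n^'n"
  obtains C where "0 \<le> C" "\<And>k i j. \<bar>matpow A k $ i $ j\<bar> \<le> C ^ k"
proof
  define C where "C = (\<Sum>i\<in>UNIV. \<Sum>j\<in>UNIV. \<bar>A $ i $ j\<bar>)"
  show "0 \<le> C" by (auto simp: C_def intro!: sum_nonneg)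
  have row: "(\<Sum>j\<in>UNIV. \<bar>A $ i $ j\<bar>) \<le> C" for i
    unfolding C_def by (rule member_le_sum) (auto intro: sum_nonneg)
  show "\<bar>matpow A k $ i $ j\<bar> \<le> C ^ k" for k i j
  proof (induction k arbitrary: i j)
    case 0
    then show ?case by (simp add: matpow_0 mat_def)
  next
    case (Suc k)
    have "\<bar>matpow A (Suc k) $ i $ j\<bar> \<le> (\<Sum>l\<in>UNIV. \<bar>A $ i $ l * matpow A k $ l $ j\<bar>)"
      by (simp add: matpow_Suc matrix_matrix_mult_def sum_abs)
    also have "\<dots> \<le> (\<Sum>l\<in>UNIV. \<bar>A $ i $ l\<bar> * C ^ k)"
      by (intro sum_mono) (auto simp: abs_mult intro!: mult_left_mono Suc)
    also have "\<dots> \<le> C * C ^ k"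
      using \<open>0 \<le> C\<close> by (auto simp: sum_distrib_right[symmetric] intro!: mult_right_mono row)
    finally show ?case by simp
  qed
qed

abbreviation semigroup_exp :: "real^'n^'n \<Rightarrow> real \<Rightarrow> real^'n^'n" where
  "semigroup_exp A t \<equiv> matexp (t *\<^sub>R A)"

text \<open>
  Each entry of \<open>e\<^sup>t\<^sup>A\<close> is a power series in \<open>t\<close>, so differentiation is left to the theory of
  power series.
\<close>

lemma semigroup_exp_entry:
  fixes A :: "real^'n^'n"
  shows "semigroup_exp A t $ i $ j = (\<Sum>k. (matpow A k $ i $ j / fact k) * t ^ k)"
    and "summable (\<lambda>k. (matpow A k $ i $ j / fact k) * t ^ k)"
proof -
  obtain C where C: "0 \<le> C" "\<And>k i j. \<bar>matpow A k $ i $ j\<bar> \<le> C ^ k"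
    using matpow_entry_bound[of A] by metis
  have sm: "summable (\<lambda>k. (matpow A k $ i $ j / fact k) * t ^ k)" for i j
  proof (rule summable_comparison_test')
    show "summable (\<lambda>k. (C * \<bar>t\<bar>) ^ k /\<^sub>R fact k)"
      by (rule summable_exp_generic)
    show "norm ((matpow A k $ i $ j / fact k) * t ^ k) \<le> (C * \<bar>t\<bar>) ^ k /\<^sub>R fact k" for k
      using C(2)[of k i j]
      by (simp add: abs_mult power_abs power_mult_distrib field_simps)
        (metis mult.commute mult_right_mono zero_le_power abs_ge_zero)
  qed
  then show "summable (\<lambda>k. (matpow A k $ i $ j / fact k) * t ^ k)" .
  have "(\<lambda>k. (1 / fact k) *\<^sub>R matpow (t *\<^sub>R A) k)
      sums (\<chi> i j. \<Sum>k. (matpow A k $ i $ j / fact k) * t ^ k)"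
    unfolding sums_def
  proof (intro vec_tendstoI)
    fix i j
    show "((\<lambda>n. (\<Sum>k<n. (1 / fact k) *\<^sub>R matpow (t *\<^sub>R A) k) $ i $ j) \<longlongrightarrow>
      (\<chi> i j. \<Sum>k. (matpow A k $ i $ j / fact k) * t ^ k) $ i $ j) sequentially"
      using summable_LIMSEQ[OF sm[of i j]] by (simp add: sum_component matpow_scaleR mult.commute)
  qed
  then show "semigroup_exp A t $ i $ j = (\<Sum>k. (matpow A k $ i $ j / fact k) * t ^ k)"
    unfolding matexp_def by (simp add: sums_unique[symmetric])
qed

lemma semigroup_exp_0 [simp]: "matexp 0 = (mat 1 :: real^'n^'n)"
proof -
  have "semigroup_exp 0 0 $ i $ j = (mat 1 :: real^'n^'n) $ i $ j" for i j
    unfolding semigroup_exp_entry powser_zero by (simp add: matpow_0)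
  then show ?thesis by (simp add: vec_eq_iff)
qed

lemma semigroup_exp_entry_deriv:
  fixes A :: "real^'n^'n"
  shows "((\<lambda>t. semigroup_exp A t $ i $ j) has_real_derivative
     (\<Sum>k. (matpow A (Suc k) $ i $ j / fact k) * t ^ k)) (at t)"
proof -
  let ?c = "\<lambda>k. matpow A k $ i $ j / fact k"
  have "((\<lambda>t. \<Sum>k. ?c k * t ^ k) has_real_derivative (\<Sum>k. diffs ?c k * t ^ k)) (at t)"
    by (rule termdiffs_strong_converges_everywhere) (rule semigroup_exp_entry(2))
  moreover have "diffs ?c k = matpow A (Suc k) $ i $ j / fact k" for k
    by (simp add: diffs_def field_simps del: of_nat_Suc)
  ultimately show ?thesis by (simp add: semigroup_exp_entry(1))
qed

text \<open>
  Differentiation shifts the coefficients by one power of \<open>A\<close>, and this factor can be split off on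
  either side.
\<close>

lemma semigroup_exp_deriv:
  fixes A :: "real^'n^'n"
  shows "(semigroup_exp A has_vector_derivative (A ** semigroup_exp A t)) (at t)"
    and "(semigroup_exp A has_vector_derivative (semigroup_exp A t ** A)) (at t)"
proof -
  have D: "(semigroup_exp A has_vector_derivative X) (at t)"
    if X: "\<And>i j. X $ i $ j = (\<Sum>k. (matpow A (Suc k) $ i $ j / fact k) * t ^ k)" for X
  proof -
    have "((\<lambda>t. semigroup_exp A t \<bullet> b) has_vector_derivative X \<bullet> b) (at t)"
      if "b \<in> Basis" for b
    proof -
      from that obtain i j where "b = axis i (axis j 1)"
        by (auto simp: Basis_vec_def)
      then show ?thesis
        using semigroup_exp_entry_deriv[of A i j t]
        by (simp add: inner_axis X has_real_derivative_iff_has_vector_derivative)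
    qed
    then show ?thesis
      unfolding has_vector_derivative_def
      by (subst has_derivative_componentwise_within) (simp add: inner_scaleR_left)
  qed
  note S = semigroup_exp_entry(2)
  show "(semigroup_exp A has_vector_derivative (A ** semigroup_exp A t)) (at t)"
  proof (rule D)
    fix i j
    have "(\<Sum>k. (matpow A (Suc k) $ i $ j / fact k) * t ^ k) =
        (\<Sum>k. \<Sum>l\<in>UNIV. A $ i $ l * ((matpow A k $ l $ j / fact k) * t ^ k))"
      by (simp add: matpow_Suc matrix_matrix_mult_def sum_divide_distrib sum_distrib_right
          mult.assoc)
    also have "\<dots> = (\<Sum>l\<in>UNIV. \<Sum>k. A $ i $ l * ((matpow A k $ l $ j / fact k) * t ^ k))"
      by (rule suminf_sum) (intro summable_mult S)
    also have "\<dots> = (A ** semigroup_exp A t) $ i $ j"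
      unfolding matrix_matrix_mult_def semigroup_exp_entry(1) vec_lambda_beta
      by (intro sum.cong refl suminf_mult S)
    finally show "(A ** semigroup_exp A t) $ i $ j =
      (\<Sum>k. (matpow A (Suc k) $ i $ j / fact k) * t ^ k)" by simp
  qed
  show "(semigroup_exp A has_vector_derivative (semigroup_exp A t ** A)) (at t)"
  proof (rule D)
    fix i j
    have "(\<Sum>k. (matpow A (Suc k) $ i $ j / fact k) * t ^ k) =
        (\<Sum>k. \<Sum>l\<in>UNIV. ((matpow A k $ i $ l / fact k) * t ^ k) * A $ l $ j)"
      by (intro suminf_cong)
        (simp add: matpow_Suc_right matrix_matrix_mult_def sum_divide_distrib sum_distrib_left
          sum_distrib_right mult_ac)
    also have "\<dots> = (\<Sum>l\<in>UNIV. \<Sum>k. ((matpow A k $ i $ l / fact k) * t ^ k) * A $ l $ j)"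
      by (rule suminf_sum) (intro summable_mult2 S)
    also have "\<dots> = (semigroup_exp A t ** A) $ i $ j"
      unfolding matrix_matrix_mult_def semigroup_exp_entry(1) vec_lambda_beta
      by (intro sum.cong refl suminf_mult2[symmetric] S)
    finally show "(semigroup_exp A t ** A) $ i $ j =
      (\<Sum>k. (matpow A (Suc k) $ i $ j / fact k) * t ^ k)" by simp
  qed
qed

lemma semigroup_exp_commute:
  fixes A :: "real^'n^'n"
  shows "A ** semigroup_exp A t = semigroup_exp A t ** A"
  using vector_derivative_unique_at semigroup_exp_deriv by blast

lemma continuous_semigroup_exp: "continuous_on S (semigroup_exp A)"
  by (rule continuous_at_imp_continuous_on, intro ballI)
     (rule has_vector_derivative_continuous[OF semigroup_exp_deriv(1)])

lemma continuous_semigroup_exp_compose [continuous_intros]: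
  "continuous_on S f \<Longrightarrow> continuous_on S (\<lambda>x. semigroup_exp A (f x))"
  using continuous_on_compose2[OF continuous_semigroup_exp[of UNIV A]] by auto

lemma borel_measurable_semigroup_exp [measurable]:
  "semigroup_exp A \<in> borel_measurable borel"
  by (intro borel_measurable_continuous_onI continuous_semigroup_exp)

lemma borel_measurable_matrix_vector [measurable (raw)]:
  fixes f :: "'a \<Rightarrow> real^'n^'m" and g :: "'a \<Rightarrow> real^'n"
  assumes "f \<in> borel_measurable N" "g \<in> borel_measurable N"
  shows "(\<lambda>x. f x *v g x) \<in> borel_measurable N"
  by (rule borel_measurable_continuous_Pair[OF assms]) (intro mv.continuous_on continuous_intros)

lemma borel_measurable_nth [measurable (raw)]:
  fixes f :: "'a \<Rightarrow> ('b::euclidean_space)^'n"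
  assumes [measurable]: "f \<in> borel_measurable N"
  shows "(\<lambda>x. f x $ i) \<in> borel_measurable N"
proof -
  have "(\<lambda>v::'b^'n. v $ i) \<in> borel_measurable borel"
    by (intro borel_measurable_continuous_onI continuous_intros)
  from measurable_compose[OF assms this] show ?thesis .
qed

lemma borel_measurable_vec_lambda [measurable (raw)]:
  fixes f :: "'a \<Rightarrow> 'n::finite \<Rightarrow> real"
  assumes "\<And>i. (\<lambda>x. f x i) \<in> borel_measurable N"
  shows "(\<lambda>x. \<chi> i. f x i) \<in> borel_measurable N"
proof (subst borel_measurable_euclidean_space, intro ballI)
  fix b :: "real^'n" assume "b \<in> Basis"
  then obtain i where "b = axis i 1" by (auto simp: Basis_vec_def)
  then show "(\<lambda>x. (\<chi> i. f x i) \<bullet> b) \<in> borel_measurable N"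
    using assms[of i] by (simp add: inner_axis)
qed

lemma continuous_compact_bound:
  fixes f :: "'a::topological_space \<Rightarrow> 'b::real_normed_vector"
  assumes "compact S" "continuous_on S f"
  obtains C where "0 \<le> C" "\<And>x. x \<in> S \<Longrightarrow> norm (f x) \<le> C"
proof -
  have "bounded (f ` S)" using assms compact_continuous_image compact_imp_bounded by blast
  then obtain C where "\<And>x. x \<in> S \<Longrightarrow> norm (f x) \<le> C" by (auto simp: bounded_iff)
  then show ?thesis using that[of "max C 0"] by (auto simp: le_max_iff_disj)
qed

lemma mv_norm_bound: "\<exists>K>0. \<forall>(X::real^'n^'m) v. norm (X *v v) \<le> norm X * norm v * K"
  using mv.pos_bounded by blast

lemma set_integrable_kernel_mult:
  fixes K :: "real \<Rightarrow> real^'n^'m" and p :: "real \<Rightarrow> real^'n"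
  assumes p: "set_integrable lborel {a..b} p" and K: "continuous_on {a..b} K"
  shows "set_integrable lborel {a..b} (\<lambda>s. K s *v p s)"
proof -
  obtain C where C: "\<And>s. s \<in> {a..b} \<Longrightarrow> norm (K s) \<le> C" "0 \<le> C"
    using continuous_compact_bound[OF compact_Icc K] by metis
  obtain L where L: "L > 0" "\<And>(X::real^'n^'m) v. norm (X *v v) \<le> norm X * norm v * L"
    using mv_norm_bound by blast
  have Km: "(\<lambda>s. indicator {a..b} s *\<^sub>R K s) \<in> borel_measurable borel"
    using borel_measurable_continuous_on_indicator[OF _ K] by auto
  have pm: "(\<lambda>s. indicator {a..b} s *\<^sub>R p s) \<in> borel_measurable borel"
    using p by (auto simp: set_integrable_def dest: borel_measurable_integrable)
  have eq: "(indicator {a..b} s *\<^sub>R K s) *v (indicator {a..b} s *\<^sub>R p s) =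
      indicator {a..b} s *\<^sub>R (K s *v p s)" for s
    by (auto simp: indicator_def)
  show ?thesis unfolding set_integrable_def
  proof (rule Bochner_Integration.integrable_bound)
    show "integrable lborel (\<lambda>s. (C * L) *\<^sub>R (indicator {a..b} s *\<^sub>R p s))"
      using p by (intro integrable_scaleR_right) (simp add: set_integrable_def)
    have "(\<lambda>s. (indicator {a..b} s *\<^sub>R K s) *v (indicator {a..b} s *\<^sub>R p s)) \<in> borel_measurable borel"
      using Km pm by measurable
    then show "(\<lambda>s. indicator {a..b} s *\<^sub>R (K s *v p s)) \<in> borel_measurable lborel"
      by (simp add: eq)
    show "AE s in lborel. norm (indicator {a..b} s *\<^sub>R (K s *v p s)) \<le>
        norm ((C * L) *\<^sub>R (indicator {a..b} s *\<^sub>R p s))"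
    proof (rule AE_I2)
      fix s
      have "norm (K s *v p s) \<le> C * L * norm (p s)" if "s \<in> {a..b}"
      proof -
        have "norm (K s *v p s) \<le> norm (K s) * norm (p s) * L" by (rule L)
        also have "\<dots> \<le> C * norm (p s) * L"
          using C(1)[OF that] L(1) by (intro mult_right_mono) auto
        finally show ?thesis by (simp add: mult_ac)
      qed
      then show "norm (indicator {a..b} s *\<^sub>R (K s *v p s)) \<le>
        norm ((C * L) *\<^sub>R (indicator {a..b} s *\<^sub>R p s))"
        using C L(1) by (auto simp: indicator_def)
    qed
  qed
qed

lemma (in pair_sigma_finite) integrable_tensor:
  fixes f :: "'a \<Rightarrow> real" and g :: "'b \<Rightarrow> real"
  assumes f: "integrable M1 f" and g: "integrable M2 g"
  shows "integrable (M1 \<Otimes>\<^sub>M M2) (\<lambda>(x, y). f x * g y)"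
proof (rule Fubini_integrable)
  note [measurable] = borel_measurable_integrable[OF f] borel_measurable_integrable[OF g]
  show "(\<lambda>(x, y). f x * g y) \<in> borel_measurable (M1 \<Otimes>\<^sub>M M2)" by measurable
  show "integrable M1 (\<lambda>x. \<integral>y. norm (case (x, y) of (x, y) \<Rightarrow> f x * g y) \<partial>M2)"
    using f by (simp add: abs_mult)
  show "AE x in M1. integrable M2 (\<lambda>y. case (x, y) of (x, y) \<Rightarrow> f x * g y)"
    using g by simp
qed

text \<open>
  The order of integration on the triangle \<open>u \<le> s \<le> T\<close>. As \<open>p\<close> is only integrable, linear equations
  whose forcing has no further regularity can be treated with it.
\<close>

lemma triangular_Fubini:
  fixes K :: "real \<Rightarrow> real \<Rightarrow> real^'n^'m" and p :: "real \<Rightarrow> real^'n"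
  assumes K: "continuous_on UNIV (\<lambda>(s, u). K s u)" and p: "set_integrable lborel {0..T} p"
  shows "(LINT s:{0..T}|lborel. LINT u:{0..s}|lborel. K s u *v p u) =
         (LINT u:{0..T}|lborel. (LINT s:{u..T}|lborel. K s u) *v p u)"
    and "set_integrable lborel {0..T} (\<lambda>s. LINT u:{0..s}|lborel. K s u *v p u)"
proof -
  define D where "D s u = (if 0 \<le> u \<and> u \<le> s \<and> s \<le> T then K s u *v p u else 0)" for s u
  define q where "q u = indicator {0..T} u *\<^sub>R p u" for u
  have q: "integrable lborel q" using p by (simp add: set_integrable_def q_def[abs_def])
  have qm[measurable]: "q \<in> borel_measurable borel" using q by auto
  obtain C where C: "\<And>s u. s \<in> {0..T} \<Longrightarrow> u \<in> {0..T} \<Longrightarrow> norm (K s u) \<le> C" "0 \<le> C"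
  proof -
    have "compact ({0..T} \<times> {0..T})" by (intro compact_Times compact_Icc)
    from continuous_compact_bound[OF this continuous_on_subset[OF K subset_UNIV]]
    obtain C where "0 \<le> C" "\<And>x. x \<in> {0..T} \<times> {0..T} \<Longrightarrow> norm (case x of (s, u) \<Rightarrow> K s u) \<le> C"
      by blast
    then show thesis using that[of C] by force
  qed
  obtain L where L: "L > 0" "\<And>(X::real^'n^'m) v. norm (X *v v) \<le> norm X * norm v * L"
    using mv_norm_bound by blast
  have Km[measurable]: "(\<lambda>(s, u). K s u) \<in> borel_measurable (borel \<Otimes>\<^sub>M borel)"
    unfolding borel_prod using K by (rule borel_measurable_continuous_onI)
  have Kn: "norm (K s u *v q u) \<le> C * L * norm (q u)" if "s \<in> {0..T}" "u \<in> {0..T}" for s u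
  proof -
    have "norm (K s u *v q u) \<le> norm (K s u) * norm (q u) * L" by (rule L)
    also have "\<dots> \<le> C * norm (q u) * L"
      using C(1)[OF that] L(1) by (intro mult_right_mono) auto
    finally show ?thesis by (simp add: mult_ac)
  qed
  have Dq: "D s u = (if 0 \<le> u \<and> u \<le> s \<and> s \<le> T then K s u *v q u else 0)" for s u
    by (auto simp: D_def q_def)
  have Dm: "(\<lambda>(s, u). D s u) \<in> borel_measurable (lborel \<Otimes>\<^sub>M lborel)"
    unfolding Dq by measurable
  have D: "integrable (lborel \<Otimes>\<^sub>M lborel) (\<lambda>(s, u). D s u)"
  proof (rule Bochner_Integration.integrable_bound[OF _ Dm])
    have "integrable (lborel \<Otimes>\<^sub>M lborel) (\<lambda>(s, u). (C * L * indicator {0..T} s) * norm (q u))"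
      by (intro lborel_pair.integrable_tensor integrable_norm q integrable_mult_right integrable_real_indicator)
        (auto simp: emeasure_lborel_Icc_eq)
    then show "integrable (lborel \<Otimes>\<^sub>M lborel) (\<lambda>(s, u). (C * L * indicator {0..T} s) * norm (q u))" .
    show "AE x in lborel \<Otimes>\<^sub>M lborel. norm (case x of (s, u) \<Rightarrow> D s u)
        \<le> norm (case x of (s, u) \<Rightarrow> (C * L * indicator {0..T} s) * norm (q u))"
      using Kn C(2) L(1) by (intro AE_I2) (auto simp: Dq split: prod.split)
  qed
  have i1: "indicator {0..T} s *\<^sub>R (LINT u:{0..s}|lborel. K s u *v p u) = (\<integral>u. D s u \<partial>lborel)" for s
  proof (cases "s \<in> {0..T}")
    case True
    then show ?thesis
      by (auto simp: set_lebesgue_integral_def D_def indicator_def intro!: Bochner_Integration.integral_cong)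
  next
    case False
    then have "D s = (\<lambda>u. 0)" by (auto simp: D_def fun_eq_iff)
    then show ?thesis using False by simp
  qed
  have i2: "indicator {0..T} u *\<^sub>R ((LINT s:{u..T}|lborel. K s u) *v p u) = (\<integral>s. D s u \<partial>lborel)" for u
  proof (cases "u \<in> {0..T}")
    case True
    have "continuous_on {u..T} (\<lambda>s. K s u)"
    proof -
      have "continuous_on {u..T} (\<lambda>s. (s, u))" by (intro continuous_intros)
      from continuous_on_compose2[OF K this] show ?thesis by simp
    qed
    then have "integrable lborel (\<lambda>s. indicator {u..T} s *\<^sub>R K s u)"
      using borel_integrable_compact[of "{u..T}"] by auto
    then have "(LINT s:{u..T}|lborel. K s u) *v p u =
        (\<integral>s. (indicator {u..T} s *\<^sub>R K s u) *v p u \<partial>lborel)"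
      unfolding set_lebesgue_integral_def
      by (intro integral_bounded_linear[OF mv.bounded_linear_left, symmetric])
    also have "\<dots> = (\<integral>s. D s u \<partial>lborel)"
      using True by (intro Bochner_Integration.integral_cong) (auto simp: D_def indicator_def)
    finally show ?thesis using True by simp
  next
    case False
    then have "D s u = 0" for s by (auto simp: D_def)
    then show ?thesis using False by simp
  qed
  show "(LINT s:{0..T}|lborel. LINT u:{0..s}|lborel. K s u *v p u) =
         (LINT u:{0..T}|lborel. (LINT s:{u..T}|lborel. K s u) *v p u)"
    unfolding set_lebesgue_integral_def[of _ "{0..T}"] i1 i2
    using lborel_pair.Fubini_integral[OF D] by simp
  show "set_integrable lborel {0..T} (\<lambda>s. LINT u:{0..s}|lborel. K s u *v p u)"
    unfolding set_integrable_def i1 using lborel_pair.integrable_fst[OF D] .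
qed

lemma LINT_semigroup_exp_right:
  fixes A :: "real^'n^'n"
  assumes "u \<le> T"
  shows "(LINT s:{u..T}|lborel. A ** semigroup_exp A (T - s)) = semigroup_exp A (T - u) - mat 1"
proof -
  have "(LINT s:{u..T}|lborel. A ** semigroup_exp A (T - s)) =
    (- semigroup_exp A (T - T)) - (- semigroup_exp A (T - u))"
    unfolding set_lebesgue_integral_def
  proof (rule integral_FTC_Icc[OF assms])
    show "((\<lambda>s. - semigroup_exp A (T - s)) has_vector_derivative A ** semigroup_exp A (T - s)) (at s within {u..T})" for s
    proof -
      have "((\<lambda>s. T - s) has_vector_derivative - 1) (at s within {u..T})"
        by (auto intro!: derivative_eq_intros)
      from vector_diff_chain_within[OF this has_vector_derivative_at_within[OF semigroup_exp_deriv(1)]]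
      have "((\<lambda>s. semigroup_exp A (T - s)) has_vector_derivative - (A ** semigroup_exp A (T - s))) (at s within {u..T})"
        by (simp add: o_def)
      from has_vector_derivative_minus[OF this] show ?thesis by simp
    qed
    show "continuous_on {u..T} (\<lambda>s. A ** semigroup_exp A (T - s))"
      by (intro mm.continuous_on continuous_intros)
  qed
  then show ?thesis by simp
qed

lemma LINT_semigroup_exp_left:
  fixes A :: "real^'n^'n"
  assumes "u \<le> T"
  shows "(LINT s:{u..T}|lborel. A ** semigroup_exp A (s - u)) = semigroup_exp A (T - u) - mat 1"
proof -
  have "(LINT s:{u..T}|lborel. A ** semigroup_exp A (s - u)) =
    semigroup_exp A (T - u) - semigroup_exp A (u - u)"
    unfolding set_lebesgue_integral_def
  proof (rule integral_FTC_Icc[OF assms])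
    show "((\<lambda>s. semigroup_exp A (s - u)) has_vector_derivative A ** semigroup_exp A (s - u)) (at s within {u..T})" for s
    proof -
      have "((\<lambda>s. s - u) has_vector_derivative 1) (at s within {u..T})"
        by (auto intro!: derivative_eq_intros)
      from vector_diff_chain_within[OF this has_vector_derivative_at_within[OF semigroup_exp_deriv(1)]]
      show ?thesis by (simp add: o_def)
    qed
    show "continuous_on {u..T} (\<lambda>s. A ** semigroup_exp A (s - u))"
      by (intro mm.continuous_on continuous_intros)
  qed
  then show ?thesis by simp
qed

lemma set_integrable_continuous:
  fixes f :: "real \<Rightarrow> 'b::euclidean_space"
  shows "continuous_on {a..b} f \<Longrightarrow> set_integrable lborel {a..b} f"
  unfolding set_integrable_def by (rule borel_integrable_compact) auto

text \<open>
  In \<open>\<integral> e\<^sup>A\<^sup>(\<^sup>T\<^sup>-\<^sup>s\<^sup>) A D(s) ds\<close> the integral defining \<open>D(s)\<close> is exchanged with the outer one. The inner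
  integral of \<open>A e\<^sup>A\<^sup>(\<^sup>T\<^sup>-\<^sup>s\<^sup>)\<close> is then \<open>e\<^sup>A\<^sup>(\<^sup>T\<^sup>-\<^sup>u\<^sup>) - 1\<close>, and the contributions of \<open>-1\<close> add up to \<open>-D(T)\<close>. The
  paths to which this is applied are absolutely continuous with an integrable density \<open>p\<close>, so an argument by
  differentiating \<open>D\<close> would not do.
\<close>

lemma variation_of_constants:
  fixes A :: "real^'n^'n" and p :: "real \<Rightarrow> real^'n"
  assumes T: "0 \<le> T" and p: "set_integrable lborel {0..T} p"
    and D: "\<And>t. t \<in> {0..T} \<Longrightarrow> D t = z0 + (LINT s:{0..t}|lborel. p s)"
  shows "D T = semigroup_exp A T *v z0 +
           (LINT s:{0..T}|lborel. semigroup_exp A (T - s) *v (p s - A *v D s))"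
proof -
  define K where "K s = A ** semigroup_exp A (T - s)" for s
  have Kc: "continuous_on S K" for S
    unfolding K_def by (intro mm.continuous_on continuous_intros)
  have KI: "set_integrable lborel {a..b} K" for a b
    by (rule set_integrable_continuous[OF Kc])
  have P0: "set_integrable lborel {0..s} p" if "s \<in> {0..T}" for s
    using that by (intro set_integrable_subset[OF p]) auto
  have PI: "set_integrable lborel {0..T} (\<lambda>s. semigroup_exp A (T - s) *v p s)"
    by (intro set_integrable_kernel_mult p continuous_intros)
  have Kp: "(LINT u:{0..s}|lborel. K s *v p u) = K s *v (LINT u:{0..s}|lborel. p u)" if "s \<in> {0..T}" for s
    using integral_bounded_linear[OF mv.bounded_linear_right P0[OF that, unfolded set_integrable_def]]
    by (simp add: set_lebesgue_integral_def mv.scaleR_right)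
  have Kz: "set_integrable lborel {0..T} (\<lambda>s. K s *v z0)"
    by (intro set_integrable_continuous mv.continuous_on Kc continuous_intros)
  have cont: "continuous_on UNIV (\<lambda>(s, u). K s :: real^'n^'n)"
    unfolding case_prod_beta by (intro continuous_on_compose2[OF Kc[of UNIV]] continuous_intros) auto
  have i1: "set_integrable lborel {0..T} (\<lambda>s. LINT u:{0..s}|lborel. K s *v p u)"
    by (rule triangular_Fubini(2)[OF cont p])
  have KD: "K s *v D s = K s *v z0 + (LINT u:{0..s}|lborel. K s *v p u)" if "s \<in> {0..T}" for s
    using that by (simp add: D Kp mv.add_right)
  have i2: "set_integrable lborel {0..T} (\<lambda>s. K s *v D s)"
    by (subst set_integrable_cong[OF refl refl KD]) (simp_all add: set_integral_add(1)[OF Kz i1])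
  have eq: "(LINT s:{u..T}|lborel. K s) = semigroup_exp A (T - u) - mat 1" if "u \<in> {0..T}" for u
    unfolding K_def using LINT_semigroup_exp_right that by auto
  have "(LINT s:{0..T}|lborel. K s *v D s) =
      (LINT s:{0..T}|lborel. K s *v z0) + (LINT s:{0..T}|lborel. LINT u:{0..s}|lborel. K s *v p u)"
    unfolding set_integral_add(2)[OF Kz i1, symmetric]
    by (intro set_lebesgue_integral_cong) (auto simp: KD)
  also have "(LINT s:{0..T}|lborel. K s *v z0) = (LINT s:{0..T}|lborel. K s) *v z0"
    using integral_bounded_linear[OF mv.bounded_linear_left KI[unfolded set_integrable_def]]
    by (simp add: set_lebesgue_integral_def mv.scaleR_left)
  also have "\<dots> = semigroup_exp A T *v z0 - z0"
    using T eq[of 0] by (simp add: mv.diff_left)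
  also have "(LINT s:{0..T}|lborel. LINT u:{0..s}|lborel. K s *v p u) =
      (LINT u:{0..T}|lborel. (LINT s:{u..T}|lborel. K s) *v p u)"
    by (rule triangular_Fubini(1)[OF cont p])
  also have "\<dots> = (LINT u:{0..T}|lborel. semigroup_exp A (T - u) *v p u - p u)"
    by (intro set_lebesgue_integral_cong) (auto simp: eq mv.diff_left)
  also have "\<dots> = (LINT u:{0..T}|lborel. semigroup_exp A (T - u) *v p u) - (D T - z0)"
    using T by (simp add: set_integral_diff(2)[OF PI p] D)
  finally have "D T = semigroup_exp A T *v z0 +
      ((LINT u:{0..T}|lborel. semigroup_exp A (T - u) *v p u) - (LINT s:{0..T}|lborel. K s *v D s))"
    by (simp add: algebra_simps)
  also have "(LINT u:{0..T}|lborel. semigroup_exp A (T - u) *v p u) - (LINT s:{0..T}|lborel. K s *v D s)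
      = (LINT s:{0..T}|lborel. semigroup_exp A (T - s) *v (p s - A *v D s))"
    unfolding set_integral_diff(2)[OF PI i2, symmetric]
    by (intro set_lebesgue_integral_cong)
       (auto simp: K_def mv.diff_right semigroup_exp_commute matrix_vector_mul_assoc)
  finally show ?thesis .
qed

text \<open>
  The solution of \<open>z' = A z + q\<close> with \<open>z(0) = z\<^sub>0\<close> by variation of constants.
\<close>

definition flow :: "real^'n^'n \<Rightarrow> real^'n \<Rightarrow> (real \<Rightarrow> real^'n) \<Rightarrow> real \<Rightarrow> real^'n" where
  "flow A z0 q t = semigroup_exp A t *v z0 + (LINT s:{0..t}|lborel. semigroup_exp A (t - s) *v q s)"

text \<open>
  The converse of \<open>variation_of_constants\<close>, again by exchanging the two integrations.
\<close>

lemma flow_solves: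
  fixes A :: "real^'n^'n"
  assumes t: "0 \<le> t" and q: "set_integrable lborel {0..t} q"
  shows "flow A z0 q t = z0 + (LINT s:{0..t}|lborel. A *v flow A z0 q s + q s)"
    and "set_integrable lborel {0..t} (flow A z0 q)"
proof -
  have cA: "continuous_on UNIV (\<lambda>(s, u). A ** semigroup_exp A (s - u))"
    and cE: "continuous_on UNIV (\<lambda>(s, u). semigroup_exp A (s - u))"
    unfolding case_prod_beta by (intro mm.continuous_on continuous_intros)+
  have E: "set_integrable lborel {0..t} (\<lambda>s. semigroup_exp A (t - s) *v q s)"
    by (intro set_integrable_kernel_mult q continuous_intros)
  have Ez: "set_integrable lborel {0..t} (\<lambda>s. semigroup_exp A s *v z0)"
    by (intro set_integrable_continuous mv.continuous_on continuous_intros)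
  have AEi: "set_integrable lborel {0..t} (\<lambda>s. A ** semigroup_exp A s)"
    by (intro set_integrable_continuous mm.continuous_on continuous_intros)
  show fi: "set_integrable lborel {0..t} (flow A z0 q)"
    unfolding flow_def[abs_def] by (intro set_integral_add Ez triangular_Fubini(2)[OF cE q])
  have Ai: "set_integrable lborel {0..t} (\<lambda>s. A *v flow A z0 q s)"
    by (intro set_integrable_kernel_mult fi continuous_intros)
  have Az: "set_integrable lborel {0..t} (\<lambda>s. (A ** semigroup_exp A s) *v z0)"
    by (intro set_integrable_continuous mv.continuous_on mm.continuous_on continuous_intros)
  have Aq: "A *v (LINT u:{0..s}|lborel. semigroup_exp A (s - u) *v q u) =
      (LINT u:{0..s}|lborel. (A ** semigroup_exp A (s - u)) *v q u)" if "s \<in> {0..t}" for s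
  proof -
    have "set_integrable lborel {0..s} (\<lambda>u. semigroup_exp A (s - u) *v q u)"
      using that by (intro set_integrable_kernel_mult continuous_intros set_integrable_subset[OF q]) auto
    from integral_bounded_linear[OF mv.bounded_linear_right this[unfolded set_integrable_def], of A]
    show ?thesis
      by (simp add: set_lebesgue_integral_def mv.scaleR_right matrix_vector_mul_assoc)
  qed
  have "(LINT s:{0..t}|lborel. A *v flow A z0 q s) = (LINT s:{0..t}|lborel. (A ** semigroup_exp A s) *v z0 +
      (LINT u:{0..s}|lborel. (A ** semigroup_exp A (s - u)) *v q u))"
    by (intro set_lebesgue_integral_cong)
       (auto simp: flow_def mv.add_right Aq matrix_vector_mul_assoc)
  also have "\<dots> = (LINT s:{0..t}|lborel. (A ** semigroup_exp A s) *v z0) +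
      (LINT s:{0..t}|lborel. LINT u:{0..s}|lborel. (A ** semigroup_exp A (s - u)) *v q u)"
    by (rule set_integral_add(2)[OF Az triangular_Fubini(2)[OF cA q]])
  also have "(LINT s:{0..t}|lborel. (A ** semigroup_exp A s) *v z0) =
      (LINT s:{0..t}|lborel. A ** semigroup_exp A s) *v z0"
    using integral_bounded_linear[OF mv.bounded_linear_left AEi[unfolded set_integrable_def]]
    by (simp add: set_lebesgue_integral_def mv.scaleR_left)
  also have "\<dots> = semigroup_exp A t *v z0 - z0"
    using LINT_semigroup_exp_left[of 0 t A] t by (simp add: mv.diff_left)
  also have "(LINT s:{0..t}|lborel. LINT u:{0..s}|lborel. (A ** semigroup_exp A (s - u)) *v q u) =
      (LINT u:{0..t}|lborel. (LINT s:{u..t}|lborel. A ** semigroup_exp A (s - u)) *v q u)"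
    by (rule triangular_Fubini(1)[OF cA q])
  also have "\<dots> = (LINT u:{0..t}|lborel. semigroup_exp A (t - u) *v q u - q u)"
    by (intro set_lebesgue_integral_cong) (auto simp: LINT_semigroup_exp_left mv.diff_left)
  also have "\<dots> = (LINT u:{0..t}|lborel. semigroup_exp A (t - u) *v q u) - (LINT u:{0..t}|lborel. q u)"
    by (rule set_integral_diff(2)[OF E q])
  finally show "flow A z0 q t = z0 + (LINT s:{0..t}|lborel. A *v flow A z0 q s + q s)"
    by (simp add: set_integral_add(2)[OF Ai q]) (simp add: flow_def)
qed

section \<open>Block structure and the functions Gamma\<close>

lemma block_proj_nth: "(block_proj blk i *v x) $ r = (if blk r = i then x $ r else 0)"
proof -
  have "(block_proj blk i *v x) $ r = (\<Sum>c\<in>UNIV. if c = r then (if blk r = i then x $ r else 0) else 0)"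
    unfolding block_proj_def matrix_vector_mult_def vec_lambda_beta
    by (intro sum.cong) auto
  then show ?thesis by simp
qed

lemma block_proj_idem: "block_proj blk i *v (block_proj blk i *v x) = block_proj blk i *v x"
  by (simp add: vec_eq_iff block_proj_nth)

lemma block_proj_orthogonal:
  "i \<noteq> j \<Longrightarrow> block_proj blk i *v (block_proj blk j *v x) = 0"
  by (auto simp: vec_eq_iff block_proj_nth)

lemma block_mv_nth:
  "(block blk i j A *v x) $ r = (if blk r = i then \<Sum>c | blk c = j. A $ r $ c * x $ c else 0)"
  by (simp add: block_def matrix_vector_mult_def if_distrib[of "\<lambda>u. u * _"] sum.If_cases cong: if_cong)

lemma sum_block_proj: "(\<Sum>j\<in>UNIV. block_proj blk j *v x) = (x :: real^'n)"
  for blk :: "'n::finite \<Rightarrow> 'm::finite"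
  by (simp add: vec_eq_iff sum_component block_proj_nth)

lemma upper_triangularD:
  assumes "block_upper_triangular blk A B"
  shows "blk c < blk r \<Longrightarrow> A $ r $ c = 0" and "j < blk r \<Longrightarrow> B $ r $ j = 0"
proof -
  show "A $ r $ c = 0" if "blk c < blk r"
  proof -
    have "block blk (blk r) (blk c) A $ r $ c = 0"
      using assms that by (simp add: block_upper_triangular_def)
    then show ?thesis by (simp add: block_def)
  qed
  show "B $ r $ j = 0" if "j < blk r"
  proof -
    have "block_col blk (blk r) j B $ r = 0"
      using assms that by (simp add: block_upper_triangular_def)
    then show ?thesis by (simp add: block_col_def)
  qed
qed

text \<open>
  A row of the triangular system sees its own block and the later ones. This is the coupling that the
  recursion for \<open>\<Gamma>\<close> follows.
\<close>

lemma block_proj_mv_upper_triangular: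
  fixes blk :: "'n::finite \<Rightarrow> 'm::{finite,linorder}"
    and A :: "real^('n::_)^('n::_)"
  assumes "block_upper_triangular blk A B"
  shows "block_proj blk i *v (A *v x) =
    block blk i i A *v (block_proj blk i *v x) +
    (\<Sum>j\<in>{i<..}. block blk i j A *v (block_proj blk j *v x))"
proof -
  have 0: "block blk i j A *v (block_proj blk j *v x) = block blk i j A *v x" for j
    by (auto simp: vec_eq_iff block_mv_nth block_proj_nth intro!: sum.cong)
  have "block_proj blk i *v (A *v x) = (\<Sum>j\<in>UNIV. block blk i j A *v x)"
  proof (simp add: vec_eq_iff sum_component block_proj_nth block_mv_nth, intro allI impI)
    fix r assume "blk r = i"
    have "(A *v x) $ r = (\<Sum>c\<in>UNIV. A $ r $ c * x $ c)"
      by (simp add: matrix_vector_mult_def)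
    also have "\<dots> = (\<Sum>j\<in>UNIV. \<Sum>c | c \<in> UNIV \<and> blk c = j. A $ r $ c * x $ c)"
      by (rule sum.group[symmetric]) auto
    finally show "(A *v x) $ r = (\<Sum>j\<in>UNIV. \<Sum>c | blk c = j. A $ r $ c * x $ c)" by simp
  qed
  also have "\<dots> = (\<Sum>j\<in>{i..}. block blk i j A *v x)"
  proof (intro sum.mono_neutral_right ballI)
    fix j assume "j \<in> UNIV - {i..}"
    then have "j < i" by auto
    then have "block blk i j A = 0" using assms by (simp add: block_upper_triangular_def)
    then show "block blk i j A *v x = 0" by simp
  qed auto
  also have "{i..} = insert i {i<..}" by auto
  finally show ?thesis by (simp add: 0)
qed

lemma set_integral_sum:
  fixes f :: "'i \<Rightarrow> 'a \<Rightarrow> 'b::{banach, second_countable_topology}"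
  assumes "\<And>i. i \<in> I \<Longrightarrow> set_integrable N S (f i)"
  shows "set_integrable N S (\<lambda>x. \<Sum>i\<in>I. f i x)"
    and "(LINT x:S|N. \<Sum>i\<in>I. f i x) = (\<Sum>i\<in>I. LINT x:S|N. f i x)"
  using assms unfolding set_integrable_def set_lebesgue_integral_def scaleR_sum_right
  by (auto intro: Bochner_Integration.integral_sum)

text \<open>
  Integrals of matrices are treated column by column, by letting the matrix act on vectors.
\<close>

lemma matrix_set_integrable:
  fixes X :: "real \<Rightarrow> real^'n^'m"
  assumes "\<And>y. set_integrable lborel S (\<lambda>s. X s *v y)"
  shows "set_integrable lborel S X"
    and "(LINT s:S|lborel. X s) *v y = (LINT s:S|lborel. X s *v y)"
proof -
  define L where "L c v = (\<chi> r c'. if c' = c then v $ r else (0::real))"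
    for c :: 'n and v :: "real^'m"
  have L: "bounded_linear (L c)" for c
    unfolding linear_conv_bounded_linear[symmetric]
    by (rule linearI) (auto simp: L_def vec_eq_iff)
  have X: "X s = (\<Sum>c\<in>UNIV. L c (X s *v axis c 1))" for s
    by (simp add: vec_eq_iff L_def sum_component matrix_vector_mult_basis column_def)
  have "integrable lborel (\<lambda>s. \<Sum>c\<in>UNIV. L c (indicator S s *\<^sub>R (X s *v axis c 1)))"
    using assms by (intro Bochner_Integration.integrable_sum integrable_bounded_linear[OF L])
      (simp add: set_integrable_def)
  also have "(\<lambda>s. \<Sum>c\<in>UNIV. L c (indicator S s *\<^sub>R (X s *v axis c 1))) = (\<lambda>s. indicator S s *\<^sub>R X s)"
    by (subst (2) X) (simp add: linear_simps[OF L] scaleR_sum_right)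
  finally show I: "set_integrable lborel S X" by (simp add: set_integrable_def)
  show "(LINT s:S|lborel. X s) *v y = (LINT s:S|lborel. X s *v y)"
    using integral_bounded_linear[OF mv.bounded_linear_left I[unfolded set_integrable_def]]
    by (simp add: set_lebesgue_integral_def mv.scaleR_left)
qed

lemma delay_less_next:
  fixes h :: "'m::{finite,linorder} \<Rightarrow> real"
  assumes "strict_mono h" "\<forall>i. 0 < h i"
  shows "h i < next_delay h i" and "h i \<le> last_delay h"
proof -
  have le: "h i \<le> last_delay h" for i
    unfolding last_delay_def using assms(1) by (simp add: strict_mono_less_eq)
  then show "h i \<le> last_delay h" .
  show "h i < next_delay h i"
  proof (cases "\<exists>j. i < j")
    case True
    then have "Min {j. i < j} \<in> {j. i < j}" by (intro Min_in) auto
    then show ?thesis using True assms(1) by (simp add: next_delay_def strict_mono_less)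
  next
    case False
    moreover have "0 < h i" using assms(2) by blast
    ultimately show ?thesis using le[of i] by (simp add: next_delay_def)
  qed
qed

lemma flow_cong:
  assumes "\<And>s. s \<in> {0..t} \<Longrightarrow> q s = q' s"
  shows "flow A z q t = flow A z q' t"
  unfolding flow_def using assms by (auto intro!: set_lebesgue_integral_cong)

text \<open>
  For \<open>u \<le> h\<^sub>i\<close> all the truncations in the definition of \<open>\<Gamma>\<^sub>i\<close> are inactive: the lower limits are \<open>0\<close>,
  the upper limits are \<open>u\<close>, and the indicator is \<open>1\<close>. What is left is the variation-of-constants formula
  for block \<open>i\<close> of \<open>z' = A z + G y\<close>, in which the later blocks \<open>z\<^sub>j\<close> act as a forcing. By induction they are
  given by \<open>\<Gamma>\<^sub>j\<close>, because \<open>u \<le> h\<^sub>i < h\<^sub>j\<close>.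
\<close>

lemma Gam_eq_flow:
  fixes blk :: "'n::finite \<Rightarrow> 'm::{finite,linorder}"
    and A :: "real^('n::_)^('n::_)"
  assumes h: "strict_mono h" "\<forall>i. 0 < h i" and tri: "block_upper_triangular blk A B"
    and G: "continuous_on {0..last_delay h} G" and u: "u \<in> {0..h i}"
  shows "Gam blk A G h i u *v y = block_proj blk i *v flow A y (\<lambda>s. G s *v y) u"
  using u
proof (induction "card {i<..}" arbitrary: i u y rule: less_induct)
  case less
  let ?P = "block_proj blk" and ?e = "\<lambda>t. semigroup_exp (block blk i i A) t"
  let ?flow = "\<lambda>y. flow A y (\<lambda>s. G s *v y)"
  have IH: "Gam blk A G h j s *v y = ?P j *v ?flow y s" if "i < j" "s \<in> {0..u}" for j s y
  proof (rule less.hyps)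
    show "card {j<..} < card {i<..}"
      using that by (intro psubset_card_mono) auto
    have "h i < h j" using that h(1) by (simp add: strict_mono_less)
    then show "s \<in> {0..h j}" using that less.prems by auto
  qed
  have ud: "u \<le> last_delay h" "0 \<le> u" using less.prems delay_less_next(2)[OF h, of i] by auto
  have Gu: "continuous_on {0..u} G" by (rule continuous_on_subset[OF G]) (use ud in auto)
  have Gy: "set_integrable lborel {0..u} (\<lambda>s. G s *v y)" for y
    by (intro set_integrable_continuous mv.continuous_on Gu continuous_intros)
  have fl: "set_integrable lborel {0..u} (?flow y)" for y
    by (intro flow_solves(2) Gy ud)
  have M: "set_integrable lborel {0..u} (\<lambda>s. K *v f s)"
    if "set_integrable lborel {0..u} f" for K :: "real^('n::_)^('n::_)" and f
    by (intro set_integrable_kernel_mult that continuous_intros)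
  define p where "p s = ?P i *v (A *v ?flow y s + G s *v y)" for s
  have p: "set_integrable lborel {0..u} p"
    unfolding p_def by (intro M set_integral_add Gy fl)
  have D: "?P i *v ?flow y t = ?P i *v y + (LINT s:{0..t}|lborel. p s)" if "t \<in> {0..u}" for t
  proof -
    have I: "set_integrable lborel {0..t} f" if "set_integrable lborel {0..u} f" for f :: "real \<Rightarrow> real^('n::_)"
      using \<open>t \<in> {0..u}\<close> by (intro set_integrable_subset[OF that]) auto
    have "(LINT s:{0..t}|lborel. p s) = ?P i *v (LINT s:{0..t}|lborel. A *v ?flow y s + G s *v y)"
      unfolding p_def
      using integral_bounded_linear[OF mv.bounded_linear_right
          I[OF set_integral_add(1)[OF M[OF fl] Gy], unfolded set_integrable_def], of "?P i" A y]
      by (simp add: set_lebesgue_integral_def mv.scaleR_right)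
    then show ?thesis
      using flow_solves(1)[OF _ I[OF Gy[of y]], of A y] that by (simp add: mv.add_right[symmetric])
  qed
  have "?P i *v ?flow y u = ?e u *v (?P i *v y) +
      (LINT s:{0..u}|lborel. ?e (u - s) *v (p s - block blk i i A *v (?P i *v ?flow y s)))"
    by (rule variation_of_constants[OF ud(2) p D])
  also have "(LINT s:{0..u}|lborel. ?e (u - s) *v (p s - block blk i i A *v (?P i *v ?flow y s))) =
      (LINT s:{0..u}|lborel. ?e (u - s) *v (?P i *v (G s *v y)) +
        (\<Sum>j\<in>{i<..}. (?e (u - s) ** block blk i j A ** Gam blk A G h j s) *v y))"
    by (intro set_lebesgue_integral_cong)
       (auto simp: p_def mv.add_right mv.sum_right block_proj_mv_upper_triangular[OF tri]
         IH matrix_vector_mul_assoc[symmetric])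
  finally have flow_eq: "?P i *v ?flow y u = ?e u *v (?P i *v y) +
      (LINT s:{0..u}|lborel. ?e (u - s) *v (?P i *v (G s *v y)) +
        (\<Sum>j\<in>{i<..}. (?e (u - s) ** block blk i j A ** Gam blk A G h j s) *v y))" .
  (* Integrability of the matrix integrands in the definition of Gam; it is inherited from the flow. *)
  have GamI: "set_integrable lborel {0..u} (\<lambda>s. (?e (u - s) ** block blk i j A ** Gam blk A G h j s) *v y)"
    if "i < j" for j y
  proof -
    have "set_integrable lborel {0..u} (\<lambda>s. (?e (u - s) ** block blk i j A) *v (?P j *v ?flow y s))"
      by (intro set_integrable_kernel_mult M fl mm.continuous_on continuous_intros)
    then show ?thesis
      by (subst set_integrable_cong[OF refl refl, where f' = "\<lambda>s. (?e (u - s) ** block blk i j A) *v (?P j *v ?flow y s)"])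
         (simp_all add: IH[OF that] matrix_vector_mul_assoc[symmetric])
  qed
  have GI: "set_integrable lborel {0..u} (\<lambda>s. (?e (u - s) ** (?P i ** G s)) *v y)" for y
    by (intro set_integrable_continuous mv.continuous_on mm.continuous_on Gu continuous_intros)
  have lims: "{max (u - next_delay h i) 0..min u (last_delay h)} = {0..u}"
    using delay_less_next(1)[OF h, of i] less.prems ud by auto
  have lims': "{max (u - next_delay h i) 0..min u (next_delay h j)} = {0..u}" if "i < j" for j
  proof -
    have "h i < h j" using that h(1) by (simp add: strict_mono_less)
    then show ?thesis
      using delay_less_next(1)[OF h, of i] delay_less_next(1)[OF h, of j] less.prems by auto
  qed
  have Th: "Theta blk A h i j (Gam blk A G h j) u *v y =
      (LINT s:{0..u}|lborel. (?e (u - s) ** block blk i j A ** Gam blk A G h j s) *v y)" if "j \<in> {i<..}" for j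
    using that matrix_set_integrable(2)[OF GamI] by (simp add: Theta_def lims')
  have "Gam blk A G h i u *v y =
     (LINT s:{0..u}|lborel. (?e (u - s) ** (?P i ** G s)) *v y) + (?e u ** ?P i) *v y +
     (\<Sum>j\<in>{i<..}. (LINT s:{0..u}|lborel. (?e (u - s) ** block blk i j A ** Gam blk A G h j s) *v y))"
    using less.prems matrix_set_integrable(2)[OF GI]
    by (subst Gam.simps) (simp add: mv.add_left mv.sum_left Th lims)
  also have "\<dots> = ?e u *v (?P i *v y) + (LINT s:{0..u}|lborel. ?e (u - s) *v (?P i *v (G s *v y)) +
        (\<Sum>j\<in>{i<..}. (?e (u - s) ** block blk i j A ** Gam blk A G h j s) *v y))"
  proof -
    have "set_integrable lborel {0..u}
        (\<lambda>s. \<Sum>j\<in>{i<..}. (?e (u - s) ** block blk i j A ** Gam blk A G h j s) *v y)"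
      by (rule set_integral_sum(1)) (simp add: GamI)
    note add = set_integral_add(2)[OF GI[of y] this]
    have sum: "(LINT s:{0..u}|lborel. \<Sum>j\<in>{i<..}. (?e (u - s) ** block blk i j A ** Gam blk A G h j s) *v y) =
      (\<Sum>j\<in>{i<..}. LINT s:{0..u}|lborel. (?e (u - s) ** block blk i j A ** Gam blk A G h j s) *v y)"
      by (rule set_integral_sum(2)) (simp add: GamI)
    have 1: "?e (u - s) *v (?P i *v (G s *v y)) = (?e (u - s) ** (?P i ** G s)) *v y" for s
      by (simp only: matrix_vector_mul_assoc matrix_mul_assoc)
    have 2: "?e u *v (?P i *v y) = (?e u ** ?P i) *v y"
      by (simp only: matrix_vector_mul_assoc)
    show ?thesis unfolding 1 2 add sum by simp
  qed
  finally show ?case using flow_eq by simp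
qed

section \<open>Steering the blocks\<close>

lemma subspace_coordinates: "subspace {x :: real^'n. \<forall>r. r \<notin> K \<longrightarrow> x $ r = 0}"
  by (auto simp: subspace_def)

lemma dim_coordinates: "dim {x :: real^'n. \<forall>r. r \<notin> K \<longrightarrow> x $ r = 0} = card K"
proof -
  let ?d = "(\<lambda>r. axis r 1 :: real^'n) ` K"
  have "{x :: real^'n. \<forall>r. r \<notin> K \<longrightarrow> x $ r = 0} = {x. \<forall>i\<in>Basis. i \<notin> ?d \<longrightarrow> x \<bullet> i = 0}"
  proof (intro Collect_cong iffI ballI impI allI)
    fix x :: "real^'n" and b assume "\<forall>r. r \<notin> K \<longrightarrow> x $ r = 0" "b \<in> Basis" "b \<notin> ?d"
    then show "x \<bullet> b = 0" by (auto simp: Basis_vec_def inner_axis)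
  next
    fix x :: "real^'n" and r assume *: "\<forall>i\<in>Basis. i \<notin> ?d \<longrightarrow> x \<bullet> i = 0" "r \<notin> K"
    then have "axis r 1 \<notin> ?d" by (auto simp: axis_eq_axis)
    with * have "x \<bullet> axis r 1 = 0" by (auto simp: Basis_vec_def)
    then show "x $ r = 0" by (simp add: inner_axis)
  qed
  moreover have "?d \<subseteq> Basis" by (auto simp: Basis_vec_def)
  ultimately have "dim {x :: real^'n. \<forall>r. r \<notin> K \<longrightarrow> x $ r = 0} = card ?d"
    using dim_substandard by auto
  also have "\<dots> = card K" by (intro card_image) (auto simp: inj_on_def axis_eq_axis)
  finally show ?thesis .
qed

text \<open>
  By Kalman's criterion the Krylov vectors of block \<open>i\<close> span a space of the same dimension as the block.
\<close>

lemma controllable_span: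
  fixes blk :: "'n::finite \<Rightarrow> 'm::finite" and x :: "real^'n"
  assumes "controllable_block blk A B i" and "\<forall>r. blk r \<noteq> i \<longrightarrow> x $ r = 0"
  shows "x \<in> span {matpow (block blk i i A) k *v block_col blk i i B | k. True}"
proof -
  let ?K = "{r. blk r = i}"
  let ?V = "{x :: real^'n. \<forall>r. r \<notin> ?K \<longrightarrow> x $ r = 0}"
  let ?S = "{matpow (block blk i i A) k *v block_col blk i i B | k. k < block_size blk i}"
  have "matpow (block blk i i A) k *v block_col blk i i B \<in> ?V" for k
  proof (cases k)
    case 0
    then show ?thesis by (simp add: matpow_0 block_col_def)
  next
    case (Suc l)
    then show ?thesis by (simp add: matpow_Suc matrix_vector_mul_assoc[symmetric] block_mv_nth)
  qed
  then have "?S \<subseteq> ?V" by blast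
  then have "span ?S \<subseteq> ?V" by (rule span_minimal[OF _ subspace_coordinates])
  moreover have "dim ?V \<le> dim (span ?S)"
    unfolding dim_coordinates dim_span using assms(1) by (simp add: controllable_block_def block_size_def)
  ultimately have "span ?S = ?V"
    using subspace_dim_equal[OF subspace_span subspace_coordinates] by blast
  with assms(2) have "x \<in> span ?S" by auto
  then show ?thesis using span_mono[of ?S "{matpow (block blk i i A) k *v block_col blk i i B | k. True}"] by blast
qed

text \<open>
  The blocks of \<open>x\<close> vanish one after the other. The vector \<open>A\<^sup>k b\<^sub>i\<close> has no component in blocks after \<open>i\<close>,
  and its component in block \<open>i\<close> is the Krylov vector of the diagonal block. If the blocks of \<open>x\<close> before
  \<open>i\<close> are already known to vanish, orthogonality to \<open>A\<^sup>k b\<^sub>i\<close> involves block \<open>i\<close> of \<open>x\<close> alone, and there the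
  Krylov vectors span everything.
\<close>

lemma orthogonal_Krylov_blocks_zero:
  fixes blk :: "'n::finite \<Rightarrow> 'm::{finite,linorder}"
    and A :: "real^('n::_)^('n::_)" and B :: "real^('m::_)^('n::_)"
  assumes tri: "block_upper_triangular blk A B" and ctr: "\<forall>i. controllable_block blk A B i"
    and orth: "\<And>i k. i \<le> j \<Longrightarrow> x \<bullet> (matpow A k *v column i B) = 0"
    and i: "i \<le> j" and r: "blk r = i"
  shows "x $ r = 0"
  using i r
proof (induction "card {..<i}" arbitrary: i r rule: less_induct)
  case less
  have IH: "x $ r = 0" if "blk r < i" for r
  proof (rule less.hyps)
    show "card {..<blk r} < card {..<i}" using that by (intro psubset_card_mono) auto
  qed (use that less.prems in auto)
  define v where "v k = matpow A k *v column i B" for k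
  define w where "w k = matpow (block blk i i A) k *v block_col blk i i B" for k
  have v: "(blk r > i \<longrightarrow> v k $ r = 0) \<and> (blk r = i \<longrightarrow> v k $ r = w k $ r)
      \<and> (blk r \<noteq> i \<longrightarrow> w k $ r = 0)" for k r
  proof (induction k arbitrary: r)
    case 0
    show ?case
      using upper_triangularD(2)[OF tri]
      by (auto simp: v_def w_def matpow_0 column_def block_col_def)
  next
    case (Suc k)
    have vS: "v (Suc k) $ r = (\<Sum>c\<in>UNIV. A $ r $ c * v k $ c)"
      by (simp add: v_def matpow_Suc matrix_vector_mul_assoc[symmetric])
         (simp add: matrix_vector_mult_def)
    have wS: "w (Suc k) = block blk i i A *v w k"
      by (simp add: w_def matpow_Suc matrix_vector_mul_assoc[symmetric])
    have 1: "v (Suc k) $ r = 0" if "i < blk r"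
      unfolding vS
    proof (rule sum.neutral, intro ballI)
      fix c show "A $ r $ c * v k $ c = 0"
        using Suc[of c] upper_triangularD(1)[OF tri, of c r] that
        by (cases "blk c < blk r") auto
    qed
    have 2: "v (Suc k) $ r = w (Suc k) $ r" if "blk r = i"
    proof -
      have "v (Suc k) $ r = (\<Sum>c | blk c = i. A $ r $ c * v k $ c)"
        unfolding vS
      proof (intro sum.mono_neutral_right ballI)
        fix c assume "c \<in> UNIV - {c. blk c = i}"
        then show "A $ r $ c * v k $ c = 0"
          using Suc[of c] upper_triangularD(1)[OF tri, of c r] that by (cases "blk c < i") auto
      qed auto
      also have "\<dots> = w (Suc k) $ r"
        using that Suc by (auto simp: wS block_mv_nth intro!: sum.cong)
      finally show ?thesis .
    qed
    show ?case using 1 2 by (auto simp: wS block_mv_nth)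
  qed
  let ?p = "block_proj blk i *v x"
  have "orthogonal ?p y" if "y \<in> {w k | k. True}" for y
  proof -
    from that obtain k where y: "y = w k" by blast
    have "x \<bullet> v k = (\<Sum>r\<in>UNIV. ?p $ r * w k $ r)"
      unfolding inner_vec_def
    proof (rule sum.cong)
      fix r
      show "x $ r \<bullet> v k $ r = ?p $ r * w k $ r"
        using v[of r k] IH[of r]
        by (cases "blk r < i"; cases "blk r = i") (auto simp: block_proj_nth)
    qed simp
    then show ?thesis
      using orth[OF less.prems(1), of k] y by (simp add: orthogonal_def inner_vec_def v_def)
  qed
  moreover have "?p \<in> span {w k | k. True}"
    unfolding w_def by (rule controllable_span) (use ctr in \<open>auto simp: block_proj_nth\<close>)
  ultimately have "orthogonal ?p ?p" using orthogonal_to_span by blast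
  then have "?p $ r = 0" by (simp add: orthogonal_self)
  then show ?case using less.prems by (simp add: block_proj_nth)
qed

text \<open>
  Differentiate the identity \<open>k\<close> times and evaluate it at \<open>0\<close>.
\<close>

lemma zero_of_vanishing_orbit:
  fixes A :: "real^'n^'n"
  assumes eps: "0 < \<epsilon>" and 0: "\<And>t. t \<in> {0..\<epsilon>} \<Longrightarrow> x \<bullet> (semigroup_exp A t *v b) = 0"
  shows "x \<bullet> (matpow A k *v b) = 0"
proof -
  have "\<forall>t\<in>{0..\<epsilon>}. x \<bullet> (semigroup_exp A t *v (matpow A k *v b)) = 0"
  proof (induction k)
    case 0
    then show ?case using assms by (simp add: matpow_0)
  next
    case (Suc k)
    show ?case
    proof
      fix t assume t: "t \<in> {0..\<epsilon>}"
      let ?f = "\<lambda>t. x \<bullet> (semigroup_exp A t *v (matpow A k *v b))"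
      have bl: "bounded_linear (\<lambda>X::real^'n^'n. x \<bullet> (X *v (matpow A k *v b)))"
        by (intro bounded_linear_compose[OF bounded_linear_inner_right] mv.bounded_linear_left)
      have D: "(?f has_vector_derivative x \<bullet> ((semigroup_exp A t ** A) *v (matpow A k *v b)))
          (at t within cbox 0 \<epsilon>)"
        by (rule bounded_linear.has_vector_derivative[OF bl has_vector_derivative_at_within[OF semigroup_exp_deriv(2)]])
      have "((\<lambda>_. 0) has_vector_derivative x \<bullet> ((semigroup_exp A t ** A) *v (matpow A k *v b)))
          (at t within cbox 0 \<epsilon>)"
        by (rule has_vector_derivative_transform[OF _ _ D]) (use t Suc in auto)
      then have "x \<bullet> ((semigroup_exp A t ** A) *v (matpow A k *v b)) = 0"
        using vector_derivative_unique_within_closed_interval[OF eps _ _ has_vector_derivative_const] t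
        by fastforce
      then show "x \<bullet> (semigroup_exp A t *v (matpow A (Suc k) *v b)) = 0"
        by (simp add: matpow_Suc matrix_vector_mul_assoc matrix_mul_assoc)
    qed
  qed
  from bspec[OF this, of 0] eps show ?thesis by simp
qed

lemma LINT_square_zero:
  fixes f :: "real \<Rightarrow> real"
  assumes f: "continuous_on {0..\<epsilon>} f" and eps: "0 < \<epsilon>"
    and 0: "(LINT t:{0..\<epsilon>}|lborel. f t * f t) = 0" and t: "t \<in> {0..\<epsilon>}"
  shows "f t = 0"
proof -
  have c: "continuous_on {0..\<epsilon>} (\<lambda>t. f t * f t)" by (intro continuous_intros f)
  have "integral {0..\<epsilon>} (\<lambda>t. f t * f t) = 0"
    using set_borel_integral_eq_integral(2)[OF set_integrable_continuous[OF c]] 0 by simp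
  then show ?thesis using integral_eq_0_iff[OF c eps] t by auto
qed

text \<open>
  The states reachable from \<open>0\<close> in time \<open>\<epsilon>\<close> through the channels \<open>i \<le> j\<close> form a subspace. A vector \<open>x\<close>
  orthogonal to it satisfies \<open>x \<bullet> e\<^sup>t\<^sup>A b\<^sub>i = 0\<close>, as one sees by using this very function as the input;
  hence its block \<open>j\<close> vanishes. So the subspace contains every unit vector of block \<open>j\<close>, and the
  corresponding inputs are the columns of \<open>V\<close>. The first \<open>j\<close> channels thus move block \<open>j\<close> alone.
\<close>

lemma steer_block:
  fixes blk :: "'n::finite \<Rightarrow> 'm::{finite,linorder}"
    and A :: "real^('n::_)^('n::_)" and B :: "real^('m::_)^('n::_)"
  assumes tri: "block_upper_triangular blk A B" and ctr: "\<forall>i. controllable_block blk A B i"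
    and eps: "0 < \<epsilon>"
  obtains V :: "real \<Rightarrow> real^('n::_)^('m::_)"
  where "continuous_on UNIV V" "\<And>t i c. j < i \<Longrightarrow> V t $ i $ c = 0"
    "(LINT t:{0..\<epsilon>}|lborel. (semigroup_exp A t ** B) ** V t) = block_proj blk j"
proof -
  define adm where "adm g \<longleftrightarrow> continuous_on UNIV g \<and> (\<forall>t i. j < i \<longrightarrow> g t $ i = 0)"
    for g :: "real \<Rightarrow> real^('m::_)"
  define reach where "reach g = (LINT t:{0..\<epsilon>}|lborel. (semigroup_exp A t ** B) *v g t)"
    for g :: "real \<Rightarrow> real^('m::_)"
  define R where "R = {reach g | g. adm g}"
  have int: "set_integrable lborel {0..\<epsilon>} (\<lambda>t. (semigroup_exp A t ** B) *v g t)" if "adm g" for g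
  proof -
    have "continuous_on {0..\<epsilon>} g" using that continuous_on_subset by (auto simp: adm_def)
    then show ?thesis
      by (intro set_integrable_continuous mv.continuous_on mm.continuous_on continuous_intros)
  qed
  have sub: "subspace R"
  proof (rule subspaceI)
    show "0 \<in> R" by (auto simp: R_def adm_def reach_def intro!: exI[of _ "\<lambda>_. 0"])
    fix x y assume "x \<in> R" "y \<in> R"
    then obtain g g' where g: "adm g" "adm g'" "x = reach g" "y = reach g'" by (auto simp: R_def)
    have "adm (\<lambda>t. g t + g' t)" using g by (auto simp: adm_def intro!: continuous_intros)
    moreover have "reach (\<lambda>t. g t + g' t) = x + y"
      using set_integral_add(2)[OF int[OF g(1)] int[OF g(2)]] by (simp add: g reach_def mv.add_right)
    ultimately show "x + y \<in> R" unfolding R_def by force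
  next
    fix c x assume "x \<in> R"
    then obtain g where g: "adm g" "x = reach g" by (auto simp: R_def)
    have "adm (\<lambda>t. c *\<^sub>R g t)" using g by (auto simp: adm_def intro!: continuous_intros)
    moreover have "reach (\<lambda>t. c *\<^sub>R g t) = c *\<^sub>R x"
      by (simp add: g reach_def mv.scaleR_right set_integral_scaleR_right)
    ultimately show "c *\<^sub>R x \<in> R" unfolding R_def by force
  qed
  have orth: "x $ r = 0" if x: "\<And>y. y \<in> R \<Longrightarrow> x \<bullet> y = 0" and r: "blk r = j" for x r
  proof (rule orthogonal_Krylov_blocks_zero[OF tri ctr _ order_refl r])
    fix i k assume i: "i \<le> j"
    (* Testing x against the state reached by the input f itself gives the integral of f squared. *)
    define f where "f t = x \<bullet> (semigroup_exp A t *v column i B)" for t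
    have fc: "continuous_on S f" for S
      unfolding f_def by (intro continuous_intros mv.continuous_on)
    define g where "g t = f t *\<^sub>R axis i (1::real)" for t
    have g: "adm g"
      using i by (auto simp: adm_def g_def axis_def intro!: continuous_intros fc)
    have "0 = x \<bullet> reach g" using x g by (auto simp: R_def)
    also have "\<dots> = (LINT t:{0..\<epsilon>}|lborel. x \<bullet> ((semigroup_exp A t ** B) *v g t))"
      using integral_bounded_linear[OF bounded_linear_inner_right int[OF g, unfolded set_integrable_def], of x]
      by (simp add: reach_def set_lebesgue_integral_def)
    also have "\<dots> = (LINT t:{0..\<epsilon>}|lborel. f t * f t)"
    proof -
      have "(semigroup_exp A t ** B) *v axis i 1 = semigroup_exp A t *v column i B" for t
        by (metis matrix_vector_mul_assoc matrix_vector_mult_basis)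
      then show ?thesis by (simp add: g_def mv.scaleR_right f_def)
    qed
    finally have 0: "(LINT t:{0..\<epsilon>}|lborel. f t * f t) = 0" by (rule sym)
    have "f t = 0" if "t \<in> {0..\<epsilon>}" for t
      by (rule LINT_square_zero[OF fc eps 0 that])
    then show "x \<bullet> (matpow A k *v column i B) = 0"
      unfolding f_def by (rule zero_of_vanishing_orbit[OF eps])
  qed
  have axis_R: "axis c 1 \<in> R" if "blk c = j" for c
  proof -
    have "axis c 1 \<in> orthogonal_comp (orthogonal_comp R)"
      using orth[OF _ that]
      by (auto simp: orthogonal_comp_def orthogonal_def inner_axis inner_commute)
    then show ?thesis using orthogonal_comp_self[OF sub] by simp
  qed
  have "\<forall>c. \<exists>g. adm g \<and> (blk c = j \<longrightarrow> reach g = axis c 1) \<and> (blk c \<noteq> j \<longrightarrow> g = (\<lambda>_. 0))"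
  proof (intro allI)
    fix c
    show "\<exists>g. adm g \<and> (blk c = j \<longrightarrow> reach g = axis c 1) \<and> (blk c \<noteq> j \<longrightarrow> g = (\<lambda>_. 0))"
    proof (cases "blk c = j")
      case True
      then obtain g where "adm g" "axis c 1 = reach g"
        using axis_R[OF True] unfolding R_def by blast
      then show ?thesis using True by (intro exI[of _ g] conjI impI) simp_all
    next
      case False
      then show ?thesis by (intro exI[of _ "\<lambda>_. 0"]) (auto simp: adm_def)
    qed
  qed
  from choice[OF this] obtain g where
    "\<forall>c. adm (g c) \<and> (blk c = j \<longrightarrow> reach (g c) = axis c 1) \<and> (blk c \<noteq> j \<longrightarrow> g c = (\<lambda>_. 0))" ..
  then have g: "\<And>c. adm (g c)" "\<And>c. blk c = j \<Longrightarrow> reach (g c) = axis c 1"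
      "\<And>c. blk c \<noteq> j \<Longrightarrow> g c = (\<lambda>_. 0)"
    by auto
  define V :: "real \<Rightarrow> real^('n::_)^('m::_)" where "V t = (\<chi> i c. g c t $ i)" for t
  have Vc: "continuous_on UNIV V"
    unfolding V_def using g(1) by (intro continuous_on_vec_lambda continuous_on_component) (auto simp: adm_def)
  have V0: "V t $ i $ c = 0" if "j < i" for t i c
    using g(1)[of c] that by (auto simp: V_def adm_def)
  have Vi: "set_integrable lborel {0..\<epsilon>} (\<lambda>t. ((semigroup_exp A t ** B) ** V t) *v y)" for y
    by (intro set_integrable_continuous mv.continuous_on mm.continuous_on continuous_intros
        continuous_on_subset[OF Vc]) auto
  have Vax: "V t *v axis c 1 = g c t" for t c
    by (simp add: matrix_vector_mult_basis column_def V_def vec_eq_iff)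
  have "column c (LINT t:{0..\<epsilon>}|lborel. (semigroup_exp A t ** B) ** V t) = column c (block_proj blk j)" for c
  proof -
    have "column c (LINT t:{0..\<epsilon>}|lborel. (semigroup_exp A t ** B) ** V t) = reach (g c)"
      unfolding matrix_vector_mult_basis[symmetric] matrix_set_integrable(2)[OF Vi]
      by (simp add: reach_def matrix_vector_mul_assoc[symmetric] Vax)
    also have "\<dots> = column c (block_proj blk j)"
    proof (cases "blk c = j")
      case True
      then show ?thesis by (auto simp: g(2) column_def block_proj_def vec_eq_iff axis_def)
    next
      case False
      then show ?thesis by (auto simp: g(3) reach_def column_def block_proj_def vec_eq_iff)
    qed
    finally show ?thesis .
  qed
  then have "(LINT t:{0..\<epsilon>}|lborel. (semigroup_exp A t ** B) ** V t) = block_proj blk j"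
    by (simp add: column_def vec_eq_iff)
  with Vc V0 show thesis by (rule that)
qed

section \<open>Positive semidefinite matrices\<close>

lemma outer_mv: "outer y y *v x = (y \<bullet> x) *\<^sub>R y"
  by (simp add: vec_eq_iff outer_def matrix_vector_mult_def inner_vec_def sum_distrib_left mult_ac)

lemma symmetric_inner_mv:
  fixes S :: "real^'n^'n"
  assumes "transpose S = S" shows "x \<bullet> (S *v y) = y \<bullet> (S *v x)"
  by (metis assms dot_lmul_matrix inner_commute vector_transpose_matrix)

text \<open>
  Cholesky elimination: with \<open>y = S e\<^sub>i / sqrt (S\<^sub>i\<^sub>i)\<close> the Schur complement \<open>S - y y\<^sup>T\<close> is positive
  semidefinite and has lost row \<open>i\<close>. If \<open>S\<^sub>i\<^sub>i = 0\<close>, row \<open>i\<close> vanishes already.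
\<close>

lemma psd_sum_outer:
  fixes S :: "real^'n^'n"
  assumes "finite K" "transpose S = S" "\<And>x. 0 \<le> x \<bullet> (S *v x)"
    "\<And>r c. r \<notin> K \<Longrightarrow> S $ r $ c = 0"
  shows "\<exists>ys. S = (\<Sum>y\<leftarrow>ys. outer y y) \<and> (\<forall>y\<in>set ys. \<forall>r. r \<notin> K \<longrightarrow> y $ r = 0)"
  using assms
proof (induction K arbitrary: S rule: finite_induct)
  case empty
  then have "S = 0" by (simp add: vec_eq_iff)
  then show ?case by (intro exI[of _ "[]"]) simp
next
  case (insert i K)
  note sym = symmetric_inner_mv[OF insert.prems(1)]
  have symc: "S $ r $ c = S $ c $ r" for r c
    using insert.prems(1) by (metis transpose_def vec_lambda_beta)
  define e where "e = (axis i 1 :: real^'n)"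
  define s where "s = S *v e"
  have s: "s $ r = S $ r $ i" for r by (simp add: s_def e_def matrix_vector_mult_basis column_def)
  have es: "e \<bullet> s = S $ i $ i" by (simp add: e_def s inner_axis')
  have quad: "(x + t *\<^sub>R e) \<bullet> (S *v (x + t *\<^sub>R e)) = x \<bullet> (S *v x) + 2 * t * (x \<bullet> s) + t^2 * S $ i $ i" for x t
    using sym[of e x] es
    by (simp add: mv.add_right mv.scaleR_right inner_add_left inner_add_right s_def[symmetric] power2_eq_square
        algebra_simps)
  have q: "0 \<le> x \<bullet> (S *v x) + 2 * t * (x \<bullet> s) + t^2 * S $ i $ i" for x t
    using insert.prems(2)[of "x + t *\<^sub>R e"] by (simp add: quad)
  have "0 \<le> S $ i $ i" using insert.prems(2)[of e] es by (simp add: s_def)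
  then consider "S $ i $ i = 0" | "0 < S $ i $ i" by linarith
  then show ?case
  proof cases
    case 1
    have xs: "x \<bullet> s = 0" for x
    proof (rule ccontr)
      assume n: "x \<bullet> s \<noteq> 0"
      (* With a vanishing diagonal entry the form is affine in t, and this t makes it equal to -1. *)
      from q[of x "- (x \<bullet> (S *v x) + 1) / (2 * (x \<bullet> s))"] 1 n show False
        by (simp add: field_simps)
    qed
    have "s = 0" using xs[of s] by simp
    then have "S $ i $ c = 0" for c using s[of c] symc[of i c] by simp
    then have "\<And>r c. r \<notin> K \<Longrightarrow> S $ r $ c = 0" using insert.prems(3) by (metis insertE)
    from insert.IH[OF insert.prems(1,2) this] show ?thesis by blast
  next
    case 2
    define y where "y = (1 / sqrt (S $ i $ i)) *\<^sub>R s"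
    define S' where "S' = S - outer y y"
    have yy: "outer y y $ r $ c = s $ r * s $ c / S $ i $ i" for r c
      using 2 by (simp add: outer_def y_def)
    have "transpose S' = S'"
      by (simp add: S'_def transpose_def vec_eq_iff yy mult.commute symc)
    moreover have "0 \<le> x \<bullet> (S' *v x)" for x
      using q[of x "- (x \<bullet> s) / S $ i $ i"] 2
      by (simp add: S'_def mv.diff_left outer_mv inner_diff_right y_def inner_commute field_simps power2_eq_square)
    moreover have "S' $ r $ c = 0" if "r \<notin> K" for r c
    proof (cases "r = i")
      case True
      then show ?thesis using 2 by (simp add: S'_def yy s symc[of i c])
    next
      case False
      then show ?thesis using that insert.prems(3)[of r] by (simp add: S'_def yy s)
    qed
    ultimately obtain ys where ys: "S' = (\<Sum>y\<leftarrow>ys. outer y y)" "\<forall>y\<in>set ys. \<forall>r. r \<notin> K \<longrightarrow> y $ r = 0"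
      using insert.IH[of S'] by blast
    have "S = (\<Sum>y\<leftarrow>y # ys. outer y y)" using ys(1) by (simp add: S'_def algebra_simps)
    moreover have "y $ r = 0" if "r \<notin> insert i K" for r
      using insert.prems(3)[OF that] by (simp add: y_def s)
    ultimately show ?thesis using ys(2) by (intro exI[of _ "y # ys"]) auto
  qed
qed

text \<open>
  The minimum of the quadratic form on the unit sphere.
\<close>

lemma pos_def_lower_bound:
  fixes S :: "real^'n^'n"
  assumes "sym_pos_def S"
  obtains c where "0 < c" "\<And>x. c * (x \<bullet> x) \<le> x \<bullet> (S *v x)"
proof -
  let ?f = "\<lambda>x. x \<bullet> (S *v x)"
  have "continuous_on (sphere 0 1) ?f" by (intro continuous_intros mv.continuous_on)
  moreover have "axis undefined 1 \<in> (sphere 0 1 :: (real^'n) set)" by (simp add: norm_axis_1)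
  ultimately obtain x0 where x0: "x0 \<in> sphere 0 1" "\<And>x. x \<in> sphere 0 1 \<Longrightarrow> ?f x0 \<le> ?f x"
    using continuous_attains_inf[OF compact_sphere, of 0 1 ?f] by blast
  show thesis
  proof
    have "x0 \<noteq> 0" using x0(1) by auto
    then show "0 < ?f x0" using assms by (simp add: sym_pos_def_def)
    show "?f x0 * (x \<bullet> x) \<le> ?f x" for x
    proof (cases "x = 0")
      case False
      define u where "u = (1 / norm x) *\<^sub>R x"
      have "?f x0 \<le> ?f u" using False by (intro x0(2)) (simp add: u_def)
      also have "?f u = ?f x / (x \<bullet> x)"
        by (simp add: u_def mv.scaleR_right power2_norm_eq_inner[symmetric] power2_eq_square)
      finally show ?thesis using False by (simp add: field_simps)
    qed simp
  qed
qed

section \<open>Square-integrable functions\<close>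

definition sq_int :: "'a measure \<Rightarrow> ('a \<Rightarrow> real) \<Rightarrow> bool" where
  "sq_int N f \<longleftrightarrow> f \<in> borel_measurable N \<and> integrable N (\<lambda>x. (f x)\<^sup>2)"

abbreviation sq_norm :: "'a measure \<Rightarrow> ('a \<Rightarrow> real) \<Rightarrow> real" where
  "sq_norm N f \<equiv> (\<integral>x. (f x)\<^sup>2 \<partial>N)"

lemma sq_int_measurable [measurable_dest]: "sq_int N f \<Longrightarrow> f \<in> borel_measurable N"
  by (simp add: sq_int_def)

lemma sq_int_zero [simp]: "sq_int N (\<lambda>_. 0)"
  by (simp add: sq_int_def)

lemma abs_mult_le_squares: "\<bar>a * b\<bar> \<le> a\<^sup>2 + b\<^sup>2" for a b :: real
proof -
  have "0 \<le> (\<bar>a\<bar> - \<bar>b\<bar>)\<^sup>2" by simp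
  then have "2 * \<bar>a * b\<bar> \<le> a\<^sup>2 + b\<^sup>2" by (simp add: power2_diff abs_mult)
  then show ?thesis by linarith
qed

lemma sq_int_mult:
  assumes "sq_int N f" "sq_int N g"
  shows "integrable N (\<lambda>x. f x * g x)"
proof (rule Bochner_Integration.integrable_bound)
  show "integrable N (\<lambda>x. (f x)\<^sup>2 + (g x)\<^sup>2)" using assms by (simp add: sq_int_def)
  show "(\<lambda>x. f x * g x) \<in> borel_measurable N" using assms by (auto simp: sq_int_def)
  show "AE x in N. norm (f x * g x) \<le> norm ((f x)\<^sup>2 + (g x)\<^sup>2)" by (simp add: abs_mult_le_squares)
qed

lemma sq_int_add:
  assumes "sq_int N f" "sq_int N g"
  shows "sq_int N (\<lambda>x. f x + g x)"
  using assms sq_int_mult[OF assms] by (auto simp: sq_int_def power2_sum mult.assoc intro!: Bochner_Integration.integrable_add)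

lemma sq_int_scale: "sq_int N f \<Longrightarrow> sq_int N (\<lambda>x. c * f x)"
  by (auto simp: sq_int_def power_mult_distrib)

lemma sq_int_diff:
  assumes "sq_int N f" "sq_int N g"
  shows "sq_int N (\<lambda>x. f x - g x)"
  using sq_int_add[OF assms(1) sq_int_scale[OF assms(2), of "-1"]] by simp

lemma sq_norm_add:
  assumes "sq_int N f" "sq_int N g"
  shows "sq_norm N (\<lambda>x. f x + g x) = sq_norm N f + 2 * (\<integral>x. f x * g x \<partial>N) + sq_norm N g"
  using assms sq_int_mult[OF assms] by (simp add: power2_sum sq_int_def mult.assoc)

lemma sq_norm_diff:
  assumes "sq_int N f" "sq_int N g"
  shows "sq_norm N (\<lambda>x. f x - g x) = sq_norm N f - 2 * (\<integral>x. f x * g x \<partial>N) + sq_norm N g"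
  using assms sq_int_mult[OF assms] by (simp add: power2_diff sq_int_def mult.assoc)

lemma sq_norm_add_le:
  assumes "sq_int N f" "sq_int N g"
  shows "sq_norm N (\<lambda>x. f x + g x) \<le> 2 * sq_norm N f + 2 * sq_norm N g"
proof -
  have "0 \<le> sq_norm N (\<lambda>x. f x - g x)" by simp
  then show ?thesis by (simp add: sq_norm_add[OF assms] sq_norm_diff[OF assms])
qed

text \<open>
  From \<open>f\<^sup>2 - g\<^sup>2 = 2 f (f - g) - (f - g)\<^sup>2\<close> and \<open>2 a b \<le> \<delta> a\<^sup>2 + b\<^sup>2 / \<delta>\<close>; the free parameter \<open>\<delta>\<close> makes both
  terms small in a limit.
\<close>

lemma sq_norm_perturb:
  assumes f: "sq_int N f" and g: "sq_int N g" and d: "0 < \<delta>"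
  shows "\<bar>sq_norm N f - sq_norm N g\<bar> \<le> \<delta> * sq_norm N f + (1 + 1 / \<delta>) * sq_norm N (\<lambda>x. f x - g x)"
proof -
  note d2 = sq_int_diff[OF f g]
  have fi: "integrable N (\<lambda>x. (f x)\<^sup>2)" "integrable N (\<lambda>x. (g x)\<^sup>2)" "integrable N (\<lambda>x. (f x - g x)\<^sup>2)"
    using f g d2 by (simp_all add: sq_int_def)
  have pt: "\<bar>a\<^sup>2 - b\<^sup>2\<bar> \<le> \<delta> * a\<^sup>2 + (1 + 1 / \<delta>) * (a - b)\<^sup>2" for a b :: real
  proof -
    define c where "c = a - b"
    have "0 \<le> (\<delta> * \<bar>a\<bar> - \<bar>c\<bar>)\<^sup>2 / \<delta>" using d by simp
    also have "(\<delta> * \<bar>a\<bar> - \<bar>c\<bar>)\<^sup>2 / \<delta> = \<delta> * a\<^sup>2 + c\<^sup>2 / \<delta> - 2 * \<bar>a * c\<bar>"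
      using d by (simp add: power2_diff power_mult_distrib abs_mult field_simps power2_eq_square)
    finally have 1: "2 * \<bar>a * c\<bar> \<le> \<delta> * a\<^sup>2 + c\<^sup>2 / \<delta>" by simp
    have "a\<^sup>2 - b\<^sup>2 = 2 * (a * c) - c\<^sup>2" by (simp add: c_def power2_eq_square algebra_simps)
    then have "\<bar>a\<^sup>2 - b\<^sup>2\<bar> \<le> 2 * \<bar>a * c\<bar> + c\<^sup>2"
      by (smt (verit) zero_le_power2)
    with 1 show ?thesis unfolding c_def[symmetric] by (simp add: algebra_simps)
  qed
  have "\<bar>sq_norm N f - sq_norm N g\<bar> = \<bar>\<integral>x. (f x)\<^sup>2 - (g x)\<^sup>2 \<partial>N\<bar>"
    using fi by simp
  also have "\<dots> \<le> (\<integral>x. \<bar>(f x)\<^sup>2 - (g x)\<^sup>2\<bar> \<partial>N)" by (rule integral_abs_bound)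
  also have "\<dots> \<le> (\<integral>x. \<delta> * (f x)\<^sup>2 + (1 + 1 / \<delta>) * (f x - g x)\<^sup>2 \<partial>N)"
    using fi pt by (intro integral_mono) auto
  also have "\<dots> = \<delta> * sq_norm N f + (1 + 1 / \<delta>) * sq_norm N (\<lambda>x. f x - g x)"
    using fi by simp
  finally show ?thesis .
qed

text \<open>
  This is how an isometry extends from a subspace to its closure.
\<close>

lemma isometry_limit:
  assumes f: "sq_int N f" and X: "sq_int M X"
    and app: "\<And>\<epsilon>. 0 < \<epsilon> \<Longrightarrow> \<exists>p P. sq_int N p \<and> sq_int M P \<and> sq_norm N p = sq_norm M P \<and>
      sq_norm N (\<lambda>s. f s - p s) < \<epsilon> \<and> sq_norm M (\<lambda>x. X x - P x) < \<epsilon>"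
  shows "sq_norm N f = sq_norm M X"
proof (rule ccontr)
  let ?a = "sq_norm N f" and ?b = "sq_norm M X"
  assume "?a \<noteq> ?b"
  define \<Delta> where "\<Delta> = \<bar>?a - ?b\<bar>"
  have D: "0 < \<Delta>" using \<open>?a \<noteq> ?b\<close> by (simp add: \<Delta>_def)
  have ab: "0 \<le> ?a" "0 \<le> ?b" by simp_all
  (* delta makes the first terms of sq_norm_perturb contribute at most Delta / 2 in total,
     epsilon then makes the second terms contribute Delta / 4. *)
  define \<delta> where "\<delta> = \<Delta> / (2 * (?a + ?b + 1))"
  have d: "0 < \<delta>" unfolding \<delta>_def
    by (intro divide_pos_pos mult_pos_pos add_nonneg_pos add_nonneg_nonneg ab D) simp_all
  define \<epsilon> where "\<epsilon> = \<Delta> / (8 * (1 + 1 / \<delta>))"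
  have d1: "0 < 1 + 1 / \<delta>" using d by (simp add: add_pos_pos)
  have e: "0 < \<epsilon>" using D d1 by (simp add: \<epsilon>_def)
  obtain p P where p: "sq_int N p" "sq_int M P" "sq_norm N p = sq_norm M P"
      "sq_norm N (\<lambda>s. f s - p s) < \<epsilon>" "sq_norm M (\<lambda>x. X x - P x) < \<epsilon>"
    using app[OF e] by blast
  have "\<Delta> \<le> \<bar>?a - sq_norm N p\<bar> + \<bar>?b - sq_norm M P\<bar>" using p(3) by (simp add: \<Delta>_def)
  also have "\<dots> \<le> (\<delta> * ?a + (1 + 1 / \<delta>) * sq_norm N (\<lambda>x. f x - p x)) +
      (\<delta> * ?b + (1 + 1 / \<delta>) * sq_norm M (\<lambda>x. X x - P x))"
    by (intro add_mono sq_norm_perturb f X p d)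
  also have "\<dots> \<le> (\<delta> * ?a + (1 + 1 / \<delta>) * \<epsilon>) + (\<delta> * ?b + (1 + 1 / \<delta>) * \<epsilon>)"
    using p(4,5) d1 by (intro add_mono mult_left_mono order_refl) auto
  also have "\<dots> = \<delta> * (?a + ?b) + \<Delta> / 4"
  proof -
    have "c * (\<Delta> / (8 * c)) = \<Delta> / 8" if "0 < c" for c using that by simp
    from this[OF d1] show ?thesis by (simp add: \<epsilon>_def algebra_simps)
  qed
  also have "\<delta> * (?a + ?b) \<le> \<delta> * (?a + ?b + 1)" using d by (intro mult_left_mono) auto
  also have "\<delta> * (?a + ?b + 1) = \<Delta> / 2"
  proof -
    have "\<Delta> / (2 * c) * c = \<Delta> / 2" if "0 < c" for c using that by simp
    moreover have "0 < ?a + ?b + 1" by (intro add_nonneg_pos add_nonneg_nonneg ab) simp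
    ultimately show ?thesis unfolding \<delta>_def by blast
  qed
  finally show False using D by simp
qed

lemma nn_integral_less_imp_integrable:
  fixes f :: "'a \<Rightarrow> real"
  assumes "f \<in> borel_measurable N" "\<And>x. 0 \<le> f x" "(\<integral>\<^sup>+x. ennreal (f x) \<partial>N) < ennreal \<epsilon>"
  shows "integrable N f" and "(\<integral>x. f x \<partial>N) < \<epsilon>"
proof -
  show I: "integrable N f"
    using assms by (intro integrableI_nonneg) (auto intro: less_trans)
  have "ennreal (\<integral>x. f x \<partial>N) < ennreal \<epsilon>"
    using assms(3) nn_integral_eq_integral[OF I] assms(2) by simp
  then show "(\<integral>x. f x \<partial>N) < \<epsilon>"
    using assms(2) by (simp add: ennreal_less_iff)
qed

lemma norm_add_sq_le:
  fixes a b :: "'a::real_normed_vector"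
  shows "(norm (a + b))\<^sup>2 \<le> 2 * (norm a)\<^sup>2 + 2 * (norm b)\<^sup>2"
proof -
  have "(norm (a + b))\<^sup>2 \<le> (norm a + norm b)\<^sup>2"
    by (intro power_mono norm_triangle_ineq) auto
  also have "\<dots> \<le> 2 * (norm a)\<^sup>2 + 2 * (norm b)\<^sup>2"
    using sum_squares_bound[of "norm a" "norm b"] by (simp add: power2_sum)
  finally show ?thesis .
qed

lemma nn_integral_norm_sq_triangle:
  fixes f g h :: "'a \<Rightarrow> 'b::euclidean_space"
  assumes [measurable]: "(\<lambda>x. f x - g x) \<in> borel_measurable N" "(\<lambda>x. g x - h x) \<in> borel_measurable N"
  shows "(\<integral>\<^sup>+x. ennreal ((norm (f x - h x))\<^sup>2) \<partial>N) \<le>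
    2 * (\<integral>\<^sup>+x. ennreal ((norm (f x - g x))\<^sup>2) \<partial>N) + 2 * (\<integral>\<^sup>+x. ennreal ((norm (g x - h x))\<^sup>2) \<partial>N)"
proof -
  have "(\<integral>\<^sup>+x. ennreal ((norm (f x - h x))\<^sup>2) \<partial>N) \<le>
    (\<integral>\<^sup>+x. 2 * ennreal ((norm (f x - g x))\<^sup>2) + 2 * ennreal ((norm (g x - h x))\<^sup>2) \<partial>N)"
  proof (rule nn_integral_mono)
    fix x
    have "(norm (f x - h x))\<^sup>2 \<le> 2 * (norm (f x - g x))\<^sup>2 + 2 * (norm (g x - h x))\<^sup>2"
      using norm_add_sq_le[of "f x - g x" "g x - h x"] by simp
    then have "ennreal ((norm (f x - h x))\<^sup>2) \<le>
        ennreal (2 * (norm (f x - g x))\<^sup>2 + 2 * (norm (g x - h x))\<^sup>2)"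
      by (rule ennreal_leI)
    then show "ennreal ((norm (f x - h x))\<^sup>2) \<le>
        2 * ennreal ((norm (f x - g x))\<^sup>2) + 2 * ennreal ((norm (g x - h x))\<^sup>2)"
      by (simp add: ennreal_plus ennreal_mult)
  qed
  also have "\<dots> = 2 * (\<integral>\<^sup>+x. ennreal ((norm (f x - g x))\<^sup>2) \<partial>N) + 2 * (\<integral>\<^sup>+x. ennreal ((norm (g x - h x))\<^sup>2) \<partial>N)"
    by (simp add: nn_integral_add nn_integral_cmult)
  finally show ?thesis .
qed

section \<open>Step functions are dense\<close>

lemma step_function_Suc:
  "step_function (Suc n) t c s = step_function n t c s + indicator {t n<..t (Suc n)} s *\<^sub>R c n"
  by (simp add: step_function_def)

lemma knots_mono:
  fixes t :: "nat \<Rightarrow> real"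
  assumes "\<And>k. k < n \<Longrightarrow> t k \<le> t (Suc k)" "k \<le> l" "l \<le> n"
  shows "t k \<le> t l"
  using assms(2,3)
proof (induction l rule: dec_induct)
  case (step m)
  then show ?case using assms(1)[of m] by auto
qed simp

lemma step_function_outside:
  assumes "\<And>k. k < n \<Longrightarrow> t k \<le> t (Suc k)" "s \<notin> {t 0<..t n}"
  shows "step_function n t c s = 0"
  unfolding step_function_def
proof (intro sum.neutral ballI)
  fix k assume "k \<in> {..<n}"
  then have "t 0 \<le> t k" "t (Suc k) \<le> t n"
    using knots_mono[of n t, OF assms(1)] by auto
  then show "indicator {t k<..t (Suc k)} s *\<^sub>R c k = 0" using assms(2) by auto
qed

lemma step_function_value:
  assumes "\<And>k. k < n \<Longrightarrow> t k \<le> t (Suc k)" "s \<in> {t 0<..t n}"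
  shows "\<exists>k<n. s \<in> {t k<..t (Suc k)} \<and> step_function n t c s = c k"
  using assms
proof (induction n)
  case (Suc n)
  show ?case
  proof (cases "s \<le> t n")
    case True
    then obtain k where k: "k < n" "s \<in> {t k<..t (Suc k)}" "step_function n t c s = c k"
      using Suc by auto
    then show ?thesis using True by (intro exI[of _ k]) (simp add: step_function_Suc)
  next
    case False
    then have "step_function n t c s = 0"
      using Suc.prems by (intro step_function_outside) auto
    then show ?thesis using False Suc.prems by (intro exI[of _ n]) (simp add: step_function_Suc)
  qed
qed simp

lemma step_function_measurable [measurable]:
  "step_function n t (c :: nat \<Rightarrow> 'b::euclidean_space) \<in> borel_measurable borel"
  unfolding step_function_def[abs_def] by measurable

lemma continuous_step_approx:
  fixes g :: "real \<Rightarrow> 'b::euclidean_space"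
  assumes ab: "a \<le> b" and g: "continuous_on {a..b} g" and eps: "0 < \<epsilon>"
  obtains n t c where "t 0 = a" "t n = b" "\<And>k. k < n \<Longrightarrow> t k \<le> t (Suc k)"
    "\<And>s. s \<in> {a<..b} \<Longrightarrow> norm (g s - step_function n t c s) < \<epsilon>"
proof -
  have "uniformly_continuous_on {a..b} g" by (intro compact_uniformly_continuous g) auto
  then obtain d where d: "0 < d"
      "\<And>x y. x \<in> {a..b} \<Longrightarrow> y \<in> {a..b} \<Longrightarrow> dist y x < d \<Longrightarrow> dist (g y) (g x) < \<epsilon>"
    using eps unfolding uniformly_continuous_on_def by meson
  obtain N :: nat where N: "(b - a) / d < real N" using reals_Archimedean2 by blast
  have N0: "0 < real N" using N ab d(1) by (smt (verit) divide_nonneg_pos)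
  define t where "t k = a + (b - a) * real k / real N" for k
  have t0: "t 0 = a" and tn: "t N = b" using N0 by (simp_all add: t_def)
  have mono: "t k \<le> t (Suc k)" for k
    using ab N0 by (simp add: t_def divide_right_mono mult_left_mono)
  have inc: "t (Suc k) - t k < d" for k
  proof -
    have "t (Suc k) - t k = (b - a) / real N" by (simp add: t_def add_divide_distrib diff_divide_distrib algebra_simps)
    also have "\<dots> < d" using N N0 d(1) by (simp add: field_simps)
    finally show ?thesis .
  qed
  have step: "norm (g s - step_function N t (\<lambda>k. g (t k)) s) < \<epsilon>" if s: "s \<in> {a<..b}" for s
  proof -
    obtain k where k: "k < N" "s \<in> {t k<..t (Suc k)}" "step_function N t (\<lambda>k. g (t k)) s = g (t k)"
      using step_function_value[of N t s "\<lambda>k. g (t k)"] mono s t0 tn by auto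
    have "t k \<in> {a..b}"
      using knots_mono[of N t 0 k] knots_mono[of N t k N] mono k(1) t0 tn by auto
    then have "dist (g s) (g (t k)) < \<epsilon>"
      using s k(2) inc[of k] by (intro d(2)) (auto simp: dist_real_def)
    then show ?thesis by (simp add: k dist_norm)
  qed
  show thesis by (rule that[of t N "\<lambda>k. g (t k)"]) (use t0 tn mono step in auto)
qed

text \<open>
  A measurable function is almost everywhere a limit of continuous ones. Projecting these to the ball of
  radius \<open>C\<close> changes neither continuity nor the limit, and makes dominated convergence applicable.
\<close>

lemma bounded_continuous_approx:
  fixes f :: "real \<Rightarrow> 'b::euclidean_space"
  assumes f: "set_borel_measurable borel {a..b} f"
    and C: "AE s in lborel. s \<in> {a..b} \<longrightarrow> norm (f s) \<le> C" and eps: "0 < \<epsilon>"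
  obtains g where "continuous_on UNIV g"
    "(\<integral>\<^sup>+s\<in>{a..b}. ennreal ((norm (f s - g s))\<^sup>2) \<partial>lborel) < ennreal \<epsilon>"
proof -
  define K where "K = max C 0"
  define f' where "f' s = indicator {a..b} s *\<^sub>R f s" for s
  have f'm[measurable]: "f' \<in> borel_measurable borel"
    using f by (simp add: f'_def[abs_def] set_borel_measurable_def)
  then have "f' \<in> borel_measurable lebesgue" by (simp add: measurable_completion)
  then have "f' measurable_on UNIV" by (rule lebesgue_measurable_imp_measurable_on) auto
  then obtain N g where N: "negligible N" and g: "\<And>n. continuous_on UNIV (g n)"
      "\<And>x. x \<notin> N \<Longrightarrow> (\<lambda>n. g n x) \<longlonglongrightarrow> f' x"
    unfolding measurable_on_def by auto
  define B where "B = (cball 0 K :: 'b set)"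
  have B: "convex B" "closed B" "B \<noteq> {}" by (auto simp: B_def K_def)
  define g' where "g' n x = closest_point B (g n x)" for n x
  have g'c: "continuous_on UNIV (g' n)" for n
    unfolding g'_def
    by (rule continuous_on_compose2[OF continuous_on_closest_point[OF B, of UNIV] g(1)]) auto
  have [measurable]: "g' n \<in> borel_measurable borel" for n
    by (intro borel_measurable_continuous_onI g'c)
  have g'B: "norm (g' n x) \<le> K" for n x
    using closest_point_in_set[OF B(2,3), of "g n x"] by (simp add: g'_def B_def)
  obtain N' where N': "N \<subseteq> N'" "N' \<in> null_sets lborel"
    using N by (auto simp: negligible_iff_null_sets null_sets_completion_iff2)
  have AEn: "AE x in lborel. x \<notin> N"
    by (rule AE_I'[OF N'(2)]) (use N'(1) in auto)
  have C': "AE x in lborel. norm (f' x) \<le> K"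
    using C by eventually_elim (auto simp: f'_def K_def indicator_def)
  have lim: "AE x in lborel. (\<lambda>n. g' n x) \<longlonglongrightarrow> f' x"
    using AEn C'
  proof eventually_elim
    case (elim x)
    have "isCont (closest_point B) (f' x)" by (rule continuous_at_closest_point[OF B])
    from isCont_tendsto_compose[OF this g(2)[OF elim(1)]]
    show ?case using elim(2) by (simp add: g'_def closest_point_self B_def)
  qed
  define I where "I n s = indicator {a..b} s * (norm (f' s - g' n s))\<^sup>2" for n s
  have Im: "I n \<in> borel_measurable lborel" for n unfolding I_def by measurable
  have "(\<lambda>n. \<integral>s. I n s \<partial>lborel) \<longlonglongrightarrow> (\<integral>s. (0::real) \<partial>(lborel :: real measure))"
  proof (rule integral_dominated_convergence[where w = "\<lambda>s. (2 * K)\<^sup>2 * indicator {a..b} s"])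
    show "integrable lborel (\<lambda>s. (2 * K)\<^sup>2 * indicator {a..b} s)"
      by (intro integrable_mult_right integrable_real_indicator) (auto simp: emeasure_lborel_Icc_eq)
    show "AE s in lborel. (\<lambda>n. I n s) \<longlonglongrightarrow> 0"
      using lim
    proof eventually_elim
      case (elim s)
      have "(\<lambda>n. indicator {a..b} s * (norm (f' s - g' n s))\<^sup>2) \<longlonglongrightarrow> indicator {a..b} s * (norm (f' s - f' s))\<^sup>2"
        by (intro tendsto_intros elim)
      then show ?case by (simp add: I_def)
    qed
    show "AE s in lborel. norm (I n s) \<le> (2 * K)\<^sup>2 * indicator {a..b} s" for n
      using C'
    proof eventually_elim
      case (elim s)
      have "norm (f' s - g' n s) \<le> 2 * K"
        using elim g'B[of n s] norm_triangle_ineq4[of "f' s" "g' n s"] by linarith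
      then have "(norm (f' s - g' n s))\<^sup>2 \<le> (2 * K)\<^sup>2" by (intro power_mono) auto
      then show ?case by (auto simp: I_def indicator_def)
    qed
  qed (use Im in auto)
  then have "eventually (\<lambda>n. (\<integral>s. I n s \<partial>lborel) < \<epsilon>) sequentially"
    using eps by (intro order_tendstoD) auto
  then obtain n where n: "(\<integral>s. I n s \<partial>lborel) < \<epsilon>" by (auto simp: eventually_sequentially)
  have In: "integrable lborel (I n)"
  proof (rule Bochner_Integration.integrable_bound)
    show "integrable lborel (\<lambda>s. (2 * K)\<^sup>2 * indicator {a..b} s)"
      by (intro integrable_mult_right integrable_real_indicator) (auto simp: emeasure_lborel_Icc_eq)
    show "AE s in lborel. norm (I n s) \<le> norm ((2 * K)\<^sup>2 * indicator {a..b} s :: real)"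
      using C'
    proof eventually_elim
      case (elim s)
      have "norm (f' s - g' n s) \<le> 2 * K"
        using elim g'B[of n s] norm_triangle_ineq4[of "f' s" "g' n s"] by linarith
      then have "(norm (f' s - g' n s))\<^sup>2 \<le> (2 * K)\<^sup>2" by (intro power_mono) auto
      then show ?case by (auto simp: I_def indicator_def)
    qed
  qed (rule Im)
  have "(\<integral>\<^sup>+s\<in>{a..b}. ennreal ((norm (f s - g' n s))\<^sup>2) \<partial>lborel) = (\<integral>\<^sup>+s. ennreal (I n s) \<partial>lborel)"
    by (intro nn_integral_cong) (auto simp: I_def f'_def indicator_def)
  also have "\<dots> = ennreal (\<integral>s. I n s \<partial>lborel)"
    by (rule nn_integral_eq_integral[OF In]) (auto simp: I_def)
  also have "\<dots> < ennreal \<epsilon>" using n eps by (simp add: ennreal_lessI)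
  finally show thesis using that[OF g'c] by blast
qed

lemma bounded_step_approx:
  fixes f :: "real \<Rightarrow> 'b::euclidean_space"
  assumes ab: "a \<le> b" and f: "set_borel_measurable borel {a..b} f"
    and C: "AE s in lborel. s \<in> {a..b} \<longrightarrow> norm (f s) \<le> C" and eps: "0 < \<epsilon>"
  obtains n t c where "t 0 = a" "t n = b" "\<And>k. k < n \<Longrightarrow> t k \<le> t (Suc k)"
    "(\<integral>\<^sup>+s\<in>{a..b}. ennreal ((norm (f s - step_function n t c s))\<^sup>2) \<partial>lborel) < ennreal \<epsilon>"
proof -
  obtain g where g: "continuous_on UNIV g"
    "(\<integral>\<^sup>+s\<in>{a..b}. ennreal ((norm (f s - g s))\<^sup>2) \<partial>lborel) < ennreal (\<epsilon> / 4)"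
    using bounded_continuous_approx[OF f C, of "\<epsilon> / 4"] eps by auto
  define \<delta> where "\<delta> = sqrt (\<epsilon> / (4 * (b - a + 1)))"
  have d: "0 < \<delta>" using ab eps by (simp add: \<delta>_def)
  obtain n t c where t: "t 0 = a" "t n = b" "\<And>k. k < n \<Longrightarrow> t k \<le> t (Suc k)"
    "\<And>s. s \<in> {a<..b} \<Longrightarrow> norm (g s - step_function n t c s) < \<delta>"
    using continuous_step_approx[OF ab continuous_on_subset[OF g(1) subset_UNIV] d, of thesis] by metis
  let ?p = "step_function n t c"
  have gm[measurable]: "g \<in> borel_measurable borel" by (intro borel_measurable_continuous_onI g)
  have fm[measurable]: "(\<lambda>s. indicator {a..b} s *\<^sub>R f s) \<in> borel_measurable borel"
    using f by (simp add: set_borel_measurable_def)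
  have "(\<integral>\<^sup>+s\<in>{a..b}. ennreal ((norm (g s - ?p s))\<^sup>2) \<partial>lborel) \<le>
      (\<integral>\<^sup>+s. ennreal (\<delta>\<^sup>2) * indicator {a..b} s \<partial>lborel)"
  proof (rule nn_integral_mono_AE)
    have "AE s in lborel. s \<noteq> a" by (rule AE_lborel_singleton)
    then show "AE s in lborel. ennreal ((norm (g s - ?p s))\<^sup>2) * indicator {a..b} s \<le>
        ennreal (\<delta>\<^sup>2) * indicator {a..b} s"
    proof eventually_elim
      case (elim s)
      show ?case
      proof (cases "s \<in> {a..b}")
        case True
        then have "norm (g s - ?p s) \<le> \<delta>" using t(4)[of s] elim by auto
        then have "(norm (g s - ?p s))\<^sup>2 \<le> \<delta>\<^sup>2" by (intro power_mono) auto
        then show ?thesis using True by (simp add: ennreal_leI)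
      qed simp
    qed
  qed
  also have "\<dots> = ennreal (\<delta>\<^sup>2 * (b - a))"
    using ab by (simp add: nn_integral_cmult_indicator ennreal_mult)
  also have "\<delta>\<^sup>2 * (b - a) < \<epsilon> / 4"
  proof -
    have "\<delta>\<^sup>2 = \<epsilon> / (4 * (b - a + 1))" using ab eps by (simp add: \<delta>_def)
    then have "\<delta>\<^sup>2 * (b - a) = (\<epsilon> / 4) * ((b - a) / (b - a + 1))" by simp
    also have "\<dots> < (\<epsilon> / 4) * 1" using ab eps by (intro mult_strict_left_mono) auto
    finally show ?thesis by simp
  qed
  then have "ennreal (\<delta>\<^sup>2 * (b - a)) < ennreal (\<epsilon> / 4)" using eps by (intro ennreal_lessI) auto
  finally have gp: "(\<integral>\<^sup>+s\<in>{a..b}. ennreal ((norm (g s - ?p s))\<^sup>2) \<partial>lborel) < ennreal (\<epsilon> / 4)" .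
  let ?i = "\<lambda>s. indicator {a..b} s :: real"
  have ind: "(\<integral>\<^sup>+s\<in>{a..b}. ennreal ((norm (u s - v s))\<^sup>2) \<partial>lborel) =
      (\<integral>\<^sup>+s. ennreal ((norm (?i s *\<^sub>R u s - ?i s *\<^sub>R v s))\<^sup>2) \<partial>lborel)" for u v :: "real \<Rightarrow> 'b"
    by (intro nn_integral_cong) (auto simp: indicator_def)
  have "(\<integral>\<^sup>+s\<in>{a..b}. ennreal ((norm (f s - ?p s))\<^sup>2) \<partial>lborel) \<le>
      2 * (\<integral>\<^sup>+s\<in>{a..b}. ennreal ((norm (f s - g s))\<^sup>2) \<partial>lborel) +
      2 * (\<integral>\<^sup>+s\<in>{a..b}. ennreal ((norm (g s - ?p s))\<^sup>2) \<partial>lborel)"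
    unfolding ind by (rule nn_integral_norm_sq_triangle) measurable
  also have "\<dots> < 2 * ennreal (\<epsilon> / 4) + 2 * ennreal (\<epsilon> / 4)"
    using g(2) gp by (intro add_strict_mono ennreal_mult_strict_left_mono) auto
  also have "\<dots> = ennreal \<epsilon>"
    using eps by (simp add: ennreal_mult[symmetric] ennreal_plus[symmetric] flip: ennreal_numeral)
  finally show thesis using that[OF t(1-3)] by blast
qed

section \<open>Fast Cauchy sequences in mean square\<close>

text \<open>
  The limit is taken pointwise so that it is measurable for \<open>N\<close> itself, which need not contain the null
  sets of \<open>M\<close>. The estimate \<open>d \<le> 2\<^sup>k d\<^sup>2 + 2\<^sup>-\<^sup>k\<close> shows that the increments are almost surely summable, and Fatou's
  lemma gives the rate.
\<close>

lemma fast_Cauchy_limit: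
  fixes S :: "nat \<Rightarrow> 'a \<Rightarrow> 'b::euclidean_space"
  assumes fin: "emeasure M (space M) = 1"
    and sub: "subalgebra M N" and S: "\<And>k. S k \<in> borel_measurable N"
    and C: "\<And>m k. k \<le> m \<Longrightarrow> (\<integral>\<^sup>+\<omega>. ennreal ((norm (S m \<omega> - S k \<omega>))\<^sup>2) \<partial>M) \<le> ennreal (C / 4 ^ k)"
    and C0: "0 \<le> C"
  obtains X where "X \<in> borel_measurable N"
    "\<And>k. (\<integral>\<^sup>+\<omega>. ennreal ((norm (X \<omega> - S k \<omega>))\<^sup>2) \<partial>M) \<le> ennreal (C / 4 ^ k)"
proof -
  have SM[measurable]: "S k \<in> borel_measurable M" for k
    using measurable_from_subalg[OF sub S] .
  define X where "X \<omega> = lim (\<lambda>k. S k \<omega>)" for \<omega>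
  have XN: "X \<in> borel_measurable N" unfolding X_def by (intro borel_measurable_lim_metric S)
  have XM[measurable]: "X \<in> borel_measurable M" using measurable_from_subalg[OF sub XN] .
  let ?D = "\<lambda>k \<omega>. norm (S (Suc k) \<omega> - S k \<omega>)"
  have D: "(\<integral>\<^sup>+\<omega>. ennreal (?D k \<omega>) \<partial>M) \<le> ennreal ((C + 1) / 2 ^ k)" for k
  proof -
    have "(\<integral>\<^sup>+\<omega>. ennreal (?D k \<omega>) \<partial>M) \<le>
        (\<integral>\<^sup>+\<omega>. ennreal (2 ^ k) * ennreal ((?D k \<omega>)\<^sup>2) + ennreal (1 / 2 ^ k) \<partial>M)"
    proof (rule nn_integral_mono)
      fix \<omega>
      let ?d = "?D k \<omega>" and ?q = "2 ^ k :: real"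
      have "0 \<le> (?q * ?d - 1)\<^sup>2 / ?q" by simp
      also have "(?q * ?d - 1)\<^sup>2 / ?q = ?q * ?d\<^sup>2 - 2 * ?d + 1 / ?q"
        by (simp add: power2_diff power_mult_distrib field_simps power2_eq_square)
      finally have "?d \<le> ?q * ?d\<^sup>2 + 1 / ?q"
        using norm_ge_zero[of "S (Suc k) \<omega> - S k \<omega>"] by linarith
      then have "ennreal ?d \<le> ennreal (?q * ?d\<^sup>2 + 1 / ?q)" by (rule ennreal_leI)
      then show "ennreal ?d \<le> ennreal ?q * ennreal (?d\<^sup>2) + ennreal (1 / ?q)"
        by (simp add: ennreal_plus ennreal_mult)
    qed
    also have "\<dots> = ennreal (2 ^ k) * (\<integral>\<^sup>+\<omega>. ennreal ((?D k \<omega>)\<^sup>2) \<partial>M) + ennreal (1 / 2 ^ k)"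
      by (subst nn_integral_add) (auto simp: nn_integral_cmult fin)
    also have "\<dots> \<le> ennreal (2 ^ k) * ennreal (C / 4 ^ k) + ennreal (1 / 2 ^ k)"
      by (intro add_mono mult_left_mono C) auto
    also have "\<dots> = ennreal (2 ^ k * (C / 4 ^ k) + 1 / 2 ^ k)"
      using C0 by (simp add: ennreal_plus ennreal_mult[symmetric] del: ennreal_power)
    also have "2 ^ k * (C / 4 ^ k) + 1 / 2 ^ k = (C + 1) / 2 ^ k"
    proof -
      have "(4::real) ^ k = 2 ^ k * 2 ^ k" by (simp add: power_mult_distrib[symmetric])
      then show ?thesis by (simp add: field_simps)
    qed
    finally show ?thesis .
  qed
  have "(\<integral>\<^sup>+\<omega>. (\<Sum>k. ennreal (?D k \<omega>)) \<partial>M) = (\<Sum>k. \<integral>\<^sup>+\<omega>. ennreal (?D k \<omega>) \<partial>M)"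
    by (rule nn_integral_suminf) measurable
  also have "\<dots> \<le> (\<Sum>k. ennreal ((C + 1) / 2 ^ k))" by (intro suminf_le D) auto
  also have "\<dots> < \<infinity>"
  proof -
    have "summable (\<lambda>k. (C + 1) * (1 / 2) ^ k)" by (intro summable_mult summable_geometric) auto
    then have "summable (\<lambda>k. (C + 1) / 2 ^ k)" by (simp add: power_one_over)
    then have "(\<Sum>k. ennreal ((C + 1) / 2 ^ k)) = ennreal (\<Sum>k. (C + 1) / 2 ^ k)"
      using C0 by (intro suminf_ennreal2) auto
    then show ?thesis by simp
  qed
  finally have "AE \<omega> in M. (\<Sum>k. ennreal (?D k \<omega>)) \<noteq> \<infinity>"
    by (intro nn_integral_PInf_AE) (auto simp: less_top)
  then have lim: "AE \<omega> in M. (\<lambda>k. S k \<omega>) \<longlonglongrightarrow> X \<omega>"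
  proof eventually_elim
    case (elim \<omega>)
    then have "summable (\<lambda>k. ?D k \<omega>)" by (intro summable_suminf_not_top) auto
    then have "summable (\<lambda>k. S (Suc k) \<omega> - S k \<omega>)" by (rule summable_norm_cancel)
    then have "convergent (\<lambda>n. \<Sum>k<n. S (Suc k) \<omega> - S k \<omega>)"
      by (simp add: summable_iff_convergent)
    then have "convergent (\<lambda>n. S n \<omega> - S 0 \<omega>)" using sum_lessThan_telescope[of "\<lambda>k. S k \<omega>"] by simp
    from convergent_add[OF this convergent_const[of "S 0 \<omega>"]]
    have "convergent (\<lambda>k. S k \<omega>)" by simp
    then show ?case by (simp add: X_def convergent_LIMSEQ_iff)
  qed
  have "(\<integral>\<^sup>+\<omega>. ennreal ((norm (X \<omega> - S k \<omega>))\<^sup>2) \<partial>M) \<le> ennreal (C / 4 ^ k)" for k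
  proof -
    have "(\<integral>\<^sup>+\<omega>. ennreal ((norm (X \<omega> - S k \<omega>))\<^sup>2) \<partial>M) =
        (\<integral>\<^sup>+\<omega>. liminf (\<lambda>m. ennreal ((norm (S m \<omega> - S k \<omega>))\<^sup>2)) \<partial>M)"
    proof (rule nn_integral_cong_AE)
      show "AE \<omega> in M. ennreal ((norm (X \<omega> - S k \<omega>))\<^sup>2) =
          liminf (\<lambda>m. ennreal ((norm (S m \<omega> - S k \<omega>))\<^sup>2))"
        using lim
      proof eventually_elim
        case (elim \<omega>)
        have "(\<lambda>m. ennreal ((norm (S m \<omega> - S k \<omega>))\<^sup>2)) \<longlonglongrightarrow> ennreal ((norm (X \<omega> - S k \<omega>))\<^sup>2)"
          by (intro tendsto_intros tendsto_ennrealI elim)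
        from lim_imp_Liminf[OF _ this] show ?case by simp
      qed
    qed
    also have "\<dots> \<le> liminf (\<lambda>m. \<integral>\<^sup>+\<omega>. ennreal ((norm (S m \<omega> - S k \<omega>))\<^sup>2) \<partial>M)"
      by (rule nn_integral_liminf) measurable
    also have "\<dots> \<le> limsup (\<lambda>m. \<integral>\<^sup>+\<omega>. ennreal ((norm (S m \<omega> - S k \<omega>))\<^sup>2) \<partial>M)"
      by (rule Liminf_le_Limsup) simp
    also have "\<dots> \<le> ennreal (C / 4 ^ k)"
      by (rule Limsup_bounded) (auto intro: eventually_sequentiallyI[of k] C)
    finally show ?thesis .
  qed
  with XN show thesis by (rule that)
qed

section \<open>The Wiener integral\<close>

locale wiener = prob_space M for M :: "'w measure" +
  fixes F :: "real \<Rightarrow> 'w measure" and W :: "real \<Rightarrow> 'w \<Rightarrow> real"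
  assumes filtration: "filtration_on M F" and wiener_process: "adapted_wiener_process M F W"
begin

lemma F_sub: "0 \<le> t \<Longrightarrow> subalgebra M (F t)"
  using filtration by (auto simp: filtration_on_def)

lemma F_mono: "0 \<le> s \<Longrightarrow> s \<le> t \<Longrightarrow> subalgebra (F t) (F s)"
  using filtration F_sub[of s] F_sub[of t] by (auto simp: filtration_on_def subalgebra_def)

lemma F_measurable_mono:
  assumes "0 \<le> s" "s \<le> t" "X \<in> borel_measurable (F s)"
  shows "X \<in> borel_measurable (F t)"
  using measurable_from_subalg[OF F_mono[OF assms(1,2)] assms(3)] .

lemma F_measurable_M: "0 \<le> t \<Longrightarrow> X \<in> borel_measurable (F t) \<Longrightarrow> X \<in> borel_measurable M"
  using measurable_from_subalg[OF F_sub] .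

lemma W_measurable_F: "0 \<le> s \<Longrightarrow> s \<le> t \<Longrightarrow> W s \<in> borel_measurable (F t)"
  using wiener_process F_measurable_mono by (auto simp: adapted_wiener_process_def)

lemma W_measurable [measurable]: "0 \<le> t \<Longrightarrow> W t \<in> borel_measurable M"
  using F_measurable_M W_measurable_F by blast

lemma sq_int_integrable: "sq_int M X \<Longrightarrow> integrable M X"
  using sq_int_mult[of M X "\<lambda>_. 1"] by (simp add: sq_int_def)

lemma increment:
  assumes "0 \<le> s" "s \<le> t"
  shows "sq_int M (\<lambda>\<omega>. W t \<omega> - W s \<omega>)" "(\<integral>\<omega>. W t \<omega> - W s \<omega> \<partial>M) = 0"
    "(\<integral>\<omega>. (W t \<omega> - W s \<omega>)\<^sup>2 \<partial>M) = t - s"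
proof -
  have m: "(\<lambda>\<omega>. W t \<omega> - W s \<omega>) \<in> borel_measurable M"
    using assms by (intro borel_measurable_diff W_measurable) auto
  consider "s = t" | "s < t" using assms by linarith
  then have "sq_int M (\<lambda>\<omega>. W t \<omega> - W s \<omega>) \<and> (\<integral>\<omega>. W t \<omega> - W s \<omega> \<partial>M) = 0 \<and>
    (\<integral>\<omega>. (W t \<omega> - W s \<omega>)\<^sup>2 \<partial>M) = t - s"
  proof cases
    case 1
    then show ?thesis by simp
  next
    case 2
    have D: "distributed M lborel (\<lambda>\<omega>. W t \<omega> - W s \<omega>) (normal_density 0 (sqrt (t - s)))"
      using wiener_process assms 2 by (auto simp: adapted_wiener_process_def)
    have p: "0 < sqrt (t - s)" using 2 by simp
    have "integrable lborel (\<lambda>x. normal_density 0 (sqrt (t - s)) x * x\<^sup>2)"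
      using integrable_normal_moment[OF p, of 0 2] by simp
    then have I: "integrable M (\<lambda>\<omega>. (W t \<omega> - W s \<omega>)\<^sup>2)"
      using distributed_integrable[OF D, of "\<lambda>x. x\<^sup>2"] by simp
    have E: "(\<integral>\<omega>. W t \<omega> - W s \<omega> \<partial>M) = 0"
      using normal_distributed_expectation[OF p D] by simp
    have "(\<integral>\<omega>. (W t \<omega> - W s \<omega>)\<^sup>2 \<partial>M) = t - s"
      using normal_distributed_variance[OF p D] 2 by (simp add: E)
    with I E m show ?thesis by (simp add: sq_int_def)
  qed
  then show "sq_int M (\<lambda>\<omega>. W t \<omega> - W s \<omega>)" "(\<integral>\<omega>. W t \<omega> - W s \<omega> \<partial>M) = 0"
    "(\<integral>\<omega>. (W t \<omega> - W s \<omega>)\<^sup>2 \<partial>M) = t - s" by auto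
qed

lemma increment_sq:
  assumes "0 \<le> s" "0 \<le> t"
  shows "integrable M (\<lambda>\<omega>. (W t \<omega> - W s \<omega>)\<^sup>2)" "(\<integral>\<omega>. (W t \<omega> - W s \<omega>)\<^sup>2 \<partial>M) = \<bar>t - s\<bar>"
proof -
  have "integrable M (\<lambda>\<omega>. (W t \<omega> - W s \<omega>)\<^sup>2) \<and> (\<integral>\<omega>. (W t \<omega> - W s \<omega>)\<^sup>2 \<partial>M) = \<bar>t - s\<bar>"
  proof (cases "s \<le> t")
    case True
    then show ?thesis using increment[of s t] assms by (simp add: sq_int_def)
  next
    case False
    then show ?thesis using increment[of t s] assms
      by (simp add: sq_int_def power2_commute[of "W t _" "W s _"])
  qed
  then show "integrable M (\<lambda>\<omega>. (W t \<omega> - W s \<omega>)\<^sup>2)" "(\<integral>\<omega>. (W t \<omega> - W s \<omega>)\<^sup>2 \<partial>M) = \<bar>t - s\<bar>"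
    by auto
qed

lemma sq_int_indicator_Ioc: "sq_int lborel (indicator {a<..b::real})"
proof -
  have "emeasure lborel {a<..b} < \<infinity>" by (cases "a \<le> b") auto
  then have "integrable lborel (indicator {a<..b} :: real \<Rightarrow> real)"
    by (intro integrable_real_indicator) auto
  then show ?thesis
    by (simp add: sq_int_def power2_eq_square indicator_inter_arith[symmetric])
qed

text \<open>
  By polarisation the product of two increments is a combination of four squares of increments.
\<close>

lemma increment_covariance:
  assumes "0 \<le> a" "a \<le> b" "0 \<le> c" "c \<le> d"
  shows "(\<integral>\<omega>. (W b \<omega> - W a \<omega>) * (W d \<omega> - W c \<omega>) \<partial>M) =
    (\<integral>s. indicator {a<..b} s * indicator {c<..d} s \<partial>lborel)"
proof -
  have pos: "0 \<le> b" "0 \<le> d" using assms by auto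
  have polar: "(W b \<omega> - W a \<omega>) * (W d \<omega> - W c \<omega>) =
      ((W d \<omega> - W a \<omega>)\<^sup>2 + (W b \<omega> - W c \<omega>)\<^sup>2 - (W d \<omega> - W b \<omega>)\<^sup>2 - (W c \<omega> - W a \<omega>)\<^sup>2) / 2" for \<omega>
    by (simp add: power2_eq_square algebra_simps)
  have "(\<integral>\<omega>. (W b \<omega> - W a \<omega>) * (W d \<omega> - W c \<omega>) \<partial>M) =
      (\<bar>d - a\<bar> + \<bar>b - c\<bar> - \<bar>d - b\<bar> - \<bar>c - a\<bar>) / 2"
    unfolding polar using assms pos by (simp add: increment_sq)
  also have "\<dots> = max 0 (min b d - max a c)"
    using assms by (auto simp: min_def max_def abs_if)
  also have "\<dots> = measure lborel {max a c<..min b d}"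
    by (cases "max a c \<le> min b d") (auto simp: max_def)
  also have "\<dots> = (\<integral>s. indicator {max a c<..min b d} s \<partial>lborel)" by simp
  also have "\<dots> = (\<integral>s. indicator {a<..b} s * indicator {c<..d} s \<partial>lborel)"
    by (intro Bochner_Integration.integral_cong) (auto simp: indicator_def)
  finally show ?thesis .
qed

text \<open>
  A step function together with its integral. The intervals may overlap, so that sums of
  such pairs are of the same kind.
\<close>

inductive step_pair :: "(real \<Rightarrow> real) \<Rightarrow> ('w \<Rightarrow> real) \<Rightarrow> bool" where
  zero: "step_pair (\<lambda>_. 0) (\<lambda>_. 0)"
| step: "step_pair p P \<Longrightarrow> 0 \<le> a \<Longrightarrow> a \<le> b \<Longrightarrow>
    step_pair (\<lambda>s. p s + c * indicator {a<..b} s) (\<lambda>\<omega>. P \<omega> + c * (W b \<omega> - W a \<omega>))"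

lemma step_pair_basic:
  assumes "step_pair p P"
  shows "sq_int lborel p" "sq_int M P" "(\<integral>\<omega>. P \<omega> \<partial>M) = 0"
proof -
  have "sq_int lborel p \<and> sq_int M P \<and> (\<integral>\<omega>. P \<omega> \<partial>M) = 0"
    using assms
  proof induction
    case zero
    then show ?case by simp
  next
    case (step p P a b c)
    then have "(\<integral>\<omega>. P \<omega> + c * (W b \<omega> - W a \<omega>) \<partial>M) = 0"
      using increment(1,2)[of a b] sq_int_integrable[of P] sq_int_integrable[OF increment(1)[of a b]]
      by simp
    with step show ?case
      by (intro conjI sq_int_add sq_int_scale sq_int_indicator_Ioc increment) auto
  qed
  then show "sq_int lborel p" "sq_int M P" "(\<integral>\<omega>. P \<omega> \<partial>M) = 0" by auto
qed

lemma step_pair_increment: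
  assumes "step_pair p P" "0 \<le> a" "a \<le> b"
  shows "(\<integral>\<omega>. (W b \<omega> - W a \<omega>) * P \<omega> \<partial>M) = (\<integral>s. indicator {a<..b} s * p s \<partial>lborel)"
  using assms(1)
proof induction
  case (step p P a' b' c)
  note I = increment(1)[OF assms(2,3)] increment(1)[OF step.hyps(2,3)]
  note S = step_pair_basic[OF step.hyps(1)]
  have "(\<integral>\<omega>. (W b \<omega> - W a \<omega>) * (P \<omega> + c * (W b' \<omega> - W a' \<omega>)) \<partial>M) =
      (\<integral>\<omega>. (W b \<omega> - W a \<omega>) * P \<omega> + c * ((W b \<omega> - W a \<omega>) * (W b' \<omega> - W a' \<omega>)) \<partial>M)"
    by (intro Bochner_Integration.integral_cong) (auto simp: algebra_simps)
  also have "\<dots> = (\<integral>\<omega>. (W b \<omega> - W a \<omega>) * P \<omega> \<partial>M) +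
      c * (\<integral>\<omega>. (W b \<omega> - W a \<omega>) * (W b' \<omega> - W a' \<omega>) \<partial>M)"
    using sq_int_mult[OF I(1) S(2)] sq_int_mult[OF I] by simp
  also have "\<dots> = (\<integral>s. indicator {a<..b} s * p s \<partial>lborel) +
      c * (\<integral>s. indicator {a<..b} s * indicator {a'<..b'} s \<partial>lborel)"
    using step.IH increment_covariance[OF assms(2,3) step.hyps(2,3)] by simp
  also have "\<dots> = (\<integral>s. indicator {a<..b} s * p s + c * (indicator {a<..b} s * indicator {a'<..b'} s) \<partial>lborel)"
    using sq_int_mult[OF sq_int_indicator_Ioc[of a b] S(1)]
      sq_int_mult[OF sq_int_indicator_Ioc[of a b] sq_int_indicator_Ioc[of a' b']] by simp
  finally show ?case by (simp add: algebra_simps)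
qed simp

lemma step_pair_isometry:
  assumes "step_pair p P" "step_pair q Q"
  shows "(\<integral>\<omega>. P \<omega> * Q \<omega> \<partial>M) = (\<integral>s. p s * q s \<partial>lborel)"
  using assms(1)
proof induction
  case (step p P a b c)
  note I = increment(1)[OF step.hyps(2,3)]
  note S = step_pair_basic[OF step.hyps(1)] and S' = step_pair_basic[OF assms(2)]
  have "(\<integral>\<omega>. (P \<omega> + c * (W b \<omega> - W a \<omega>)) * Q \<omega> \<partial>M) =
      (\<integral>\<omega>. P \<omega> * Q \<omega> + c * ((W b \<omega> - W a \<omega>) * Q \<omega>) \<partial>M)"
    by (intro Bochner_Integration.integral_cong) (auto simp: algebra_simps)
  also have "\<dots> = (\<integral>\<omega>. P \<omega> * Q \<omega> \<partial>M) + c * (\<integral>\<omega>. (W b \<omega> - W a \<omega>) * Q \<omega> \<partial>M)"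
    using sq_int_mult[OF S(2) S'(2)] sq_int_mult[OF I S'(2)] by simp
  also have "\<dots> = (\<integral>s. p s * q s \<partial>lborel) + c * (\<integral>s. indicator {a<..b} s * q s \<partial>lborel)"
    using step.IH step_pair_increment[OF assms(2) step.hyps(2,3)] by simp
  also have "\<dots> = (\<integral>s. p s * q s + c * (indicator {a<..b} s * q s) \<partial>lborel)"
    using sq_int_mult[OF sq_int_indicator_Ioc[of a b] S'(1)] sq_int_mult[OF S(1) S'(1)] by simp
  finally show ?case by (simp add: algebra_simps)
qed simp

lemma step_pair_add:
  assumes "step_pair p P" "step_pair q Q"
  shows "step_pair (\<lambda>s. p s + q s) (\<lambda>\<omega>. P \<omega> + Q \<omega>)"
  using assms(2)
proof induction
  case zero
  then show ?case using assms(1) by simp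
next
  case (step q Q a b c)
  from step_pair.step[OF step.IH step.hyps(2,3), of c] show ?case by (simp add: add.assoc)
qed

lemma step_pair_scale:
  assumes "step_pair p P"
  shows "step_pair (\<lambda>s. r * p s) (\<lambda>\<omega>. r * P \<omega>)"
  using assms
proof induction
  case zero
  then show ?case using step_pair.zero by simp
next
  case (step p P a b c)
  from step_pair.step[OF step.IH step.hyps(2,3), of "r * c"] show ?case
    by (simp add: algebra_simps)
qed

lemma step_pair_diff:
  assumes "step_pair p P" "step_pair q Q"
  shows "step_pair (\<lambda>s. p s - q s) (\<lambda>\<omega>. P \<omega> - Q \<omega>)"
  using step_pair_add[OF assms(1) step_pair_scale[OF assms(2), of "-1"]] by simp

lemma step_pair_step_function:
  assumes "0 \<le> t 0" "\<And>k. k < n \<Longrightarrow> t k \<le> t (Suc k)"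
  shows "step_pair (\<lambda>s. step_function n t c s \<bullet> b) (\<lambda>\<omega>. step_integral W n t c \<omega> \<bullet> b)"
  using assms(2)
proof (induction n)
  case 0
  then show ?case by (simp add: step_function_def step_integral_def step_pair.zero)
next
  case (Suc n)
  have "0 \<le> t n" using knots_mono[of "Suc n" t 0 n] Suc.prems assms(1) by force
  moreover have "t n \<le> t (Suc n)" using Suc.prems by simp
  moreover have "step_pair (\<lambda>s. step_function n t c s \<bullet> b) (\<lambda>\<omega>. step_integral W n t c \<omega> \<bullet> b)"
    using Suc by simp
  ultimately have "step_pair (\<lambda>s. step_function n t c s \<bullet> b + (c n \<bullet> b) * indicator {t n<..t (Suc n)} s)
     (\<lambda>\<omega>. step_integral W n t c \<omega> \<bullet> b + (c n \<bullet> b) * (W (t (Suc n)) \<omega> - W (t n) \<omega>))"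
    by (intro step_pair.step)
  then show ?case
    by (simp add: step_function_def step_integral_def inner_add_left mult.commute)
qed

text \<open>
  The closure in mean square of the step pairs: \<open>X\<close> is a version of \<open>\<integral> f dW\<close> over \<open>[0, \<infinity>)\<close>.
\<close>

definition wi :: "(real \<Rightarrow> real) \<Rightarrow> ('w \<Rightarrow> real) \<Rightarrow> bool" where
  "wi f X \<longleftrightarrow> sq_int lborel f \<and> sq_int M X \<and>
     (\<forall>\<epsilon>>0. \<exists>p P. step_pair p P \<and> sq_norm lborel (\<lambda>s. f s - p s) < \<epsilon> \<and>
        sq_norm M (\<lambda>\<omega>. X \<omega> - P \<omega>) < \<epsilon>)"

lemma wi_sq_int: "wi f X \<Longrightarrow> sq_int lborel f" "wi f X \<Longrightarrow> sq_int M X"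
  by (simp_all add: wi_def)

lemma wi_isometry_sq:
  assumes "wi f X" shows "sq_norm M X = sq_norm lborel f"
proof (rule isometry_limit[symmetric])
  show "sq_int lborel f" "sq_int M X" using assms by (simp_all add: wi_def)
  fix \<epsilon> :: real assume "0 < \<epsilon>"
  then obtain p P where p: "step_pair p P" "sq_norm lborel (\<lambda>s. f s - p s) < \<epsilon>"
      "sq_norm M (\<lambda>\<omega>. X \<omega> - P \<omega>) < \<epsilon>" using assms by (auto simp: wi_def)
  have "sq_norm lborel p = sq_norm M P"
    using step_pair_isometry[OF p(1) p(1)] by (simp add: power2_eq_square)
  with p step_pair_basic[OF p(1)] show "\<exists>p P. sq_int lborel p \<and> sq_int M P \<and> sq_norm lborel p = sq_norm M P \<and>
      sq_norm lborel (\<lambda>s. f s - p s) < \<epsilon> \<and> sq_norm M (\<lambda>x. X x - P x) < \<epsilon>" by blast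
qed

lemma wi_add:
  assumes "wi f X" "wi g Y"
  shows "wi (\<lambda>s. f s + g s) (\<lambda>\<omega>. X \<omega> + Y \<omega>)"
  unfolding wi_def
proof (intro conjI allI impI)
  note f = wi_sq_int[OF assms(1)] and g = wi_sq_int[OF assms(2)]
  show "sq_int lborel (\<lambda>s. f s + g s)" "sq_int M (\<lambda>\<omega>. X \<omega> + Y \<omega>)"
    using f g by (auto intro: sq_int_add)
  fix \<epsilon> :: real assume "0 < \<epsilon>"
  then have e: "0 < \<epsilon> / 4" by simp
  obtain p P where p: "step_pair p P" "sq_norm lborel (\<lambda>s. f s - p s) < \<epsilon> / 4"
      "sq_norm M (\<lambda>\<omega>. X \<omega> - P \<omega>) < \<epsilon> / 4" using assms(1) e unfolding wi_def by blast
  obtain q Q where q: "step_pair q Q" "sq_norm lborel (\<lambda>s. g s - q s) < \<epsilon> / 4"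
      "sq_norm M (\<lambda>\<omega>. Y \<omega> - Q \<omega>) < \<epsilon> / 4" using assms(2) e unfolding wi_def by blast
  note p' = step_pair_basic[OF p(1)] and q' = step_pair_basic[OF q(1)]
  have "sq_norm lborel (\<lambda>s. (f s - p s) + (g s - q s)) < \<epsilon>"
    using sq_norm_add_le[OF sq_int_diff[OF f(1) p'(1)] sq_int_diff[OF g(1) q'(1)]] p q by linarith
  moreover have "sq_norm M (\<lambda>s. (X s - P s) + (Y s - Q s)) < \<epsilon>"
    using sq_norm_add_le[OF sq_int_diff[OF f(2) p'(2)] sq_int_diff[OF g(2) q'(2)]] p q by linarith
  ultimately show "\<exists>p P. step_pair p P \<and> sq_norm lborel (\<lambda>s. f s + g s - p s) < \<epsilon> \<and>
      sq_norm M (\<lambda>\<omega>. X \<omega> + Y \<omega> - P \<omega>) < \<epsilon>"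
    by (intro exI conjI) (rule step_pair_add[OF p(1) q(1)], simp_all add: algebra_simps)
qed

lemma wi_scale:
  assumes "wi f X"
  shows "wi (\<lambda>s. c * f s) (\<lambda>\<omega>. c * X \<omega>)"
  unfolding wi_def
proof (intro conjI allI impI)
  note f = wi_sq_int[OF assms(1)]
  show "sq_int lborel (\<lambda>s. c * f s)" "sq_int M (\<lambda>\<omega>. c * X \<omega>)"
    using f by (auto intro: sq_int_scale)
  fix \<epsilon> :: real assume e: "0 < \<epsilon>"
  have c1: "0 < 1 + c\<^sup>2" by (simp add: add_pos_nonneg)
  then have e': "0 < \<epsilon> / (1 + c\<^sup>2)" using e by simp
  obtain p P where p: "step_pair p P" "sq_norm lborel (\<lambda>s. f s - p s) < \<epsilon> / (1 + c\<^sup>2)"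
      "sq_norm M (\<lambda>\<omega>. X \<omega> - P \<omega>) < \<epsilon> / (1 + c\<^sup>2)" using assms(1) e' unfolding wi_def by blast
  have small: "c\<^sup>2 * u < \<epsilon>" if "u < \<epsilon> / (1 + c\<^sup>2)" "0 \<le> u" for u
  proof -
    have "c\<^sup>2 * u \<le> (1 + c\<^sup>2) * u" using that(2) by (intro mult_right_mono) auto
    also have "\<dots> < \<epsilon>" using that(1) c1 by (simp add: field_simps)
    finally show ?thesis .
  qed
  have sc: "sq_norm N (\<lambda>x. c * u x - c * v x) = c\<^sup>2 * sq_norm N (\<lambda>x. u x - v x)" for N :: "'z measure" and u v
    by (simp add: right_diff_distrib[symmetric] power_mult_distrib)
  show "\<exists>p P. step_pair p P \<and> sq_norm lborel (\<lambda>s. c * f s - p s) < \<epsilon> \<and>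
      sq_norm M (\<lambda>\<omega>. c * X \<omega> - P \<omega>) < \<epsilon>"
    by (intro exI conjI, rule step_pair_scale[OF p(1), of c]) (simp_all add: sc small p)
qed

lemma wi_diff: "wi f X \<Longrightarrow> wi g Y \<Longrightarrow> wi (\<lambda>s. f s - g s) (\<lambda>\<omega>. X \<omega> - Y \<omega>)"
  using wi_add[of f X "\<lambda>s. -1 * g s" "\<lambda>\<omega>. -1 * Y \<omega>"] wi_scale[of g Y "-1"] by simp

lemma wi_step: "step_pair p P \<Longrightarrow> wi p P"
  using step_pair_basic by (force simp: wi_def)

lemma wi_zero: "wi (\<lambda>_. 0) (\<lambda>_. 0)"
  by (intro wi_step step_pair.zero)

lemma wi_sum:
  assumes "finite I" "\<And>i. i \<in> I \<Longrightarrow> wi (f i) (X i)"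
  shows "wi (\<lambda>s. \<Sum>i\<in>I. f i s) (\<lambda>\<omega>. \<Sum>i\<in>I. X i \<omega>)"
  using assms by (induction I rule: finite_induct) (auto intro: wi_zero wi_add)

text \<open>
  Polarisation of \<open>wi_isometry_sq\<close>.
\<close>

lemma wi_isometry:
  assumes "wi f X" "wi g Y"
  shows "(\<integral>\<omega>. X \<omega> * Y \<omega> \<partial>M) = (\<integral>s. f s * g s \<partial>lborel)"
proof -
  note f = wi_sq_int[OF assms(1)] and g = wi_sq_int[OF assms(2)]
  have "sq_norm M (\<lambda>\<omega>. X \<omega> + Y \<omega>) = sq_norm lborel (\<lambda>s. f s + g s)"
    by (rule wi_isometry_sq[OF wi_add[OF assms]])
  then show ?thesis
    using wi_isometry_sq[OF assms(1)] wi_isometry_sq[OF assms(2)]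
    by (simp add: sq_norm_add[OF f(1) g(1)] sq_norm_add[OF f(2) g(2)])
qed

lemma wi_mean:
  assumes "wi f X"
  shows "(\<integral>\<omega>. X \<omega> \<partial>M) = 0"
proof (rule ccontr)
  assume "(\<integral>\<omega>. X \<omega> \<partial>M) \<noteq> 0"
  then have "0 < (\<integral>\<omega>. X \<omega> \<partial>M)\<^sup>2" by simp
  then obtain p P where p: "step_pair p P" "sq_norm M (\<lambda>\<omega>. X \<omega> - P \<omega>) < (\<integral>\<omega>. X \<omega> \<partial>M)\<^sup>2"
    using assms unfolding wi_def by blast
  note X = wi_sq_int(2)[OF assms] and P = step_pair_basic[OF p(1)]
  note D = sq_int_diff[OF X P(2)]
  have "(\<integral>\<omega>. X \<omega> - P \<omega> \<partial>M) = (\<integral>\<omega>. X \<omega> \<partial>M)"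
    using sq_int_integrable[OF X] sq_int_integrable[OF P(2)] P(3) by simp
  then have "variance (\<lambda>\<omega>. X \<omega> - P \<omega>) = sq_norm M (\<lambda>\<omega>. X \<omega> - P \<omega>) - (\<integral>\<omega>. X \<omega> \<partial>M)\<^sup>2"
    using variance_eq[OF sq_int_integrable[OF D]] D by (simp add: sq_int_def)
  then have "(\<integral>\<omega>. X \<omega> \<partial>M)\<^sup>2 \<le> sq_norm M (\<lambda>\<omega>. X \<omega> - P \<omega>)"
    using variance_positive[of "\<lambda>\<omega>. X \<omega> - P \<omega>"] by linarith
  with p(2) show False by simp
qed

lemma wi_AE_eq:
  assumes "wi f X" "sq_int M Y" "(\<integral>\<omega>. (X \<omega> - Y \<omega>)\<^sup>2 \<partial>M) = 0"
  shows "AE \<omega> in M. X \<omega> = Y \<omega>"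
proof -
  have "integrable M (\<lambda>\<omega>. (X \<omega> - Y \<omega>)\<^sup>2)"
    using sq_int_diff[OF wi_sq_int(2)[OF assms(1)] assms(2)] by (simp add: sq_int_def)
  from integral_nonneg_eq_0_iff_AE[OF this] assms(3) show ?thesis by auto
qed

lemma wi_unique:
  assumes "wi f X" "wi f Y"
  shows "AE \<omega> in M. X \<omega> = Y \<omega>"
proof (rule wi_AE_eq[OF assms(1) wi_sq_int(2)[OF assms(2)]])
  show "(\<integral>\<omega>. (X \<omega> - Y \<omega>)\<^sup>2 \<partial>M) = 0"
    using wi_isometry_sq[OF wi_diff[OF assms]] by simp
qed

lemma wi_cong_AE:
  assumes X: "wi f X" and fg: "AE s in lborel. f s = g s" and XY: "AE \<omega> in M. X \<omega> = Y \<omega>"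
    and g: "g \<in> borel_measurable borel" and Y: "Y \<in> borel_measurable M"
  shows "wi g Y"
  unfolding wi_def
proof (intro conjI allI impI)
  note X' = wi_sq_int[OF X]
  have [measurable]: "f \<in> borel_measurable borel" "X \<in> borel_measurable M"
    using X' by (auto simp: sq_int_def)
  note [measurable] = g Y
  have "integrable lborel (\<lambda>s. (g s)\<^sup>2)"
    using X'(1) fg by (subst integrable_cong_AE[where g = "\<lambda>s. (f s)\<^sup>2"]) (auto simp: sq_int_def)
  then show sg: "sq_int lborel g" by (simp add: sq_int_def)
  have "integrable M (\<lambda>s. (Y s)\<^sup>2)"
    using X'(2) XY by (subst integrable_cong_AE[where g = "\<lambda>s. (X s)\<^sup>2"]) (auto simp: sq_int_def)
  then show sY: "sq_int M Y" by (simp add: sq_int_def)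
  fix \<epsilon> :: real assume "0 < \<epsilon>"
  then obtain p P where p: "step_pair p P" "sq_norm lborel (\<lambda>s. f s - p s) < \<epsilon>"
      "sq_norm M (\<lambda>\<omega>. X \<omega> - P \<omega>) < \<epsilon>" using X by (auto simp: wi_def)
  have [measurable]: "p \<in> borel_measurable borel" "P \<in> borel_measurable M"
    using step_pair_basic[OF p(1)] by (auto simp: sq_int_def)
  have "sq_norm lborel (\<lambda>s. g s - p s) = sq_norm lborel (\<lambda>s. f s - p s)"
    using fg by (intro integral_cong_AE) auto
  moreover have "sq_norm M (\<lambda>s. Y s - P s) = sq_norm M (\<lambda>s. X s - P s)"
    using XY by (intro integral_cong_AE) auto
  ultimately show "\<exists>p P. step_pair p P \<and> sq_norm lborel (\<lambda>s. g s - p s) < \<epsilon> \<and>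
      sq_norm M (\<lambda>\<omega>. Y \<omega> - P \<omega>) < \<epsilon>" using p by (intro exI[of _ p] exI[of _ P]) simp
qed

text \<open>
  An integral over \<open>[a, b]\<close> is the integral of the function extended by zero. In this form integrals over
  different intervals can be compared.
\<close>

lemma wiener_integral_wi:
  fixes f :: "real \<Rightarrow> 'b::euclidean_space"
  assumes X: "has_wiener_integral M W f a b X" and a: "0 \<le> a" and e: "e \<in> Basis"
  shows "wi (\<lambda>s. (indicator {a..b} s *\<^sub>R f s) \<bullet> e) (\<lambda>\<omega>. X \<omega> \<bullet> e)"
proof -
  let ?f = "\<lambda>s. (indicator {a..b} s *\<^sub>R f s) \<bullet> e" and ?X = "\<lambda>\<omega>. X \<omega> \<bullet> e"
  have [measurable]: "(\<lambda>s. indicator {a..b} s *\<^sub>R f s) \<in> borel_measurable borel" "X \<in> borel_measurable M"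
    using X by (auto simp: has_wiener_integral_def set_borel_measurable_def)
  have approx: "\<exists>p P. step_pair p P \<and> sq_int lborel (\<lambda>s. ?f s - p s) \<and> sq_int M (\<lambda>\<omega>. ?X \<omega> - P \<omega>) \<and>
      sq_norm lborel (\<lambda>s. ?f s - p s) < \<epsilon> \<and> sq_norm M (\<lambda>\<omega>. ?X \<omega> - P \<omega>) < \<epsilon>" if eps: "0 < \<epsilon>" for \<epsilon>
  proof -
    obtain n t c where t: "t 0 = a" "t n = b" "\<forall>k<n. t k \<le> t (Suc k)"
      and 1: "(\<integral>\<^sup>+s\<in>{a..b}. ennreal ((norm (f s - step_function n t c s))\<^sup>2) \<partial>lborel) < ennreal \<epsilon>"
      and 2: "(\<integral>\<^sup>+\<omega>. ennreal ((norm (X \<omega> - step_integral W n t c \<omega>))\<^sup>2) \<partial>M) < ennreal \<epsilon>"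
      using X eps unfolding has_wiener_integral_def by blast
    let ?p = "\<lambda>s. step_function n t c s \<bullet> e" and ?P = "\<lambda>\<omega>. step_integral W n t c \<omega> \<bullet> e"
    have sp: "step_pair ?p ?P" by (rule step_pair_step_function) (use t a in auto)
    note sp' = step_pair_basic[OF sp]
    have [measurable]: "?p \<in> borel_measurable borel" "?P \<in> borel_measurable M"
      using sp' by (auto simp: sq_int_def)
    have le: "((v - w) \<bullet> e)\<^sup>2 \<le> (norm (v - w))\<^sup>2" for v w :: 'b
      using Basis_le_norm[OF e, of "v - w"] by (simp add: abs_le_square_iff[symmetric])
    have "(\<integral>\<^sup>+s. ennreal ((?f s - ?p s)\<^sup>2) \<partial>lborel) \<le>
        (\<integral>\<^sup>+s\<in>{a..b}. ennreal ((norm (f s - step_function n t c s))\<^sup>2) \<partial>lborel)"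
    proof (rule nn_integral_mono)
      fix s
      have "step_function n t c s = 0" if "s \<notin> {a..b}"
        by (rule step_function_outside) (use t that in auto)
      then show "ennreal ((?f s - ?p s)\<^sup>2) \<le>
          ennreal ((norm (f s - step_function n t c s))\<^sup>2) * indicator {a..b} s"
        using le[of "f s" "step_function n t c s"]
        by (cases "s \<in> {a..b}") (auto simp: inner_diff_left intro!: ennreal_leI)
    qed
    with 1 have 1: "(\<integral>\<^sup>+s. ennreal ((?f s - ?p s)\<^sup>2) \<partial>lborel) < ennreal \<epsilon>" by simp
    have "(\<integral>\<^sup>+\<omega>. ennreal ((?X \<omega> - ?P \<omega>)\<^sup>2) \<partial>M) \<le>
        (\<integral>\<^sup>+\<omega>. ennreal ((norm (X \<omega> - step_integral W n t c \<omega>))\<^sup>2) \<partial>M)"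
      using le by (intro nn_integral_mono ennreal_leI) (simp add: inner_diff_left[symmetric])
    with 2 have 2: "(\<integral>\<^sup>+\<omega>. ennreal ((?X \<omega> - ?P \<omega>)\<^sup>2) \<partial>M) < ennreal \<epsilon>" by simp
    have m1: "(\<lambda>s. ?f s - ?p s) \<in> borel_measurable lborel" and m2: "(\<lambda>\<omega>. ?X \<omega> - ?P \<omega>) \<in> borel_measurable M"
      by measurable
    note l1 = nn_integral_less_imp_integrable[OF borel_measurable_power[OF m1] zero_le_power2 1]
    note l2 = nn_integral_less_imp_integrable[OF borel_measurable_power[OF m2] zero_le_power2 2]
    show ?thesis
      by (intro exI[of _ ?p] exI[of _ ?P] conjI sp) (simp_all only: sq_int_def l1 l2 m1 m2)
  qed
  obtain p P where p: "step_pair p P" "sq_int lborel (\<lambda>s. ?f s - p s)" "sq_int M (\<lambda>\<omega>. ?X \<omega> - P \<omega>)"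
    using approx[of 1] by auto
  have "sq_int lborel ?f" "sq_int M ?X"
    using sq_int_add[OF p(2) step_pair_basic(1)[OF p(1)]] sq_int_add[OF p(3) step_pair_basic(2)[OF p(1)]]
    by simp_all
  then show ?thesis unfolding wi_def using approx by blast
qed

lemma step_integral_measurable:
  assumes "0 \<le> t 0" "\<And>k. k < n \<Longrightarrow> t k \<le> t (Suc k)"
  shows "step_integral W n t (c :: nat \<Rightarrow> 'b::euclidean_space) \<in> borel_measurable (F (t n))"
proof -
  have "W (t k) \<in> borel_measurable (F (t n))" if "k \<le> n" for k
    using knots_mono[of n t 0 k] knots_mono[of n t k n] assms that by (intro W_measurable_F) force+
  then show ?thesis unfolding step_integral_def[abs_def]
    by (intro borel_measurable_sum borel_measurable_scaleR borel_measurable_diff) auto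
qed

lemma step_integral_isometry:
  fixes c c' :: "nat \<Rightarrow> 'b::euclidean_space"
  assumes t: "0 \<le> t 0" "\<And>k. k < n \<Longrightarrow> t k \<le> t (Suc k)"
    and t': "0 \<le> t' 0" "\<And>k. k < n' \<Longrightarrow> t' k \<le> t' (Suc k)"
  shows "(\<integral>\<^sup>+\<omega>. ennreal ((norm (step_integral W n t c \<omega> - step_integral W n' t' c' \<omega>))\<^sup>2) \<partial>M) =
    (\<integral>\<^sup>+s. ennreal ((norm (step_function n t c s - step_function n' t' c' s))\<^sup>2) \<partial>lborel)"
proof -
  let ?d = "\<lambda>e s. step_function n t c s \<bullet> e - step_function n' t' c' s \<bullet> e"
  let ?D = "\<lambda>e \<omega>. step_integral W n t c \<omega> \<bullet> e - step_integral W n' t' c' \<omega> \<bullet> e"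
  have sp: "step_pair (?d e) (?D e)" for e
    by (intro step_pair_diff step_pair_step_function t t')
  note b = step_pair_basic[OF sp]
  have [measurable]: "?d e \<in> borel_measurable borel" "?D e \<in> borel_measurable M" for e
    using b[of e] by (auto simp: sq_int_def)
  have n: "ennreal ((norm (v - w))\<^sup>2) = (\<Sum>e\<in>Basis. ennreal ((v \<bullet> e - w \<bullet> e)\<^sup>2))" for v w :: 'b
  proof -
    have "(norm (v - w))\<^sup>2 = (\<Sum>e\<in>Basis. (v \<bullet> e - w \<bullet> e)\<^sup>2)"
      unfolding power2_norm_eq_inner by (subst euclidean_inner) (simp add: inner_diff_left power2_eq_square)
    then show ?thesis by simp
  qed
  have "(\<integral>\<^sup>+\<omega>. ennreal ((?D e \<omega>)\<^sup>2) \<partial>M) = (\<integral>\<^sup>+s. ennreal ((?d e s)\<^sup>2) \<partial>lborel)" for e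
    using b[of e] step_pair_isometry[OF sp sp, of e e]
    by (simp add: nn_integral_eq_integral sq_int_def power2_eq_square)
  then show ?thesis unfolding n by (simp add: nn_integral_sum del: sum_ennreal)
qed

text \<open>
  Step functions that approximate \<open>f\<close> at a geometric rate have, by the isometry, integrals to which
  \<open>fast_Cauchy_limit\<close> applies. The version obtained is measurable at the final time \<open>b\<close>.
\<close>

theorem wiener_integral_exists:
  fixes f :: "real \<Rightarrow> 'b::euclidean_space"
  assumes a: "0 \<le> a" "a \<le> b" and f: "set_borel_measurable borel {a..b} f"
    and C: "AE s in lborel. s \<in> {a..b} \<longrightarrow> norm (f s) \<le> C"
  obtains X where "X \<in> borel_measurable (F b)" "has_wiener_integral M W f a b X"
proof -
  have "\<exists>n t c. t 0 = a \<and> t n = b \<and> (\<forall>k<n. t k \<le> t (Suc k)) \<and>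
      (\<integral>\<^sup>+s\<in>{a..b}. ennreal ((norm (f s - step_function n t c s))\<^sup>2) \<partial>lborel) < ennreal (1 / 4 ^ j)" for j
  proof -
    have "0 < (1 / 4 ^ j :: real)" by simp
    show ?thesis
    proof (rule bounded_step_approx[OF a(2) f C \<open>0 < 1 / 4 ^ j\<close>])
      fix n :: nat and t c assume "t 0 = a" "t n = b" "\<And>k. k < n \<Longrightarrow> t k \<le> t (Suc k)"
        "(\<integral>\<^sup>+s\<in>{a..b}. ennreal ((norm (f s - step_function n t c s))\<^sup>2) \<partial>lborel) < ennreal (1 / 4 ^ j)"
      then show ?thesis by (intro exI[of _ n] exI[of _ t] exI[of _ c]) simp
    qed
  qed
  then have "\<forall>j. \<exists>x. fst (snd x) 0 = a \<and> fst (snd x) (fst x) = b \<and>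
      (\<forall>k<fst x. fst (snd x) k \<le> fst (snd x) (Suc k)) \<and>
      (\<integral>\<^sup>+s\<in>{a..b}. ennreal ((norm (f s - step_function (fst x) (fst (snd x)) (snd (snd x)) s))\<^sup>2) \<partial>lborel)
        < ennreal (1 / 4 ^ j)"
    by simp
  from choice[OF this] obtain x where x: "\<forall>j. fst (snd (x j)) 0 = a \<and> fst (snd (x j)) (fst (x j)) = b \<and>
      (\<forall>k<fst (x j). fst (snd (x j)) k \<le> fst (snd (x j)) (Suc k)) \<and>
      (\<integral>\<^sup>+s\<in>{a..b}. ennreal ((norm (f s - step_function (fst (x j)) (fst (snd (x j))) (snd (snd (x j))) s))\<^sup>2) \<partial>lborel)
        < ennreal (1 / 4 ^ j)" ..
  define n t c where "n j = fst (x j)" and "t j = fst (snd (x j))" and "c j = snd (snd (x j))" for j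
  from x have t: "\<And>j. t j 0 = a" "\<And>j. t j (n j) = b" "\<And>j k. k < n j \<Longrightarrow> t j k \<le> t j (Suc k)"
      and app: "\<And>j. (\<integral>\<^sup>+s\<in>{a..b}. ennreal ((norm (f s - step_function (n j) (t j) (c j) s))\<^sup>2) \<partial>lborel) < ennreal (1 / 4 ^ j)"
    unfolding n_def t_def c_def by blast+
  define S where "S j = step_integral W (n j) (t j) (c j)" for j
  define p where "p j = step_function (n j) (t j) (c j)" for j
  define f' where "f' s = indicator {a..b} s *\<^sub>R f s" for s
  have [measurable]: "f' \<in> borel_measurable borel"
    using f by (simp add: f'_def[abs_def] set_borel_measurable_def)
  have [measurable]: "p j \<in> borel_measurable borel" for j by (simp add: p_def)
  have SF: "S j \<in> borel_measurable (F b)" for j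
  proof -
    have "S j \<in> borel_measurable (F (t j (n j)))"
      unfolding S_def by (rule step_integral_measurable) (use t a in auto)
    then show ?thesis by (simp add: t)
  qed
  have app': "(\<integral>\<^sup>+s. ennreal ((norm (f' s - p j s))\<^sup>2) \<partial>lborel) \<le> ennreal (1 / 4 ^ j)" for j
  proof -
    have "(\<integral>\<^sup>+s. ennreal ((norm (f' s - p j s))\<^sup>2) \<partial>lborel) =
      (\<integral>\<^sup>+s\<in>{a..b}. ennreal ((norm (f s - p j s))\<^sup>2) \<partial>lborel)"
    proof (rule nn_integral_cong)
      fix s
      have "p j s = 0" if "s \<notin> {a..b}"
        unfolding p_def by (rule step_function_outside) (use t that in auto)
      then show "ennreal ((norm (f' s - p j s))\<^sup>2) = ennreal ((norm (f s - p j s))\<^sup>2) * indicator {a..b} s"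
        by (cases "s \<in> {a..b}") (auto simp: f'_def)
    qed
    with app[of j] show ?thesis by (simp add: p_def)
  qed
  have cauchy: "(\<integral>\<^sup>+\<omega>. ennreal ((norm (S m \<omega> - S k \<omega>))\<^sup>2) \<partial>M) \<le> ennreal (4 / 4 ^ k)" if "k \<le> m" for m k
  proof -
    have "(\<integral>\<^sup>+\<omega>. ennreal ((norm (S m \<omega> - S k \<omega>))\<^sup>2) \<partial>M) =
        (\<integral>\<^sup>+s. ennreal ((norm (p m s - p k s))\<^sup>2) \<partial>lborel)"
      unfolding S_def p_def by (rule step_integral_isometry) (use t a in auto)
    also have "\<dots> \<le> 2 * (\<integral>\<^sup>+s. ennreal ((norm (p m s - f' s))\<^sup>2) \<partial>lborel) +
        2 * (\<integral>\<^sup>+s. ennreal ((norm (f' s - p k s))\<^sup>2) \<partial>lborel)"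
      by (rule nn_integral_norm_sq_triangle) measurable
    also have "\<dots> \<le> 2 * ennreal (1 / 4 ^ m) + 2 * ennreal (1 / 4 ^ k)"
      using app'[of m] app'[of k] by (intro add_mono mult_left_mono) (auto simp: norm_minus_commute)
    also have "\<dots> \<le> 2 * ennreal (1 / 4 ^ k) + 2 * ennreal (1 / 4 ^ k)"
      using that by (intro add_mono mult_left_mono ennreal_leI divide_left_mono power_increasing) auto
    also have "\<dots> = ennreal (4 / 4 ^ k)"
      by (simp add: ennreal_mult[symmetric] ennreal_plus[symmetric] flip: ennreal_numeral)
    finally show ?thesis .
  qed
  have "0 \<le> b" using a by simp
  obtain X where X: "X \<in> borel_measurable (F b)"
      "\<And>k. (\<integral>\<^sup>+\<omega>. ennreal ((norm (X \<omega> - S k \<omega>))\<^sup>2) \<partial>M) \<le> ennreal (4 / 4 ^ k)"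
    by (rule fast_Cauchy_limit[OF emeasure_space_1 F_sub[OF \<open>0 \<le> b\<close>] SF cauchy]) auto
  have "has_wiener_integral M W f a b X"
    unfolding has_wiener_integral_def
  proof (intro conjI allI impI)
    show "set_borel_measurable borel {a..b} f" by fact
    show "X \<in> borel_measurable M" using F_measurable_M[OF \<open>0 \<le> b\<close> X(1)] .
    fix \<epsilon> :: real assume e: "0 < \<epsilon>"
    then obtain j where j: "(1 / 4) ^ j < \<epsilon> / 4"
      using real_arch_pow_inv[of "\<epsilon> / 4" "1 / 4"] by auto
    then have j': "4 / 4 ^ j < \<epsilon>" by (simp add: power_one_over)
    then have "1 / 4 ^ j < \<epsilon>" by (smt (verit) divide_strict_right_mono zero_less_power)
    then have 1: "(\<integral>\<^sup>+s\<in>{a..b}. ennreal ((norm (f s - step_function (n j) (t j) (c j) s))\<^sup>2) \<partial>lborel) < ennreal \<epsilon>"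
      using app[of j] e by (meson ennreal_lessI less_trans)
    have 2: "(\<integral>\<^sup>+\<omega>. ennreal ((norm (X \<omega> - step_integral W (n j) (t j) (c j) \<omega>))\<^sup>2) \<partial>M) < ennreal \<epsilon>"
      using X(2)[of j] j' e unfolding S_def by (meson ennreal_lessI le_less_trans)
    show "\<exists>n t c. t 0 = a \<and> t n = b \<and> (\<forall>k<n. t k \<le> t (Suc k)) \<and>
        (\<integral>\<^sup>+s\<in>{a..b}. ennreal ((norm (f s - step_function n t c s))\<^sup>2) \<partial>lborel) < ennreal \<epsilon> \<and>
        (\<integral>\<^sup>+\<omega>. ennreal ((norm (X \<omega> - step_integral W n t c \<omega>))\<^sup>2) \<partial>M) < ennreal \<epsilon>"
      using 1 2 t by (intro exI[of _ "n j"] exI[of _ "t j"] exI[of _ "c j"]) auto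
  qed
  with X(1) show thesis by (rule that)
qed

end

section \<open>Time integrals of Wiener integrals\<close>

text \<open>
  Expand \<open>\<integral> (f - c)\<^sup>2 \<ge> 0\<close> over \<open>[0, T]\<close> with \<open>c = \<integral> f / (T + 1)\<close>; the summand \<open>1\<close> takes care of
  \<open>T = 0\<close>.
\<close>

lemma sq_integral_le:
  assumes f: "sq_int lborel f" and supp: "\<And>s. s \<notin> {0..T} \<Longrightarrow> f s = 0" and T: "0 \<le> T"
  shows "(\<integral>s. f s \<partial>lborel)\<^sup>2 \<le> (T + 1) * sq_norm lborel f"
proof -
  let ?i = "\<lambda>s. indicator {0..T} s :: real"
  define X where "X = (\<integral>s. f s \<partial>lborel)"
  define c where "c = X / (T + 1)"
  have i: "sq_int lborel ?i"
    using T by (auto simp: sq_int_def power2_eq_square indicator_inter_arith[symmetric] intro!: integrable_real_indicator)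
  have iT: "sq_norm lborel ?i = T" using T by (simp add: power2_eq_square indicator_inter_arith[symmetric])
  have fi: "f s * ?i s = f s" for s using supp[of s] by (auto simp: indicator_def)
  have "0 \<le> sq_norm lborel (\<lambda>s. f s - c * ?i s)" by simp
  also have "\<dots> = sq_norm lborel f - 2 * c * X + c\<^sup>2 * T"
    using sq_norm_diff[OF f sq_int_scale[OF i, of c]] iT
    by (simp add: power_mult_distrib X_def mult.left_commute[of _ c] fi)
  finally have "2 * c * X - c\<^sup>2 * T \<le> sq_norm lborel f" by simp
  moreover have "2 * c * X - c\<^sup>2 * T = X\<^sup>2 * (T + 2) / (T + 1)\<^sup>2"
    using T by (simp add: c_def power_divide divide_simps) (simp add: power2_eq_square algebra_simps)
  moreover have "X\<^sup>2 / (T + 1) \<le> X\<^sup>2 * (T + 2) / (T + 1)\<^sup>2"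
  proof -
    have "X\<^sup>2 / (T + 1) = X\<^sup>2 * (T + 1) / (T + 1)\<^sup>2" using T by (simp add: power2_eq_square)
    also have "\<dots> \<le> X\<^sup>2 * (T + 2) / (T + 1)\<^sup>2" by (intro divide_right_mono mult_left_mono) auto
    finally show ?thesis .
  qed
  ultimately have "X\<^sup>2 / (T + 1) \<le> sq_norm lborel f" by linarith
  then show ?thesis using T by (simp add: X_def field_simps)
qed

lemma ennreal_norm_sq_nth: "ennreal ((norm v)\<^sup>2) = (\<Sum>i\<in>UNIV. ennreal ((v $ i)\<^sup>2))"
  for v :: "real^'n"
  unfolding power2_norm_eq_inner inner_vec_def by (simp add: power2_eq_square)

lemma vec_measurable_iff:
  fixes f :: "'a \<Rightarrow> real^'n"
  shows "f \<in> borel_measurable N \<longleftrightarrow> (\<forall>i. (\<lambda>x. f x $ i) \<in> borel_measurable N)"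
proof
  assume "f \<in> borel_measurable N"
  then show "\<forall>i. (\<lambda>x. f x $ i) \<in> borel_measurable N" by (simp add: borel_measurable_nth)
next
  assume "\<forall>i. (\<lambda>x. f x $ i) \<in> borel_measurable N"
  then show "f \<in> borel_measurable N" using borel_measurable_vec_lambda[of "\<lambda>x i. f x $ i" N] by simp
qed

lemma vec_set_integral:
  fixes f :: "real \<Rightarrow> real^'n"
  assumes "\<And>i. set_integrable lborel S (\<lambda>s. f s $ i)"
  shows "set_integrable lborel S f" and "(LINT s:S|lborel. f s) $ i = (LINT s:S|lborel. f s $ i)"
proof -
  have "integrable lborel (\<lambda>s. \<Sum>i\<in>UNIV. (indicator S s *\<^sub>R f s $ i) *\<^sub>R (axis i 1 :: real^'n))"
    using assms by (intro Bochner_Integration.integrable_sum integrable_scaleR_left) (simp add: set_integrable_def)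
  also have "(\<lambda>s. \<Sum>i\<in>UNIV. (indicator S s *\<^sub>R f s $ i) *\<^sub>R (axis i 1 :: real^'n)) = (\<lambda>s. indicator S s *\<^sub>R f s)"
    by (simp add: fun_eq_iff vec_eq_iff sum_component axis_def if_distrib cong: if_cong)
  finally show I: "set_integrable lborel S f" by (simp add: set_integrable_def)
  show "(LINT s:S|lborel. f s) $ i = (LINT s:S|lborel. f s $ i)"
    using integral_bounded_linear[OF bounded_linear_vec_nth I[unfolded set_integrable_def], of i]
    by (simp add: set_lebesgue_integral_def)
qed

context wiener
begin

text \<open>
  Let \<open>X = \<integral> x\<^sub>s ds\<close> and \<open>K = \<integral> k\<^sub>s ds\<close>. The theorem of Fubini and the isometry for the single \<open>x\<^sub>s\<close> give
  \<open>E[X \<eta>] = \<integral> K g\<close> for every \<open>\<eta> = \<integral> g dW\<close>, and then also \<open>E[X\<^sup>2] = \<integral> K\<^sup>2\<close>. So \<open>X\<close> has mean-square distance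
  \<open>0\<close> from the Wiener integral of \<open>K\<close>.
\<close>

lemma wi_time_integral:
  fixes x :: "real \<Rightarrow> 'w \<Rightarrow> real" and k :: "real \<Rightarrow> real \<Rightarrow> real"
  assumes T: "0 \<le> T"
    and xm: "(\<lambda>(s, \<omega>). indicator {0..T} s * x s \<omega>) \<in> borel_measurable (lborel \<Otimes>\<^sub>M M)"
    and km: "(\<lambda>(s, u). indicator {0..T} s * k s u) \<in> borel_measurable (lborel \<Otimes>\<^sub>M lborel)"
    and wi: "\<And>s. s \<in> {0..T} \<Longrightarrow> wi (k s) (x s)"
    and kb: "\<And>s u. s \<in> {0..T} \<Longrightarrow> \<bar>k s u\<bar> \<le> C * indicator {0..T} u"
  shows "wi (\<lambda>u. LINT s:{0..T}|lborel. k s u) (\<lambda>\<omega>. LINT s:{0..T}|lborel. x s \<omega>)"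
    and "AE \<omega> in M. set_integrable lborel {0..T} (\<lambda>s. x s \<omega>)"
proof -
  interpret P: pair_sigma_finite "lborel :: real measure" M ..
  let ?i = "\<lambda>s. indicator {0..T} s :: real"
  define y where "y s \<omega> = ?i s * x s \<omega>" for s \<omega>
  define l where "l s u = ?i s * k s u" for s u
  define X where "X \<omega> = (\<integral>s. y s \<omega> \<partial>lborel)" for \<omega>
  define K where "K u = (\<integral>s. l s u \<partial>lborel)" for u
  have ym[measurable]: "(\<lambda>(s, \<omega>). y s \<omega>) \<in> borel_measurable (lborel \<Otimes>\<^sub>M M)"
    using xm by (simp add: y_def)
  have lm[measurable]: "(\<lambda>(s, u). l s u) \<in> borel_measurable (lborel \<Otimes>\<^sub>M lborel)"
    using km by (simp add: l_def)
  have wiy: "wi (l s) (y s)" for s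
  proof (cases "s \<in> {0..T}")
    case True
    then show ?thesis using wi[OF True] by (simp add: l_def[abs_def] y_def[abs_def])
  next
    case False
    then show ?thesis using wi_zero by (simp add: l_def[abs_def] y_def[abs_def])
  qed
  note ys = wi_sq_int(2)[OF wiy]
  have C: "0 \<le> C" using kb[of 0 0] T by (auto simp: order_trans[OF abs_ge_zero])
  have lb: "\<bar>l s u\<bar> \<le> C * (?i s * ?i u)" for s u
    using kb[of s u] by (auto simp: l_def indicator_def)
  have ii: "integrable lborel ?i" using T by (intro integrable_real_indicator) auto
  have sql: "sq_norm lborel (l s) \<le> C\<^sup>2 * T * ?i s" for s
  proof -
    have "sq_norm lborel (l s) \<le> (\<integral>u. C\<^sup>2 * ?i s * ?i u \<partial>lborel)"
    proof (rule integral_mono)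
      show "integrable lborel (\<lambda>u. (l s u)\<^sup>2)" using wi_sq_int(1)[OF wiy] by (simp add: sq_int_def)
      show "integrable lborel (\<lambda>u. C\<^sup>2 * ?i s * ?i u)" by (intro integrable_mult_right ii)
      fix u
      have "(l s u)\<^sup>2 \<le> (C * (?i s * ?i u))\<^sup>2" using lb[of s u] by (simp add: abs_le_square_iff[symmetric])
      also have "\<dots> = C\<^sup>2 * ?i s * ?i u" by (auto simp: power_mult_distrib indicator_def)
      finally show "(l s u)\<^sup>2 \<le> C\<^sup>2 * ?i s * ?i u" .
    qed
    also have "\<dots> = C\<^sup>2 * T * ?i s" using T by simp
    finally show ?thesis .
  qed
  have y2: "integrable (lborel \<Otimes>\<^sub>M M) (\<lambda>(s, \<omega>). (y s \<omega>)\<^sup>2)"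
  proof (rule P.Fubini_integrable)
    show "(\<lambda>(s, \<omega>). (y s \<omega>)\<^sup>2) \<in> borel_measurable (lborel \<Otimes>\<^sub>M M)" by measurable
    show "AE s in lborel. integrable M (\<lambda>\<omega>. case (s, \<omega>) of (s, \<omega>) \<Rightarrow> (y s \<omega>)\<^sup>2)"
      using ys by (simp add: sq_int_def)
    have "integrable lborel (\<lambda>s. sq_norm M (y s))"
    proof (rule Bochner_Integration.integrable_bound)
      show "integrable lborel (\<lambda>s. C\<^sup>2 * T * ?i s)" by (intro integrable_mult_right ii)
      show "(\<lambda>s. sq_norm M (y s)) \<in> borel_measurable lborel" by measurable
      show "AE s in lborel. norm (sq_norm M (y s)) \<le> norm (C\<^sup>2 * T * ?i s)"
        using sql T by (intro AE_I2) (simp add: wi_isometry_sq[OF wiy] abs_mult)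
    qed
    then show "integrable lborel (\<lambda>s. \<integral>\<omega>. norm (case (s, \<omega>) of (s, \<omega>) \<Rightarrow> (y s \<omega>)\<^sup>2) \<partial>M)" by simp
  qed
  have y\<eta>: "integrable (lborel \<Otimes>\<^sub>M M) (\<lambda>(s, \<omega>). y s \<omega> * \<eta> \<omega>)" if \<eta>: "sq_int M \<eta>" for \<eta>
  proof (rule Bochner_Integration.integrable_bound)
    have [measurable]: "\<eta> \<in> borel_measurable M" using \<eta> by (simp add: sq_int_def)
    have "integrable (lborel \<Otimes>\<^sub>M M) (\<lambda>(s, \<omega>). ?i s * (\<eta> \<omega>)\<^sup>2)"
      using \<eta> by (intro P.integrable_tensor ii) (simp add: sq_int_def)
    from Bochner_Integration.integrable_add[OF y2 this]
    show "integrable (lborel \<Otimes>\<^sub>M M) (\<lambda>(s, \<omega>). (y s \<omega>)\<^sup>2 + ?i s * (\<eta> \<omega>)\<^sup>2)"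
      by (simp add: case_prod_unfold)
    show "(\<lambda>(s, \<omega>). y s \<omega> * \<eta> \<omega>) \<in> borel_measurable (lborel \<Otimes>\<^sub>M M)" by measurable
    have "\<bar>y s \<omega> * \<eta> \<omega>\<bar> \<le> (y s \<omega>)\<^sup>2 + ?i s * (\<eta> \<omega>)\<^sup>2" for s \<omega>
      using abs_mult_le_squares[of "y s \<omega>" "\<eta> \<omega>"] by (cases "s \<in> {0..T}") (simp_all add: y_def)
    then show "AE p in lborel \<Otimes>\<^sub>M M. norm (case p of (s, \<omega>) \<Rightarrow> y s \<omega> * \<eta> \<omega>)
        \<le> norm (case p of (s, \<omega>) \<Rightarrow> (y s \<omega>)\<^sup>2 + ?i s * (\<eta> \<omega>)\<^sup>2)"
      by (intro AE_I2) (auto simp: split: prod.split intro: order_trans)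
  qed
  have one: "sq_int M (\<lambda>_. 1)" by (simp add: sq_int_def)
  have yint: "AE \<omega> in M. integrable lborel (\<lambda>s. y s \<omega>)"
    using P.AE_integrable_snd[OF y\<eta>[OF one]] by simp
  then show "AE \<omega> in M. set_integrable lborel {0..T} (\<lambda>s. x s \<omega>)"
    by (simp add: set_integrable_def y_def)
  have Xm[measurable]: "X \<in> borel_measurable M" unfolding X_def by measurable
  have "integrable M (\<lambda>\<omega>. (X \<omega>)\<^sup>2)"
  proof (rule Bochner_Integration.integrable_bound)
    show "integrable M (\<lambda>\<omega>. (T + 1) * (\<integral>s. (y s \<omega>)\<^sup>2 \<partial>lborel))"
      by (intro integrable_mult_right P.integrable_snd y2)
    show "(\<lambda>\<omega>. (X \<omega>)\<^sup>2) \<in> borel_measurable M" by measurable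
    show "AE \<omega> in M. norm ((X \<omega>)\<^sup>2) \<le> norm ((T + 1) * (\<integral>s. (y s \<omega>)\<^sup>2 \<partial>lborel))"
      using P.AE_integrable_snd[OF y2] yint
    proof eventually_elim
      case (elim \<omega>)
      then have "sq_int lborel (\<lambda>s. y s \<omega>)" by (auto simp: sq_int_def)
      from sq_integral_le[OF this _ T] T show ?case
        by (simp add: X_def y_def abs_mult)
    qed
  qed
  with Xm have sqX: "sq_int M X" by (simp add: sq_int_def)
  have Km[measurable]: "K \<in> borel_measurable borel" unfolding K_def by measurable
  have lg: "integrable (lborel \<Otimes>\<^sub>M lborel) (\<lambda>(s, u). l s u * g u)" if g: "sq_int lborel g" for g
  proof (rule Bochner_Integration.integrable_bound)
    have [measurable]: "g \<in> borel_measurable borel" using g by (simp add: sq_int_def)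
    show "integrable (lborel \<Otimes>\<^sub>M lborel) (\<lambda>(s, u). ?i s * (C\<^sup>2 * ?i u + (g u)\<^sup>2))"
      using g by (intro lborel_pair.integrable_tensor ii Bochner_Integration.integrable_add integrable_mult_right)
        (simp add: sq_int_def)
    show "(\<lambda>(s, u). l s u * g u) \<in> borel_measurable (lborel \<Otimes>\<^sub>M lborel)" by measurable
    have "\<bar>l s u * g u\<bar> \<le> ?i s * (C\<^sup>2 * ?i u + (g u)\<^sup>2)" for s u
    proof (cases "s \<in> {0..T}")
      case True
      have "(l s u)\<^sup>2 \<le> (C * (?i s * ?i u))\<^sup>2" using lb[of s u] by (simp add: abs_le_square_iff[symmetric])
      also have "\<dots> = C\<^sup>2 * ?i u" using True by (auto simp: power_mult_distrib indicator_def)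
      finally show ?thesis using abs_mult_le_squares[of "l s u" "g u"] True by simp
    qed (simp add: l_def)
    then show "AE p in lborel \<Otimes>\<^sub>M lborel. norm (case p of (s, u) \<Rightarrow> l s u * g u)
        \<le> norm (case p of (s, u) \<Rightarrow> ?i s * (C\<^sup>2 * ?i u + (g u)\<^sup>2))"
      by (intro AE_I2) (auto split: prod.split intro: order_trans)
  qed
  have Fub_y: "(\<integral>\<omega>. X \<omega> * \<eta> \<omega> \<partial>M) = (\<integral>s. (\<integral>\<omega>. y s \<omega> * \<eta> \<omega> \<partial>M) \<partial>lborel)" if "sq_int M \<eta>" for \<eta>
    using P.Fubini_integral[OF y\<eta>[OF that]] by (simp add: X_def)
  have Fub_l: "(\<integral>s. (\<integral>u. l s u * g u \<partial>lborel) \<partial>lborel) = (\<integral>u. K u * g u \<partial>lborel)" if "sq_int lborel g" for g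
    using lborel_pair.Fubini_integral[OF lg[OF that]] by (simp add: K_def)
  have cov: "(\<integral>\<omega>. X \<omega> * \<eta> \<omega> \<partial>M) = (\<integral>u. K u * g u \<partial>lborel)" if "wi g \<eta>" for g \<eta>
    using Fub_y[OF wi_sq_int(2)[OF that]] Fub_l[OF wi_sq_int(1)[OF that]] wi_isometry[OF wiy that] by simp
  have Kb: "\<bar>K u\<bar> \<le> C * T * ?i u" for u
  proof -
    have "\<bar>K u\<bar> \<le> (\<integral>s. \<bar>l s u\<bar> \<partial>lborel)" unfolding K_def by (rule integral_abs_bound)
    also have "\<dots> \<le> (\<integral>s. C * ?i u * ?i s \<partial>lborel)"
    proof (rule integral_mono')
      show "integrable lborel (\<lambda>s. C * ?i u * ?i s)" by (intro integrable_mult_right ii)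
      show "\<bar>l s u\<bar> \<le> C * ?i u * ?i s" for s using lb[of s u] by (simp add: mult_ac)
    qed (use C in simp)
    also have "\<dots> = C * T * ?i u" using T by simp
    finally show ?thesis .
  qed
  obtain Y where Y: "has_wiener_integral M W K 0 T Y"
  proof (rule wiener_integral_exists[OF order_refl T, of K "C * T"])
    show "set_borel_measurable borel {0..T} K" unfolding set_borel_measurable_def by measurable
    have "norm (K s) \<le> C * T" for s
      using Kb[of s] C T by (cases "s \<in> {0..T}") (auto intro: order_trans[OF _ mult_nonneg_nonneg])
    then show "AE s in lborel. s \<in> {0..T} \<longrightarrow> norm (K s) \<le> C * T" by simp
  qed
  have "?i s * K s = K s" for s using Kb[of s] by (cases "s \<in> {0..T}") auto
  then have iK: "(\<lambda>s. ?i s * K s) = K" by (rule ext)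
  have wiK: "wi K Y"
    using wiener_integral_wi[OF Y order_refl, of 1]
    by (simp only: real_scaleR_def inner_real_def mult_1_right iK Basis_real_def singletonI simp_thms)
  note sY = wi_sq_int(2)[OF wiK] and sK = wi_sq_int(1)[OF wiK]
  have XX: "(\<integral>\<omega>. X \<omega> * X \<omega> \<partial>M) = (\<integral>u. K u * K u \<partial>lborel)"
  proof -
    have "(\<integral>\<omega>. y s \<omega> * X \<omega> \<partial>M) = (\<integral>u. l s u * K u \<partial>lborel)" for s
      using cov[OF wiy[of s]] by (simp add: mult.commute)
    then show ?thesis using Fub_y[OF sqX] Fub_l[OF sK] by simp
  qed
  have "(\<integral>\<omega>. (Y \<omega> - X \<omega>)\<^sup>2 \<partial>M) = 0"
    using sq_norm_diff[OF sY sqX] wi_isometry_sq[OF wiK] cov[OF wiK] XX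
    by (simp add: mult.commute power2_eq_square)
  from wi_AE_eq[OF wiK sqX this] have "AE \<omega> in M. Y \<omega> = X \<omega>" .
  from wi_cong_AE[OF wiK _ this Km Xm]
  have "wi K X" by simp
  then show "wi (\<lambda>u. LINT s:{0..T}|lborel. k s u) (\<lambda>\<omega>. LINT s:{0..T}|lborel. x s \<omega>)"
    by (simp add: K_def[abs_def] X_def[abs_def] l_def y_def set_lebesgue_integral_def)
qed

definition wiv :: "(real \<Rightarrow> real^'n) \<Rightarrow> ('w \<Rightarrow> real^'n) \<Rightarrow> bool" where
  "wiv f X \<longleftrightarrow> (\<forall>i. wi (\<lambda>s. f s $ i) (\<lambda>\<omega>. X \<omega> $ i))"

lemma wiener_integral_wiv:
  assumes "has_wiener_integral M W f a b X" "0 \<le> a"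
  shows "wiv (\<lambda>s. indicator {a..b} s *\<^sub>R f s) X"
  unfolding wiv_def
proof
  fix i
  show "wi (\<lambda>s. (indicator {a..b} s *\<^sub>R f s) $ i) (\<lambda>\<omega>. X \<omega> $ i)"
  proof -
    have "axis i (1::real) \<in> Basis" by (auto simp: Basis_vec_def)
    from wiener_integral_wi[OF assms this] show ?thesis by (simp add: inner_axis)
  qed
qed

lemma wiv_measurable:
  "wiv f X \<Longrightarrow> f \<in> borel_measurable borel" "wiv f X \<Longrightarrow> X \<in> borel_measurable M"
  unfolding wiv_def vec_measurable_iff
  using sq_int_measurable[OF wi_sq_int(1)] sq_int_measurable[OF wi_sq_int(2)] by force+

lemma wiv_mv:
  fixes L :: "real^'n^'m"
  assumes "wiv f X"
  shows "wiv (\<lambda>s. L *v f s) (\<lambda>\<omega>. L *v X \<omega>)"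
  unfolding wiv_def matrix_vector_mult_def vec_lambda_beta
  using assms by (intro allI wi_sum wi_scale) (auto simp: wiv_def)

lemma wiv_add: "wiv f X \<Longrightarrow> wiv g Y \<Longrightarrow> wiv (\<lambda>s. f s + g s) (\<lambda>\<omega>. X \<omega> + Y \<omega>)"
  by (auto simp: wiv_def intro: wi_add)

lemma wiv_zero: "wiv (\<lambda>_. 0) (\<lambda>_. 0)"
  by (simp add: wiv_def wi_zero)

lemma wiv_sum:
  "finite I \<Longrightarrow> (\<And>i. i \<in> I \<Longrightarrow> wiv (f i) (X i)) \<Longrightarrow> wiv (\<lambda>s. \<Sum>i\<in>I. f i s) (\<lambda>\<omega>. \<Sum>i\<in>I. X i \<omega>)"
  by (induction I rule: finite_induct) (auto intro: wiv_zero wiv_add)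

lemma wiv_unique:
  assumes "wiv f X" "wiv f Y" shows "AE \<omega> in M. X \<omega> = Y \<omega>"
proof -
  have "AE \<omega> in M. \<forall>i\<in>UNIV. X \<omega> $ i = Y \<omega> $ i"
  proof (rule AE_finite_allI)
    fix i
    show "AE \<omega> in M. X \<omega> $ i = Y \<omega> $ i"
      using assms by (intro wi_unique[of "\<lambda>s. f s $ i"]) (auto simp: wiv_def)
  qed simp
  then show ?thesis by (simp add: vec_eq_iff)
qed

lemma wiv_cong_AE:
  assumes "wiv f X" "AE s in lborel. f s = g s" "AE \<omega> in M. X \<omega> = Y \<omega>"
    "g \<in> borel_measurable borel" "Y \<in> borel_measurable M"
  shows "wiv g Y"
  unfolding wiv_def
proof
  fix i
  show "wi (\<lambda>s. g s $ i) (\<lambda>\<omega>. Y \<omega> $ i)"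
  proof (rule wi_cong_AE)
    show "wi (\<lambda>s. f s $ i) (\<lambda>\<omega>. X \<omega> $ i)" using assms by (auto simp: wiv_def)
    show "AE s in lborel. f s $ i = g s $ i" using assms(2) by eventually_elim simp
    show "AE \<omega> in M. X \<omega> $ i = Y \<omega> $ i" using assms(3) by eventually_elim simp
  qed (use assms in measurable)
qed

lemma wiv_time_integral:
  fixes x :: "real \<Rightarrow> 'w \<Rightarrow> real^'n" and k :: "real \<Rightarrow> real \<Rightarrow> real^'n"
  assumes T: "0 \<le> T"
    and xm: "(\<lambda>(s, \<omega>). indicator {0..T} s *\<^sub>R x s \<omega>) \<in> borel_measurable (lborel \<Otimes>\<^sub>M M)"
    and km: "(\<lambda>(s, u). indicator {0..T} s *\<^sub>R k s u) \<in> borel_measurable (lborel \<Otimes>\<^sub>M lborel)"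
    and wiv: "\<And>s. s \<in> {0..T} \<Longrightarrow> wiv (k s) (x s)"
    and kb: "\<And>s u. s \<in> {0..T} \<Longrightarrow> norm (k s u) \<le> C * indicator {0..T} u"
  shows "wiv (\<lambda>u. LINT s:{0..T}|lborel. k s u) (\<lambda>\<omega>. LINT s:{0..T}|lborel. x s \<omega>)"
    and "AE \<omega> in M. set_integrable lborel {0..T} (\<lambda>s. x s \<omega>)"
proof -
  have kbi: "\<bar>k s u $ i\<bar> \<le> C * indicator {0..T} u" if "s \<in> {0..T}" for s u i
    using kb[OF that, of u] component_le_norm_cart[of "k s u" i] by linarith
  have xmi: "(\<lambda>(s, \<omega>). indicator {0..T} s * x s \<omega> $ i) \<in> borel_measurable (lborel \<Otimes>\<^sub>M M)" for i
    using borel_measurable_nth[OF xm, of i] by (simp add: case_prod_beta)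
  have kmi: "(\<lambda>(s, u). indicator {0..T} s * k s u $ i) \<in> borel_measurable (lborel \<Otimes>\<^sub>M lborel)" for i
    using borel_measurable_nth[OF km, of i] by (simp add: case_prod_beta)
  have wii: "wi (\<lambda>u. k s u $ i) (\<lambda>\<omega>. x s \<omega> $ i)" if "s \<in> {0..T}" for s i
    using wiv[OF that] by (simp add: wiv_def)
  note TI = wi_time_integral[OF T xmi kmi wii kbi]
  have "AE \<omega> in M. \<forall>i\<in>UNIV. set_integrable lborel {0..T} (\<lambda>s. x s \<omega> $ i)"
    by (intro AE_finite_allI TI(2)) auto
  then have xint: "AE \<omega> in M. \<forall>i. set_integrable lborel {0..T} (\<lambda>s. x s \<omega> $ i)" by simp
  then show "AE \<omega> in M. set_integrable lborel {0..T} (\<lambda>s. x s \<omega>)"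
    by eventually_elim (auto intro: vec_set_integral)
  have kint: "set_integrable lborel {0..T} (\<lambda>s. k s u $ i)" for u i
    unfolding set_integrable_def
  proof (rule Bochner_Integration.integrable_bound)
    show "integrable lborel (\<lambda>s. C * indicator {0..T} s :: real)"
      using T by (intro integrable_mult_right integrable_real_indicator) auto
    show "(\<lambda>s. indicator {0..T} s *\<^sub>R k s u $ i) \<in> borel_measurable lborel"
      using measurable_compose[OF measurable_Pair2'[of u lborel lborel] kmi[of i]] by simp
    show "AE s in lborel. norm (indicator {0..T} s *\<^sub>R k s u $ i) \<le> norm (C * indicator {0..T} s :: real)"
    proof (rule AE_I2)
      fix s
      have "\<bar>k s u $ i\<bar> \<le> \<bar>C\<bar>" if "s \<in> {0..T}"
        using kbi[OF that, of u i] by (cases "u \<in> {0..T}") auto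
      then show "norm (indicator {0..T} s *\<^sub>R k s u $ i) \<le> norm (C * indicator {0..T} s :: real)"
        by (simp add: indicator_def)
    qed
  qed
  show "wiv (\<lambda>u. LINT s:{0..T}|lborel. k s u) (\<lambda>\<omega>. LINT s:{0..T}|lborel. x s \<omega>)"
    unfolding wiv_def
  proof
    fix i
    show "wi (\<lambda>u. (LINT s:{0..T}|lborel. k s u) $ i) (\<lambda>\<omega>. (LINT s:{0..T}|lborel. x s \<omega>) $ i)"
    proof (rule wi_cong_AE[OF TI(1)[of i]])
      show "AE u in lborel. (LINT s:{0..T}|lborel. k s u $ i) = (LINT s:{0..T}|lborel. k s u) $ i"
        by (simp add: vec_set_integral(2) kint)
      show "AE \<omega> in M. (LINT s:{0..T}|lborel. x s \<omega> $ i) = (LINT s:{0..T}|lborel. x s \<omega>) $ i"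
        using xint by eventually_elim (simp add: vec_set_integral(2))
      have "(\<lambda>u. LINT s:{0..T}|lborel. k s u) \<in> borel_measurable borel"
        unfolding set_lebesgue_integral_def
        by (intro lborel.borel_measurable_lebesgue_integral) (use measurable_pair_swap[OF km] in \<open>simp add: case_prod_beta\<close>)
      then show "(\<lambda>u. (LINT s:{0..T}|lborel. k s u) $ i) \<in> borel_measurable borel" by measurable
      have "(\<lambda>\<omega>. LINT s:{0..T}|lborel. x s \<omega>) \<in> borel_measurable M"
        unfolding set_lebesgue_integral_def
        by (intro lborel.borel_measurable_lebesgue_integral) (use measurable_pair_swap[OF xm] in \<open>simp add: case_prod_beta\<close>)
      then show "(\<lambda>\<omega>. (LINT s:{0..T}|lborel. x s \<omega>) $ i) \<in> borel_measurable M" by measurable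
    qed
  qed
qed

lemma wiv_moments:
  fixes X :: "'w \<Rightarrow> real^'n"
  assumes "wiv f X"
  shows "integrable M X" "mean M X = 0"
    "integrable M (\<lambda>\<omega>. outer (X \<omega>) (X \<omega>))"
    "(\<integral>\<omega>. outer (X \<omega>) (X \<omega>) \<partial>M) $ i $ j = (\<integral>s. f s $ i * f s $ j \<partial>lborel)"
proof -
  have wi: "wi (\<lambda>s. f s $ i) (\<lambda>\<omega>. X \<omega> $ i)" for i using assms by (simp add: wiv_def)
  note sq = wi_sq_int(2)[OF wi]
  have bounded_linear_axis: "bounded_linear (axis i :: 'b::euclidean_space \<Rightarrow> 'b^'k)" for i
    unfolding linear_conv_bounded_linear[symmetric]
    by (rule linearI) (auto simp: axis_def vec_eq_iff)
  have nth_int: "integrable M Z" if "\<And>i. integrable M (\<lambda>\<omega>. Z \<omega> $ i)" for Z :: "'w \<Rightarrow> ('b::euclidean_space)^'k"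
  proof -
    have "integrable M (\<lambda>\<omega>. \<Sum>i\<in>UNIV. axis i (Z \<omega> $ i))"
      by (intro Bochner_Integration.integrable_sum integrable_bounded_linear[OF bounded_linear_axis that])
    also have "(\<lambda>\<omega>. \<Sum>i\<in>UNIV. axis i (Z \<omega> $ i)) = Z"
      by (simp add: fun_eq_iff vec_eq_iff sum_component axis_def if_distrib cong: if_cong)
    finally show ?thesis .
  qed
  show I: "integrable M X" by (intro nth_int sq_int_integrable sq)
  show "mean M X = 0"
    unfolding mean_def vec_eq_iff
    using integral_bounded_linear[OF bounded_linear_vec_nth I] wi_mean[OF wi] by simp
  have O: "integrable M (\<lambda>\<omega>. outer (X \<omega>) (X \<omega>))"
    by (intro nth_int) (simp add: outer_def sq_int_mult sq)
  then show "integrable M (\<lambda>\<omega>. outer (X \<omega>) (X \<omega>))" .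
  have bl: "bounded_linear (\<lambda>Z::real^'n^'n. Z $ i $ j)"
    by (intro bounded_linear_compose[OF bounded_linear_vec_nth bounded_linear_vec_nth])
  have "(\<integral>\<omega>. outer (X \<omega>) (X \<omega>) \<partial>M) $ i $ j = (\<integral>\<omega>. outer (X \<omega>) (X \<omega>) $ i $ j \<partial>M)"
    using integral_bounded_linear[OF bl O] by simp
  also have "\<dots> = (\<integral>s. f s $ i * f s $ j \<partial>lborel)"
    using wi_isometry[OF wi[of i] wi[of j]] by (simp add: outer_def)
  finally show "(\<integral>\<omega>. outer (X \<omega>) (X \<omega>) \<partial>M) $ i $ j = (\<integral>s. f s $ i * f s $ j \<partial>lborel)" .
qed

end

section \<open>Progressively measurable processes\<close>

abbreviation clip :: "real \<Rightarrow> real \<Rightarrow> real" where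
  "clip t s \<equiv> max 0 (min t s)"

abbreviation prog_space :: "(real \<Rightarrow> 'w measure) \<Rightarrow> real \<Rightarrow> (real \<times> 'w) measure" where
  "prog_space F t \<equiv> restrict_space borel {0..t} \<Otimes>\<^sub>M F t"

lemma progressively_measurableD:
  "progressively_measurable F T X \<Longrightarrow> t \<in> {0..T} \<Longrightarrow>
    (\<lambda>p. X (fst p) (snd p)) \<in> borel_measurable (prog_space F t)"
  by (simp add: progressively_measurable_def case_prod_unfold)

lemma progressively_measurableI:
  "(\<And>t. t \<in> {0..T} \<Longrightarrow> (\<lambda>p. X (fst p) (snd p)) \<in> borel_measurable (prog_space F t)) \<Longrightarrow>
    progressively_measurable F T X"
  by (simp add: progressively_measurable_def case_prod_unfold)

lemma prog_fst_measurable: "fst \<in> borel_measurable (prog_space F t)"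
  using measurable_fst[of "restrict_space borel {0..t}" "F t"]
  by (simp add: measurable_restrict_space2_iff)

lemma prog_space_fst: "p \<in> space (prog_space F t) \<Longrightarrow> fst p \<in> {0..t}"
  by (auto simp: space_pair_measure space_restrict_space)

lemma progressive_section:
  assumes "progressively_measurable F T X" "t \<in> {0..T}"
  shows "X t \<in> borel_measurable (F t)"
proof -
  have "Pair t \<in> F t \<rightarrow>\<^sub>M prog_space F t"
    using assms(2) by (intro measurable_Pair1') (auto simp: space_restrict_space)
  from measurable_compose[OF this progressively_measurableD[OF assms]] show ?thesis by simp
qed

lemma progressive_deterministic:
  fixes f :: "real \<Rightarrow> 'b::euclidean_space"
  assumes "set_borel_measurable borel {0..T} f"
  shows "progressively_measurable F T (\<lambda>s _. f s)"
proof (rule progressively_measurableI)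
  fix t assume t: "t \<in> {0..T}"
  have "(\<lambda>p. indicator {0..T} (fst p) *\<^sub>R f (fst p)) \<in> borel_measurable (prog_space F t)"
    by (rule measurable_compose[OF prog_fst_measurable assms[unfolded set_borel_measurable_def]])
  also have "?this \<longleftrightarrow> (\<lambda>p. f (fst p)) \<in> borel_measurable (prog_space F t)"
    by (intro measurable_cong) (use t in \<open>auto dest!: prog_space_fst\<close>)
  finally show "(\<lambda>p. f (fst p)) \<in> borel_measurable (prog_space F t)" .
qed

lemma progressive_add:
  assumes "progressively_measurable F T X" "progressively_measurable F T Y"
  shows "progressively_measurable F T (\<lambda>s \<omega>. X s \<omega> + Y s \<omega>)"
  using assms by (intro progressively_measurableI borel_measurable_add) (auto intro: progressively_measurableD)

lemma progressive_mv:
  fixes X :: "real \<Rightarrow> 'w \<Rightarrow> real^'n" and A :: "real^'n^'m"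
  assumes "progressively_measurable F T X"
  shows "progressively_measurable F T (\<lambda>s \<omega>. A *v X s \<omega>)"
  using assms by (intro progressively_measurableI borel_measurable_matrix_vector) (auto intro: progressively_measurableD)

lemma sub_ident_measurable: "subalgebra M N \<Longrightarrow> (\<lambda>x. x) \<in> M \<rightarrow>\<^sub>M N"
  by (auto simp: measurable_def subalgebra_def sets.sets_into_space Int_absorb2)

lemma has_wiener_integral_cong:
  assumes "has_wiener_integral M W f a b X" "AE \<omega> in M. X \<omega> = Y \<omega>" "Y \<in> borel_measurable M"
  shows "has_wiener_integral M W f a b Y"
proof -
  have "(\<integral>\<^sup>+\<omega>. ennreal ((norm (Y \<omega> - Z \<omega>))\<^sup>2) \<partial>M) = (\<integral>\<^sup>+\<omega>. ennreal ((norm (X \<omega> - Z \<omega>))\<^sup>2) \<partial>M)" for Z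
    using assms(2) by (intro nn_integral_cong_AE) (auto elim!: eventually_mono)
  then show ?thesis using assms(1,3) by (simp add: has_wiener_integral_def)
qed

lemma C1_on_continuous: "C1_on S H \<Longrightarrow> continuous_on S H"
  by (auto simp: C1_on_def continuous_on_eq_continuous_within intro: has_vector_derivative_continuous)

text \<open>
  A kernel that is \<open>C\<^sup>1\<close> on a compact interval is bounded and Lipschitz there.
\<close>

lemma C1_on_Lipschitz:
  fixes H :: "real \<Rightarrow> 'b::euclidean_space"
  assumes "C1_on {0..h} H"
  obtains K L where "0 \<le> K" "0 \<le> L" "\<And>x. x \<in> {0..h} \<Longrightarrow> norm (H x) \<le> K"
    "\<And>x y. x \<in> {0..h} \<Longrightarrow> y \<in> {0..h} \<Longrightarrow> norm (H x - H y) \<le> L * \<bar>x - y\<bar>"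
proof -
  obtain H' where H': "continuous_on {0..h} H'"
      "\<And>x. x \<in> {0..h} \<Longrightarrow> (H has_vector_derivative H' x) (at x within {0..h})"
    using assms by (auto simp: C1_on_def)
  have "continuous_on {0..h} H" by (rule C1_on_continuous[OF assms])
  then obtain K where K: "0 \<le> K" "\<And>x. x \<in> {0..h} \<Longrightarrow> norm (H x) \<le> K"
    using continuous_compact_bound[OF compact_Icc] by metis
  obtain L where L: "0 \<le> L" "\<And>x. x \<in> {0..h} \<Longrightarrow> norm (H' x) \<le> L"
    using continuous_compact_bound[OF compact_Icc H'(1)] by metis
  have "norm (H x - H y) \<le> L * norm (x - y)" if "x \<in> {0..h}" "y \<in> {0..h}" for x y
  proof (rule differentiable_bound[OF _ _ _ that])
    show "(H has_derivative (\<lambda>u. u *\<^sub>R H' x)) (at x within {0..h})" if "x \<in> {0..h}" for x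
      using H'(2)[OF that] by (simp add: has_vector_derivative_def)
    show "onorm (\<lambda>u. u *\<^sub>R H' x) \<le> L" if "x \<in> {0..h}" for x
      using L(2)[OF that] by (intro onorm_le) (simp add: mult.commute[of L] mult_left_mono)
  qed simp
  with K L(1) show thesis by (intro that[of K L]) auto
qed

context wiener
begin

lemma progressive_joint:
  fixes X :: "real \<Rightarrow> 'w \<Rightarrow> 'b::euclidean_space"
  assumes X: "progressively_measurable F T X" and T: "0 \<le> T"
  shows "(\<lambda>(s, \<omega>). indicator {0..T} s *\<^sub>R X s \<omega>) \<in> borel_measurable (lborel \<Otimes>\<^sub>M M)"
proof -
  have c: "(\<lambda>p. clip T (fst p)) \<in> lborel \<Otimes>\<^sub>M M \<rightarrow>\<^sub>M restrict_space borel {0..T}"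
    using T by (intro measurable_restrict_space2) auto
  have s: "snd \<in> lborel \<Otimes>\<^sub>M M \<rightarrow>\<^sub>M F T"
    using measurable_compose[OF measurable_snd sub_ident_measurable[OF F_sub[OF T]]] .
  have "(\<lambda>p. X (clip T (fst p)) (snd p)) \<in> borel_measurable (lborel \<Otimes>\<^sub>M M)"
    using measurable_compose[OF measurable_Pair[OF c s] progressively_measurableD[OF X, of T]] T by simp
  then have "(\<lambda>p. indicator {0..T} (fst p) *\<^sub>R X (clip T (fst p)) (snd p)) \<in> borel_measurable (lborel \<Otimes>\<^sub>M M)"
    by (intro borel_measurable_scaleR) auto
  also have "(\<lambda>p. indicator {0..T} (fst p) *\<^sub>R X (clip T (fst p)) (snd p)) =
      (\<lambda>(s, \<omega>). indicator {0..T} s *\<^sub>R X s \<omega>)"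
    by (auto simp: fun_eq_iff indicator_def)
  finally show ?thesis .
qed

text \<open>
  The process is sampled at the dyadic time before \<open>t\<close>. These approximations are progressively measurable,
  and at each \<open>t\<close> their squared errors are summable in mean, so that they converge almost surely to \<open>X t\<close>.
  The pointwise limit is the version sought.
\<close>

lemma progressive_version:
  fixes X :: "real \<Rightarrow> 'w \<Rightarrow> 'b::euclidean_space"
  assumes C0: "0 \<le> C"
    and X: "\<And>t. t \<in> {0..T} \<Longrightarrow> X t \<in> borel_measurable (F t)"
    and C: "\<And>s t. 0 \<le> s \<Longrightarrow> s \<le> t \<Longrightarrow> t \<le> T \<Longrightarrow>
      (\<integral>\<^sup>+\<omega>. ennreal ((norm (X t \<omega> - X s \<omega>))\<^sup>2) \<partial>M) \<le> ennreal (C * (t - s))"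
  obtains X' where "progressively_measurable F T X'"
    "\<And>t. t \<in> {0..T} \<Longrightarrow> AE \<omega> in M. X' t \<omega> = X t \<omega>"
proof -
  define D where "D n s = real_of_int \<lfloor>s * 2 ^ n\<rfloor> / 2 ^ n" for n :: nat and s :: real
  have D: "D n s \<le> s" "s - D n s \<le> 1 / 2 ^ n" for n s
  proof -
    have "s - D n s = (s * 2 ^ n - real_of_int \<lfloor>s * 2 ^ n\<rfloor>) / 2 ^ n"
      by (simp add: D_def diff_divide_distrib)
    moreover have "0 \<le> (s * 2 ^ n - real_of_int \<lfloor>s * 2 ^ n\<rfloor>) / 2 ^ n" by simp
    moreover have "(s * 2 ^ n - real_of_int \<lfloor>s * 2 ^ n\<rfloor>) / 2 ^ n \<le> 1 / 2 ^ n"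
      by (intro divide_right_mono) (linarith, simp)
    ultimately show "D n s \<le> s" "s - D n s \<le> 1 / 2 ^ n" by linarith+
  qed
  have D0: "0 \<le> D n s" if "0 \<le> s" for n s using that by (simp add: D_def)
  (* D n s is the last multiple of 1 / 2 ^ n before s. *)
  define X' where "X' s \<omega> = lim (\<lambda>n. X (D n s) \<omega>)" for s \<omega>
  have "progressively_measurable F T X'"
  proof (rule progressively_measurableI)
    fix t assume t: "t \<in> {0..T}"
    (* Clipping at t changes nothing on [0, t] and keeps the sampling times before t. *)
    have Xm: "(\<lambda>p. X (clip t (real_of_int \<lfloor>fst p * 2 ^ n\<rfloor> / 2 ^ n)) (snd p)) \<in> borel_measurable (prog_space F t)" for n
    proof (rule measurable_compose_countable[where f = "\<lambda>i p. X (clip t (real_of_int i / 2 ^ n)) (snd p)"])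
      fix i :: int
      let ?s = "clip t (real_of_int i / 2 ^ n)"
      have "?s \<in> {0..T}" "?s \<le> t" "0 \<le> ?s" using t by auto
      then have "X ?s \<in> borel_measurable (F t)" using F_measurable_mono X by blast
      then show "(\<lambda>p. X ?s (snd p)) \<in> borel_measurable (prog_space F t)"
        by (rule measurable_compose[OF measurable_snd])
      have [measurable]: "fst \<in> borel_measurable (prog_space F t)" by (rule prog_fst_measurable)
      show "(\<lambda>p. \<lfloor>fst p * 2 ^ n\<rfloor>) \<in> prog_space F t \<rightarrow>\<^sub>M count_space UNIV" by measurable
    qed
    have "(\<lambda>p. X (D n (fst p)) (snd p)) \<in> borel_measurable (prog_space F t)" for n
    proof (subst measurable_cong[where g = "\<lambda>p. X (clip t (real_of_int \<lfloor>fst p * 2 ^ n\<rfloor> / 2 ^ n)) (snd p)"])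
      fix p assume p: "p \<in> space (prog_space F t)"
      from p have "fst p \<in> {0..t}" by (rule prog_space_fst)
      with D(1)[of n "fst p"] D0[of "fst p" n]
      have "clip t (D n (fst p)) = D n (fst p)" by auto
      then show "X (D n (fst p)) (snd p) = X (clip t (real_of_int \<lfloor>fst p * 2 ^ n\<rfloor> / 2 ^ n)) (snd p)"
        by (simp add: D_def)
    qed (rule Xm)
    then show "(\<lambda>p. X' (fst p) (snd p)) \<in> borel_measurable (prog_space F t)"
      unfolding X'_def by (intro borel_measurable_lim_metric)
  qed
  moreover have "AE \<omega> in M. X' t \<omega> = X t \<omega>" if t: "t \<in> {0..T}" for t
  proof -
    have XM: "X s \<in> borel_measurable M" if "s \<in> {0..T}" for s
      using F_measurable_M X that by auto
    have Dt: "D n t \<in> {0..T}" for n using D(1)[of n t] D0[of t n] t by auto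
    note [measurable] = XM[OF Dt] XM[OF t]
    let ?e = "\<lambda>n \<omega>. (norm (X t \<omega> - X (D n t) \<omega>))\<^sup>2"
    have "(\<integral>\<^sup>+\<omega>. (\<Sum>n. ennreal (?e n \<omega>)) \<partial>M) = (\<Sum>n. \<integral>\<^sup>+\<omega>. ennreal (?e n \<omega>) \<partial>M)"
      by (rule nn_integral_suminf) measurable
    also have "\<dots> \<le> (\<Sum>n. ennreal (C * (1 / 2) ^ n))"
    proof (rule suminf_le)
      fix n
      have "(\<integral>\<^sup>+\<omega>. ennreal (?e n \<omega>) \<partial>M) \<le> ennreal (C * (t - D n t))"
        using t D(1)[of n t] D0[of t n] by (intro C) auto
      also have "\<dots> \<le> ennreal (C * (1 / 2) ^ n)"
        using D(2)[of t n] C0 by (intro ennreal_leI mult_left_mono) (auto simp: power_one_over)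
      finally show "(\<integral>\<^sup>+\<omega>. ennreal (?e n \<omega>) \<partial>M) \<le> ennreal (C * (1 / 2) ^ n)" .
    qed auto
    also have "\<dots> < \<infinity>"
    proof -
      have "summable (\<lambda>n. C * (1 / 2) ^ n)" by (intro summable_mult summable_geometric) auto
      then have "(\<Sum>n. ennreal (C * (1 / 2) ^ n)) = ennreal (\<Sum>n. C * (1 / 2) ^ n)"
        using C0 by (intro suminf_ennreal2) auto
      then show ?thesis by simp
    qed
    finally have "AE \<omega> in M. (\<Sum>n. ennreal (?e n \<omega>)) \<noteq> \<infinity>"
      by (intro nn_integral_PInf_AE) (auto simp: less_top)
    then show ?thesis
    proof eventually_elim
      case (elim \<omega>)
      then have "summable (\<lambda>n. ?e n \<omega>)" by (intro summable_suminf_not_top) auto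
      then have "(\<lambda>n. sqrt (?e n \<omega>)) \<longlonglongrightarrow> sqrt 0" by (intro tendsto_real_sqrt summable_LIMSEQ_zero)
      then have "(\<lambda>n. norm (X (D n t) \<omega> - X t \<omega>)) \<longlonglongrightarrow> 0" by (simp add: norm_minus_commute)
      then have "(\<lambda>n. X (D n t) \<omega>) \<longlonglongrightarrow> X t \<omega>" using LIM_zero_iff tendsto_norm_zero_iff by blast
      then show ?case by (simp add: X'_def limI)
    qed
  qed
  ultimately show thesis by (rule that)
qed

lemma wiv_isometry_nn:
  fixes X :: "'w \<Rightarrow> real^'n"
  assumes "wiv f X"
  shows "(\<integral>\<^sup>+\<omega>. ennreal ((norm (X \<omega>))\<^sup>2) \<partial>M) = (\<integral>\<^sup>+s. ennreal ((norm (f s))\<^sup>2) \<partial>lborel)"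
proof -
  have wi: "wi (\<lambda>s. f s $ i) (\<lambda>\<omega>. X \<omega> $ i)" for i using assms by (simp add: wiv_def)
  note sq = wi_sq_int[OF wi]
  note [measurable] = wiv_measurable[OF assms]
  have "(\<integral>\<^sup>+\<omega>. ennreal ((X \<omega> $ i)\<^sup>2) \<partial>M) = (\<integral>\<^sup>+s. ennreal ((f s $ i)\<^sup>2) \<partial>lborel)" for i
    using sq[of i] wi_isometry_sq[OF wi[of i]] by (simp add: nn_integral_eq_integral sq_int_def)
  then show ?thesis unfolding ennreal_norm_sq_nth by (simp add: nn_integral_sum del: sum_ennreal)
qed

lemma wiv_diff:
  assumes "wiv f X" "wiv g Y" shows "wiv (\<lambda>s. f s - g s) (\<lambda>\<omega>. X \<omega> - Y \<omega>)"
  using assms by (auto simp: wiv_def intro: wi_diff)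

text \<open>
  Passing from \<open>s\<close> to \<open>t\<close> changes the kernel by \<open>O(t - s)\<close> on the common part of the two windows, where \<open>H\<close>
  is Lipschitz, and by a bounded amount on two intervals of length at most \<open>t - s\<close>. The mean-square
  increments are therefore \<open>O(t - s)\<close>, as \<open>progressive_version\<close> requires.
\<close>

theorem memory_process:
  fixes H :: "real \<Rightarrow> real^'n^'n" and \<sigma> :: "real \<Rightarrow> real^'n"
  assumes T: "0 \<le> T" and h: "0 < h" and H: "C1_on {0..h} H" and \<sigma>: "essentially_bounded T \<sigma>"
  obtains r where "r \<in> L2_progressive M F T"
    "\<And>t. t \<in> {0..T} \<Longrightarrow> has_wiener_integral M W (\<lambda>s. H (t - s) *v \<sigma> s) (max 0 (t - h)) t (r t)"
proof -
  obtain C0 where C0: "AE s in lborel. s \<in> {0..T} \<longrightarrow> norm (\<sigma> s) \<le> C0"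
    and \<sigma>m: "set_borel_measurable borel {0..T} \<sigma>" using \<sigma> by (auto simp: essentially_bounded_def)
  define C where "C = max C0 0"
  have C: "0 \<le> C" "AE s in lborel. s \<in> {0..T} \<longrightarrow> norm (\<sigma> s) \<le> C"
    using C0 by (auto simp: C_def elim!: eventually_mono)
  obtain K L where KL: "0 \<le> K" "0 \<le> L" "\<And>x. x \<in> {0..h} \<Longrightarrow> norm (H x) \<le> K"
    "\<And>x y. x \<in> {0..h} \<Longrightarrow> y \<in> {0..h} \<Longrightarrow> norm (H x - H y) \<le> L * \<bar>x - y\<bar>"
    using C1_on_Lipschitz[OF H] by metis
  obtain c where c: "0 < c" "\<And>(X::real^'n^'n) v. norm (X *v v) \<le> norm X * norm v * c"
    using mv_norm_bound by blast
  have mvb: "norm (X *v v) \<le> a * C * c" if "norm X \<le> a" "norm v \<le> C" "0 \<le> a" for X :: "real^'n^'n" and v a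
  proof -
    have "norm (X *v v) \<le> norm X * norm v * c" by (rule c)
    also have "\<dots> \<le> a * C * c" using that c(1) C(1) by (intro mult_right_mono mult_mono) auto
    finally show ?thesis .
  qed
  define w where "w t = {max 0 (t - h)..t}" for t
  have wD: "u \<in> {0..T}" "t - u \<in> {0..h}" if "u \<in> w t" "t \<in> {0..T}" for u t
    using that by (auto simp: w_def)
  define k where "k t u = indicator (w t) u *\<^sub>R (H (t - u) *v \<sigma> u)" for t u
  have km: "k t \<in> borel_measurable borel" if t: "t \<in> {0..T}" for t
  proof -
    have "continuous_on (w t) (\<lambda>u. H (t - u))"
      using wD(2) t by (intro continuous_on_compose2[OF C1_on_continuous[OF H]] continuous_intros) auto
    then have "(\<lambda>u. indicator (w t) u *\<^sub>R H (t - u)) \<in> borel_measurable borel"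
      by (intro borel_measurable_continuous_on_indicator) (auto simp: w_def)
    then have "(\<lambda>u. (indicator (w t) u *\<^sub>R H (t - u)) *v (indicator {0..T} u *\<^sub>R \<sigma> u)) \<in> borel_measurable borel"
      using \<sigma>m by (intro borel_measurable_matrix_vector) (simp_all add: set_borel_measurable_def)
    also have "(\<lambda>u. (indicator (w t) u *\<^sub>R H (t - u)) *v (indicator {0..T} u *\<^sub>R \<sigma> u)) = k t"
      using wD(1)[OF _ t] by (auto simp: k_def fun_eq_iff indicator_def)
    finally show ?thesis .
  qed
  have kb: "AE u in lborel. \<forall>t\<in>{0..T}. norm (k t u) \<le> K * C * c"
    using C(2)
  proof eventually_elim
    case (elim u)
    have nn: "0 \<le> K * C * c" using KL C c by simp
    show ?case
    proof
      fix t assume t: "t \<in> {0..T}"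
      show "norm (k t u) \<le> K * C * c"
      proof (cases "u \<in> w t")
        case True
        then show ?thesis using mvb[OF KL(3)[OF wD(2)[OF True t]] _ KL(1)] elim wD(1)[OF True t]
          by (simp add: k_def)
      qed (simp add: k_def nn)
    qed
  qed
  have "\<exists>X. X \<in> borel_measurable (F t) \<and>
      has_wiener_integral M W (\<lambda>s. H (t - s) *v \<sigma> s) (max 0 (t - h)) t X" if t: "t \<in> {0..T}" for t
  proof (rule wiener_integral_exists)
    show "0 \<le> max 0 (t - h)" "max 0 (t - h) \<le> t" using t h by auto
    show "set_borel_measurable borel {max 0 (t - h)..t} (\<lambda>s. H (t - s) *v \<sigma> s)"
      using km[OF t] by (simp add: set_borel_measurable_def k_def[abs_def] w_def)
    show "AE s in lborel. s \<in> {max 0 (t - h)..t} \<longrightarrow> norm (H (t - s) *v \<sigma> s) \<le> K * C * c"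
      using kb
    proof eventually_elim
      case (elim s)
      from bspec[OF elim t] show ?case by (auto simp: k_def w_def)
    qed
  qed blast
  then obtain X where X: "\<And>t. t \<in> {0..T} \<Longrightarrow> X t \<in> borel_measurable (F t)"
    "\<And>t. t \<in> {0..T} \<Longrightarrow> has_wiener_integral M W (\<lambda>s. H (t - s) *v \<sigma> s) (max 0 (t - h)) t (X t)"
    by metis
  have wivX: "wiv (k t) (X t)" if "t \<in> {0..T}" for t
    using wiener_integral_wiv[OF X(2)[OF that]] by (simp add: k_def[abs_def] w_def)
  define B where "B = (C * c)\<^sup>2 * (L\<^sup>2 * T\<^sup>2 + 2 * K\<^sup>2)"
  have lip: "(\<integral>\<^sup>+\<omega>. ennreal ((norm (X t \<omega> - X s \<omega>))\<^sup>2) \<partial>M) \<le> ennreal (B * (t - s))"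
    if st: "0 \<le> s" "s \<le> t" "t \<le> T" for s t
  proof -
    let ?a = "(C * c)\<^sup>2 * (L\<^sup>2 * (t - s)\<^sup>2)" and ?b = "(C * c)\<^sup>2 * K\<^sup>2"
    have t: "s \<in> {0..T}" "t \<in> {0..T}" using st by auto
    have "(\<integral>\<^sup>+\<omega>. ennreal ((norm (X t \<omega> - X s \<omega>))\<^sup>2) \<partial>M) = (\<integral>\<^sup>+u. ennreal ((norm (k t u - k s u))\<^sup>2) \<partial>lborel)"
      by (rule wiv_isometry_nn[OF wiv_diff[OF wivX wivX]]) (use t in auto)
    also have "\<dots> \<le> (\<integral>\<^sup>+u. ennreal ?a * indicator {0..T} u + (ennreal ?b * indicator {s..t} u +
        ennreal ?b * indicator {s - h..t - h} u) \<partial>lborel)"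
    proof (rule nn_integral_mono_AE)
      show "AE u in lborel. ennreal ((norm (k t u - k s u))\<^sup>2) \<le> ennreal ?a * indicator {0..T} u +
        (ennreal ?b * indicator {s..t} u + ennreal ?b * indicator {s - h..t - h} u)"
        using C(2) kb
      proof eventually_elim
        case (elim u)
        have b: "ennreal ((norm (k t' u))\<^sup>2) \<le> ennreal ?b" if "t' \<in> {0..T}" for t'
        proof -
          have "(norm (k t' u))\<^sup>2 \<le> (K * C * c)\<^sup>2" using elim(2) that by (intro power_mono) auto
          then show ?thesis by (intro ennreal_leI) (simp add: power_mult_distrib mult_ac)
        qed
        (* The integrand is compared on the common window, on its two exclusive parts, and outside. *)
        consider "u \<in> w t" "u \<in> w s" | "u \<in> w t" "u \<notin> w s" | "u \<notin> w t" "u \<in> w s" | "u \<notin> w t" "u \<notin> w s"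
          by blast
        then show ?case
        proof cases
          case 1
          note u = wD[OF 1(1) t(2)] wD[OF 1(2) t(1)]
          have "norm (H (t - u) - H (s - u)) \<le> L * (t - s)"
            using KL(4)[OF u(2) u(4)] st by simp
          then have "norm ((H (t - u) - H (s - u)) *v \<sigma> u) \<le> L * (t - s) * C * c"
            using elim(1) u(1) KL(2) st by (intro mvb) auto
          then have "norm (k t u - k s u) \<le> L * (t - s) * C * c"
            using 1 by (simp add: k_def mv.diff_left)
          then have "(norm (k t u - k s u))\<^sup>2 \<le> (L * (t - s) * C * c)\<^sup>2" by (intro power_mono) auto
          then have "ennreal ((norm (k t u - k s u))\<^sup>2) \<le> ennreal ?a"
            by (intro ennreal_leI) (simp add: power_mult_distrib mult_ac)
          then show ?thesis using u(1) by (simp add: add_increasing2)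
        next
          case 2
          then have "k t u - k s u = k t u" "u \<in> {s..t}" using st by (auto simp: k_def w_def)
          then show ?thesis using b[OF t(2)] by (simp add: add_increasing add_increasing2)
        next
          case 3
          then have "norm (k t u - k s u) = norm (k s u)" "u \<in> {s - h..t - h}"
            using st by (auto simp: k_def w_def)
          then show ?thesis using b[OF t(1)] by (simp add: add_increasing add_increasing2)
        next
          case 4
          then show ?thesis by (simp add: k_def)
        qed
      qed
    qed
    also have "\<dots> = ennreal ?a * ennreal T + (ennreal ?b * ennreal (t - s) + ennreal ?b * ennreal (t - s))"
      using T st by (simp add: nn_integral_add nn_integral_cmult_indicator)
    also have "\<dots> = ennreal (?a * T + (?b * (t - s) + ?b * (t - s)))"
      using T st by (simp add: ennreal_mult[symmetric] ennreal_plus[symmetric] del: ennreal_plus)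
    also have "\<dots> \<le> ennreal (B * (t - s))"
    proof (rule ennreal_leI)
      have "(t - s)\<^sup>2 * T \<le> T\<^sup>2 * (t - s)"
      proof -
        have "(t - s) * (t - s) * T \<le> T * (t - s) * T" using st T by (intro mult_right_mono) auto
        then show ?thesis by (simp add: power2_eq_square mult_ac)
      qed
      then have "(C * c)\<^sup>2 * L\<^sup>2 * ((t - s)\<^sup>2 * T) \<le> (C * c)\<^sup>2 * L\<^sup>2 * (T\<^sup>2 * (t - s))"
        by (intro mult_left_mono) auto
      then show "?a * T + (?b * (t - s) + ?b * (t - s)) \<le> B * (t - s)"
        by (simp add: B_def algebra_simps)
    qed
    finally show ?thesis .
  qed
  have "0 \<le> B" by (simp add: B_def)
  obtain r where r: "progressively_measurable F T r" "\<And>t. t \<in> {0..T} \<Longrightarrow> AE \<omega> in M. r t \<omega> = X t \<omega>"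
    using progressive_version[where T = T and X = X, OF \<open>0 \<le> B\<close> X(1) lip] by blast
  have hr: "has_wiener_integral M W (\<lambda>s. H (t - s) *v \<sigma> s) (max 0 (t - h)) t (r t)" if t: "t \<in> {0..T}" for t
  proof (rule has_wiener_integral_cong[OF X(2)[OF t]])
    show "AE \<omega> in M. X t \<omega> = r t \<omega>" using r(2)[OF t] by eventually_elim simp
    show "r t \<in> borel_measurable M" using progressive_section[OF r(1) t] F_measurable_M t by auto
  qed
  have "(\<integral>\<^sup>+s\<in>{0..T}. (\<integral>\<^sup>+\<omega>. ennreal ((norm (r s \<omega>))\<^sup>2) \<partial>M) \<partial>lborel) \<le>
      (\<integral>\<^sup>+s. ennreal ((K * C * c)\<^sup>2 * T) * indicator {0..T} s \<partial>lborel)"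
  proof (intro nn_integral_mono)
    fix s
    show "(\<integral>\<^sup>+\<omega>. ennreal ((norm (r s \<omega>))\<^sup>2) \<partial>M) * indicator {0..T} s \<le> ennreal ((K * C * c)\<^sup>2 * T) * indicator {0..T} s"
    proof (cases "s \<in> {0..T}")
      case True
      have "wiv (k s) (r s)"
        using wiener_integral_wiv[OF hr[OF True]] by (simp add: k_def[abs_def] w_def)
      from wiv_isometry_nn[OF this]
      have "(\<integral>\<^sup>+\<omega>. ennreal ((norm (r s \<omega>))\<^sup>2) \<partial>M) = (\<integral>\<^sup>+u. ennreal ((norm (k s u))\<^sup>2) \<partial>lborel)" .
      also have "\<dots> \<le> (\<integral>\<^sup>+u. ennreal ((K * C * c)\<^sup>2) * indicator {0..T} u \<partial>lborel)"
      proof (rule nn_integral_mono_AE)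
        show "AE u in lborel. ennreal ((norm (k s u))\<^sup>2) \<le> ennreal ((K * C * c)\<^sup>2) * indicator {0..T} u"
          using kb
        proof eventually_elim
          case (elim u)
          show ?case
          proof (cases "u \<in> w s")
            case u: True
            have "(norm (k s u))\<^sup>2 \<le> (K * C * c)\<^sup>2" using elim True by (intro power_mono) auto
            then show ?thesis using wD(1)[OF u True] by (simp add: ennreal_leI)
          qed (simp add: k_def)
        qed
      qed
      also have "\<dots> = ennreal ((K * C * c)\<^sup>2 * T)"
        using T by (simp add: nn_integral_cmult_indicator ennreal_mult)
      finally show ?thesis using True by simp
    qed simp
  qed
  also have "\<dots> = ennreal ((K * C * c)\<^sup>2 * T) * ennreal T"
    using T by (simp add: nn_integral_cmult_indicator)
  also have "\<dots> < \<infinity>" by (simp add: ennreal_mult_less_top)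
  finally have "r \<in> L2_progressive M F T" using r(1) by (simp add: L2_progressive_def)
  with hr show thesis using that by blast
qed

end

section \<open>The controlled equation\<close>

lemma flow_norm_bound:
  fixes A :: "real^'n^'n"
  obtains c where "0 \<le> c" "\<And>z q t. t \<in> {0..T} \<Longrightarrow> set_borel_measurable borel {0..T} q \<Longrightarrow>
    ennreal (norm (flow A z q t)) \<le> ennreal c * (ennreal (norm z) + (\<integral>\<^sup>+s\<in>{0..T}. ennreal (norm (q s)) \<partial>lborel))"
proof -
  obtain C where C: "0 \<le> C" "\<And>t. t \<in> {0..T} \<Longrightarrow> norm (semigroup_exp A t) \<le> C"
    using continuous_compact_bound[OF compact_Icc continuous_semigroup_exp] by metis
  obtain \<kappa> where \<kappa>: "0 < \<kappa>" "\<And>(X::real^'n^'n) v. norm (X *v v) \<le> norm X * norm v * \<kappa>"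
    using mv_norm_bound by blast
  have E: "norm (semigroup_exp A t *v v) \<le> C * \<kappa> * norm v" if "t \<in> {0..T}" for t v
  proof -
    have "norm (semigroup_exp A t *v v) \<le> norm (semigroup_exp A t) * norm v * \<kappa>" by (rule \<kappa>)
    also have "\<dots> \<le> C * norm v * \<kappa>" using C(2)[OF that] \<kappa>(1) by (intro mult_right_mono) auto
    finally show ?thesis by (simp add: mult_ac)
  qed
  have c: "0 \<le> C * \<kappa>" using C \<kappa> by simp
  show thesis
  proof (rule that[OF c])
    fix z :: "real^'n" and q :: "real \<Rightarrow> real^'n" and t assume t: "t \<in> {0..T}" and qm: "set_borel_measurable borel {0..T} q"
    have "(\<lambda>s. ennreal (norm (indicator {0..T} s *\<^sub>R q s))) \<in> borel_measurable lborel"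
      using qm unfolding set_borel_measurable_def by measurable
    also have "(\<lambda>s. ennreal (norm (indicator {0..T} s *\<^sub>R q s))) = (\<lambda>s. ennreal (norm (q s)) * indicator {0..T} s)"
      by (auto simp: fun_eq_iff indicator_def)
    finally have qm': "(\<lambda>s. ennreal (norm (q s)) * indicator {0..T} s) \<in> borel_measurable lborel" .
    let ?g = "\<lambda>s. indicator {0..t} s *\<^sub>R (semigroup_exp A (t - s) *v q s)"
    have "ennreal (norm (\<integral>s. ?g s \<partial>lborel)) \<le> (\<integral>\<^sup>+s. ennreal (norm (?g s)) \<partial>lborel)"
    proof (cases "integrable lborel ?g")
      case True
      then show ?thesis by (rule integral_norm_bound_ennreal)
    qed (simp add: not_integrable_integral_eq)
    also have "\<dots> \<le> (\<integral>\<^sup>+s. ennreal (C * \<kappa>) * (ennreal (norm (q s)) * indicator {0..T} s) \<partial>lborel)"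
    proof (rule nn_integral_mono)
      fix s
      show "ennreal (norm (?g s)) \<le> ennreal (C * \<kappa>) * (ennreal (norm (q s)) * indicator {0..T} s)"
      proof (cases "s \<in> {0..t}")
        case True
        then have "norm (?g s) \<le> C * \<kappa> * norm (q s)" using E[of "t - s" "q s"] t by simp
        then show ?thesis using True t c by (simp add: ennreal_mult[symmetric] ennreal_leI)
      qed simp
    qed
    also have "\<dots> = ennreal (C * \<kappa>) * (\<integral>\<^sup>+s\<in>{0..T}. ennreal (norm (q s)) \<partial>lborel)"
      by (rule nn_integral_cmult[OF qm'])
    finally have 1: "ennreal (norm (\<integral>s. ?g s \<partial>lborel)) \<le> ennreal (C * \<kappa>) * (\<integral>\<^sup>+s\<in>{0..T}. ennreal (norm (q s)) \<partial>lborel)" .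
    have 2: "ennreal (norm (semigroup_exp A t *v z)) \<le> ennreal (C * \<kappa>) * ennreal (norm z)"
      using E[OF t, of z] c by (simp add: ennreal_mult[symmetric] ennreal_leI)
    have "ennreal (norm (flow A z q t)) \<le> ennreal (norm (semigroup_exp A t *v z)) + ennreal (norm (\<integral>s. ?g s \<partial>lborel))"
      unfolding flow_def set_lebesgue_integral_def
      by (simp add: ennreal_plus[symmetric] norm_triangle_ineq ennreal_leI del: ennreal_plus)
    also have "\<dots> \<le> ennreal (C * \<kappa>) * (ennreal (norm z) + (\<integral>\<^sup>+s\<in>{0..T}. ennreal (norm (q s)) \<partial>lborel))"
      unfolding distrib_left by (intro add_mono 1 2)
    finally show "ennreal (norm (flow A z q t)) \<le>
        ennreal (C * \<kappa>) * (ennreal (norm z) + (\<integral>\<^sup>+s\<in>{0..T}. ennreal (norm (q s)) \<partial>lborel))" .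
  qed
qed

lemma ennreal_add_square_le: "((a::ennreal) + b)\<^sup>2 \<le> 2 * a\<^sup>2 + 2 * b\<^sup>2"
proof (cases "a = top \<or> b = top")
  case True
  then show ?thesis by (auto simp: power2_eq_square ennreal_mult_eq_top_iff)
next
  case False
  then obtain x y where xy: "a = ennreal x" "b = ennreal y" "0 \<le> x" "0 \<le> y"
    by (metis ennreal_cases)
  have "(x + y)\<^sup>2 \<le> 2 * x\<^sup>2 + 2 * y\<^sup>2"
    using norm_add_sq_le[of x y] xy by (simp add: power2_eq_square)
  then have "ennreal ((x + y)\<^sup>2) \<le> ennreal (2 * x\<^sup>2 + 2 * y\<^sup>2)" by (rule ennreal_leI)
  also have "\<dots> = 2 * ennreal (x\<^sup>2) + 2 * ennreal (y\<^sup>2)" by (simp add: ennreal_plus ennreal_mult)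
  also have "\<dots> = 2 * a\<^sup>2 + 2 * b\<^sup>2" using xy by (simp add: ennreal_power)
  also have "ennreal ((x + y)\<^sup>2) = (a + b)\<^sup>2"
    using xy by (simp add: ennreal_power[symmetric] ennreal_plus[symmetric] del: ennreal_plus)
  finally show ?thesis .
qed

text \<open>
  The part of the delayed input that stems from the given history.
\<close>

definition history_input :: "('m::finite \<Rightarrow> real) \<Rightarrow> (real \<Rightarrow> real^'m) \<Rightarrow> real \<Rightarrow> real^'m" where
  "history_input h hist s = (\<chi> i. if s - h i < 0 then hist (s - h i) $ i else 0)"

lemma delayed_input_split:
  "delayed_input h hist U s \<omega> = history_input h hist s + delayed_input h (\<lambda>_. 0) U s \<omega>"
  by (simp add: delayed_input_def history_input_def vec_eq_iff)

lemma history_input_integrable: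
  fixes h :: "'m::finite \<Rightarrow> real"
  assumes hist: "set_integrable lborel {-d..<0} hist" and h: "\<And>i. h i \<le> d"
  shows "set_integrable lborel {0..T} (\<lambda>s. history_input h hist s)"
proof (rule vec_set_integral(1))
  fix i
  let ?g = "\<lambda>x. indicator {-d..<0} x *\<^sub>R hist x"
  have g: "integrable lborel ?g" using hist by (simp add: set_integrable_def)
  have gi: "integrable lborel (\<lambda>x. ?g x $ i)"
    by (rule integrable_bounded_linear[OF bounded_linear_vec_nth g])
  have "integrable lborel (\<lambda>s. ?g (- h i + 1 * s) $ i)"
    by (rule lborel_integrable_real_affine[OF gi]) simp
  then have "integrable lborel (\<lambda>s. indicator {0..T} s *\<^sub>R (?g (- h i + 1 * s) $ i))"
    by (intro integrable_mult_indicator) auto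
  moreover have "(\<lambda>s. indicator {0..T} s *\<^sub>R (?g (- h i + 1 * s) $ i)) =
      (\<lambda>s. indicator {0..T} s *\<^sub>R (history_input h hist s $ i))"
    using h[of i] by (auto simp: history_input_def indicator_def fun_eq_iff)
  ultimately show "set_integrable lborel {0..T} (\<lambda>s. history_input h hist s $ i)"
    by (simp only: set_integrable_def)
qed

text \<open>
  As the delays are positive, the delayed input at time \<open>t\<close> depends on the control before \<open>t\<close>.
\<close>

lemma progressive_delayed:
  fixes h :: "'m::finite \<Rightarrow> real" and U :: "real \<Rightarrow> 'w \<Rightarrow> real^'m"
  assumes U: "progressively_measurable F T U" and h: "\<And>i. 0 < h i"
  shows "progressively_measurable F T (delayed_input h (\<lambda>_. 0) U)"
proof (rule progressively_measurableI)
  fix t assume t: "t \<in> {0..T}"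
  have [measurable]: "fst \<in> borel_measurable (prog_space F t)" by (rule prog_fst_measurable)
  have "(\<lambda>p. if fst p - h i < 0 then 0 else U (clip t (fst p - h i)) (snd p) $ i) \<in> borel_measurable (prog_space F t)" for i
  proof -
    have "(\<lambda>p. clip t (fst p - h i)) \<in> prog_space F t \<rightarrow>\<^sub>M restrict_space borel {0..t}"
      using t by (intro measurable_restrict_space2) auto
    then have "(\<lambda>p. (clip t (fst p - h i), snd p)) \<in> prog_space F t \<rightarrow>\<^sub>M prog_space F t"
      by (intro measurable_Pair measurable_snd)
    from measurable_compose[OF this progressively_measurableD[OF U t]]
    have "(\<lambda>p. U (clip t (fst p - h i)) (snd p)) \<in> borel_measurable (prog_space F t)" by simp
    then show ?thesis by measurable
  qed
  then have "(\<lambda>p. \<chi> i. if fst p - h i < 0 then 0 else U (clip t (fst p - h i)) (snd p) $ i) \<in> borel_measurable (prog_space F t)"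
    by (intro borel_measurable_vec_lambda)
  moreover have "delayed_input h (\<lambda>_. 0) U (fst p) (snd p) =
      (\<chi> i. if fst p - h i < 0 then 0 else U (clip t (fst p - h i)) (snd p) $ i)"
    if "p \<in> space (prog_space F t)" for p
  proof -
    have "clip t (fst p - h i) = fst p - h i" if "\<not> fst p - h i < 0" for i
    proof -
      have "fst p \<in> {0..t}" using \<open>p \<in> _\<close> by (rule prog_space_fst)
      then show ?thesis using h[of i] that by auto
    qed
    then show ?thesis by (simp add: delayed_input_def vec_eq_iff)
  qed
  ultimately show "(\<lambda>p. delayed_input h (\<lambda>_. 0) U (fst p) (snd p)) \<in> borel_measurable (prog_space F t)"
    by (subst measurable_cong) auto
qed

context wiener
begin

lemma progressive_flow:
  fixes A :: "real^'n^'n"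
  assumes q: "progressively_measurable F T q"
  shows "progressively_measurable F T (\<lambda>s \<omega>. flow A z (\<lambda>u. q u \<omega>) s)"
proof (rule progressively_measurableI)
  fix t assume t: "t \<in> {0..T}"
  let ?N = "prog_space F t"
  have f[measurable]: "fst \<in> borel_measurable ?N" by (rule prog_fst_measurable)
  have ff[measurable]: "(\<lambda>p. fst (fst p)) \<in> borel_measurable (?N \<Otimes>\<^sub>M lborel)"
    by (rule measurable_compose[OF measurable_fst f])
  have c: "(\<lambda>p. clip t (snd p)) \<in> ?N \<Otimes>\<^sub>M lborel \<rightarrow>\<^sub>M restrict_space borel {0..t}"
    using t by (intro measurable_restrict_space2) auto
  have s: "(\<lambda>p. snd (fst p)) \<in> ?N \<Otimes>\<^sub>M (lborel :: real measure) \<rightarrow>\<^sub>M F t" by measurable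
  have [measurable]: "(\<lambda>p. q (clip t (snd p)) (snd (fst p))) \<in> borel_measurable (?N \<Otimes>\<^sub>M lborel)"
    using measurable_compose[OF measurable_Pair[OF c s] progressively_measurableD[OF q t]] by simp
  have "(\<lambda>p. if 0 \<le> snd p \<and> snd p \<le> fst (fst p) then
      semigroup_exp A (fst (fst p) - snd p) *v q (clip t (snd p)) (snd (fst p)) else 0) \<in> borel_measurable (?N \<Otimes>\<^sub>M lborel)"
    by measurable
  then have "(\<lambda>p. \<integral>u. (if 0 \<le> u \<and> u \<le> fst p then
      semigroup_exp A (fst p - u) *v q (clip t u) (snd p) else 0) \<partial>lborel) \<in> borel_measurable ?N"
    by (intro lborel.borel_measurable_lebesgue_integral) (simp add: case_prod_unfold)
  then have "(\<lambda>p. semigroup_exp A (fst p) *v z + (\<integral>u. (if 0 \<le> u \<and> u \<le> fst p then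
      semigroup_exp A (fst p - u) *v q (clip t u) (snd p) else 0) \<partial>lborel)) \<in> borel_measurable ?N"
    by measurable
  also have "?this \<longleftrightarrow> (\<lambda>p. flow A z (\<lambda>u. q u (snd p)) (fst p)) \<in> borel_measurable ?N"
  proof (rule measurable_cong)
    fix p assume "p \<in> space ?N"
    then have "fst p \<in> {0..t}" by (rule prog_space_fst)
    then show "semigroup_exp A (fst p) *v z + (\<integral>u. (if 0 \<le> u \<and> u \<le> fst p then
      semigroup_exp A (fst p - u) *v q (clip t u) (snd p) else 0) \<partial>lborel) = flow A z (\<lambda>u. q u (snd p)) (fst p)"
      by (auto simp: flow_def set_lebesgue_integral_def intro!: Bochner_Integration.integral_cong)
  qed
  finally show "(\<lambda>p. flow A z (\<lambda>u. q u (snd p)) (fst p)) \<in> borel_measurable ?N" .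
qed

abbreviation energy :: "real \<Rightarrow> (real \<Rightarrow> 'w \<Rightarrow> 'b::euclidean_space) \<Rightarrow> ennreal" where
  "energy T X \<equiv> (\<integral>\<^sup>+s\<in>{0..T}. (\<integral>\<^sup>+\<omega>. ennreal ((norm (X s \<omega>))\<^sup>2) \<partial>M) \<partial>lborel)"

lemma L2_progressiveD:
  "X \<in> L2_progressive M F T \<Longrightarrow> progressively_measurable F T X"
  "X \<in> L2_progressive M F T \<Longrightarrow> energy T X < \<infinity>"
  by (auto simp: L2_progressive_def)

lemma joint_section:
  fixes X :: "real \<Rightarrow> 'w \<Rightarrow> 'b::euclidean_space"
  assumes "progressively_measurable F T X" "0 \<le> T"
  shows "\<omega> \<in> space M \<Longrightarrow> (\<lambda>s. indicator {0..T} s *\<^sub>R X s \<omega>) \<in> borel_measurable borel"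
    and "s \<in> {0..T} \<Longrightarrow> (\<lambda>\<omega>. X s \<omega>) \<in> borel_measurable M"
proof -
  show "(\<lambda>s. indicator {0..T} s *\<^sub>R X s \<omega>) \<in> borel_measurable borel" if "\<omega> \<in> space M"
    using measurable_compose[OF measurable_Pair2'[OF that] progressive_joint[OF assms]] by simp
  show "(\<lambda>\<omega>. X s \<omega>) \<in> borel_measurable M" if "s \<in> {0..T}"
    using progressive_section[OF assms(1) that] F_measurable_M that by auto
qed

lemma energy_measurable:
  fixes X :: "real \<Rightarrow> 'w \<Rightarrow> 'b::euclidean_space"
  assumes "progressively_measurable F T X" "0 \<le> T"
  shows "(\<lambda>s. (\<integral>\<^sup>+\<omega>. ennreal ((norm (X s \<omega>))\<^sup>2) \<partial>M) * indicator {0..T} s) \<in> borel_measurable borel"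
proof -
  have "(\<lambda>s. \<integral>\<^sup>+\<omega>. ennreal ((norm (indicator {0..T} s *\<^sub>R X s \<omega>))\<^sup>2) \<partial>M) \<in> borel_measurable lborel"
    using progressive_joint[OF assms] by measurable
  also have "(\<lambda>s. \<integral>\<^sup>+\<omega>. ennreal ((norm (indicator {0..T} s *\<^sub>R X s \<omega>))\<^sup>2) \<partial>M) =
      (\<lambda>s. (\<integral>\<^sup>+\<omega>. ennreal ((norm (X s \<omega>))\<^sup>2) \<partial>M) * indicator {0..T} s)"
    by (auto simp: fun_eq_iff indicator_def)
  finally show ?thesis by simp
qed

lemma L2_progressive_add:
  assumes X: "X \<in> L2_progressive M F T" and Y: "Y \<in> L2_progressive M F T" and T: "0 \<le> T"
  shows "(\<lambda>s \<omega>. X s \<omega> + Y s \<omega>) \<in> L2_progressive M F T"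
proof -
  note pX = L2_progressiveD(1)[OF X] and pY = L2_progressiveD(1)[OF Y]
  note eX = energy_measurable[OF pX T] and eY = energy_measurable[OF pY T]
  have "energy T (\<lambda>s \<omega>. X s \<omega> + Y s \<omega>) \<le>
    (\<integral>\<^sup>+s. 2 * ((\<integral>\<^sup>+\<omega>. ennreal ((norm (X s \<omega>))\<^sup>2) \<partial>M) * indicator {0..T} s) +
      2 * ((\<integral>\<^sup>+\<omega>. ennreal ((norm (Y s \<omega>))\<^sup>2) \<partial>M) * indicator {0..T} s) \<partial>lborel)"
  proof (rule nn_integral_mono)
    fix s
    show "(\<integral>\<^sup>+\<omega>. ennreal ((norm (X s \<omega> + Y s \<omega>))\<^sup>2) \<partial>M) * indicator {0..T} s \<le>
      2 * ((\<integral>\<^sup>+\<omega>. ennreal ((norm (X s \<omega>))\<^sup>2) \<partial>M) * indicator {0..T} s) +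
      2 * ((\<integral>\<^sup>+\<omega>. ennreal ((norm (Y s \<omega>))\<^sup>2) \<partial>M) * indicator {0..T} s)"
    proof (cases "s \<in> {0..T}")
      case True
      note [measurable] = joint_section(2)[OF pX T True] joint_section(2)[OF pY T True]
      have "(\<integral>\<^sup>+\<omega>. ennreal ((norm (X s \<omega> + Y s \<omega>))\<^sup>2) \<partial>M) \<le>
        (\<integral>\<^sup>+\<omega>. 2 * ennreal ((norm (X s \<omega>))\<^sup>2) + 2 * ennreal ((norm (Y s \<omega>))\<^sup>2) \<partial>M)"
      proof (rule nn_integral_mono)
        fix \<omega>
        have "ennreal ((norm (X s \<omega> + Y s \<omega>))\<^sup>2) \<le> ennreal (2 * (norm (X s \<omega>))\<^sup>2 + 2 * (norm (Y s \<omega>))\<^sup>2)"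
          by (intro ennreal_leI norm_add_sq_le)
        then show "ennreal ((norm (X s \<omega> + Y s \<omega>))\<^sup>2) \<le> 2 * ennreal ((norm (X s \<omega>))\<^sup>2) + 2 * ennreal ((norm (Y s \<omega>))\<^sup>2)"
          by (simp add: ennreal_plus ennreal_mult)
      qed
      then show ?thesis using True by (simp add: nn_integral_add nn_integral_cmult)
    qed simp
  qed
  also have "\<dots> = 2 * energy T X + 2 * energy T Y"
    using eX eY by (simp add: nn_integral_add nn_integral_cmult)
  also have "\<dots> < \<infinity>"
    using L2_progressiveD(2)[OF X] L2_progressiveD(2)[OF Y] by (simp add: ennreal_mult_less_top)
  finally show ?thesis using progressive_add[OF pX pY] by (simp add: L2_progressive_def)
qed

lemma L2_progressive_mv:
  fixes A :: "real^'n^'m"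
  assumes X: "X \<in> L2_progressive M F T" and T: "0 \<le> T"
  shows "(\<lambda>s \<omega>. A *v X s \<omega>) \<in> L2_progressive M F T"
proof -
  note pX = L2_progressiveD(1)[OF X]
  obtain c where c: "0 < c" "\<And>(X::real^'n^'m) v. norm (X *v v) \<le> norm X * norm v * c"
    using mv_norm_bound by blast
  let ?k = "ennreal ((norm A * c)\<^sup>2)"
  have "energy T (\<lambda>s \<omega>. A *v X s \<omega>) \<le>
    (\<integral>\<^sup>+s. ?k * ((\<integral>\<^sup>+\<omega>. ennreal ((norm (X s \<omega>))\<^sup>2) \<partial>M) * indicator {0..T} s) \<partial>lborel)"
  proof (rule nn_integral_mono)
    fix s
    show "(\<integral>\<^sup>+\<omega>. ennreal ((norm (A *v X s \<omega>))\<^sup>2) \<partial>M) * indicator {0..T} s \<le>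
      ?k * ((\<integral>\<^sup>+\<omega>. ennreal ((norm (X s \<omega>))\<^sup>2) \<partial>M) * indicator {0..T} s)"
    proof (cases "s \<in> {0..T}")
      case True
      note [measurable] = joint_section(2)[OF pX T True]
      have "(\<integral>\<^sup>+\<omega>. ennreal ((norm (A *v X s \<omega>))\<^sup>2) \<partial>M) \<le> (\<integral>\<^sup>+\<omega>. ?k * ennreal ((norm (X s \<omega>))\<^sup>2) \<partial>M)"
      proof (rule nn_integral_mono)
        fix \<omega>
        have "(norm (A *v X s \<omega>))\<^sup>2 \<le> (norm A * norm (X s \<omega>) * c)\<^sup>2" by (intro power_mono c) simp
        then have "ennreal ((norm (A *v X s \<omega>))\<^sup>2) \<le> ennreal ((norm A * c)\<^sup>2 * (norm (X s \<omega>))\<^sup>2)"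
          by (intro ennreal_leI) (simp add: power_mult_distrib mult_ac)
        then show "ennreal ((norm (A *v X s \<omega>))\<^sup>2) \<le> ?k * ennreal ((norm (X s \<omega>))\<^sup>2)"
          by (simp add: ennreal_mult)
      qed
      then show ?thesis using True by (simp add: nn_integral_cmult)
    qed simp
  qed
  also have "\<dots> = ?k * energy T X"
    using energy_measurable[OF pX T] by (simp add: nn_integral_cmult)
  also have "\<dots> < \<infinity>" using L2_progressiveD(2)[OF X] by (simp add: ennreal_mult_less_top)
  finally show ?thesis using progressive_mv[OF pX] by (simp add: L2_progressive_def)
qed

text \<open>
  The Cauchy-Schwarz inequality in time, then Tonelli.
\<close>

lemma L1_norm_square:
  fixes X :: "real \<Rightarrow> 'w \<Rightarrow> 'b::euclidean_space"
  assumes X: "X \<in> L2_progressive M F T" and T: "0 \<le> T"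
  shows "(\<integral>\<^sup>+\<omega>. (\<integral>\<^sup>+s\<in>{0..T}. ennreal (norm (X s \<omega>)) \<partial>lborel)\<^sup>2 \<partial>M) \<le> ennreal T * energy T X"
    and "(\<integral>\<^sup>+\<omega>. (\<integral>\<^sup>+s\<in>{0..T}. ennreal (norm (X s \<omega>)) \<partial>lborel)\<^sup>2 \<partial>M) < \<infinity>"
    and "(\<lambda>\<omega>. \<integral>\<^sup>+s\<in>{0..T}. ennreal (norm (X s \<omega>)) \<partial>lborel) \<in> borel_measurable M"
proof -
  interpret P: pair_sigma_finite "lborel :: real measure" M ..
  note pX = L2_progressiveD(1)[OF X]
  let ?x = "\<lambda>s \<omega>. indicator {0..T} s *\<^sub>R X s \<omega>"
  have j[measurable]: "(\<lambda>(s, \<omega>). ?x s \<omega>) \<in> borel_measurable (lborel \<Otimes>\<^sub>M M)" by (rule progressive_joint[OF pX T])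
  have e1: "(\<integral>\<^sup>+s\<in>{0..T}. ennreal (norm (X s \<omega>)) \<partial>lborel) = (\<integral>\<^sup>+s. ennreal (norm (?x s \<omega>)) * indicator {0..T} s \<partial>lborel)" for \<omega>
    by (intro nn_integral_cong) (auto simp: indicator_def)
  have [measurable]: "(\<lambda>(\<omega>, s). ?x s \<omega>) \<in> borel_measurable (M \<Otimes>\<^sub>M lborel)"
    using measurable_pair_swap[OF j] unfolding case_prod_unfold by simp
  have j': "(\<lambda>(\<omega>, s). ennreal (norm (?x s \<omega>)) * indicator {0..T} s) \<in> borel_measurable (M \<Otimes>\<^sub>M lborel)"
    by measurable
  show "(\<lambda>\<omega>. \<integral>\<^sup>+s\<in>{0..T}. ennreal (norm (X s \<omega>)) \<partial>lborel) \<in> borel_measurable M"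
    unfolding e1 by (rule lborel.borel_measurable_nn_integral[OF j'])
  have "(\<integral>\<^sup>+\<omega>. (\<integral>\<^sup>+s\<in>{0..T}. ennreal (norm (X s \<omega>)) \<partial>lborel)\<^sup>2 \<partial>M) \<le>
      (\<integral>\<^sup>+\<omega>. ennreal T * (\<integral>\<^sup>+s. ennreal ((norm (?x s \<omega>))\<^sup>2) \<partial>lborel) \<partial>M)"
  proof (rule nn_integral_mono)
    fix \<omega> assume w: "\<omega> \<in> space M"
    have [measurable]: "(\<lambda>s. ?x s \<omega>) \<in> borel_measurable borel" by (rule joint_section(1)[OF pX T w])
    have "(\<integral>\<^sup>+s. ennreal (norm (?x s \<omega>)) * indicator {0..T} s \<partial>lborel)\<^sup>2 \<le>
        (\<integral>\<^sup>+s. (ennreal (norm (?x s \<omega>)))\<^sup>2 \<partial>lborel) * (\<integral>\<^sup>+s. (indicator {0..T} s)\<^sup>2 \<partial>lborel)"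
      by (rule Cauchy_Schwarz_nn_integral) measurable
    also have "(\<integral>\<^sup>+s. (indicator {0..T} s :: ennreal)\<^sup>2 \<partial>lborel) = (\<integral>\<^sup>+s. indicator {0..T} s \<partial>(lborel :: real measure))"
      by (intro nn_integral_cong) (simp add: indicator_def)
    also have "\<dots> = ennreal T" using T by simp
    finally show "(\<integral>\<^sup>+s\<in>{0..T}. ennreal (norm (X s \<omega>)) \<partial>lborel)\<^sup>2 \<le>
      ennreal T * (\<integral>\<^sup>+s. ennreal ((norm (?x s \<omega>))\<^sup>2) \<partial>lborel)"
      unfolding e1 by (simp add: mult.commute ennreal_power)
  qed
  also have "\<dots> = ennreal T * (\<integral>\<^sup>+\<omega>. \<integral>\<^sup>+s. ennreal ((norm (?x s \<omega>))\<^sup>2) \<partial>lborel \<partial>M)"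
    by (rule nn_integral_cmult)
       (intro lborel.borel_measurable_nn_integral, measurable)
  also have "(\<integral>\<^sup>+\<omega>. \<integral>\<^sup>+s. ennreal ((norm (?x s \<omega>))\<^sup>2) \<partial>lborel \<partial>M) =
      (\<integral>\<^sup>+s. \<integral>\<^sup>+\<omega>. ennreal ((norm (?x s \<omega>))\<^sup>2) \<partial>M \<partial>lborel)"
  proof (rule P.Fubini')
    show "(\<lambda>(s, \<omega>). ennreal ((norm (?x s \<omega>))\<^sup>2)) \<in> borel_measurable (lborel \<Otimes>\<^sub>M M)" by measurable
  qed
  also have "\<dots> = energy T X" by (intro nn_integral_cong) (auto simp: indicator_def)
  finally show 1: "(\<integral>\<^sup>+\<omega>. (\<integral>\<^sup>+s\<in>{0..T}. ennreal (norm (X s \<omega>)) \<partial>lborel)\<^sup>2 \<partial>M) \<le> ennreal T * energy T X" .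
  show "(\<integral>\<^sup>+\<omega>. (\<integral>\<^sup>+s\<in>{0..T}. ennreal (norm (X s \<omega>)) \<partial>lborel)\<^sup>2 \<partial>M) < \<infinity>"
    by (rule le_less_trans[OF 1]) (use L2_progressiveD(2)[OF X] in \<open>simp add: ennreal_mult_less_top\<close>)
qed

lemma L2_progressive_AE_integrable:
  fixes X :: "real \<Rightarrow> 'w \<Rightarrow> 'b::euclidean_space"
  assumes X: "X \<in> L2_progressive M F T" and T: "0 \<le> T"
  shows "AE \<omega> in M. set_integrable lborel {0..T} (\<lambda>s. X s \<omega>)"
proof -
  have "AE \<omega> in M. (\<integral>\<^sup>+s\<in>{0..T}. ennreal (norm (X s \<omega>)) \<partial>lborel)\<^sup>2 \<noteq> \<infinity>"
    using L1_norm_square[OF X T] by (intro nn_integral_PInf_AE) (auto simp: less_top)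
  then show ?thesis
  proof (rule AE_mp, intro AE_I2 impI)
    fix \<omega> assume w: "\<omega> \<in> space M"
      and f: "(\<integral>\<^sup>+s\<in>{0..T}. ennreal (norm (X s \<omega>)) \<partial>lborel)\<^sup>2 \<noteq> \<infinity>"
    show "set_integrable lborel {0..T} (\<lambda>s. X s \<omega>)"
      unfolding set_integrable_def
    proof (rule integrableI_bounded)
      show "(\<lambda>s. indicator {0..T} s *\<^sub>R X s \<omega>) \<in> borel_measurable lborel"
        using joint_section(1)[OF L2_progressiveD(1)[OF X] T w] by simp
      have "(\<integral>\<^sup>+s. ennreal (norm (indicator {0..T} s *\<^sub>R X s \<omega>)) \<partial>lborel) =
          (\<integral>\<^sup>+s\<in>{0..T}. ennreal (norm (X s \<omega>)) \<partial>lborel)"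
        by (intro nn_integral_cong) (auto simp: indicator_def)
      also have "\<dots> < \<infinity>" using f by (auto simp: less_top power_eq_top_ennreal)
      finally show "(\<integral>\<^sup>+s. ennreal (norm (indicator {0..T} s *\<^sub>R X s \<omega>)) \<partial>lborel) < \<infinity>" .
    qed
  qed
qed

lemma L2_progressive_flow:
  fixes A :: "real^'n^'n" and q1 :: "real \<Rightarrow> 'w \<Rightarrow> real^'n"
  assumes q1: "q1 \<in> L2_progressive M F T" and q2: "set_integrable lborel {0..T} q2" and T: "0 \<le> T"
  shows "(\<lambda>s \<omega>. flow A z (\<lambda>u. q1 u \<omega> + q2 u) s) \<in> L2_progressive M F T"
proof -
  obtain c where c: "0 \<le> c" "\<And>z q t. t \<in> {0..T} \<Longrightarrow> set_borel_measurable borel {0..T} q \<Longrightarrow>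
    ennreal (norm (flow A z q t)) \<le> ennreal c * (ennreal (norm z) + (\<integral>\<^sup>+s\<in>{0..T}. ennreal (norm (q s)) \<partial>lborel))"
    by (rule flow_norm_bound[of T A]) blast
  have q2m: "set_borel_measurable borel {0..T} q2"
    using q2 borel_measurable_integrable by (auto simp: set_borel_measurable_def set_integrable_def)
  have pq: "progressively_measurable F T (\<lambda>u \<omega>. q1 u \<omega> + q2 u)"
    by (rule progressive_add[OF L2_progressiveD(1)[OF q1] progressive_deterministic[OF q2m]])
  define R where "R \<omega> = (\<integral>\<^sup>+s\<in>{0..T}. ennreal (norm (q1 s \<omega>)) \<partial>lborel)" for \<omega>
  define a where "a = ennreal (norm z) + (\<integral>\<^sup>+s\<in>{0..T}. ennreal (norm (q2 s)) \<partial>lborel)"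
  have Rm[measurable]: "R \<in> borel_measurable M" unfolding R_def by (rule L1_norm_square(3)[OF q1 T])
  have "(\<integral>\<^sup>+s\<in>{0..T}. ennreal (norm (q2 s)) \<partial>lborel) = (\<integral>\<^sup>+s. ennreal (norm (indicator {0..T} s *\<^sub>R q2 s)) \<partial>lborel)"
    by (intro nn_integral_cong) (auto simp: indicator_def)
  also have "\<dots> < \<infinity>" using q2 by (auto simp: set_integrable_def integrable_iff_bounded)
  finally have a: "a < \<infinity>" by (simp add: a_def)
  have bound: "(ennreal (norm (flow A z (\<lambda>u. q1 u \<omega> + q2 u) s)))\<^sup>2 \<le> (ennreal c)\<^sup>2 * (2 * a\<^sup>2 + 2 * (R \<omega>)\<^sup>2)"
    if s: "s \<in> {0..T}" and w: "\<omega> \<in> space M" for s \<omega>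
  proof -
    have [measurable]: "(\<lambda>s. indicator {0..T} s *\<^sub>R q1 s \<omega>) \<in> borel_measurable borel"
      "(\<lambda>s. indicator {0..T} s *\<^sub>R q2 s) \<in> borel_measurable borel"
      using joint_section(1)[OF L2_progressiveD(1)[OF q1] T w] q2m by (auto simp: set_borel_measurable_def)
    have qm: "set_borel_measurable borel {0..T} (\<lambda>u. q1 u \<omega> + q2 u)"
      unfolding set_borel_measurable_def scaleR_add_right by measurable
    have ind: "ennreal (norm (v s)) * indicator {0..T} s = ennreal (norm (indicator {0..T} s *\<^sub>R v s))" for v :: "real \<Rightarrow> real^'n" and s
      by (auto simp: indicator_def)
    have "(\<integral>\<^sup>+s\<in>{0..T}. ennreal (norm (q1 s \<omega> + q2 s)) \<partial>lborel) \<le>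
       (\<integral>\<^sup>+s. ennreal (norm (indicator {0..T} s *\<^sub>R q1 s \<omega>)) + ennreal (norm (indicator {0..T} s *\<^sub>R q2 s)) \<partial>lborel)"
      by (intro nn_integral_mono)
        (auto simp: indicator_def ennreal_plus[symmetric] norm_triangle_ineq intro!: ennreal_leI simp del: ennreal_plus)
    also have "\<dots> = R \<omega> + (\<integral>\<^sup>+s\<in>{0..T}. ennreal (norm (q2 s)) \<partial>lborel)"
      unfolding R_def ind ind[of "\<lambda>s. q1 s \<omega>"] by (rule nn_integral_add) measurable
    finally have "(\<integral>\<^sup>+s\<in>{0..T}. ennreal (norm (q1 s \<omega> + q2 s)) \<partial>lborel) \<le>
      R \<omega> + (\<integral>\<^sup>+s\<in>{0..T}. ennreal (norm (q2 s)) \<partial>lborel)" .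
    from add_left_mono[OF this, of "ennreal (norm z)"]
    have I: "ennreal (norm z) + (\<integral>\<^sup>+s\<in>{0..T}. ennreal (norm (q1 s \<omega> + q2 s)) \<partial>lborel) \<le> a + R \<omega>"
      unfolding a_def by (simp only: add_ac)
    have "ennreal (norm (flow A z (\<lambda>u. q1 u \<omega> + q2 u) s)) \<le> ennreal c * (a + R \<omega>)"
      using c(2)[OF s qm, of z] mult_left_mono[OF I, of "ennreal c"] by simp
    then have "(ennreal (norm (flow A z (\<lambda>u. q1 u \<omega> + q2 u) s)))\<^sup>2 \<le> (ennreal c * (a + R \<omega>))\<^sup>2"
      by (intro power_mono) auto
    also have "\<dots> \<le> (ennreal c)\<^sup>2 * (2 * a\<^sup>2 + 2 * (R \<omega>)\<^sup>2)"
      unfolding power_mult_distrib by (intro mult_left_mono ennreal_add_square_le) simp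
    finally show ?thesis .
  qed
  have "energy T (\<lambda>s \<omega>. flow A z (\<lambda>u. q1 u \<omega> + q2 u) s) \<le>
      (\<integral>\<^sup>+s. (\<integral>\<^sup>+\<omega>. (ennreal c)\<^sup>2 * (2 * a\<^sup>2 + 2 * (R \<omega>)\<^sup>2) \<partial>M) * indicator {0..T} s \<partial>lborel)"
    using bound by (intro nn_integral_mono) (auto simp: indicator_def ennreal_power[symmetric] intro!: nn_integral_mono)
  also have "\<dots> = (\<integral>\<^sup>+\<omega>. (ennreal c)\<^sup>2 * (2 * a\<^sup>2 + 2 * (R \<omega>)\<^sup>2) \<partial>M) * ennreal T"
    using T by (simp add: nn_integral_cmult_indicator)
  also have "(\<integral>\<^sup>+\<omega>. (ennreal c)\<^sup>2 * (2 * a\<^sup>2 + 2 * (R \<omega>)\<^sup>2) \<partial>M) =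
      (ennreal c)\<^sup>2 * (2 * a\<^sup>2 + 2 * (\<integral>\<^sup>+\<omega>. (R \<omega>)\<^sup>2 \<partial>M))"
    by (simp add: nn_integral_cmult nn_integral_add emeasure_space_1)
  also have "\<dots> * ennreal T < \<infinity>"
    using a L1_norm_square(2)[OF q1 T]
    by (simp add: ennreal_mult_less_top R_def ennreal_power power_less_top_ennreal)
  finally show ?thesis using progressive_flow[OF pq, of A z] by (simp add: L2_progressive_def)
qed

lemma L2_progressive_delayed:
  fixes h :: "'m::finite \<Rightarrow> real" and U :: "real \<Rightarrow> 'w \<Rightarrow> real^'m"
  assumes U: "U \<in> L2_progressive M F T" and h: "\<And>i. 0 < h i" and T: "0 \<le> T"
  shows "delayed_input h (\<lambda>_. 0) U \<in> L2_progressive M F T"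
proof -
  note pU = L2_progressiveD(1)[OF U]
  define e where "e s = (\<integral>\<^sup>+\<omega>. ennreal ((norm (U s \<omega>))\<^sup>2) \<partial>M) * indicator {0..T} s" for s
  have em[measurable]: "e \<in> borel_measurable borel" unfolding e_def by (rule energy_measurable[OF pU T])
  have "energy T (delayed_input h (\<lambda>_. 0) U) \<le> (\<integral>\<^sup>+s. (\<Sum>i\<in>UNIV. e (- h i + 1 * s)) \<partial>lborel)"
  proof (rule nn_integral_mono)
    fix s
    show "(\<integral>\<^sup>+\<omega>. ennreal ((norm (delayed_input h (\<lambda>_. 0) U s \<omega>))\<^sup>2) \<partial>M) * indicator {0..T} s \<le>
      (\<Sum>i\<in>UNIV. e (- h i + 1 * s))"
    proof (cases "s \<in> {0..T}")
      case True
      let ?u = "\<lambda>i \<omega>. if s - h i < 0 then 0 else U (s - h i) \<omega> $ i"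
      have um[measurable]: "?u i \<in> borel_measurable M" for i
      proof (cases "s - h i < 0")
        case False
        then have "s - h i \<in> {0..T}" using True h[of i] by auto
        from joint_section(2)[OF pU T this] False show ?thesis by (simp add: borel_measurable_nth)
      qed simp
      have d: "delayed_input h (\<lambda>_. 0) U s \<omega> $ i = ?u i \<omega>" for \<omega> i by (simp add: delayed_input_def)
      have "(\<integral>\<^sup>+\<omega>. ennreal ((norm (delayed_input h (\<lambda>_. 0) U s \<omega>))\<^sup>2) \<partial>M) =
          (\<Sum>i\<in>UNIV. \<integral>\<^sup>+\<omega>. ennreal ((?u i \<omega>)\<^sup>2) \<partial>M)"
        unfolding ennreal_norm_sq_nth d by (rule nn_integral_sum) measurable
      also have "\<dots> \<le> (\<Sum>i\<in>UNIV. e (- h i + 1 * s))"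
      proof (rule sum_mono)
        fix i
        show "(\<integral>\<^sup>+\<omega>. ennreal ((?u i \<omega>)\<^sup>2) \<partial>M) \<le> e (- h i + 1 * s)"
        proof (cases "s - h i < 0")
          case False
          have "(\<integral>\<^sup>+\<omega>. ennreal ((U (s - h i) \<omega> $ i)\<^sup>2) \<partial>M) \<le> (\<integral>\<^sup>+\<omega>. ennreal ((norm (U (s - h i) \<omega>))\<^sup>2) \<partial>M)"
          proof (intro nn_integral_mono ennreal_leI)
            fix \<omega>
            show "(U (s - h i) \<omega> $ i)\<^sup>2 \<le> (norm (U (s - h i) \<omega>))\<^sup>2"
              using component_le_norm_cart[of "U (s - h i) \<omega>" i] by (simp add: abs_le_square_iff[symmetric])
          qed
          then show ?thesis using False True h[of i] by (simp add: e_def)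
        qed simp
      qed
      finally show ?thesis using True by simp
    qed simp
  qed
  also have "\<dots> = (\<Sum>i\<in>UNIV. \<integral>\<^sup>+s. e (- h i + 1 * s) \<partial>lborel)" by (rule nn_integral_sum) measurable
  also have "\<dots> = (\<Sum>i\<in>(UNIV::'m set). energy T U)"
  proof (rule sum.cong)
    fix i
    show "(\<integral>\<^sup>+s. e (- h i + 1 * s) \<partial>lborel) = energy T U"
      using nn_integral_real_affine[OF em, of 1 "- h i"] by (simp add: e_def[abs_def])
  qed simp
  also have "\<dots> < \<infinity>" using L2_progressiveD(2)[OF U] by (simp add: ennreal_mult_less_top of_nat_less_top)
  finally show ?thesis using progressive_delayed[where F = F and T = T and U = U and h = h, OF pU h]
    by (simp add: L2_progressive_def)
qed

end

locale controlled_system = wiener M F W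
  for M :: "'w measure" and F :: "real \<Rightarrow> 'w measure" and W :: "real \<Rightarrow> 'w \<Rightarrow> real" +
  fixes T :: real and h :: "'m::{finite,linorder} \<Rightarrow> real"
    and A :: "real^'n^'n" and B :: "real^('m::_)^'n" and G :: "real \<Rightarrow> real^'n^'n"
    and \<sigma> :: "real \<Rightarrow> real^'n" and z0 :: "real^'n" and hist :: "real \<Rightarrow> real^('m::_)"
  assumes h_mono: "strict_mono h" and h_pos: "\<forall>i. 0 < h i"
    and G_C1: "C1_on {0..last_delay h} G" and \<sigma>_bounded: "essentially_bounded T \<sigma>"
    and hist_integrable: "set_integrable lborel {- last_delay h..<0} hist"
    and horizon: "last_delay h < T"
begin

lemma h_le: "h i \<le> last_delay h"
  by (rule delay_less_next(2)[OF h_mono h_pos])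

lemma d_pos: "0 < last_delay h" and T_pos: "0 < T" and T_nonneg: "0 \<le> T"
  using h_le[of undefined] h_pos[rule_format, of undefined] horizon by linarith+

lemma progressive_diff:
  fixes X Y :: "real \<Rightarrow> 'w \<Rightarrow> 'b::euclidean_space"
  assumes "progressively_measurable F T X" "progressively_measurable F T Y"
  shows "progressively_measurable F T (\<lambda>s \<omega>. X s \<omega> - Y s \<omega>)"
  using assms by (intro progressively_measurableI borel_measurable_diff) (auto intro: progressively_measurableD)

lemma history_integrable: "set_integrable lborel {0..T} (\<lambda>s. B *v history_input h hist s)"
  by (intro set_integrable_kernel_mult history_input_integrable[OF hist_integrable] h_le continuous_intros)

lemma progressive_delayed_input:
  assumes "U \<in> L2_progressive M F T"
  shows "progressively_measurable F T (delayed_input h hist U)"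
proof -
  have "set_integrable lborel {0..T} (history_input h hist)"
    by (rule history_input_integrable[OF hist_integrable h_le])
  then have "set_borel_measurable borel {0..T} (history_input h hist)"
    using borel_measurable_integrable by (auto simp: set_borel_measurable_def set_integrable_def)
  then have "progressively_measurable F T (\<lambda>s \<omega>. history_input h hist s + delayed_input h (\<lambda>_. 0) U s \<omega>)"
    by (intro progressive_add progressive_deterministic
        L2_progressiveD(1)[OF L2_progressive_delayed[OF assms _ T_nonneg]]) (use h_pos in auto)
  then show ?thesis by (simp add: delayed_input_split[of h hist U, abs_def])
qed

text \<open>
  The integrals \<open>\<integral>\<^sub>0\<^sup>t \<sigma> dW\<close> are the memory integrals with constant kernel \<open>1\<close> and a window of length \<open>T\<close>.
\<close>

lemma driving_noise:
  obtains Y where "Y \<in> L2_progressive M F T" "\<And>t. t \<in> {0..T} \<Longrightarrow> has_wiener_integral M W \<sigma> 0 t (Y t)"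
proof -
  have C1: "C1_on {0..T} (\<lambda>_. mat 1 :: real^'n^'n)"
    by (auto simp: C1_on_def intro!: exI[of _ "\<lambda>_. 0"])
  show thesis
  proof (rule memory_process[OF T_nonneg T_pos C1 \<sigma>_bounded])
    fix r assume r: "r \<in> L2_progressive M F T"
      "\<And>t. t \<in> {0..T} \<Longrightarrow> has_wiener_integral M W (\<lambda>s. mat 1 *v \<sigma> s) (max 0 (t - T)) t (r t)"
    have "has_wiener_integral M W \<sigma> 0 t (r t)" if "t \<in> {0..T}" for t
    proof -
      have "max 0 (t - T) = 0" using that by auto
      with r(2)[OF that] show ?thesis by simp
    qed
    with r(1) show thesis by (rule that)
  qed
qed

lemma noise_memory_exists: "\<exists>r. noise_memory M F W T h G \<sigma> r"
  using memory_process[OF T_nonneg d_pos G_C1 \<sigma>_bounded] unfolding noise_memory_def by metis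

text \<open>
  If \<open>Y\<close> is the process \<open>\<integral>\<^sub>0\<^sup>t \<sigma> dW\<close>, then \<open>V = Z - Y\<close> has absolutely continuous paths with
  \<open>V' = A V + forcing\<close>.
\<close>

definition forcing :: "(real \<Rightarrow> 'w \<Rightarrow> real^'n) \<Rightarrow> (real \<Rightarrow> 'w \<Rightarrow> real^'n) \<Rightarrow> (real \<Rightarrow> 'w \<Rightarrow> real^('m::_)) \<Rightarrow> real \<Rightarrow> 'w \<Rightarrow> real^'n" where
  "forcing Y r U s \<omega> = A *v Y s \<omega> + (B *v delayed_input h hist U s \<omega> + r s \<omega>)"

lemma forcing_split:
  "forcing Y r U s \<omega> = (A *v Y s \<omega> + (B *v delayed_input h (\<lambda>_. 0) U s \<omega> + r s \<omega>)) + B *v history_input h hist s"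
  by (simp add: forcing_def delayed_input_split[of h hist U] mv.add_right)

text \<open>
  The equation for \<open>Z - Y\<close> is solved path by path with \<open>flow\<close>.
\<close>

theorem solution_exists:
  assumes U: "U \<in> L2_progressive M F T"
  shows "\<exists>Z. is_solution M F W T A B h G \<sigma> z0 hist U Z"
proof -
  obtain Y where Y: "Y \<in> L2_progressive M F T" "\<And>t. t \<in> {0..T} \<Longrightarrow> has_wiener_integral M W \<sigma> 0 t (Y t)"
    using driving_noise by blast
  obtain r where r: "noise_memory M F W T h G \<sigma> r" using noise_memory_exists by blast
  then have rL: "r \<in> L2_progressive M F T" by (simp add: noise_memory_def)
  note hd = history_integrable
  have q1: "(\<lambda>s \<omega>. A *v Y s \<omega> + (B *v delayed_input h (\<lambda>_. 0) U s \<omega> + r s \<omega>)) \<in> L2_progressive M F T"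
    by (intro L2_progressive_add L2_progressive_mv L2_progressive_delayed Y U rL T_nonneg) (use h_pos in auto)
  define V where "V s \<omega> = flow A z0 (\<lambda>u. forcing Y r U u \<omega>) s" for s \<omega>
  define Z where "Z s \<omega> = Y s \<omega> + V s \<omega>" for s \<omega>
  have V: "V \<in> L2_progressive M F T"
    unfolding V_def[abs_def] forcing_split by (rule L2_progressive_flow[OF q1 hd T_nonneg])
  have ZL: "Z \<in> L2_progressive M F T"
    unfolding Z_def[abs_def] by (rule L2_progressive_add[OF Y(1) V T_nonneg])
  have drift: "A *v Z s \<omega> + B *v delayed_input h hist U s \<omega> + r s \<omega> =
      A *v V s \<omega> + forcing Y r U s \<omega>" for s \<omega>
    by (simp add: Z_def forcing_def mv.add_right)
  have qi: "AE \<omega> in M. set_integrable lborel {0..T} (\<lambda>s. forcing Y r U s \<omega>)"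
    using L2_progressive_AE_integrable[OF q1 T_nonneg]
    by eventually_elim (simp only: forcing_split, rule set_integral_add(1)[OF _ hd])
  have "AE \<omega> in M. set_integrable lborel {0..T} (\<lambda>s. A *v Z s \<omega> + B *v delayed_input h hist U s \<omega> + r s \<omega>)"
    using qi
  proof eventually_elim
    case (elim \<omega>)
    have "set_integrable lborel {0..T} (\<lambda>s. A *v V s \<omega>)"
      unfolding V_def
      by (intro set_integrable_kernel_mult flow_solves(2)[OF T_nonneg elim] continuous_intros)
    then show ?case unfolding drift using elim by (rule set_integral_add(1))
  qed
  moreover have "AE \<omega> in M. Z t \<omega> = z0 + (LINT s:{0..t}|lborel. A *v Z s \<omega> + B *v delayed_input h hist U s \<omega> + r s \<omega>) + Y t \<omega>"
    if t: "t \<in> {0..T}" for t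
    using qi
  proof eventually_elim
    case (elim \<omega>)
    have "set_integrable lborel {0..t} (\<lambda>s. forcing Y r U s \<omega>)"
      by (rule set_integrable_subset[OF elim]) (use t in auto)
    from flow_solves(1)[OF _ this, of A z0] t show ?case
      unfolding drift by (simp add: Z_def V_def)
  qed
  ultimately have "is_solution M F W T A B h G \<sigma> z0 hist U Z"
    unfolding is_solution_def Let_def using ZL r Y(2) by blast
  then show ?thesis by blast
qed

text \<open>
  The equation holds at each time outside a null set that depends on the time. By Fubini's theorem
  almost every path satisfies it at almost every time, and also at time \<open>T\<close>. For such a path \<open>Z - Y\<close> agrees
  almost everywhere with an absolutely continuous function \<open>D\<close>, to which variation of constants applies.
\<close>

theorem solution_formula:
  assumes U: "U \<in> L2_progressive M F T" and Z: "is_solution M F W T A B h G \<sigma> z0 hist U Z"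
    and Y: "Y \<in> L2_progressive M F T" "\<And>t. t \<in> {0..T} \<Longrightarrow> has_wiener_integral M W \<sigma> 0 t (Y t)"
  shows "\<exists>r. noise_memory M F W T h G \<sigma> r \<and>
    (AE \<omega> in M. set_integrable lborel {0..T} (\<lambda>s. forcing Y r U s \<omega>)) \<and>
    (AE \<omega> in M. Z T \<omega> = Y T \<omega> + flow A z0 (\<lambda>s. forcing Y r U s \<omega>) T)"
proof -
  obtain r where r: "noise_memory M F W T h G \<sigma> r"
    and ZL: "Z \<in> L2_progressive M F T"
    and int: "AE \<omega> in M. set_integrable lborel {0..T} (\<lambda>s. A *v Z s \<omega> + B *v delayed_input h hist U s \<omega> + r s \<omega>)"
    and eq: "\<And>t. t \<in> {0..T} \<Longrightarrow> \<exists>I. has_wiener_integral M W \<sigma> 0 t I \<and> (AE \<omega> in M. Z t \<omega> = z0 +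
      (LINT s:{0..t}|lborel. A *v Z s \<omega> + B *v delayed_input h hist U s \<omega> + r s \<omega>) + I \<omega>)"
    using Z unfolding is_solution_def Let_def by blast
  have rL: "r \<in> L2_progressive M F T" using r by (simp add: noise_memory_def)
  note p = L2_progressiveD(1)
  define dr where "dr s \<omega> = A *v Z s \<omega> + B *v delayed_input h hist U s \<omega> + r s \<omega>" for s \<omega>
  have pdr: "progressively_measurable F T dr"
    unfolding dr_def[abs_def]
    by (intro progressive_add progressive_mv progressive_delayed_input p[OF ZL] U p[OF rL])
  (* The flow of the zero matrix is plain integration; written like this, D is progressively
     measurable by progressive_flow. *)
  define D where "D s \<omega> = flow 0 z0 (\<lambda>u. dr u \<omega>) s" for s \<omega>
  have D: "D s \<omega> = z0 + (LINT u:{0..s}|lborel. dr u \<omega>)" for s \<omega> by (simp add: D_def flow_def)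
  have pD: "progressively_measurable F T D"
    unfolding D_def[abs_def] by (rule progressive_flow[OF pdr])
  have eqY: "AE \<omega> in M. Z t \<omega> = D t \<omega> + Y t \<omega>" if t: "t \<in> {0..T}" for t
  proof -
    obtain I where I: "has_wiener_integral M W \<sigma> 0 t I" "AE \<omega> in M. Z t \<omega> = D t \<omega> + I \<omega>"
      using eq[OF t] by (auto simp: D dr_def)
    have "AE \<omega> in M. I \<omega> = Y t \<omega>"
      by (rule wiv_unique[OF wiener_integral_wiv[OF I(1)] wiener_integral_wiv[OF Y(2)[OF t]]]) simp_all
    with I(2) show ?thesis by eventually_elim simp
  qed
  interpret P: pair_sigma_finite "lborel :: real measure" M ..
  have pgap: "progressively_measurable F T (\<lambda>s \<omega>. Z s \<omega> - (D s \<omega> + Y s \<omega>))"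
    by (intro progressive_diff progressive_add p[OF ZL] pD p[OF Y(1)])
  let ?gap = "\<lambda>s \<omega>. indicator {0..T} s *\<^sub>R (Z s \<omega> - (D s \<omega> + Y s \<omega>))"
  have gm: "(\<lambda>x. ?gap (fst x) (snd x)) \<in> borel_measurable (lborel \<Otimes>\<^sub>M M)"
    using progressive_joint[OF pgap T_nonneg] by (simp add: case_prod_unfold)
  (* Exchange of the two null sets. *)
  have "AE s in lborel. AE \<omega> in M. ?gap s \<omega> = 0"
  proof (rule AE_I2)
    fix s :: real
    show "AE \<omega> in M. ?gap s \<omega> = 0"
    proof (cases "s \<in> {0..T}")
      case True
      from eqY[OF this] show ?thesis by eventually_elim simp
    qed simp
  qed
  moreover have "{x \<in> space (lborel \<Otimes>\<^sub>M M). ?gap (fst x) (snd x) = 0} \<in> sets (lborel \<Otimes>\<^sub>M M)"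
    using measurable_sets[OF gm, of "{0}"] by (simp add: vimage_def Int_def conj_commute)
  ultimately have ae: "AE \<omega> in M. AE s in lborel. ?gap s \<omega> = 0"
    using P.AE_commute[of "\<lambda>s \<omega>. ?gap s \<omega> = 0"] by blast
  have pq: "progressively_measurable F T (forcing Y r U)"
    unfolding forcing_def[abs_def]
    by (intro progressive_add progressive_mv progressive_delayed_input p[OF Y(1)] U p[OF rL])
  have pdD: "progressively_measurable F T (\<lambda>s \<omega>. dr s \<omega> - A *v D s \<omega>)"
    by (intro progressive_diff pdr progressive_mv pD)
  have T_in: "T \<in> {0..T}" using T_nonneg by simp
  note hd = history_integrable
  have q1: "(\<lambda>s \<omega>. A *v Y s \<omega> + (B *v delayed_input h (\<lambda>_. 0) U s \<omega> + r s \<omega>)) \<in> L2_progressive M F T"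
    by (intro L2_progressive_add L2_progressive_mv L2_progressive_delayed Y U rL T_nonneg) (use h_pos in auto)
  have qi: "AE \<omega> in M. set_integrable lborel {0..T} (\<lambda>s. forcing Y r U s \<omega>)"
    using L2_progressive_AE_integrable[OF q1 T_nonneg]
    by eventually_elim (simp only: forcing_split, rule set_integral_add(1)[OF _ hd])
  have "AE \<omega> in M. Z T \<omega> = Y T \<omega> + flow A z0 (\<lambda>s. forcing Y r U s \<omega>) T"
    using ae int eqY[OF T_in] AE_space
  proof eventually_elim
    case (elim \<omega>)
    have dri: "set_integrable lborel {0..T} (\<lambda>s. dr s \<omega>)" using elim(2) by (simp add: dr_def)
    have "D T \<omega> = semigroup_exp A T *v z0 +
        (LINT s:{0..T}|lborel. semigroup_exp A (T - s) *v (dr s \<omega> - A *v D s \<omega>))"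
      by (rule variation_of_constants[OF T_nonneg dri]) (rule D)
    also have "(LINT s:{0..T}|lborel. semigroup_exp A (T - s) *v (dr s \<omega> - A *v D s \<omega>)) =
        (LINT s:{0..T}|lborel. semigroup_exp A (T - s) *v forcing Y r U s \<omega>)"
      unfolding set_lebesgue_integral_def
    proof (rule integral_cong_AE)
      note [measurable] = joint_section(1)[OF pdD T_nonneg elim(4)] joint_section(1)[OF pq T_nonneg elim(4)]
      have "(\<lambda>s. semigroup_exp A (T - s) *v (indicator {0..T} s *\<^sub>R (dr s \<omega> - A *v D s \<omega>))) \<in> borel_measurable lborel"
        by measurable
      then show "(\<lambda>s. indicator {0..T} s *\<^sub>R (semigroup_exp A (T - s) *v (dr s \<omega> - A *v D s \<omega>))) \<in> borel_measurable lborel"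
        by (simp add: mv.scaleR_right)
      have "(\<lambda>s. semigroup_exp A (T - s) *v (indicator {0..T} s *\<^sub>R forcing Y r U s \<omega>)) \<in> borel_measurable lborel"
        by measurable
      then show "(\<lambda>s. indicator {0..T} s *\<^sub>R (semigroup_exp A (T - s) *v forcing Y r U s \<omega>)) \<in> borel_measurable lborel"
        by (simp add: mv.scaleR_right)
      show "AE s in lborel. indicator {0..T} s *\<^sub>R (semigroup_exp A (T - s) *v (dr s \<omega> - A *v D s \<omega>)) =
          indicator {0..T} s *\<^sub>R (semigroup_exp A (T - s) *v forcing Y r U s \<omega>)"
        using elim(1)
      proof eventually_elim
        case (elim s)
        show ?case
        proof (cases "s \<in> {0..T}")
          case True
          with elim have "Z s \<omega> = D s \<omega> + Y s \<omega>" by simp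
          then have "dr s \<omega> - A *v D s \<omega> = forcing Y r U s \<omega>"
            by (simp add: dr_def forcing_def mv.add_right)
          then show ?thesis by simp
        qed simp
      qed
    qed
    finally show ?case using elim(3) by (simp add: flow_def)
  qed
  with r qi show ?thesis by blast
qed

end

section \<open>The noise that no control can remove\<close>

interpretation outer: bounded_bilinear "outer :: real^'n \<Rightarrow> real^'n \<Rightarrow> real^'n^'n"
  unfolding bilinear_conv_bounded_bilinear[symmetric] bilinear_def
  by (auto intro!: linearI simp: vec_eq_iff outer_def algebra_simps)

lemma borel_measurable_outer [measurable (raw)]:
  fixes f g :: "'a \<Rightarrow> real^'n"
  assumes "f \<in> borel_measurable N" "g \<in> borel_measurable N"
  shows "(\<lambda>x. outer (f x) (g x)) \<in> borel_measurable N"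
  by (rule borel_measurable_continuous_Pair[OF assms]) (intro outer.continuous_on continuous_intros)

lemma conjugate_outer: "X ** outer v v ** transpose X = outer (X *v v) (X *v v)"
  for X :: "real^'n^'n"
proof -
  have "(X ** outer v v ** transpose X) $ a $ b = outer (X *v v) (X *v v) $ a $ b" for a b
  proof -
    have "(X ** outer v v ** transpose X) $ a $ b = (\<Sum>c\<in>UNIV. (\<Sum>d\<in>UNIV. X $ a $ d * (v $ d * v $ c)) * X $ b $ c)"
      by (simp add: matrix_matrix_mult_def outer_def transpose_def)
    also have "\<dots> = (\<Sum>d\<in>UNIV. X $ a $ d * v $ d) * (\<Sum>c\<in>UNIV. X $ b $ c * v $ c)"
      unfolding sum_distrib_left sum_distrib_right by (intro sum.cong refl) (simp add: mult_ac)
    finally show ?thesis by (simp add: outer_def matrix_vector_mult_def)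
  qed
  then show ?thesis by (simp add: vec_eq_iff)
qed

text \<open>
  Values on a null set and outside \<open>[0, T]\<close> are set to zero, so that the integrands below are bounded and Borel
  measurable everywhere.
\<close>

lemma essentially_bounded_version:
  fixes \<sigma> :: "real \<Rightarrow> real^'n"
  assumes "essentially_bounded T \<sigma>"
  obtains \<sigma>' C where "\<sigma>' \<in> borel_measurable borel" "0 \<le> C"
    "\<And>s. norm (\<sigma>' s) \<le> C * indicator {0..T} s" "AE s in lborel. s \<in> {0..T} \<longrightarrow> \<sigma>' s = \<sigma> s"
proof -
  obtain C where m: "set_borel_measurable borel {0..T} \<sigma>"
    and C: "AE s in lborel. s \<in> {0..T} \<longrightarrow> norm (\<sigma> s) \<le> C"
    using assms by (auto simp: essentially_bounded_def)
  define g where "g s = indicator {0..T} s *\<^sub>R \<sigma> s" for s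
  have [measurable]: "g \<in> borel_measurable borel"
    using m by (simp add: g_def[abs_def] set_borel_measurable_def)
  define \<sigma>' where "\<sigma>' s = (if norm (g s) \<le> max C 0 then g s else 0)" for s
  show thesis
  proof (rule that[of \<sigma>' "max C 0"])
    show "\<sigma>' \<in> borel_measurable borel" unfolding \<sigma>'_def by measurable
    show "norm (\<sigma>' s) \<le> max C 0 * indicator {0..T} s" for s
      by (cases "s \<in> {0..T}") (auto simp: \<sigma>'_def g_def)
    show "AE s in lborel. s \<in> {0..T} \<longrightarrow> \<sigma>' s = \<sigma> s"
      using C by eventually_elim (auto simp: \<sigma>'_def g_def)
  qed simp
qed

text \<open>
  The left-hand side collects the effect at time \<open>T\<close> of a unit impulse \<open>y\<close> at time \<open>u\<close>: the impulse itself and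
  everything that it feeds into the drift later on. With \<open>s = u + v\<close> this is the flow started
  from \<open>y\<close> at time \<open>u\<close>.
\<close>

lemma flow_shift:
  fixes A :: "real^'n^'n" and g :: "real \<Rightarrow> real^'n"
  assumes u: "u \<in> {0..T}" and g: "set_integrable lborel {0..T - u} g" and g0: "\<And>v. v < 0 \<Longrightarrow> g v = 0"
  shows "y + (LINT s:{0..T}|lborel. semigroup_exp A (T - s) *v (A *v (if u \<le> s then y else 0) + g (s - u)))
    = flow A y g (T - u)"
proof -
  let ?w = "T - u"
  have w: "0 \<le> ?w" using u by simp
  let ?f = "\<lambda>s. indicator {0..T} s *\<^sub>R (semigroup_exp A (T - s) *v (A *v (if u \<le> s then y else 0) + g (s - u)))"
  have "(\<integral>s. ?f s \<partial>lborel) = (\<integral>v. ?f (u + 1 * v) \<partial>lborel)"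
    by (subst lborel_integral_real_affine[of 1 _ u]) auto
  also have "\<dots> = (LINT v:{0..?w}|lborel. semigroup_exp A (?w - v) *v (A *v y) + semigroup_exp A (?w - v) *v g v)"
    unfolding set_lebesgue_integral_def
  proof (rule Bochner_Integration.integral_cong)
    fix v
    have e: "T - (u + 1 * v) = ?w - v" by simp
    consider "v < 0" | "v \<in> {0..?w}" | "?w < v" by fastforce
    then show "?f (u + 1 * v) = indicator {0..?w} v *\<^sub>R (semigroup_exp A (?w - v) *v (A *v y) + semigroup_exp A (?w - v) *v g v)"
    proof cases
      case 2
      then have "u + v \<in> {0..T}" using u by auto
      then show ?thesis using 2 unfolding e by (simp add: mv.add_right)
    qed (use u g0 in \<open>auto simp: indicator_def\<close>)
  qed simp
  also have "\<dots> = (LINT v:{0..?w}|lborel. semigroup_exp A (?w - v) *v (A *v y)) +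
      (LINT v:{0..?w}|lborel. semigroup_exp A (?w - v) *v g v)"
    by (intro set_integral_add set_integrable_kernel_mult g set_integrable_continuous mv.continuous_on continuous_intros)
  also have "(LINT v:{0..?w}|lborel. semigroup_exp A (?w - v) *v (A *v y)) =
      (LINT v:{0..?w}|lborel. A ** semigroup_exp A (?w - v)) *v y"
  proof -
    have i: "set_integrable lborel {0..?w} (\<lambda>v. A ** semigroup_exp A (?w - v))"
      by (intro set_integrable_continuous mm.continuous_on continuous_intros)
    from integral_bounded_linear[OF mv.bounded_linear_left i[unfolded set_integrable_def], of y]
    show ?thesis
      by (simp only: set_lebesgue_integral_def mv.scaleR_left semigroup_exp_commute matrix_vector_mul_assoc)
  qed
  also have "\<dots> = semigroup_exp A ?w *v y - y"
    using LINT_semigroup_exp_right[OF w, of A] by (simp add: mv.diff_left)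
  finally show ?thesis unfolding flow_def set_lebesgue_integral_def by simp
qed

context controlled_system
begin

lemma Gam_set_integrable:
  assumes tri: "block_upper_triangular blk A B"
  shows "set_integrable lborel {0..h i} (Gam blk A G h i)"
proof (rule matrix_set_integrable(1))
  fix y
  have Gc: "continuous_on {0..h i} G"
    by (rule continuous_on_subset[OF C1_on_continuous[OF G_C1]]) (use h_le in auto)
  have "set_integrable lborel {0..h i} (\<lambda>s. G s *v y)"
    by (intro set_integrable_continuous mv.continuous_on Gc continuous_intros)
  then have "set_integrable lborel {0..h i} (flow A y (\<lambda>s. G s *v y))"
    using h_pos by (intro flow_solves(2)) (auto simp: less_imp_le)
  then have "set_integrable lborel {0..h i} (\<lambda>u. block_proj blk i *v flow A y (\<lambda>s. G s *v y) u)"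
    by (intro set_integrable_kernel_mult continuous_intros)
  then show "set_integrable lborel {0..h i} (\<lambda>u. Gam blk A G h i u *v y)"
    by (subst set_integrable_cong[OF refl refl Gam_eq_flow[OF h_mono h_pos tri C1_on_continuous[OF G_C1]]])
qed

text \<open>
  The Wiener integral of \<open>\<Phi>\<close> is the part of the state at time \<open>T\<close> that stems from the noise and not from the
  initial value, the history or the control.
\<close>

definition free_noise_kernel :: "(real \<Rightarrow> real^'n) \<Rightarrow> bool" where
  "free_noise_kernel \<Phi> \<longleftrightarrow> (\<forall>Y r. Y \<in> L2_progressive M F T \<longrightarrow>
      (\<forall>t\<in>{0..T}. has_wiener_integral M W \<sigma> 0 t (Y t)) \<longrightarrow> noise_memory M F W T h G \<sigma> r \<longrightarrow>
      wiv \<Phi> (\<lambda>\<omega>. Y T \<omega> + (LINT s:{0..T}|lborel. semigroup_exp A (T - s) *v (A *v Y s \<omega> + r s \<omega>))) \<and>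
      (AE \<omega> in M. set_integrable lborel {0..T} (\<lambda>s. semigroup_exp A (T - s) *v (A *v Y s \<omega> + r s \<omega>))))"

text \<open>
  The kernel \<open>\<Phi> u\<close> is the sum of \<open>\<sigma>(u)\<close> and of the time integral of the kernels of
  \<open>e\<^sup>A\<^sup>(\<^sup>T\<^sup>-\<^sup>s\<^sup>) (A Y(s) + r(s))\<close>. By \<open>flow_shift\<close> it is the flow started from \<open>\<sigma>(u)\<close> with forcing \<open>G \<sigma>(u)\<close>, and
  \<open>Gam_eq_flow\<close> identifies its blocks.
\<close>

theorem open_loop_kernel:
  fixes blk :: "'n \<Rightarrow> 'm"
  assumes tri: "block_upper_triangular blk A B"
  obtains \<Phi> C where "\<Phi> \<in> borel_measurable borel" "0 \<le> C" "\<And>u. norm (\<Phi> u) \<le> C * indicator {0..T} u"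
    "free_noise_kernel \<Phi>"
    "\<And>i. AE u in lborel. u \<in> {T - h i..T} \<longrightarrow> Gam blk A G h i (T - u) *v \<sigma> u = block_proj blk i *v \<Phi> u"
proof -
  let ?d = "last_delay h"
  obtain \<sigma>' C where \<sigma>'m[measurable]: "\<sigma>' \<in> borel_measurable borel" and C: "0 \<le> C"
    and \<sigma>'b: "\<And>s. norm (\<sigma>' s) \<le> C * indicator {0..T} s" and \<sigma>'e: "AE s in lborel. s \<in> {0..T} \<longrightarrow> \<sigma>' s = \<sigma> s"
    by (rule essentially_bounded_version[OF \<sigma>_bounded]) (rule that)
  have \<sigma>'0: "\<sigma>' s = 0" if "s \<notin> {0..T}" for s using \<sigma>'b[of s] that by simp
  define Gx where "Gx v = indicator {0..?d} v *\<^sub>R G v" for v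
  have Gxm[measurable]: "Gx \<in> borel_measurable borel"
    unfolding Gx_def by (intro borel_measurable_continuous_on_indicator C1_on_continuous[OF G_C1]) simp
  obtain K where K: "0 \<le> K" "\<And>v. norm (Gx v) \<le> K"
  proof -
    obtain K L where K: "0 \<le> K" "0 \<le> L" "\<And>x. x \<in> {0..?d} \<Longrightarrow> norm (G x) \<le> K"
      "\<And>x y. x \<in> {0..?d} \<Longrightarrow> y \<in> {0..?d} \<Longrightarrow> norm (G x - G y) \<le> L * \<bar>x - y\<bar>"
      using C1_on_Lipschitz[OF G_C1] by metis
    then have "norm (Gx v) \<le> K" for v by (cases "v \<in> {0..?d}") (auto simp: Gx_def)
    with K(1) show thesis by (rule that)
  qed
  have "continuous_on {0..T} (\<lambda>s. semigroup_exp A (T - s))" by (intro continuous_intros)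
  from continuous_compact_bound[OF compact_Icc this]
  obtain CE where CE: "0 \<le> CE" "\<And>s. s \<in> {0..T} \<Longrightarrow> norm (semigroup_exp A (T - s)) \<le> CE"
    by blast
  obtain \<kappa> where \<kappa>: "0 < \<kappa>" "\<And>(X::real^'n^'n) v. norm (X *v v) \<le> norm X * norm v * \<kappa>"
    using mv_norm_bound by blast
  define kY where "kY s u = (if u \<le> s then \<sigma>' u else 0)" for s u
  define kr where "kr s u = Gx (s - u) *v \<sigma>' u" for s u
  define k where "k s u = semigroup_exp A (T - s) *v (A *v kY s u + kr s u)" for s u
  define \<Phi> where "\<Phi> u = kY T u + (LINT s:{0..T}|lborel. k s u)" for u
  have kYb: "norm (kY s u) \<le> C * indicator {0..T} u" for s u
    using \<sigma>'b[of u] C by (auto simp: kY_def)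
  have krb: "norm (kr s u) \<le> K * C * \<kappa> * indicator {0..T} u" for s u
  proof -
    have "norm (kr s u) \<le> norm (Gx (s - u)) * norm (\<sigma>' u) * \<kappa>" unfolding kr_def by (rule \<kappa>)
    also have "\<dots> \<le> K * (C * indicator {0..T} u) * \<kappa>"
      using K \<kappa>(1) \<sigma>'b by (intro mult_right_mono mult_mono) auto
    finally show ?thesis by (simp add: mult_ac)
  qed
  define Ck where "Ck = CE * (norm A * C * \<kappa> + K * C * \<kappa>) * \<kappa>"
  have Ck: "0 \<le> Ck" using CE K C \<kappa> by (simp add: Ck_def)
  have kb: "norm (k s u) \<le> Ck * indicator {0..T} u" if "s \<in> {0..T}" for s u
  proof -
    have "norm (A *v kY s u) \<le> norm A * norm (kY s u) * \<kappa>" by (rule \<kappa>)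
    also have "\<dots> \<le> norm A * (C * indicator {0..T} u) * \<kappa>"
      using \<kappa>(1) kYb by (intro mult_right_mono mult_left_mono) auto
    finally have "norm (A *v kY s u + kr s u) \<le> (norm A * C * \<kappa> + K * C * \<kappa>) * indicator {0..T} u"
      using krb[of s u] norm_triangle_ineq[of "A *v kY s u" "kr s u"] by (simp add: algebra_simps)
    moreover have "norm (k s u) \<le> norm (semigroup_exp A (T - s)) * norm (A *v kY s u + kr s u) * \<kappa>"
      unfolding k_def by (rule \<kappa>)
    ultimately have "norm (k s u) \<le> CE * ((norm A * C * \<kappa> + K * C * \<kappa>) * indicator {0..T} u) * \<kappa>"
      using CE(2)[OF that] CE(1) \<kappa>(1)
      by (meson less_imp_le mult_mono mult_right_mono norm_ge_zero order_trans)
    then show ?thesis by (simp add: Ck_def mult_ac)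
  qed
  have km: "(\<lambda>(s, u). k s u) \<in> borel_measurable (borel \<Otimes>\<^sub>M borel)"
    unfolding k_def kY_def kr_def by measurable
  have km': "(\<lambda>(s, u). indicator {0..T} s *\<^sub>R k s u) \<in> borel_measurable (lborel \<Otimes>\<^sub>M lborel)"
    using km by measurable
  have wivY: "wiv (kY s) (Y s)" if "has_wiener_integral M W \<sigma> 0 s (Y s)" "s \<in> {0..T}" for Y :: "real \<Rightarrow> 'w \<Rightarrow> real^'n" and s
  proof -
    note w = wiener_integral_wiv[OF that(1) order_refl]
    show ?thesis
    proof (rule wiv_cong_AE[OF w])
      show "AE u in lborel. indicator {0..s} u *\<^sub>R \<sigma> u = kY s u"
        using \<sigma>'e
      proof eventually_elim
        case (elim u)
        then show ?case using \<sigma>'0[of u] that(2) by (cases "u \<in> {0..T}") (auto simp: kY_def indicator_def)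
      qed
      show "kY s \<in> borel_measurable borel" unfolding kY_def by measurable
    qed (simp_all add: wiv_measurable[OF w])
  qed
  have wivr: "wiv (kr s) (r s)" if "noise_memory M F W T h G \<sigma> r" "s \<in> {0..T}" for r s
  proof -
    have "has_wiener_integral M W (\<lambda>u. G (s - u) *v \<sigma> u) (max 0 (s - ?d)) s (r s)"
      using that by (simp add: noise_memory_def)
    note w = wiener_integral_wiv[OF this max.cobounded1]
    show ?thesis
    proof (rule wiv_cong_AE[OF w])
      show "AE u in lborel. indicator {max 0 (s - ?d)..s} u *\<^sub>R (G (s - u) *v \<sigma> u) = kr s u"
        using \<sigma>'e
      proof eventually_elim
        case (elim u)
        show ?case
        proof (cases "u \<in> {0..T}")
          case True
          then show ?thesis using elim by (auto simp: kr_def Gx_def indicator_def)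
        next
          case False
          then show ?thesis using \<sigma>'0[OF False] that(2) by (auto simp: kr_def indicator_def)
        qed
      qed
      show "kr s \<in> borel_measurable borel" unfolding kr_def by measurable
    qed (simp_all add: wiv_measurable[OF w])
  qed
  have \<Phi>m: "\<Phi> \<in> borel_measurable borel"
  proof -
    have "(\<lambda>(u, s). indicator {0..T} s *\<^sub>R k s u) \<in> borel_measurable (borel \<Otimes>\<^sub>M lborel)"
      using km by measurable
    then have "(\<lambda>u. LINT s:{0..T}|lborel. k s u) \<in> borel_measurable borel"
      unfolding set_lebesgue_integral_def by (rule lborel.borel_measurable_lebesgue_integral)
    then show ?thesis unfolding \<Phi>_def kY_def by measurable
  qed
  have \<Phi>b: "norm (\<Phi> u) \<le> (C + Ck * T) * indicator {0..T} u" for u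
  proof -
    have "norm (LINT s:{0..T}|lborel. k s u) \<le> (\<integral>s. norm (indicator {0..T} s *\<^sub>R k s u) \<partial>lborel)"
      unfolding set_lebesgue_integral_def by (rule integral_norm_bound)
    also have "\<dots> \<le> (\<integral>s. Ck * indicator {0..T} u * indicator {0..T} s \<partial>lborel)"
    proof (rule integral_mono')
      show "integrable lborel (\<lambda>s. Ck * indicator {0..T} u * indicator {0..T} s)"
        using T_nonneg by (intro integrable_mult_right integrable_real_indicator) auto
      show "norm (indicator {0..T} s *\<^sub>R k s u) \<le> Ck * indicator {0..T} u * indicator {0..T} s" for s
        using kb[of s u] by (auto simp: indicator_def)
    qed (use Ck in simp)
    also have "\<dots> = Ck * T * indicator {0..T} u" using T_nonneg by simp
    finally show ?thesis
      unfolding \<Phi>_def using kYb[of T u] norm_triangle_ineq[of "kY T u" "LINT s:{0..T}|lborel. k s u"]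
      by (simp add: algebra_simps)
  qed
  have noise: "wiv \<Phi> (\<lambda>\<omega>. Y T \<omega> + (LINT s:{0..T}|lborel. semigroup_exp A (T - s) *v (A *v Y s \<omega> + r s \<omega>))) \<and>
      (AE \<omega> in M. set_integrable lborel {0..T} (\<lambda>s. semigroup_exp A (T - s) *v (A *v Y s \<omega> + r s \<omega>)))"
    if Y: "Y \<in> L2_progressive M F T" "\<And>t. t \<in> {0..T} \<Longrightarrow> has_wiener_integral M W \<sigma> 0 t (Y t)"
      and r: "noise_memory M F W T h G \<sigma> r" for Y r
  proof -
    have rL: "r \<in> L2_progressive M F T" using r by (simp add: noise_memory_def)
    have "progressively_measurable F T (\<lambda>s \<omega>. A *v Y s \<omega> + r s \<omega>)"
      by (intro progressive_add progressive_mv L2_progressiveD(1) Y(1) rL)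
    note [measurable] = progressive_joint[OF this T_nonneg]
    have "(\<lambda>(s, \<omega>). semigroup_exp A (T - s) *v (indicator {0..T} s *\<^sub>R (A *v Y s \<omega> + r s \<omega>))) \<in> borel_measurable (lborel \<Otimes>\<^sub>M M)"
      by measurable
    then have xm: "(\<lambda>(s, \<omega>). indicator {0..T} s *\<^sub>R (semigroup_exp A (T - s) *v (A *v Y s \<omega> + r s \<omega>))) \<in> borel_measurable (lborel \<Otimes>\<^sub>M M)"
      by (simp only: mv.scaleR_right)
    have w: "wiv (k s) (\<lambda>\<omega>. semigroup_exp A (T - s) *v (A *v Y s \<omega> + r s \<omega>))" if "s \<in> {0..T}" for s
      unfolding k_def by (intro wiv_mv wiv_add wivY wivr that Y r)
    have "wiv (\<lambda>u. LINT s:{0..T}|lborel. k s u)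
        (\<lambda>\<omega>. LINT s:{0..T}|lborel. semigroup_exp A (T - s) *v (A *v Y s \<omega> + r s \<omega>))"
      by (rule wiv_time_integral(1)[OF T_nonneg xm km' w kb])
    moreover have "AE \<omega> in M. set_integrable lborel {0..T} (\<lambda>s. semigroup_exp A (T - s) *v (A *v Y s \<omega> + r s \<omega>))"
      by (rule wiv_time_integral(2)[OF T_nonneg xm km' w kb])
    moreover have "wiv (kY T) (Y T)" by (rule wivY) (use Y T_nonneg in auto)
    ultimately show ?thesis unfolding \<Phi>_def[abs_def] using wiv_add by blast
  qed
  have gam: "AE u in lborel. u \<in> {T - h i..T} \<longrightarrow> Gam blk A G h i (T - u) *v \<sigma> u = block_proj blk i *v \<Phi> u" for i
    using \<sigma>'e
  proof eventually_elim
    case (elim u)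
    show ?case
    proof
      assume u: "u \<in> {T - h i..T}"
      have hi: "h i \<le> ?d" "h i < T" using h_le[of i] horizon by auto
      then have uT: "u \<in> {0..T}" using u by auto
      then have eq: "\<sigma>' u = \<sigma> u" using elim by simp
      have Gc: "continuous_on {0..T - u} G"
        by (rule continuous_on_subset[OF C1_on_continuous[OF G_C1]]) (use u hi in auto)
      have GG: "Gx v = G v" if "v \<in> {0..T - u}" for v using that u hi by (simp add: Gx_def)
      have gi: "set_integrable lborel {0..T - u} (\<lambda>v. Gx v *v \<sigma>' u)"
        by (subst set_integrable_cong[OF refl refl, where f' = "\<lambda>v. G v *v \<sigma>' u"])
           (auto simp: GG intro!: set_integrable_continuous mv.continuous_on Gc continuous_intros)
      have "\<Phi> u = flow A (\<sigma>' u) (\<lambda>v. Gx v *v \<sigma>' u) (T - u)"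
        unfolding \<Phi>_def k_def kY_def kr_def
        using flow_shift[OF uT gi] uT by (simp add: Gx_def)
      also have "\<dots> = flow A (\<sigma>' u) (\<lambda>v. G v *v \<sigma>' u) (T - u)"
        by (rule flow_cong) (simp add: GG)
      finally have "\<Phi> u = flow A (\<sigma> u) (\<lambda>v. G v *v \<sigma> u) (T - u)" by (simp add: eq)
      moreover have "Gam blk A G h i (T - u) *v \<sigma> u = block_proj blk i *v flow A (\<sigma> u) (\<lambda>v. G v *v \<sigma> u) (T - u)"
        by (rule Gam_eq_flow[OF h_mono h_pos tri C1_on_continuous[OF G_C1]]) (use u in auto)
      ultimately show "Gam blk A G h i (T - u) *v \<sigma> u = block_proj blk i *v \<Phi> u" by simp
    qed
  qed
  have "0 \<le> C + Ck * T" using C Ck T_nonneg by simp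
  moreover have "free_noise_kernel \<Phi>" unfolding free_noise_kernel_def using noise by blast
  ultimately show thesis using that[OF \<Phi>m _ \<Phi>b _ gam] by blast
qed

lemma Sigma_min_entry:
  assumes tri: "block_upper_triangular blk A B" and \<Phi>m: "\<Phi> \<in> borel_measurable borel"
    and \<Phi>b: "\<And>u. norm (\<Phi> u) \<le> C * indicator {0..T} u" and C: "0 \<le> C"
    and gam: "AE u in lborel. u \<in> {T - h i..T} \<longrightarrow> Gam blk A G h i (T - u) *v \<sigma> u = block_proj blk i *v \<Phi> u"
  shows "Sigma_min blk A G h \<sigma> T i $ a $ b =
    (LINT u:{T - h i..T}|lborel. (block_proj blk i *v \<Phi> u) $ a * (block_proj blk i *v \<Phi> u) $ b)"
proof -
  let ?S = "{T - h i..T}" and ?p = "\<lambda>u. block_proj blk i *v \<Phi> u" and ?X = "\<lambda>u. Gam blk A G h i (T - u)"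
  note [measurable] = \<Phi>m
  have hi: "0 < h i" "h i < T" using h_pos h_le[of i] horizon by auto
  have Xm[measurable]: "(\<lambda>u. indicator ?S u *\<^sub>R ?X u) \<in> borel_measurable borel"
  proof -
    have "(\<lambda>v. indicator {0..h i} v *\<^sub>R Gam blk A G h i v) \<in> borel_measurable borel"
      using borel_measurable_integrable[OF Gam_set_integrable[OF tri, of i, unfolded set_integrable_def]] by simp
    then have "(\<lambda>u. indicator {0..h i} (T - u) *\<^sub>R Gam blk A G h i (T - u)) \<in> borel_measurable borel"
      by (rule measurable_compose[rotated]) measurable
    also have "(\<lambda>u. indicator {0..h i} (T - u) *\<^sub>R Gam blk A G h i (T - u)) = (\<lambda>u. indicator ?S u *\<^sub>R ?X u)"
      by (auto simp: fun_eq_iff indicator_def)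
    finally show ?thesis .
  qed
  have \<sigma>m[measurable]: "(\<lambda>u. indicator {0..T} u *\<^sub>R \<sigma> u) \<in> borel_measurable borel"
    using \<sigma>_bounded by (simp add: essentially_bounded_def set_borel_measurable_def)
  have pm[measurable]: "?p \<in> borel_measurable borel" by measurable
  have "Sigma_min blk A G h \<sigma> T i = (\<integral>u. indicator ?S u *\<^sub>R outer (?X u *v \<sigma> u) (?X u *v \<sigma> u) \<partial>lborel)"
    unfolding Sigma_min_def set_lebesgue_integral_def conjugate_outer ..
  also have "\<dots> = (\<integral>u. indicator ?S u *\<^sub>R outer (?p u) (?p u) \<partial>lborel)"
  proof (rule integral_cong_AE)
    have "(\<lambda>u. outer ((indicator ?S u *\<^sub>R ?X u) *v (indicator {0..T} u *\<^sub>R \<sigma> u))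
        ((indicator ?S u *\<^sub>R ?X u) *v (indicator {0..T} u *\<^sub>R \<sigma> u))) \<in> borel_measurable lborel"
      by measurable
    also have "(\<lambda>u. outer ((indicator ?S u *\<^sub>R ?X u) *v (indicator {0..T} u *\<^sub>R \<sigma> u))
        ((indicator ?S u *\<^sub>R ?X u) *v (indicator {0..T} u *\<^sub>R \<sigma> u))) =
        (\<lambda>u. indicator ?S u *\<^sub>R outer (?X u *v \<sigma> u) (?X u *v \<sigma> u))"
      using hi by (auto simp: fun_eq_iff indicator_def outer.zero_left)
    finally show "(\<lambda>u. indicator ?S u *\<^sub>R outer (?X u *v \<sigma> u) (?X u *v \<sigma> u)) \<in> borel_measurable lborel" .
    show "(\<lambda>u. indicator ?S u *\<^sub>R outer (?p u) (?p u)) \<in> borel_measurable lborel" by measurable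
    show "AE u in lborel. indicator ?S u *\<^sub>R outer (?X u *v \<sigma> u) (?X u *v \<sigma> u) = indicator ?S u *\<^sub>R outer (?p u) (?p u)"
      using gam by eventually_elim (auto simp: indicator_def)
  qed
  finally have eq: "Sigma_min blk A G h \<sigma> T i = (\<integral>u. indicator ?S u *\<^sub>R outer (?p u) (?p u) \<partial>lborel)" .
  have I: "integrable lborel (\<lambda>u. indicator ?S u *\<^sub>R outer (?p u) (?p u))"
  proof -
    obtain \<kappa> where \<kappa>: "0 < \<kappa>" "\<And>(X::real^'n^'n) v. norm (X *v v) \<le> norm X * norm v * \<kappa>"
      using mv_norm_bound by blast
    obtain \<kappa>' where \<kappa>': "0 < \<kappa>'" "\<And>(v::real^'n) w. norm (outer v w) \<le> norm v * norm w * \<kappa>'"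
      using outer.pos_bounded by blast
    define D where "D = norm (block_proj blk i :: real^'n^'n) * C * \<kappa>"
    have pD: "norm (?p u) \<le> D" for u
    proof -
      have "norm (\<Phi> u) \<le> C" using \<Phi>b[of u] C by (cases "u \<in> {0..T}") auto
      then have "norm (block_proj blk i :: real^'n^'n) * norm (\<Phi> u) * \<kappa> \<le> D"
        unfolding D_def using \<kappa>(1) by (intro mult_right_mono mult_left_mono) auto
      with \<kappa>(2)[of "block_proj blk i" "\<Phi> u"] show ?thesis by linarith
    qed
    then have D0: "0 \<le> D" using norm_ge_zero order_trans by blast
    show ?thesis
    proof (rule Bochner_Integration.integrable_bound)
      show "integrable lborel (\<lambda>u. (D * D * \<kappa>') * indicator ?S u :: real)"
        using hi by (intro integrable_mult_right integrable_real_indicator) auto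
      show "(\<lambda>u. indicator ?S u *\<^sub>R outer (?p u) (?p u)) \<in> borel_measurable lborel" by measurable
      show "AE u in lborel. norm (indicator ?S u *\<^sub>R outer (?p u) (?p u)) \<le> norm ((D * D * \<kappa>') * indicator ?S u :: real)"
      proof (rule AE_I2)
        fix u
        have "norm (outer (?p u) (?p u)) \<le> norm (?p u) * norm (?p u) * \<kappa>'" by (rule \<kappa>')
        also have "\<dots> \<le> D * D * \<kappa>'" using pD[of u] D0 \<kappa>'(1) by (intro mult_right_mono mult_mono) auto
        finally show "norm (indicator ?S u *\<^sub>R outer (?p u) (?p u)) \<le> norm ((D * D * \<kappa>') * indicator ?S u :: real)"
          using D0 \<kappa>'(1) by (simp add: indicator_def abs_mult)
      qed
    qed
  qed
  have bl: "bounded_linear (\<lambda>Z::real^'n^'n. Z $ a $ b)"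
    by (intro bounded_linear_compose[OF bounded_linear_vec_nth bounded_linear_vec_nth])
  show ?thesis
    unfolding eq using integral_bounded_linear[OF bl I]
    by (simp add: set_lebesgue_integral_def outer_def)
qed

end

section \<open>Realising a covariance\<close>

text \<open>
  Each vector occupies half of the interval that is still free, with a value normalised by the square
  root of the length; the disjointness of the pieces removes the mixed terms.
\<close>

lemma realise_covariance:
  fixes ys :: "(real^'n) list" and \<alpha> \<beta> :: real
  assumes "\<alpha> < \<beta>" and "\<forall>y\<in>set ys. \<forall>r. r \<notin> K \<longrightarrow> y $ r = 0"
  shows "\<exists>\<phi> C. \<phi> \<in> borel_measurable borel \<and> 0 \<le> C \<and> (\<forall>s. norm (\<phi> s) \<le> C) \<and>
    (\<forall>s. s \<notin> {\<alpha><..\<beta>} \<longrightarrow> \<phi> s = 0) \<and> (\<forall>s r. r \<notin> K \<longrightarrow> \<phi> s $ r = 0) \<and>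
    (\<forall>a b. integrable lborel (\<lambda>s. \<phi> s $ a * \<phi> s $ b) \<and>
      (\<integral>s. \<phi> s $ a * \<phi> s $ b \<partial>lborel) = (\<Sum>y\<leftarrow>ys. outer y y) $ a $ b)"
  using assms
proof (induction ys arbitrary: \<alpha>)
  case Nil
  then show ?case by (intro exI[of _ "\<lambda>_. 0"] exI[of _ 0]) auto
next
  case (Cons y ys)
  (* The first half carries y, the second half is left for the other vectors. *)
  define \<gamma> where "\<gamma> = (\<alpha> + \<beta>) / 2"
  have \<gamma>: "\<alpha> < \<gamma>" "\<gamma> < \<beta>" using Cons.prems(1) by (auto simp: \<gamma>_def)
  obtain \<phi> C where \<phi>: "\<phi> \<in> borel_measurable borel" "0 \<le> C" "\<And>s. norm (\<phi> s) \<le> C"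
    "\<And>s. s \<notin> {\<gamma><..\<beta>} \<Longrightarrow> \<phi> s = 0" "\<And>s r. r \<notin> K \<Longrightarrow> \<phi> s $ r = 0"
    "\<And>a b. integrable lborel (\<lambda>s. \<phi> s $ a * \<phi> s $ b)"
    "\<And>a b. (\<integral>s. \<phi> s $ a * \<phi> s $ b \<partial>lborel) = (\<Sum>y\<leftarrow>ys. outer y y) $ a $ b"
    using Cons.IH[OF \<gamma>(2)] Cons.prems(2) by auto
  define c where "c = 1 / sqrt (\<gamma> - \<alpha>)"
  have c: "c * c * (\<gamma> - \<alpha>) = 1" using \<gamma> by (simp add: c_def)
  define \<psi> where "\<psi> s = (indicator {\<alpha><..\<gamma>} s * c) *\<^sub>R y + \<phi> s" for s
  have [measurable]: "\<phi> \<in> borel_measurable borel" by (rule \<phi>)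
  have prod: "\<psi> s $ a * \<psi> s $ b = (c * c * (y $ a * y $ b)) * indicator {\<alpha><..\<gamma>} s + \<phi> s $ a * \<phi> s $ b" for s a b
    using \<phi>(4)[of s] by (auto simp: \<psi>_def indicator_def)
  have i: "integrable lborel (indicator {\<alpha><..\<gamma>} :: real \<Rightarrow> real)"
    using \<gamma> by (intro integrable_real_indicator) auto
  show ?case
  proof (intro exI[of _ \<psi>] exI[of _ "\<bar>c\<bar> * norm y + C"] conjI allI impI)
    show "\<psi> \<in> borel_measurable borel" unfolding \<psi>_def by measurable
    show "0 \<le> \<bar>c\<bar> * norm y + C" using \<phi>(2) by simp
    fix s
    have "norm ((indicator {\<alpha><..\<gamma>} s * c) *\<^sub>R y) \<le> \<bar>c\<bar> * norm y" by (simp add: indicator_def)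
    then show "norm (\<psi> s) \<le> \<bar>c\<bar> * norm y + C"
      unfolding \<psi>_def using norm_triangle_ineq[of "(indicator {\<alpha><..\<gamma>} s * c) *\<^sub>R y" "\<phi> s"] \<phi>(3)[of s] by linarith
    show "\<psi> s = 0" if "s \<notin> {\<alpha><..\<beta>}"
      using \<phi>(4)[of s] that \<gamma> by (auto simp: \<psi>_def)
    show "\<psi> s $ r = 0" if "r \<notin> K" for r
      using \<phi>(5)[OF that] Cons.prems(2) that by (simp add: \<psi>_def)
    fix a b
    show "integrable lborel (\<lambda>s. \<psi> s $ a * \<psi> s $ b)"
      unfolding prod by (intro Bochner_Integration.integrable_add integrable_mult_right i \<phi>(6))
    have "(\<integral>s. \<psi> s $ a * \<psi> s $ b \<partial>lborel) = (c * c * (y $ a * y $ b)) * (\<gamma> - \<alpha>) + (\<Sum>y\<leftarrow>ys. outer y y) $ a $ b"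
      unfolding prod using i \<phi>(6,7) \<gamma> by simp
    also have "(c * c * (y $ a * y $ b)) * (\<gamma> - \<alpha>) = outer y y $ a $ b"
      using c by (simp add: outer_def mult_ac)
    finally show "(\<integral>s. \<psi> s $ a * \<psi> s $ b \<partial>lborel) = (\<Sum>y\<leftarrow>y # ys. outer y y) $ a $ b" by simp
  qed
qed

lemma block_mv_eq_proj: "block blk i i S *v x = block_proj blk i *v (S *v (block_proj blk i *v x))"
proof -
  have nth: "(S *v y) $ r = (\<Sum>c\<in>UNIV. S $ r $ c * y $ c)" for y r
    by (simp add: matrix_vector_mult_def)
  have "(\<Sum>c | blk c = i. S $ r $ c * x $ c) = (S *v (block_proj blk i *v x)) $ r" for r
    unfolding nth block_proj_nth
    by (rule sum.mono_neutral_cong_left) auto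
  then show ?thesis by (simp add: vec_eq_iff block_mv_nth block_proj_nth)
qed

lemma block_proj_inner: "(block_proj blk i *v x) \<bullet> y = x \<bullet> (block_proj blk i *v y)"
  by (auto simp: inner_vec_def block_proj_nth intro!: sum.cong)

text \<open>
  The quadratic form of the block of the target at \<open>x\<close> is at least \<open>c |P x|\<^sup>2\<close>, and that of the noise
  collected during \<open>(\<alpha>, \<beta>]\<close> is at most \<open>C\<^sup>2 (\<beta> - \<alpha>) |P x|\<^sup>2\<close>, where \<open>P\<close> is the projection to the block. So the
  difference is positive semidefinite.
\<close>

lemma covariance_deficit:
  fixes blk :: "'n::finite \<Rightarrow> 'm" and S :: "real^('n::_)^('n::_)" and \<Phi> :: "real \<Rightarrow> real^('n::_)"
  assumes S: "transpose S = S" "\<And>x. c * (x \<bullet> x) \<le> x \<bullet> (S *v x)"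
    and \<Phi>: "\<Phi> \<in> borel_measurable borel" "\<And>u. norm (\<Phi> u) \<le> C" and C: "0 \<le> C"
    and ab: "\<alpha> \<le> \<beta>" and small: "C\<^sup>2 * (\<beta> - \<alpha>) \<le> c"
  shows "\<exists>ys. (\<forall>y\<in>set ys. \<forall>r. r \<notin> {r. blk r = i} \<longrightarrow> y $ r = 0) \<and>
    (\<forall>a b. integrable lborel (\<lambda>u. indicator {\<alpha><..\<beta>} u * ((block_proj blk i *v \<Phi> u) $ a * (block_proj blk i *v \<Phi> u) $ b)) \<and>
      (\<Sum>y\<leftarrow>ys. outer y y) $ a $ b + (\<integral>u. indicator {\<alpha><..\<beta>} u * ((block_proj blk i *v \<Phi> u) $ a * (block_proj blk i *v \<Phi> u) $ b) \<partial>lborel)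
        = block blk i i S $ a $ b)"
proof -
  let ?P = "block_proj blk i" and ?I = "\<lambda>u. indicator {\<alpha><..\<beta>} u :: real"
  note [measurable] = \<Phi>(1)
  have comp: "\<bar>(?P *v \<Phi> u) $ a\<bar> \<le> C" for u a
    using component_le_norm_cart[of "\<Phi> u" a] \<Phi>(2)[of u] C by (simp add: block_proj_nth)
  have iI: "integrable lborel ?I" using ab by (intro integrable_real_indicator) auto
  have int: "integrable lborel (\<lambda>u. ?I u * ((?P *v \<Phi> u) $ a * (?P *v \<Phi> u) $ b))" for a b
  proof (rule Bochner_Integration.integrable_bound)
    show "integrable lborel (\<lambda>u. C * C * ?I u)" by (intro integrable_mult_right iI)
    show "(\<lambda>u. ?I u * ((?P *v \<Phi> u) $ a * (?P *v \<Phi> u) $ b)) \<in> borel_measurable lborel" by measurable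
    show "AE u in lborel. norm (?I u * ((?P *v \<Phi> u) $ a * (?P *v \<Phi> u) $ b)) \<le> norm (C * C * ?I u)"
    proof (rule AE_I2)
      fix u
      have "\<bar>(?P *v \<Phi> u) $ a\<bar> * \<bar>(?P *v \<Phi> u) $ b\<bar> \<le> C * C"
        using comp C by (intro mult_mono) auto
      then show "norm (?I u * ((?P *v \<Phi> u) $ a * (?P *v \<Phi> u) $ b)) \<le> norm (C * C * ?I u)"
        by (simp add: indicator_def abs_mult)
    qed
  qed
  define R where "R = (\<chi> a b. \<integral>u. ?I u * ((?P *v \<Phi> u) $ a * (?P *v \<Phi> u) $ b) \<partial>lborel)"
  define D where "D = block blk i i S - R"
  have symS: "S $ a $ b = S $ b $ a" for a b using S(1) by (metis transpose_def vec_lambda_beta)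
  have quadR: "x \<bullet> (R *v x) = (\<integral>u. ?I u * (\<Phi> u \<bullet> (?P *v x))\<^sup>2 \<partial>lborel)" for x
  proof -
    have "x \<bullet> (R *v x) = (\<Sum>a\<in>UNIV. \<Sum>b\<in>UNIV. x $ a * x $ b * R $ a $ b)"
      by (simp add: inner_vec_def matrix_vector_mult_def sum_distrib_left mult_ac)
    also have "\<dots> = (\<Sum>a\<in>UNIV. \<Sum>b\<in>UNIV. \<integral>u. x $ a * x $ b * (?I u * ((?P *v \<Phi> u) $ a * (?P *v \<Phi> u) $ b)) \<partial>lborel)"
      by (simp add: R_def int)
    also have "\<dots> = (\<integral>u. (\<Sum>a\<in>UNIV. \<Sum>b\<in>UNIV. x $ a * x $ b * (?I u * ((?P *v \<Phi> u) $ a * (?P *v \<Phi> u) $ b))) \<partial>lborel)"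
    proof -
      have i2: "integrable lborel (\<lambda>u. x $ a * x $ b * (?I u * ((?P *v \<Phi> u) $ a * (?P *v \<Phi> u) $ b)))" for a b
        by (intro integrable_mult_right int)
      show ?thesis
        by (subst Bochner_Integration.integral_sum)
           (intro Bochner_Integration.integrable_sum i2, subst Bochner_Integration.integral_sum, rule i2, rule refl)
    qed
    also have "\<dots> = (\<integral>u. ?I u * (\<Phi> u \<bullet> (?P *v x))\<^sup>2 \<partial>lborel)"
    proof (rule Bochner_Integration.integral_cong)
      fix u
      have "(\<Phi> u \<bullet> (?P *v x)) = (\<Sum>a\<in>UNIV. x $ a * (?P *v \<Phi> u) $ a)"
        unfolding block_proj_inner[symmetric] by (simp add: inner_vec_def mult.commute)
      then have "(\<Phi> u \<bullet> (?P *v x))\<^sup>2 = (\<Sum>a\<in>UNIV. \<Sum>b\<in>UNIV. (x $ a * (?P *v \<Phi> u) $ a) * (x $ b * (?P *v \<Phi> u) $ b))"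
        by (simp add: power2_eq_square sum_product)
      then show "(\<Sum>a\<in>UNIV. \<Sum>b\<in>UNIV. x $ a * x $ b * (?I u * ((?P *v \<Phi> u) $ a * (?P *v \<Phi> u) $ b))) =
          ?I u * (\<Phi> u \<bullet> (?P *v x))\<^sup>2"
        by (simp add: sum_distrib_left mult_ac)
    qed simp
    finally show ?thesis .
  qed
  have "transpose D = D"
    by (auto simp: D_def transpose_def vec_eq_iff block_def symS R_def mult_ac)
  moreover have "0 \<le> x \<bullet> (D *v x)" for x
  proof -
    let ?y = "?P *v x"
    have "x \<bullet> (R *v x) \<le> (\<integral>u. (C\<^sup>2 * (?y \<bullet> ?y)) * ?I u \<partial>lborel)"
      unfolding quadR
    proof (rule integral_mono')
      show "integrable lborel (\<lambda>u. (C\<^sup>2 * (?y \<bullet> ?y)) * ?I u)" by (intro integrable_mult_right iI)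
      fix u
      have "\<bar>\<Phi> u \<bullet> ?y\<bar> \<le> norm (\<Phi> u) * norm ?y" by (rule Cauchy_Schwarz_ineq2)
      also have "\<dots> \<le> C * norm ?y" using \<Phi>(2) by (intro mult_right_mono) auto
      finally have "(\<Phi> u \<bullet> ?y)\<^sup>2 \<le> (C * norm ?y)\<^sup>2" using C by (simp add: abs_le_square_iff[symmetric] abs_mult)
      then show "?I u * (\<Phi> u \<bullet> ?y)\<^sup>2 \<le> (C\<^sup>2 * (?y \<bullet> ?y)) * ?I u"
        by (auto simp: indicator_def power_mult_distrib power2_norm_eq_inner)
    qed simp
    also have "\<dots> = (C\<^sup>2 * (\<beta> - \<alpha>)) * (?y \<bullet> ?y)" using ab by simp
    also have "\<dots> \<le> c * (?y \<bullet> ?y)" using small by (intro mult_right_mono) auto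
    also have "\<dots> \<le> ?y \<bullet> (S *v ?y)" by (rule S(2))
    also have "\<dots> = x \<bullet> (block blk i i S *v x)" by (simp add: block_mv_eq_proj block_proj_inner)
    finally show ?thesis by (simp add: D_def mv.diff_left inner_diff_right)
  qed
  moreover have "D $ r $ c = 0" if "r \<notin> {r. blk r = i}" for r c
    using that by (simp add: D_def block_def R_def block_proj_nth)
  ultimately obtain ys where ys: "D = (\<Sum>y\<leftarrow>ys. outer y y)" "\<forall>y\<in>set ys. \<forall>r. r \<notin> {r. blk r = i} \<longrightarrow> y $ r = 0"
    using psd_sum_outer[of "{r. blk r = i}" D] by auto
  have "(\<Sum>y\<leftarrow>ys. outer y y) $ a $ b + (\<integral>u. ?I u * ((?P *v \<Phi> u) $ a * (?P *v \<Phi> u) $ b) \<partial>lborel) = block blk i i S $ a $ b" for a b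
    unfolding ys(1)[symmetric] by (simp add: D_def R_def)
  with ys(2) int show ?thesis by blast
qed

section \<open>The steering control\<close>

lemma (in wiener) L2_progressive_sum:
  fixes X :: "'i \<Rightarrow> real \<Rightarrow> 'w \<Rightarrow> 'b::euclidean_space"
  assumes "finite I" "\<And>i. i \<in> I \<Longrightarrow> X i \<in> L2_progressive M F T" "0 \<le> T"
  shows "(\<lambda>s \<omega>. \<Sum>i\<in>I. X i s \<omega>) \<in> L2_progressive M F T"
  using assms(1,2)
proof (induction I rule: finite_induct)
  case empty
  have "progressively_measurable F T (\<lambda>_ _. 0 :: 'b)"
    by (intro progressive_deterministic) (simp add: set_borel_measurable_def)
  then show ?case by (simp add: L2_progressive_def)
next
  case (insert i I)
  then show ?case using L2_progressive_add[OF _ _ assms(3), of "X i" "\<lambda>s \<omega>. \<Sum>i\<in>I. X i s \<omega>"] by simp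
qed

text \<open>
  The factor \<open>Q\<close> vanishes before time \<open>\<tau>\<close>, hence the random vector is used only when it is known.
\<close>

lemma (in wiener) L2_progressive_delayed_factor:
  fixes Q :: "real \<Rightarrow> real^'n^'m" and \<xi> :: "'w \<Rightarrow> real^'n"
  assumes T: "0 \<le> T" and \<tau>: "0 \<le> \<tau>" and Q: "Q \<in> borel_measurable borel"
    and Qb: "\<And>s. s \<in> {0..T} \<Longrightarrow> norm (Q s) \<le> CQ" and Q0: "\<And>s. s < \<tau> \<Longrightarrow> Q s = 0"
    and \<xi>: "\<xi> \<in> borel_measurable (F \<tau>)" and fin: "(\<integral>\<^sup>+\<omega>. ennreal ((norm (\<xi> \<omega>))\<^sup>2) \<partial>M) < \<infinity>"
  shows "(\<lambda>s \<omega>. Q s *v \<xi> \<omega>) \<in> L2_progressive M F T"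
proof -
  note [measurable] = Q
  have "progressively_measurable F T (\<lambda>s \<omega>. Q s *v \<xi> \<omega>)"
  proof (rule progressively_measurableI)
    fix t assume t: "t \<in> {0..T}"
    have [measurable]: "fst \<in> borel_measurable (prog_space F t)" by (rule prog_fst_measurable)
    show "(\<lambda>p. Q (fst p) *v \<xi> (snd p)) \<in> borel_measurable (prog_space F t)"
    proof (cases "t < \<tau>")
      case True
      have "(\<lambda>p. Q (fst p) *v \<xi> (snd p)) \<in> borel_measurable (prog_space F t) \<longleftrightarrow>
          (\<lambda>p. 0) \<in> (borel_measurable (prog_space F t) :: (real \<times> 'w \<Rightarrow> real^'m) set)"
      proof (rule measurable_cong)
        fix p assume "p \<in> space (prog_space F t)"
        then have "fst p \<in> {0..t}" by (rule prog_space_fst)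
        then show "Q (fst p) *v \<xi> (snd p) = 0" using Q0 True by simp
      qed
      then show ?thesis by simp
    next
      case False
      then have "\<xi> \<in> borel_measurable (F t)" using F_measurable_mono[OF \<tau> _ \<xi>] by simp
      then have [measurable]: "(\<lambda>p. \<xi> (snd p)) \<in> borel_measurable (prog_space F t)"
        by (rule measurable_compose[OF measurable_snd])
      show ?thesis by measurable
    qed
  qed
  moreover have "energy T (\<lambda>s \<omega>. Q s *v \<xi> \<omega>) < \<infinity>"
  proof -
    obtain \<kappa> where \<kappa>: "0 < \<kappa>" "\<And>(X::real^'n^'m) v. norm (X *v v) \<le> norm X * norm v * \<kappa>"
      using mv_norm_bound by blast
    have [measurable]: "\<xi> \<in> borel_measurable M" using F_measurable_M[OF \<tau> \<xi>] .
    let ?E = "\<integral>\<^sup>+\<omega>. ennreal ((norm (\<xi> \<omega>))\<^sup>2) \<partial>M"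
    have "energy T (\<lambda>s \<omega>. Q s *v \<xi> \<omega>) \<le> (\<integral>\<^sup>+s. (ennreal ((CQ * \<kappa>)\<^sup>2) * ?E) * indicator {0..T} s \<partial>lborel)"
    proof (rule nn_integral_mono)
      fix s
      show "(\<integral>\<^sup>+\<omega>. ennreal ((norm (Q s *v \<xi> \<omega>))\<^sup>2) \<partial>M) * indicator {0..T} s \<le> (ennreal ((CQ * \<kappa>)\<^sup>2) * ?E) * indicator {0..T} s"
      proof (cases "s \<in> {0..T}")
        case True
        have "(\<integral>\<^sup>+\<omega>. ennreal ((norm (Q s *v \<xi> \<omega>))\<^sup>2) \<partial>M) \<le> (\<integral>\<^sup>+\<omega>. ennreal ((CQ * \<kappa>)\<^sup>2) * ennreal ((norm (\<xi> \<omega>))\<^sup>2) \<partial>M)"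
        proof (rule nn_integral_mono)
          fix \<omega>
          have "norm (Q s *v \<xi> \<omega>) \<le> norm (Q s) * norm (\<xi> \<omega>) * \<kappa>" by (rule \<kappa>)
          also have "\<dots> \<le> CQ * norm (\<xi> \<omega>) * \<kappa>" using Qb[OF True] \<kappa>(1) by (intro mult_right_mono) auto
          finally have "(norm (Q s *v \<xi> \<omega>))\<^sup>2 \<le> (CQ * norm (\<xi> \<omega>) * \<kappa>)\<^sup>2" by (intro power_mono) auto
          then have "ennreal ((norm (Q s *v \<xi> \<omega>))\<^sup>2) \<le> ennreal ((CQ * \<kappa>)\<^sup>2 * (norm (\<xi> \<omega>))\<^sup>2)"
            by (intro ennreal_leI) (simp add: power_mult_distrib mult_ac)
          then show "ennreal ((norm (Q s *v \<xi> \<omega>))\<^sup>2) \<le> ennreal ((CQ * \<kappa>)\<^sup>2) * ennreal ((norm (\<xi> \<omega>))\<^sup>2)"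
            by (simp add: ennreal_mult)
        qed
        also have "\<dots> = ennreal ((CQ * \<kappa>)\<^sup>2) * ?E" by (rule nn_integral_cmult) measurable
        finally show ?thesis using True by simp
      qed simp
    qed
    also have "\<dots> = (ennreal ((CQ * \<kappa>)\<^sup>2) * ?E) * ennreal T"
      using T by (simp add: nn_integral_cmult_indicator)
    also have "\<dots> < \<infinity>" using fin by (simp add: ennreal_mult_less_top)
    finally show ?thesis .
  qed
  ultimately show ?thesis by (simp add: L2_progressive_def)
qed

lemma terminal_effect:
  fixes A :: "real^'n^'n" and B :: "real^'m^'n" and V :: "real \<Rightarrow> real^'n^'m"
  assumes V: "continuous_on UNIV V" and \<epsilon>: "0 < \<epsilon>" "\<epsilon> < T"
    and E: "(LINT t:{0..\<epsilon>}|lborel. (semigroup_exp A t ** B) ** V t) = P"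
  shows "set_integrable lborel {0..T} (\<lambda>s. semigroup_exp A (T - s) *v (B *v ((if T - \<epsilon> \<le> s then V (T - s) else 0) *v w)))"
    and "(LINT s:{0..T}|lborel. semigroup_exp A (T - s) *v (B *v ((if T - \<epsilon> \<le> s then V (T - s) else 0) *v w))) = P *v w"
proof -
  let ?g = "\<lambda>t. indicator {0..\<epsilon>} t *\<^sub>R (((semigroup_exp A t ** B) ** V t) *v w)"
  let ?f = "\<lambda>s. indicator {0..T} s *\<^sub>R (semigroup_exp A (T - s) *v (B *v ((if T - \<epsilon> \<le> s then V (T - s) else 0) *v w)))"
  have fg: "?f s = ?g (T + (-1) * s)" for s
    using \<epsilon> by (auto simp: indicator_def matrix_vector_mul_assoc matrix_mul_assoc)
  have Mi: "set_integrable lborel {0..\<epsilon>} (\<lambda>t. ((semigroup_exp A t ** B) ** V t) *v w)" for w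
    by (intro set_integrable_continuous mv.continuous_on mm.continuous_on continuous_intros continuous_on_subset[OF V]) auto
  have gi: "integrable lborel ?g" using Mi[of w] by (simp add: set_integrable_def)
  have "integrable lborel (\<lambda>s. ?g (T + (-1) * s))"
    by (rule lborel_integrable_real_affine[OF gi]) simp
  then show "set_integrable lborel {0..T} (\<lambda>s. semigroup_exp A (T - s) *v (B *v ((if T - \<epsilon> \<le> s then V (T - s) else 0) *v w)))"
    unfolding set_integrable_def fg .
  have "(\<integral>s. ?f s \<partial>lborel) = (\<integral>s. ?g (T + (-1) * s) \<partial>lborel)" unfolding fg ..
  also have "\<dots> = (\<integral>t. ?g t \<partial>lborel)"
    using lborel_integral_real_affine[of "-1" ?g T] by simp
  also have "\<dots> = P *v w"
    using matrix_set_integrable(2)[OF Mi, of w] E by (simp add: set_lebesgue_integral_def)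
  finally show "(LINT s:{0..T}|lborel. semigroup_exp A (T - s) *v (B *v ((if T - \<epsilon> \<le> s then V (T - s) else 0) *v w))) = P *v w"
    by (simp add: set_lebesgue_integral_def)
qed

lemma norm_le_rows:
  fixes Q :: "real^'n^'m"
  assumes "\<And>i. norm (Q $ i) \<le> C"
  shows "norm Q \<le> of_nat CARD('m) * C"
proof -
  have "norm Q \<le> (\<Sum>i\<in>UNIV. norm (Q $ i))" unfolding norm_vec_def by (rule L2_set_le_sum) auto
  also have "\<dots> \<le> (\<Sum>i\<in>(UNIV::'m set). C)" by (intro sum_mono assms)
  finally show ?thesis by simp
qed

context controlled_system
begin

text \<open>
  The inputs of \<open>steer_block\<close> for block \<open>j\<close>, multiplied by \<open>\<xi>\<^sub>j\<close>, are applied so that they arrive during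
  \<open>[T - \<epsilon>, T]\<close>. Channel \<open>i \<le> j\<close> has to be set from time \<open>T - \<epsilon> - h\<^sub>i \<ge> T - \<epsilon> - h\<^sub>j\<close> on, when \<open>\<xi>\<^sub>j\<close> is known;
  the channels \<open>i > j\<close> stay at zero. Since \<open>\<epsilon> < T - h\<^sub>m\<close>, no channel needs to be set before time \<open>0\<close>.
\<close>

lemma steering_control:
  fixes blk :: "'n \<Rightarrow> 'm" and \<xi> :: "'m \<Rightarrow> 'w \<Rightarrow> real^'n"
  assumes tri: "block_upper_triangular blk A B" and ctr: "\<forall>i. controllable_block blk A B i"
    and \<epsilon>: "0 < \<epsilon>" "\<epsilon> < T - last_delay h"
    and \<xi>: "\<And>j. \<xi> j \<in> borel_measurable (F (T - h j - \<epsilon>))"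
    and fin: "\<And>j. (\<integral>\<^sup>+\<omega>. ennreal ((norm (\<xi> j \<omega>))\<^sup>2) \<partial>M) < \<infinity>"
  obtains U where "U \<in> L2_progressive M F T"
    "\<And>\<omega>. set_integrable lborel {0..T} (\<lambda>s. semigroup_exp A (T - s) *v (B *v delayed_input h (\<lambda>_. 0) U s \<omega>))"
    "\<And>\<omega>. (LINT s:{0..T}|lborel. semigroup_exp A (T - s) *v (B *v delayed_input h (\<lambda>_. 0) U s \<omega>)) =
      (\<Sum>j\<in>UNIV. block_proj blk j *v \<xi> j \<omega>)"
proof -
  have "\<forall>j. \<exists>V. continuous_on UNIV V \<and> (\<forall>t i c. j < i \<longrightarrow> V t $ i $ c = 0) \<and>
    (LINT t:{0..\<epsilon>}|lborel. (semigroup_exp A t ** B) ** V t) = block_proj blk j"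
  proof
    fix j
    show "\<exists>V. continuous_on UNIV V \<and> (\<forall>t i c. j < i \<longrightarrow> V t $ i $ c = 0) \<and>
      (LINT t:{0..\<epsilon>}|lborel. (semigroup_exp A t ** B) ** V t) = block_proj blk j"
      by (rule steer_block[OF tri ctr \<epsilon>(1), of j]) blast
  qed
  from choice[OF this] obtain V where
    "\<forall>j. continuous_on UNIV (V j) \<and> (\<forall>t i c. j < i \<longrightarrow> V j t $ i $ c = 0) \<and>
      (LINT t:{0..\<epsilon>}|lborel. (semigroup_exp A t ** B) ** V j t) = block_proj blk j" ..
  then have V: "\<And>j. continuous_on UNIV (V j)" "\<And>j t i c. j < i \<Longrightarrow> V j t $ i $ c = 0"
    "\<And>j. (LINT t:{0..\<epsilon>}|lborel. (semigroup_exp A t ** B) ** V j t) = block_proj blk j"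
    by blast+
  have eT: "\<epsilon> < T" using \<epsilon>(2) d_pos by simp
  define Q where "Q j s = (\<chi> i c. if T - \<epsilon> \<le> s + h i \<and> s + h i \<le> T then V j (T - s - h i) $ i $ c else 0)" for j s
  define U where "U s \<omega> = (\<Sum>j\<in>UNIV. Q j s *v \<xi> j \<omega>)" for s \<omega>
  have UL: "U \<in> L2_progressive M F T"
    unfolding U_def[abs_def]
  proof (rule L2_progressive_sum)
    fix j
    have "continuous_on {0..\<epsilon>} (V j)" by (rule continuous_on_subset[OF V(1)]) simp
    from continuous_compact_bound[OF compact_Icc this]
    obtain C where C: "0 \<le> C" "\<And>t. t \<in> {0..\<epsilon>} \<Longrightarrow> norm (V j t) \<le> C" by blast
    show "(\<lambda>s \<omega>. Q j s *v \<xi> j \<omega>) \<in> L2_progressive M F T"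
    proof (rule L2_progressive_delayed_factor[OF T_nonneg _ _ _ _ \<xi> fin])
      show "0 \<le> T - h j - \<epsilon>" using \<epsilon>(2) h_le[of j] by linarith
      have [measurable]: "V j \<in> borel_measurable borel" by (rule borel_measurable_continuous_onI[OF V(1)])
      have "(\<lambda>s. Q j s $ i $ c) \<in> borel_measurable borel" for i c
        unfolding Q_def vec_lambda_beta by measurable
      moreover have "(\<lambda>s. Q j s \<bullet> axis i (axis c 1)) = (\<lambda>s. Q j s $ i $ c)" for i c
        by (simp add: inner_axis)
      ultimately show "Q j \<in> borel_measurable borel"
        by (subst borel_measurable_euclidean_space) (auto simp: Basis_vec_def)
      show "norm (Q j s) \<le> of_nat CARD('m) * C" for s
      proof (rule norm_le_rows)
        fix i
        show "norm (Q j s $ i) \<le> C"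
        proof (cases "T - \<epsilon> \<le> s + h i \<and> s + h i \<le> T")
          case True
          then have "Q j s $ i = V j (T - s - h i) $ i" by (simp add: Q_def vec_eq_iff)
          then have "norm (Q j s $ i) \<le> norm (V j (T - s - h i))"
            using Finite_Cartesian_Product.norm_nth_le[of "V j (T - s - h i)" i] by simp
          also have "\<dots> \<le> C" using True by (intro C) auto
          finally show ?thesis .
        next
          case False
          then have "Q j s $ i = 0" by (auto simp: Q_def vec_eq_iff)
          then show ?thesis using C by simp
        qed
      qed
      show "Q j s = 0" if "s < T - h j - \<epsilon>" for s
      proof -
        have "Q j s $ i $ c = 0" for i c
        proof (cases "j < i")
          case True
          then show ?thesis by (simp add: Q_def V(2))
        next
          case False
          then have "h i \<le> h j" using h_mono by (simp add: strict_mono_less_eq)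
          then show ?thesis using that by (simp add: Q_def)
        qed
        then show ?thesis by (simp add: vec_eq_iff)
      qed
    qed
  qed (use T_nonneg in auto)
  let ?v = "\<lambda>j s \<omega>. (if T - \<epsilon> \<le> s then V j (T - s) else 0) *v \<xi> j \<omega>"
  have del: "delayed_input h (\<lambda>_. 0) U s \<omega> = (\<Sum>j\<in>UNIV. ?v j s \<omega>)" if s: "s \<in> {0..T}" for s \<omega>
  proof -
    have "delayed_input h (\<lambda>_. 0) U s \<omega> $ i = (\<Sum>j\<in>UNIV. ?v j s \<omega>) $ i" for i
    proof (cases "s - h i < 0")
      case True
      then have "\<not> T - \<epsilon> \<le> s" using \<epsilon>(2) h_le[of i] by auto
      then show ?thesis using True by (simp add: delayed_input_def)
    next
      case False
      have "(Q j (s - h i) *v x) $ i = ((if T - \<epsilon> \<le> s then V j (T - s) else 0) *v x) $ i" for j x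
        using s by (simp add: matrix_vector_mult_def Q_def)
      then show ?thesis using False by (simp add: delayed_input_def U_def sum_component)
    qed
    then show ?thesis by (simp add: vec_eq_iff)
  qed
  have del': "semigroup_exp A (T - s) *v (B *v delayed_input h (\<lambda>_. 0) U s \<omega>) =
      (\<Sum>j\<in>UNIV. semigroup_exp A (T - s) *v (B *v ?v j s \<omega>))" if "s \<in> {0..T}" for s \<omega>
    by (simp only: del[OF that] mv.sum_right)
  note te = terminal_effect[OF V(1) \<epsilon>(1) eT V(3)]
  have i: "set_integrable lborel {0..T} (\<lambda>s. \<Sum>j\<in>UNIV. semigroup_exp A (T - s) *v (B *v ?v j s \<omega>))" for \<omega>
    by (rule set_integral_sum(1)) (rule te(1))
  show thesis
  proof (rule that[OF UL])
    fix \<omega>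
    show "set_integrable lborel {0..T} (\<lambda>s. semigroup_exp A (T - s) *v (B *v delayed_input h (\<lambda>_. 0) U s \<omega>))"
      by (subst set_integrable_cong[OF refl refl del']) (simp_all add: i)
    have "(LINT s:{0..T}|lborel. semigroup_exp A (T - s) *v (B *v delayed_input h (\<lambda>_. 0) U s \<omega>)) =
        (LINT s:{0..T}|lborel. \<Sum>j\<in>UNIV. semigroup_exp A (T - s) *v (B *v ?v j s \<omega>))"
      by (intro set_lebesgue_integral_cong) (auto simp: del')
    also have "\<dots> = (\<Sum>j\<in>UNIV. LINT s:{0..T}|lborel. semigroup_exp A (T - s) *v (B *v ?v j s \<omega>))"
      by (rule set_integral_sum(2)) (rule te(1))
    also have "\<dots> = (\<Sum>j\<in>UNIV. block_proj blk j *v \<xi> j \<omega>)" by (simp only: te(2))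
    finally show "(LINT s:{0..T}|lborel. semigroup_exp A (T - s) *v (B *v delayed_input h (\<lambda>_. 0) U s \<omega>)) =
      (\<Sum>j\<in>UNIV. block_proj blk j *v \<xi> j \<omega>)" .
  qed
qed

end

section \<open>Steering mean and covariance\<close>

lemma (in wiener) wiv_finite:
  fixes X :: "'w \<Rightarrow> real^'n"
  assumes "wiv f X"
  shows "(\<integral>\<^sup>+\<omega>. ennreal ((norm (X \<omega>))\<^sup>2) \<partial>M) < \<infinity>"
proof -
  have sq: "sq_int M (\<lambda>\<omega>. X \<omega> $ i)" for i using assms wi_sq_int(2) by (auto simp: wiv_def)
  note [measurable] = wiv_measurable(2)[OF assms]
  have "(\<integral>\<^sup>+\<omega>. ennreal ((X \<omega> $ i)\<^sup>2) \<partial>M) < \<infinity>" for i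
    using sq[of i] by (simp add: nn_integral_eq_integral sq_int_def)
  then show ?thesis unfolding ennreal_norm_sq_nth by (simp add: nn_integral_sum del: sum_ennreal)
qed

lemma (in wiener) wiv_affine_moments:
  fixes X V :: "'w \<Rightarrow> real^'n"
  assumes X: "wiv f X" and V: "V \<in> borel_measurable M" "AE \<omega> in M. V \<omega> = v + X \<omega>"
  shows "mean M V = v" and "covariance M V $ a $ b = (\<integral>s. f s $ a * f s $ b \<partial>lborel)"
proof -
  note mom = wiv_moments[OF X]
  note [measurable] = wiv_measurable(2)[OF X] V(1)
  have "mean M V = (\<integral>\<omega>. v + X \<omega> \<partial>M)"
    unfolding mean_def using V(2) by (intro integral_cong_AE) auto
  also have "\<dots> = v" using mom(1,2) by (simp add: mean_def prob_space)
  finally show m: "mean M V = v" .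
  have "covariance M V = (\<integral>\<omega>. outer (X \<omega>) (X \<omega>) \<partial>M)"
    unfolding covariance_def m
  proof (rule integral_cong_AE)
    show "AE \<omega> in M. outer (V \<omega> - v) (V \<omega> - v) = outer (X \<omega>) (X \<omega>)"
      using V(2) by eventually_elim simp
  qed measurable
  then show "covariance M V $ a $ b = (\<integral>s. f s $ a * f s $ b \<partial>lborel)"
    using mom(4) by simp
qed

context controlled_system
begin

text \<open>
  The expected state at time \<open>T\<close> under the control zero.
\<close>

definition free_mean :: "real^'n" where
  "free_mean = semigroup_exp A T *v z0 + (LINT s:{0..T}|lborel. semigroup_exp A (T - s) *v (B *v history_input h hist s))"

lemma terminal_state:
  fixes blk :: "'n \<Rightarrow> 'm"
  assumes U: "U \<in> L2_progressive M F T"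
    and Ui: "\<And>\<omega>. set_integrable lborel {0..T} (\<lambda>s. semigroup_exp A (T - s) *v (B *v delayed_input h (\<lambda>_. 0) U s \<omega>))"
    and UT: "\<And>\<omega>. (LINT s:{0..T}|lborel. semigroup_exp A (T - s) *v (B *v delayed_input h (\<lambda>_. 0) U s \<omega>)) = x + R \<omega>"
    and \<Phi>: "free_noise_kernel \<Phi>"
    and Z: "is_solution M F W T A B h G \<sigma> z0 hist U Z"
  shows "\<exists>N. wiv \<Phi> N \<and> Z T \<in> borel_measurable M \<and> (AE \<omega> in M. Z T \<omega> = (free_mean + x) + (N \<omega> + R \<omega>))"
proof -
  obtain Y where Y: "Y \<in> L2_progressive M F T" "\<And>t. t \<in> {0..T} \<Longrightarrow> has_wiener_integral M W \<sigma> 0 t (Y t)"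
    using driving_noise by blast
  obtain r where r: "noise_memory M F W T h G \<sigma> r"
    and ZT: "AE \<omega> in M. Z T \<omega> = Y T \<omega> + flow A z0 (\<lambda>s. forcing Y r U s \<omega>) T"
    using solution_formula[OF U Z Y] by blast
  let ?n = "\<lambda>\<omega> s. semigroup_exp A (T - s) *v (A *v Y s \<omega> + r s \<omega>)"
  let ?u = "\<lambda>\<omega> s. semigroup_exp A (T - s) *v (B *v delayed_input h (\<lambda>_. 0) U s \<omega>)"
  let ?b = "\<lambda>s. semigroup_exp A (T - s) *v (B *v history_input h hist s)"
  let ?N = "\<lambda>\<omega>. Y T \<omega> + (LINT s:{0..T}|lborel. ?n \<omega> s)"
  have N: "wiv \<Phi> ?N" and ni: "AE \<omega> in M. set_integrable lborel {0..T} (?n \<omega>)"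
    using \<Phi> Y r unfolding free_noise_kernel_def by auto
  have bi: "set_integrable lborel {0..T} ?b"
    by (intro set_integrable_kernel_mult history_integrable continuous_intros)
  have split: "semigroup_exp A (T - s) *v forcing Y r U s \<omega> = (?n \<omega> s + ?u \<omega> s) + ?b s" for s \<omega>
    unfolding mv.add_right[symmetric] by (rule arg_cong[where f = "(*v) _"]) (simp add: forcing_split)
  have "AE \<omega> in M. Z T \<omega> = (free_mean + x) + (?N \<omega> + R \<omega>)"
    using ZT ni
  proof eventually_elim
    case (elim \<omega>)
    have "flow A z0 (\<lambda>s. forcing Y r U s \<omega>) T = semigroup_exp A T *v z0 +
        ((LINT s:{0..T}|lborel. ?n \<omega> s) + (LINT s:{0..T}|lborel. ?u \<omega> s) + (LINT s:{0..T}|lborel. ?b s))"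
      unfolding flow_def split
      by (simp only: set_integral_add(2)[OF set_integral_add(1)[OF elim(2) Ui] bi] set_integral_add(2)[OF elim(2) Ui])
    then show ?case using elim(1) by (simp add: UT free_mean_def)
  qed
  moreover have "Z T \<in> borel_measurable M"
  proof -
    have "Z \<in> L2_progressive M F T" using Z by (simp add: is_solution_def)
    from joint_section(2)[OF L2_progressiveD(1)[OF this] T_nonneg] T_nonneg show ?thesis by simp
  qed
  ultimately show ?thesis using N by blast
qed

text \<open>
  Under the control constructed here the kernel of block \<open>i\<close> of \<open>Z(T)\<close> is \<open>\<phi>\<^sub>i\<close> on \<open>[0, T - h\<^sub>i - \<epsilon>]\<close> and block
  \<open>i\<close> of \<open>\<Phi>\<close> afterwards. The choice of \<open>\<phi>\<^sub>i\<close> makes the covariance collected up to \<open>T - h\<^sub>i\<close> equal to the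
  block of the target.
\<close>

theorem steering:
  fixes blk :: "'n \<Rightarrow> 'm"
  assumes tri: "block_upper_triangular blk A B" and ctr: "\<forall>i. controllable_block blk A B i"
    and S: "sym_pos_def S"
  shows "\<exists>U \<in> L2_progressive M F T. \<forall>Z. is_solution M F W T A B h G \<sigma> z0 hist U Z \<longrightarrow>
    mean M (Z T) = ZT \<and>
    (\<forall>i. covariance M (\<lambda>\<omega>. block_proj blk i *v Z T \<omega>) = block blk i i S + Sigma_min blk A G h \<sigma> T i)"
proof -
  let ?P = "block_proj blk"
  obtain \<Phi> C where \<Phi>m: "\<Phi> \<in> borel_measurable borel" and C: "0 \<le> C"
    and \<Phi>b: "\<And>u. norm (\<Phi> u) \<le> C * indicator {0..T} u"
    and \<Phi>w: "free_noise_kernel \<Phi>"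
    and gam: "\<And>i. AE u in lborel. u \<in> {T - h i..T} \<longrightarrow> Gam blk A G h i (T - u) *v \<sigma> u = block_proj blk i *v \<Phi> u"
    using open_loop_kernel[OF tri] by blast
  note [measurable] = \<Phi>m
  have \<Phi>C: "norm (\<Phi> u) \<le> C" for u using \<Phi>b[of u] C by (cases "u \<in> {0..T}") auto
  have \<Phi>0: "\<Phi> u = 0" if "u \<notin> {0..T}" for u using \<Phi>b[of u] that by simp
  obtain c where c: "0 < c" "\<And>x. c * (x \<bullet> x) \<le> x \<bullet> (S *v x)" using pos_def_lower_bound[OF S] by blast
  have Ssym: "transpose S = S" using S by (simp add: sym_pos_def_def)
  (* The first bound leaves time for the largest delay, the second keeps the noise collected
     during a time epsilon below the target. *)
  define \<epsilon> where "\<epsilon> = min ((T - last_delay h) / 2) (c / (C\<^sup>2 + 1))"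
  have C1: "0 < C\<^sup>2 + 1" by (simp add: add_nonneg_pos)
  have e: "0 < \<epsilon>" "\<epsilon> < T - last_delay h"
  proof -
    show "0 < \<epsilon>" using horizon c C1 by (simp add: \<epsilon>_def)
    have "\<epsilon> \<le> (T - last_delay h) / 2" unfolding \<epsilon>_def by (rule min.cobounded1)
    then show "\<epsilon> < T - last_delay h" using horizon by simp
  qed
  have small: "C\<^sup>2 * \<epsilon> \<le> c"
  proof -
    have "C\<^sup>2 * \<epsilon> \<le> C\<^sup>2 * (c / (C\<^sup>2 + 1))" by (intro mult_left_mono) (auto simp: \<epsilon>_def)
    also have "\<dots> \<le> (C\<^sup>2 + 1) * (c / (C\<^sup>2 + 1))" using c C1 by (intro mult_right_mono) auto
    also have "\<dots> = c" using C1 by simp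
    finally show ?thesis .
  qed
  define \<alpha> where "\<alpha> i = T - h i - \<epsilon>" for i
  define \<beta> where "\<beta> i = T - h i" for i
  have ab: "0 < \<alpha> i" "\<alpha> i < \<beta> i" "\<beta> i < T" for i
    using e h_le[of i] h_pos by (auto simp: \<alpha>_def \<beta>_def)
  let ?pp = "\<lambda>i a b u. (?P i *v \<Phi> u) $ a * (?P i *v \<Phi> u) $ b"
  define good where "good i \<phi> \<longleftrightarrow> \<phi> \<in> borel_measurable borel \<and> (\<exists>C. \<forall>s. norm (\<phi> s) \<le> C) \<and>
      (\<forall>s. s \<notin> {0<..\<alpha> i} \<longrightarrow> \<phi> s = 0) \<and> (\<forall>s r. blk r \<noteq> i \<longrightarrow> \<phi> s $ r = 0) \<and>
      (\<forall>a b. integrable lborel (\<lambda>s. \<phi> s $ a * \<phi> s $ b) \<and>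
        integrable lborel (\<lambda>u. indicator {\<alpha> i<..\<beta> i} u * ?pp i a b u) \<and>
        (\<integral>s. \<phi> s $ a * \<phi> s $ b \<partial>lborel) + (\<integral>u. indicator {\<alpha> i<..\<beta> i} u * ?pp i a b u \<partial>lborel)
          = block blk i i S $ a $ b)" for i and \<phi> :: "real \<Rightarrow> real^'n"
  have "\<exists>\<phi>. good i \<phi>" for i
  proof -
    have "C\<^sup>2 * (\<beta> i - \<alpha> i) \<le> c" using small by (simp add: \<alpha>_def \<beta>_def)
    from covariance_deficit[OF Ssym c(2) \<Phi>m \<Phi>C C less_imp_le[OF ab(2)[of i]] this, of blk i]
    obtain ys where ys: "\<forall>y\<in>set ys. \<forall>r. r \<notin> {r. blk r = i} \<longrightarrow> y $ r = 0"
      "\<And>a b. integrable lborel (\<lambda>u. indicator {\<alpha> i<..\<beta> i} u * ?pp i a b u)"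
      "\<And>a b. (\<Sum>y\<leftarrow>ys. outer y y) $ a $ b + (\<integral>u. indicator {\<alpha> i<..\<beta> i} u * ?pp i a b u \<partial>lborel) = block blk i i S $ a $ b"
      by blast
    obtain \<phi> where \<phi>: "\<phi> \<in> borel_measurable borel" "\<exists>C. \<forall>s. norm (\<phi> s) \<le> C"
      "\<forall>s. s \<notin> {0<..\<alpha> i} \<longrightarrow> \<phi> s = 0" "\<forall>s r. r \<notin> {r. blk r = i} \<longrightarrow> \<phi> s $ r = 0"
      "\<forall>a b. integrable lborel (\<lambda>s. \<phi> s $ a * \<phi> s $ b) \<and>
        (\<integral>s. \<phi> s $ a * \<phi> s $ b \<partial>lborel) = (\<Sum>y\<leftarrow>ys. outer y y) $ a $ b"
      using realise_covariance[OF ab(1)[of i] ys(1)] by blast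
    have "good i \<phi>"
      unfolding good_def
    proof (intro conjI allI)
      fix a b
      show "integrable lborel (\<lambda>s. \<phi> s $ a * \<phi> s $ b)" using \<phi>(5) by blast
      show "(\<integral>s. \<phi> s $ a * \<phi> s $ b \<partial>lborel) + (\<integral>u. indicator {\<alpha> i<..\<beta> i} u * ?pp i a b u \<partial>lborel)
          = block blk i i S $ a $ b"
        using \<phi>(5) ys(3)[of a b] by simp
    qed (use \<phi> ys(2) in auto)
    then show ?thesis by blast
  qed
  then have "\<forall>i. \<exists>\<phi>. good i \<phi>" by simp
  from choice[OF this] obtain \<phi> where \<phi>: "\<forall>i. good i (\<phi> i)" ..
  have \<phi>m[measurable]: "\<phi> i \<in> borel_measurable borel" for i using \<phi> by (simp add: good_def)
  have \<phi>0: "\<phi> i s = 0" if "s \<notin> {0<..\<alpha> i}" for i s using \<phi> that by (simp add: good_def)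
  have \<phi>P: "?P i *v \<phi> i s = \<phi> i s" for i s
    using \<phi> by (auto simp: good_def vec_eq_iff block_proj_nth)
  define f where "f j u = ?P j *v (\<phi> j u - \<Phi> u)" for j u
  have fm[measurable]: "f j \<in> borel_measurable borel" for j unfolding f_def by measurable
  have "\<exists>X. X \<in> borel_measurable (F (\<alpha> j)) \<and> has_wiener_integral M W (f j) 0 (\<alpha> j) X" for j
  proof -
    have "\<exists>C. \<forall>s. norm (\<phi> j s) \<le> C" using \<phi> by (simp add: good_def)
    then obtain C' where C': "\<And>s. norm (\<phi> j s) \<le> C'" by blast
    obtain \<kappa> where \<kappa>: "0 < \<kappa>" "\<And>(X::real^'n^'n) v. norm (X *v v) \<le> norm X * norm v * \<kappa>"
      using mv_norm_bound by blast
    have "norm (f j s) \<le> norm (?P j :: real^'n^'n) * (C' + C) * \<kappa>" for s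
    proof -
      have "norm (\<phi> j s - \<Phi> s) \<le> C' + C"
        using norm_triangle_ineq4[of "\<phi> j s" "\<Phi> s"] C'[of s] \<Phi>C[of s] by linarith
      then have "norm (?P j :: real^'n^'n) * norm (\<phi> j s - \<Phi> s) * \<kappa> \<le> norm (?P j :: real^'n^'n) * (C' + C) * \<kappa>"
        using \<kappa>(1) by (intro mult_right_mono mult_left_mono) auto
      with \<kappa>(2)[of "?P j" "\<phi> j s - \<Phi> s"] show ?thesis unfolding f_def by linarith
    qed
    then have "AE s in lborel. s \<in> {0..\<alpha> j} \<longrightarrow> norm (f j s) \<le> norm (?P j :: real^'n^'n) * (C' + C) * \<kappa>" by simp
    moreover have "set_borel_measurable borel {0..\<alpha> j} (f j)" unfolding set_borel_measurable_def by measurable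
    ultimately show ?thesis
      using wiener_integral_exists[OF order_refl less_imp_le[OF ab(1)[of j]], of "f j"] by blast
  qed
  then have "\<forall>j. \<exists>X. X \<in> borel_measurable (F (\<alpha> j)) \<and> has_wiener_integral M W (f j) 0 (\<alpha> j) X" by simp
  from choice[OF this] obtain \<xi> where
    "\<forall>j. \<xi> j \<in> borel_measurable (F (\<alpha> j)) \<and> has_wiener_integral M W (f j) 0 (\<alpha> j) (\<xi> j)" ..
  then have \<xi>F: "\<xi> j \<in> borel_measurable (F (\<alpha> j))"
    and \<xi>I: "has_wiener_integral M W (f j) 0 (\<alpha> j) (\<xi> j)" for j by auto
  have \<xi>w: "wiv (\<lambda>u. indicator {0..\<alpha> j} u *\<^sub>R f j u) (\<xi> j)" for j
    by (rule wiener_integral_wiv[OF \<xi>I order_refl])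
  have \<xi>M[measurable]: "\<xi> j \<in> borel_measurable M" for j by (rule wiv_measurable(2)[OF \<xi>w])
  (* All blocks of the correction x of the mean are distributed over the xi j. *)
  define x where "x = ZT - free_mean"
  have fin: "(\<integral>\<^sup>+\<omega>. ennreal ((norm (\<xi> j \<omega> + x))\<^sup>2) \<partial>M) < \<infinity>" for j
  proof -
    have "(\<integral>\<^sup>+\<omega>. ennreal ((norm (\<xi> j \<omega> - - x))\<^sup>2) \<partial>M) \<le>
        2 * (\<integral>\<^sup>+\<omega>. ennreal ((norm (\<xi> j \<omega> - 0))\<^sup>2) \<partial>M) + 2 * (\<integral>\<^sup>+\<omega>. ennreal ((norm (0 - - x))\<^sup>2) \<partial>M)"
      by (rule nn_integral_norm_sq_triangle) measurable
    also have "\<dots> < \<infinity>"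
      using wiv_finite[OF \<xi>w[of j]] by (simp add: ennreal_mult_less_top emeasure_space_1)
    finally show ?thesis by simp
  qed
  have \<xi>F': "(\<lambda>\<omega>. \<xi> j \<omega> + x) \<in> borel_measurable (F (T - h j - \<epsilon>))" for j
    using \<xi>F[of j] unfolding \<alpha>_def by measurable
  obtain U where U: "U \<in> L2_progressive M F T"
    "\<And>\<omega>. set_integrable lborel {0..T} (\<lambda>s. semigroup_exp A (T - s) *v (B *v delayed_input h (\<lambda>_. 0) U s \<omega>))"
    "\<And>\<omega>. (LINT s:{0..T}|lborel. semigroup_exp A (T - s) *v (B *v delayed_input h (\<lambda>_. 0) U s \<omega>)) =
      (\<Sum>j\<in>UNIV. ?P j *v (\<xi> j \<omega> + x))"
    by (rule steering_control[OF tri ctr e \<xi>F' fin]) (rule that)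
  have UT: "(LINT s:{0..T}|lborel. semigroup_exp A (T - s) *v (B *v delayed_input h (\<lambda>_. 0) U s \<omega>)) =
      x + (\<Sum>j\<in>UNIV. ?P j *v \<xi> j \<omega>)" for \<omega>
    unfolding U(3) mv.add_right sum.distrib sum_block_proj by simp
  show ?thesis
  proof (rule bexI[OF _ U(1)], intro allI impI conjI)
    fix Z assume Z: "is_solution M F W T A B h G \<sigma> z0 hist U Z"
    obtain N where N: "wiv \<Phi> N" and ZM: "Z T \<in> borel_measurable M"
      and ZT: "AE \<omega> in M. Z T \<omega> = (free_mean + x) + (N \<omega> + (\<Sum>j\<in>UNIV. ?P j *v \<xi> j \<omega>))"
      using terminal_state[OF U(1,2) UT \<Phi>w Z] by blast
    define \<Psi> where "\<Psi> u = \<Phi> u + (\<Sum>j\<in>UNIV. ?P j *v (indicator {0..\<alpha> j} u *\<^sub>R f j u))" for u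
    define N' where "N' \<omega> = N \<omega> + (\<Sum>j\<in>UNIV. ?P j *v \<xi> j \<omega>)" for \<omega>
    have N': "wiv \<Psi> N'"
      unfolding \<Psi>_def[abs_def] N'_def[abs_def] by (intro wiv_add N wiv_sum wiv_mv \<xi>w) simp
    have ZN: "AE \<omega> in M. Z T \<omega> = ZT + N' \<omega>"
      using ZT by eventually_elim (simp add: x_def N'_def)
    show "mean M (Z T) = ZT" by (rule wiv_affine_moments(1)[OF N' ZM ZN])
    fix i
    have PZ: "AE \<omega> in M. ?P i *v Z T \<omega> = ?P i *v ZT + ?P i *v N' \<omega>"
      using ZN by eventually_elim (simp add: mv.add_right)
    have PM: "(\<lambda>\<omega>. ?P i *v Z T \<omega>) \<in> borel_measurable M" using ZM by measurable
    have P\<Psi>: "?P i *v \<Psi> u = \<phi> i u + (1 - indicator {0..\<alpha> i} u) *\<^sub>R (?P i *v \<Phi> u)" for u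
    proof -
      have "?P i *v \<Psi> u = ?P i *v \<Phi> u + (\<Sum>j\<in>UNIV. ?P i *v (?P j *v (indicator {0..\<alpha> j} u *\<^sub>R f j u)))"
        by (simp add: \<Psi>_def mv.add_right mv.sum_right)
      also have "(\<Sum>j\<in>UNIV. ?P i *v (?P j *v (indicator {0..\<alpha> j} u *\<^sub>R f j u))) =
          (\<Sum>j\<in>UNIV. if j = i then ?P i *v (indicator {0..\<alpha> i} u *\<^sub>R f i u) else 0)"
        by (intro sum.cong) (auto simp: block_proj_idem block_proj_orthogonal)
      also have "\<dots> = indicator {0..\<alpha> i} u *\<^sub>R (\<phi> i u - ?P i *v \<Phi> u)"
        by (simp add: f_def mv.scaleR_right block_proj_idem mv.diff_right \<phi>P)
      also have "indicator {0..\<alpha> i} u *\<^sub>R (\<phi> i u - ?P i *v \<Phi> u) =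
          \<phi> i u - indicator {0..\<alpha> i} u *\<^sub>R (?P i *v \<Phi> u)"
        using \<phi>0[of u i] by (auto simp: indicator_def)
      finally show ?thesis by (simp add: algebra_simps)
    qed
    have "covariance M (\<lambda>\<omega>. ?P i *v Z T \<omega>) $ a $ b = (block blk i i S + Sigma_min blk A G h \<sigma> T i) $ a $ b" for a b
    proof -
      have iPhi: "integrable lborel (?pp i a b)"
        using wiv_mv[OF N, of "?P i"] wi_sq_int(1) by (auto simp: wiv_def intro!: sq_int_mult)
      have "covariance M (\<lambda>\<omega>. ?P i *v Z T \<omega>) $ a $ b = (\<integral>u. (?P i *v \<Psi> u) $ a * (?P i *v \<Psi> u) $ b \<partial>lborel)"
        by (rule wiv_affine_moments(2)[OF wiv_mv[OF N'] PM PZ])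
      also have "\<dots> = (\<integral>u. \<phi> i u $ a * \<phi> i u $ b + (indicator {\<alpha> i<..\<beta> i} u * ?pp i a b u +
          indicator {\<beta> i<..T} u * ?pp i a b u) \<partial>lborel)"
      proof (rule Bochner_Integration.integral_cong)
        fix u
        consider "u \<notin> {0..T}" | "u \<in> {0..\<alpha> i}" | "u \<in> {\<alpha> i<..\<beta> i}" | "u \<in> {\<beta> i<..T}" by fastforce
        then show "(?P i *v \<Psi> u) $ a * (?P i *v \<Psi> u) $ b = \<phi> i u $ a * \<phi> i u $ b +
            (indicator {\<alpha> i<..\<beta> i} u * ?pp i a b u + indicator {\<beta> i<..T} u * ?pp i a b u)"
        proof cases
          case 1
          then have "\<phi> i u = 0" using ab[of i] by (intro \<phi>0) auto
          then show ?thesis using \<Phi>0[OF 1] by (simp add: P\<Psi>)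
        next
          case 2
          then show ?thesis using ab[of i] by (simp add: P\<Psi>)
        next
          case 3
          then have "\<phi> i u = 0" by (intro \<phi>0) auto
          then show ?thesis using 3 ab[of i] by (simp add: P\<Psi>)
        next
          case 4
          then have "\<phi> i u = 0" using ab[of i] by (intro \<phi>0) auto
          then show ?thesis using 4 ab[of i] by (simp add: P\<Psi>)
        qed
      qed simp
      also have "\<dots> = (\<integral>u. \<phi> i u $ a * \<phi> i u $ b \<partial>lborel) + ((\<integral>u. indicator {\<alpha> i<..\<beta> i} u * ?pp i a b u \<partial>lborel) +
          (\<integral>u. indicator {\<beta> i<..T} u * ?pp i a b u \<partial>lborel))"
      proof -
        have 1: "integrable lborel (\<lambda>u. \<phi> i u $ a * \<phi> i u $ b)"
          and 2: "integrable lborel (\<lambda>u. indicator {\<alpha> i<..\<beta> i} u * ?pp i a b u)"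
          using \<phi> by (auto simp: good_def)
        have 3: "integrable lborel (\<lambda>u. indicator {\<beta> i<..T} u * ?pp i a b u)"
          using integrable_mult_indicator[OF _ iPhi, of "{\<beta> i<..T}"] by simp
        show ?thesis using 1 2 3 by simp
      qed
      also have "\<dots> = block blk i i S $ a $ b + (\<integral>u. indicator {\<beta> i<..T} u * ?pp i a b u \<partial>lborel)"
        using \<phi> by (simp add: good_def add.assoc[symmetric])
      also have "(\<integral>u. indicator {\<beta> i<..T} u * ?pp i a b u \<partial>lborel) = Sigma_min blk A G h \<sigma> T i $ a $ b"
        unfolding Sigma_min_entry[OF tri \<Phi>m \<Phi>b C gam] set_lebesgue_integral_def
      proof (rule integral_cong_AE)
        have "AE u in lborel. u \<noteq> \<beta> i" by (rule AE_lborel_singleton)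
        then show "AE u in lborel. indicator {\<beta> i<..T} u * ?pp i a b u = indicator {T - h i..T} u *\<^sub>R ?pp i a b u"
          by eventually_elim (auto simp: \<beta>_def indicator_def)
      qed measurable
      finally show ?thesis by simp
    qed
    then show "covariance M (\<lambda>\<omega>. ?P i *v Z T \<omega>) = block blk i i S + Sigma_min blk A G h \<sigma> T i"
      by (simp add: vec_eq_iff)
  qed
qed

end

theorem theorem4p5:
  fixes M :: "'w measure"
    and F :: "real \<Rightarrow> 'w measure"
    and W :: "real \<Rightarrow> 'w \<Rightarrow> real"
    and T :: real
    and blk :: "'n::{finite,linorder} \<Rightarrow> 'm::{finite,linorder}"
    and h :: "'m \<Rightarrow> real"
    and A :: "real^('n::_)^('n::_)"
    and B :: "real^('m::_)^('n::_)"
    and G :: "real \<Rightarrow> real^('n::_)^('n::_)"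
    and \<sigma> :: "real \<Rightarrow> real^('n::_)"
    and z0 ZT :: "real^('n::_)"
    and hist :: "real \<Rightarrow> real^('m::_)"
    and \<Sigma>T :: "real^('n::_)^('n::_)"
  assumes "prob_space M"
    and "filtration_on M F"
    and "adapted_wiener_process M F W"
    and "strict_mono h" and "\<forall>i. 0 < h i"
    and "splitting blk"
    and "block_upper_triangular blk A B"
    and "\<forall>i. controllable_block blk A B i"
    and "C1_on {0..last_delay h} G"
    and "essentially_bounded T \<sigma>"
    and "set_integrable lborel {- last_delay h..<0} hist"
    and "last_delay h < T"
    and "sym_pos_def \<Sigma>T"
  shows "\<exists>U \<in> L2_progressive M F T.
           (\<exists>Z. is_solution M F W T A B h G \<sigma> z0 hist U Z) \<and>
           (\<forall>Z. is_solution M F W T A B h G \<sigma> z0 hist U Z \<longrightarrow>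
              mean M (Z T) = ZT \<and>
              (\<forall>i. covariance M (\<lambda>\<omega>. block_proj blk i *v Z T \<omega>)
                     = block blk i i \<Sigma>T + Sigma_min blk A G h \<sigma> T i))"
proof -
  interpret controlled_system M F W T h A B G \<sigma> z0 hist
    by (intro controlled_system.intro wiener.intro wiener_axioms.intro controlled_system_axioms.intro assms)
  obtain U where U: "U \<in> L2_progressive M F T"
    "\<forall>Z. is_solution M F W T A B h G \<sigma> z0 hist U Z \<longrightarrow> mean M (Z T) = ZT \<and>
      (\<forall>i. covariance M (\<lambda>\<omega>. block_proj blk i *v Z T \<omega>) = block blk i i \<Sigma>T + Sigma_min blk A G h \<sigma> T i)"
    using steering[OF assms(7,8,13), of ZT] by blast
  then show ?thesis using solution_exists[OF U(1)] by blast
qed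

end
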